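(* Let $\Gamma$ be a finitely presented group, fix $n\in\mathbb{N}$, and let $G=GL_{n}$. Then $$\mathcal{X}_{\Gamma}G=\bigsqcup_{[k]\in\mathcal{P}_{n}}\mathcal{X}_{\Gamma}^{[k]}G,$$ as a disjoint union of locally closed quasi-projective varieties.
   Context: All varieties are over $\mathbb{C}$ and $GL_n=GL(n,\mathbb{C})$. $\mathcal{X}_{\Gamma}G:=\mathrm{Hom}(\Gamma,G)/\!\!/G$ is the $G$-character variety of $\Gamma$, the affine GIT quotient $\mathrm{Spec}(\mathbb{C}[\mathrm{Hom}(\Gamma,G)]^{G})$ for the conjugation action. Its points are in bijection with $G$-conjugacy classes of polystable representations, i.e. those with Zariski closed $G$-orbit in $\mathrm{Hom}(\Gamma,G)$, equivalently completely reducible ones. A partition of $n$ is written $[k]=[1^{k_1}\cdots j^{k_j}\cdots n^{k_n}]$, where $k_j\ge 0$ is the number of parts of size $j$ and $n=\sum_j j\,k_j$; $\mathcal{P}_n$ is the set of partitions of $n$. For $[k]\in\mathcal{P}_n$, a representation $\rho\in\mathrm{Hom}(\Gamma,GL_n)$ is called $[k]$-polystable if it is conjugate to $\bigoplus_{j=1}^{n}\rho_j$, where each $\rho_j$ is a direct sum of $k_j>0$ irreducible representations in $\mathrm{Hom}(\Gamma,GL_j)$ (if $k_j=0$, then $\rho_j$ is not present in the direct sum). $\mathcal{X}_{\Gamma}^{[k]}G\subset\mathcal{X}_{\Gamma}G$ is the subset of equivalence classes under conjugation of $[k]$-polystable representations. *)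

theory Defs
  imports
    "HOL-Algebra.Generated_Rings"
    "HOL-Library.Disjoint_Sets"
    "HOL-Analysis.Abstract_Topology"
    "Jordan_Normal_Form.VS_Connect"
begin

section \<open>Finitely presented groups\<close>

text \<open>
  Words in the letters \<open>x\<^sub>0, \<dots>, x\<^sub>m\<^sub>-\<^sub>1\<close> and their formal inverses; \<open>(i, True)\<close> stands for
  \<open>x\<^sub>i\<close> and \<open>(i, False)\<close> for its inverse.
\<close>

definition words :: "nat \<Rightarrow> (nat \<times> bool) list set" where
  "words m = lists ({..<m} \<times> UNIV)"

inductive_set presentation_rel ::
  "nat \<Rightarrow> (nat \<times> bool) list set \<Rightarrow> ((nat \<times> bool) list \<times> (nat \<times> bool) list) set"
  for m R where
    refl: "w \<in> words m \<Longrightarrow> (w, w) \<in> presentation_rel m R"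
  | sym: "(v, w) \<in> presentation_rel m R \<Longrightarrow> (w, v) \<in> presentation_rel m R"
  | trans: "\<lbrakk>(u, v) \<in> presentation_rel m R; (v, w) \<in> presentation_rel m R\<rbrakk>
            \<Longrightarrow> (u, w) \<in> presentation_rel m R"
  | cancel: "\<lbrakk>u \<in> words m; v \<in> words m; i < m\<rbrakk>
            \<Longrightarrow> (u @ [(i, b), (i, \<not> b)] @ v, u @ v) \<in> presentation_rel m R"
  | relator: "\<lbrakk>u \<in> words m; v \<in> words m; r \<in> R; r \<in> words m\<rbrakk>
            \<Longrightarrow> (u @ r @ v, u @ v) \<in> presentation_rel m R"

text \<open>The group \<open>\<langle>x\<^sub>0, \<dots>, x\<^sub>m\<^sub>-\<^sub>1 | R\<rangle>\<close>.\<close>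

definition presented_group ::
  "nat \<Rightarrow> (nat \<times> bool) list set \<Rightarrow> (nat \<times> bool) list set monoid" where
  "presented_group m R =
     \<lparr>carrier = words m // presentation_rel m R,
      mult = (\<lambda>X Y. \<Union>u\<in>X. \<Union>v\<in>Y. presentation_rel m R `` {u @ v}),
      one = presentation_rel m R `` {[]}\<rparr>"

definition finitely_presented :: "('a, 'b) monoid_scheme \<Rightarrow> bool" where
  "finitely_presented \<Gamma> \<longleftrightarrow>
     group \<Gamma> \<and> (\<exists>m R. finite R \<and> R \<subseteq> words m \<and> \<Gamma> \<cong> presented_group m R)"


section \<open>Spaces with functions and quasi-projective varieties\<close>

text \<open>
  Varieties are classical (possibly reducible) complex varieties, given by their closed points,
  the Zariski topology and, for each open set \<open>U\<close>, the regular functions on \<open>U\<close>.  Functions are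
  total in HOL; whether \<open>f \<in> regular X U\<close> depends only on the values of \<open>f\<close> on \<open>U\<close>.
\<close>

record 'p space_with_functions =
  zariski :: "'p topology"
  regular :: "'p set \<Rightarrow> ('p \<Rightarrow> complex) set"

text \<open>The structure induced on a subset: locally, regular functions are restrictions.\<close>

definition induced ::
  "'p space_with_functions \<Rightarrow> 'p set \<Rightarrow> 'p space_with_functions" where
  "induced X Z =
     \<lparr>zariski = subtopology (zariski X) Z,
      regular = (\<lambda>U. {f. \<forall>p\<in>U. \<exists>V h. openin (zariski X) V \<and> p \<in> V \<and> h \<in> regular X V \<and>
                             (\<forall>q\<in>U \<inter> V. f q = h q)})\<rparr>"

definition isomorphic_spaces ::
  "'p space_with_functions \<Rightarrow> 'q space_with_functions \<Rightarrow> bool" where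
  "isomorphic_spaces X Y \<longleftrightarrow>
     (\<exists>\<phi>. homeomorphic_map (zariski X) (zariski Y) \<phi> \<and>
          (\<forall>V f. openin (zariski Y) V \<longrightarrow>
             (f \<in> regular Y V \<longleftrightarrow>
              f \<circ> \<phi> \<in> regular X {p \<in> topspace (zariski X). \<phi> p \<in> V})))"

definition locally_closed_in :: "'p topology \<Rightarrow> 'p set \<Rightarrow> bool" where
  "locally_closed_in T Z \<longleftrightarrow> (\<exists>U C. openin T U \<and> closedin T C \<and> Z = U \<inter> C)"

text \<open>
  Homogeneous polynomials of degree \<open>d\<close> in the coordinates \<open>x\<^sub>0, \<dots>, x\<^sub>N\<close>, as functions on
  \<open>\<complex>\<^sup>N\<^sup>+\<^sup>1\<close>.
\<close>

definition homogeneous_polys :: "nat \<Rightarrow> nat \<Rightarrow> (complex vec \<Rightarrow> complex) set" where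
  "homogeneous_polys N d =
     {F. \<exists>c. F = (\<lambda>v. \<Sum>\<alpha> \<in> {\<alpha> \<in> {..N} \<rightarrow>\<^sub>E UNIV. sum \<alpha> {..N} = d}.
                        c \<alpha> * (\<Prod>i\<le>N. (v $ i) ^ \<alpha> i))}"

definition line_through :: "complex vec \<Rightarrow> complex vec set" where
  "line_through v = {c \<cdot>\<^sub>v v | c. True}"

definition nonzero_vecs :: "nat \<Rightarrow> complex vec set" where
  "nonzero_vecs N = carrier_vec (Suc N) - {0\<^sub>v (Suc N)}"

text \<open>
  \<open>\<P>\<^sup>N\<close>: the points are the lines through the origin of \<open>\<complex>\<^sup>N\<^sup>+\<^sup>1\<close>, the sets \<open>F \<noteq> 0\<close> with \<open>F\<close>
  homogeneous form a base of the topology, and regular functions are locally quotients \<open>F / G\<close> of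
  homogeneous polynomials of equal degree.
\<close>

definition projective_space :: "nat \<Rightarrow> complex vec set space_with_functions" where
  "projective_space N =
     (let T = topology_generated_by
                {{line_through v | v. v \<in> nonzero_vecs N \<and> F v \<noteq> 0} | F d.
                   F \<in> homogeneous_polys N d}
      in \<lparr>zariski = T,
          regular = (\<lambda>U. {f. \<forall>L\<in>U. \<exists>V d. \<exists>F\<in>homogeneous_polys N d. \<exists>G\<in>homogeneous_polys N d.
                        openin T V \<and> L \<in> V \<and>
                        (\<forall>v\<in>nonzero_vecs N. line_through v \<in> U \<inter> V \<longrightarrow>
                            G v \<noteq> 0 \<and> f (line_through v) = F v / G v)})\<rparr>)"

definition quasi_projective_variety :: "'p space_with_functions \<Rightarrow> bool" where
  "quasi_projective_variety X \<longleftrightarrow>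
     (\<exists>N W. locally_closed_in (zariski (projective_space N)) W \<and>
            isomorphic_spaces X (induced (projective_space N) W))"


section \<open>Spectra of algebras of functions\<close>

definition function_ring :: "'y set \<Rightarrow> ('y \<Rightarrow> complex) ring" where
  "function_ring Y =
     \<lparr>carrier = Y \<rightarrow>\<^sub>E UNIV,
      mult = (\<lambda>f g. \<lambda>y\<in>Y. f y * g y),
      one = (\<lambda>y\<in>Y. 1),
      zero = (\<lambda>y\<in>Y. 0),
      add = (\<lambda>f g. \<lambda>y\<in>Y. f y + g y)\<rparr>"

text \<open>
  Below, \<open>A\<close> is (the carrier of) a subalgebra, containing the constants, of the algebra of all
  complex functions on \<open>Y\<close>.  The value of \<open>a \<in> A\<close> at a maximal ideal \<open>M\<close> with residue field \<open>\<complex>\<close>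
  is the scalar \<open>c\<close> with \<open>a \<equiv> c\<close> modulo \<open>M\<close>.
\<close>

definition residue_at :: "'y set \<Rightarrow> ('y \<Rightarrow> complex) set \<Rightarrow> ('y \<Rightarrow> complex) \<Rightarrow> complex" where
  "residue_at Y M a = (THE c. (\<lambda>y\<in>Y. a y - c) \<in> M)"

definition max_spec ::
  "'y set \<Rightarrow> ('y \<Rightarrow> complex) set \<Rightarrow> ('y \<Rightarrow> complex) set space_with_functions" where
  "max_spec Y A =
     (let T = topology_generated_by
                {{M. maximalideal M (function_ring Y\<lparr>carrier := A\<rparr>) \<and> a \<notin> M} | a. a \<in> A}
      in \<lparr>zariski = T,
          regular = (\<lambda>U. {f. \<forall>M\<in>U. \<exists>V. \<exists>a\<in>A. \<exists>b\<in>A. openin T V \<and> M \<in> V \<and>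
                        (\<forall>M'\<in>U \<inter> V. residue_at Y M' b \<noteq> 0 \<and>
                            f M' = residue_at Y M' a / residue_at Y M' b)})\<rparr>)"


section \<open>Representations and the character variety\<close>

definition GL :: "nat \<Rightarrow> complex mat monoid" where
  "GL n = units_of (ring_mat TYPE(complex) n ())"

text \<open>Representations are \<^const>\<open>undefined\<close> outside the carrier, so that equality of functions is equality on \<open>\<Gamma>\<close>.\<close>

definition Reps :: "('a, 'b) monoid_scheme \<Rightarrow> nat \<Rightarrow> ('a \<Rightarrow> complex mat) set" where
  "Reps \<Gamma> n = hom \<Gamma> (GL n) \<inter> extensional (carrier \<Gamma>)"

definition conj_action ::
  "('a, 'b) monoid_scheme \<Rightarrow> nat \<Rightarrow> complex mat \<Rightarrow> ('a \<Rightarrow> complex mat) \<Rightarrow> 'a \<Rightarrow> complex mat" where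
  "conj_action \<Gamma> n g \<rho> =
     (\<lambda>\<gamma>\<in>carrier \<Gamma>. g \<otimes>\<^bsub>GL n\<^esub> \<rho> \<gamma> \<otimes>\<^bsub>GL n\<^esub> inv\<^bsub>GL n\<^esub> g)"

text \<open>
  The coordinate ring of \<open>Hom(\<Gamma>, GL\<^sub>n)\<close>.  If \<open>\<Gamma>\<close> is generated by \<open>\<gamma>\<^sub>1, \<dots>, \<gamma>\<^sub>m\<close>, then these are the
  restrictions of the regular functions along the closed embedding
  \<open>\<rho> \<mapsto> (\<rho> \<gamma>\<^sub>1, \<dots>, \<rho> \<gamma>\<^sub>m)\<close> into \<open>(GL\<^sub>n)\<^sup>m\<close>; using all elements of \<open>\<Gamma>\<close> avoids the choice.
\<close>

definition coordinate_ring ::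
  "('a, 'b) monoid_scheme \<Rightarrow> nat \<Rightarrow> (('a \<Rightarrow> complex mat) \<Rightarrow> complex) set" where
  "coordinate_ring \<Gamma> n = generate_ring (function_ring (Reps \<Gamma> n))
     ({\<lambda>\<rho>\<in>Reps \<Gamma> n. c | c. True}
      \<union> {\<lambda>\<rho>\<in>Reps \<Gamma> n. \<rho> \<gamma> $$ (i, j) | \<gamma> i j. \<gamma> \<in> carrier \<Gamma> \<and> i < n \<and> j < n}
      \<union> {\<lambda>\<rho>\<in>Reps \<Gamma> n. 1 / det (\<rho> \<gamma>) | \<gamma>. \<gamma> \<in> carrier \<Gamma>})"

definition invariant_ring ::
  "('a, 'b) monoid_scheme \<Rightarrow> nat \<Rightarrow> (('a \<Rightarrow> complex mat) \<Rightarrow> complex) set" where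
  "invariant_ring \<Gamma> n =
     {f \<in> coordinate_ring \<Gamma> n.
        \<forall>g\<in>carrier (GL n). \<forall>\<rho>\<in>Reps \<Gamma> n. f (conj_action \<Gamma> n g \<rho>) = f \<rho>}"

definition character_variety ::
  "('a, 'b) monoid_scheme \<Rightarrow> nat \<Rightarrow> (('a \<Rightarrow> complex mat) \<Rightarrow> complex) set space_with_functions"
  where
  "character_variety \<Gamma> n = max_spec (Reps \<Gamma> n) (invariant_ring \<Gamma> n)"

text \<open>The point of the GIT quotient under \<open>\<rho>\<close>; it depends only on the conjugacy class of \<open>\<rho>\<close>.\<close>

definition git_point ::
  "('a, 'b) monoid_scheme \<Rightarrow> nat \<Rightarrow> ('a \<Rightarrow> complex mat) \<Rightarrow> (('a \<Rightarrow> complex mat) \<Rightarrow> complex) set"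
  where
  "git_point \<Gamma> n \<rho> = {f \<in> invariant_ring \<Gamma> n. f \<rho> = 0}"


section \<open>The stratification by polystable type\<close>

definition irreducible_rep ::
  "('a, 'b) monoid_scheme \<Rightarrow> nat \<Rightarrow> ('a \<Rightarrow> complex mat) \<Rightarrow> bool" where
  "irreducible_rep \<Gamma> j \<sigma> \<longleftrightarrow> \<sigma> \<in> Reps \<Gamma> j \<and> 0 < j \<and>
     (\<forall>W. VectorSpace.subspace class_ring W (module_vec TYPE(complex) j) \<and>
          (\<forall>\<gamma>\<in>carrier \<Gamma>. \<forall>w\<in>W. \<sigma> \<gamma> *\<^sub>v w \<in> W)
          \<longrightarrow> W = {0\<^sub>v j} \<or> W = carrier_vec j)"

definition direct_sum_rep ::
  "('a, 'b) monoid_scheme \<Rightarrow> ('a \<Rightarrow> complex mat) list \<Rightarrow> 'a \<Rightarrow> complex mat" where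
  "direct_sum_rep \<Gamma> \<sigma>s = (\<lambda>\<gamma>\<in>carrier \<Gamma>. diag_block_mat (map (\<lambda>\<sigma>. \<sigma> \<gamma>) \<sigma>s))"

text \<open>The partition \<open>[1\<^sup>k\<^sup>1 \<cdots> n\<^sup>k\<^sup>n]\<close> is given by its multiplicity function \<open>j \<mapsto> k j\<close>.\<close>

definition partitions_of :: "nat \<Rightarrow> (nat \<Rightarrow> nat) set" where
  "partitions_of n = {k. (\<forall>j. j \<notin> {1..n} \<longrightarrow> k j = 0) \<and> (\<Sum>j=1..n. j * k j) = n}"

text \<open>
  Here \<open>\<sigma> j\<close> lists the summands of \<open>\<rho>\<^sub>j\<close>; it is empty, hence contributes nothing, if \<open>k j = 0\<close>.
\<close>

definition type_polystable ::
  "('a, 'b) monoid_scheme \<Rightarrow> nat \<Rightarrow> (nat \<Rightarrow> nat) \<Rightarrow> ('a \<Rightarrow> complex mat) \<Rightarrow> bool" where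
  "type_polystable \<Gamma> n k \<rho> \<longleftrightarrow> \<rho> \<in> Reps \<Gamma> n \<and>
     (\<exists>\<sigma> :: nat \<Rightarrow> ('a \<Rightarrow> complex mat) list.
        (\<forall>j\<in>{1..n}. length (\<sigma> j) = k j \<and> (\<forall>\<tau>\<in>set (\<sigma> j). irreducible_rep \<Gamma> j \<tau>)) \<and>
        (\<exists>g\<in>carrier (GL n).
           \<rho> = conj_action \<Gamma> n g (direct_sum_rep \<Gamma> (concat (map \<sigma> [1..<Suc n])))))"

definition stratum ::
  "('a, 'b) monoid_scheme \<Rightarrow> nat \<Rightarrow> (nat \<Rightarrow> nat) \<Rightarrow> (('a \<Rightarrow> complex mat) \<Rightarrow> complex) set set"
  where
  "stratum \<Gamma> n k = git_point \<Gamma> n ` {\<rho>. type_polystable \<Gamma> n k \<rho>}"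

end

theory Submission
  imports Defs "HOL-Library.Function_Algebras" "HOL-Computational_Algebra.Fundamental_Theorem_Algebra"
    "Jordan_Normal_Form.Schur_Decomposition" "HOL-Analysis.Continuum_Not_Denumerable"
begin

text \<open>
  Reynolds operators and Hilbert's theorem are replaced by an elementary averaging: on homogeneous
  polynomials the group of invertible block diagonal matrices acts by a family of matrices closed
  under adjoints, so each polynomial has an affine combination of its translates that is invariant.
  By degeneration to semisimple tuples and linear independence of characters, the nullcone is cut
  out by traces of words; hence the invariants are finite over the algebra of traces.  This gives
  finite generation and, with Nakayama's lemma and the Nullstellensatz, the lying over property: if
  a maximal ideal contains all invariants that vanish on the block diagonal representations of type
  \<open>ds\<close>, then it comes from such a representation.  For \<open>ds = [n]\<close> this says that all points come
  from representations, which may be taken semisimple after a degeneration.  For general \<open>ds\<close>, the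
  points that come from block diagonal representations of type \<open>ds\<close> form a closed set, and a stratum
  is one of these sets minus finitely many others, those of types with more parts.  Strata are
  disjoint because characters determine the dimensions of the irreducible summands.  Finally, finitely
  many generators of the invariant ring embed its maximal spectrum into projective space.
\<close>

section \<open>Noetherian rings and Hilbert's basis theorem\<close>

text \<open>An averaging operator depends on the polynomial that it makes invariant, so no single
  Reynolds operator is constructed; the properties in \<open>averaging\<close> survive composition,
  which allows finitely many polynomials to be treated in turn. The delicate point is that the image
  of the block diagonal representations in the quotient is closed. Invariants of the full group,
  pulled back to block diagonal tuples, form only part of the invariants of the block group, and a
  maximal ideal pulls back to a set that is an ideal over the pulled back ring alone. Traces of
  words bridge the gap: they are pulled back from full traces, yet all block invariants are finite
  over them, so the argument can stay inside the pulled back ideal. Degeneration is phrased without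
  orbit closures: the semisimple tuple has the same value as the given one under every continuous
  invariant function, and a point of the quotient sees nothing else. Tuples live on a finite
  generating set; the relations of the group return as polynomials that vanish on all
  representations.\<close>

inductive_set ideal_span :: "'r::comm_ring_1 set \<Rightarrow> 'r set \<Rightarrow> 'r set" for B U where
  zero: "0 \<in> ideal_span B U"
| step: "\<lbrakk>b \<in> B; u \<in> U; x \<in> ideal_span B U\<rbrakk> \<Longrightarrow> b * u + x \<in> ideal_span B U"

definition unital_subring :: "'r::comm_ring_1 set \<Rightarrow> bool" where
  "unital_subring B \<longleftrightarrow>
     1 \<in> B \<and> (\<forall>a\<in>B. \<forall>b\<in>B. a + b \<in> B \<and> a * b \<in> B) \<and> (\<forall>a\<in>B. - a \<in> B)"

lemma unital_subringD:
  assumes "unital_subring B"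
  shows "1 \<in> B" "0 \<in> B" "a \<in> B \<Longrightarrow> b \<in> B \<Longrightarrow> a + b \<in> B"
    "a \<in> B \<Longrightarrow> b \<in> B \<Longrightarrow> a * b \<in> B" "a \<in> B \<Longrightarrow> - a \<in> B" "a \<in> B \<Longrightarrow> b \<in> B \<Longrightarrow> a - b \<in> B"
proof -
  show 1: "1 \<in> B" and add: "a \<in> B \<Longrightarrow> b \<in> B \<Longrightarrow> a + b \<in> B" and
    "a \<in> B \<Longrightarrow> b \<in> B \<Longrightarrow> a * b \<in> B" and um: "a \<in> B \<Longrightarrow> - a \<in> B" for a b
    using assms by (auto simp: unital_subring_def)
  show "0 \<in> B" using add[OF 1 um[OF 1]] by simp
  show "a \<in> B \<Longrightarrow> b \<in> B \<Longrightarrow> a - b \<in> B" for a b using add[OF _ um] by fastforce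
qed

lemma unital_subring_sum:
  assumes "unital_subring B" "\<And>i. i \<in> A \<Longrightarrow> f i \<in> B"
  shows "sum f A \<in> B"
  using assms(2)
  by (induction A rule: infinite_finite_induct) (auto intro: unital_subringD[OF assms(1)])

lemma unital_subring_power:
  assumes "unital_subring B" "f \<in> B"
  shows "f ^ k \<in> B"
  by (induction k) (auto intro: unital_subringD[OF assms(1)] assms(2))

lemma ideal_span_add: "x \<in> ideal_span B U \<Longrightarrow> y \<in> ideal_span B U \<Longrightarrow> x + y \<in> ideal_span B U"
  by (induction x rule: ideal_span.induct) (auto simp: add.assoc intro: ideal_span.intros)

lemma ideal_span_mult:
  assumes "unital_subring B" "c \<in> B"
  shows "x \<in> ideal_span B U \<Longrightarrow> c * x \<in> ideal_span B U"
proof (induction x rule: ideal_span.induct)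
  case (step b u x)
  have "(c * b) * u + c * x \<in> ideal_span B U"
    using step unital_subringD(4)[OF assms(1) assms(2)] by (intro ideal_span.step) auto
  then show ?case by (simp add: algebra_simps)
qed (simp add: ideal_span.zero)

lemma ideal_span_incl: "unital_subring B \<Longrightarrow> u \<in> U \<Longrightarrow> u \<in> ideal_span B U"
  using ideal_span.step[of 1 B u U 0] by (auto simp: ideal_span.zero unital_subringD)

lemma ideal_span_mult_incl: "b \<in> B \<Longrightarrow> u \<in> U \<Longrightarrow> b * u \<in> ideal_span B U"
  using ideal_span.step[of b B u U 0] by (auto simp: ideal_span.zero)

lemma ideal_span_trans:
  assumes "unital_subring B" "U \<subseteq> ideal_span B V" "x \<in> ideal_span B U"
  shows "x \<in> ideal_span B V"
  using assms(3)
proof (induction x rule: ideal_span.induct)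
  case (step b u x)
  then show ?case using assms(2) by (auto intro!: ideal_span_add ideal_span_mult[OF assms(1)])
qed (simp add: ideal_span.zero)

lemma ideal_span_mono:
  assumes "x \<in> ideal_span B U" "U \<subseteq> V" shows "x \<in> ideal_span B V"
  using assms(1) by (induction x rule: ideal_span.induct) (use assms(2) in \<open>auto intro: ideal_span.intros\<close>)

text \<open>With \<open>U\<close> inside \<open>B\<close> the span is an ideal. The same notion with
  \<open>U\<close> outside \<open>B\<close> serves later as the module generated by
  \<open>U\<close>, over the constants or over the algebra of traces.\<close>

lemma ideal_span_subset:
  assumes "unital_subring B" "U \<subseteq> B" "x \<in> ideal_span B U" shows "x \<in> B"
  using assms(3)
  by (induction x rule: ideal_span.induct) (use assms(2) in \<open>auto intro!: unital_subringD[OF assms(1)]\<close>)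

lemma ideal_span_sum:
  assumes "\<And>i. i \<in> A \<Longrightarrow> f i \<in> ideal_span B U"
  shows "sum f A \<in> ideal_span B U"
  using assms
  by (induction A rule: infinite_finite_induct) (auto intro: ideal_span.zero ideal_span_add)

lemma ideal_span_finite:
  assumes "x \<in> ideal_span B U"
  shows "\<exists>F. finite F \<and> F \<subseteq> U \<and> x \<in> ideal_span B F"
  using assms
proof (induction x rule: ideal_span.induct)
  case zero
  show ?case by (rule exI[of _ "{}"]) (auto intro: ideal_span.zero)
next
  case (step b u x)
  then obtain F where F: "finite F" "F \<subseteq> U" "x \<in> ideal_span B F" by auto
  have "b * u + x \<in> ideal_span B (insert u F)"
    using F step by (intro ideal_span.step) (auto intro: ideal_span_mono)
  with F step show ?case by (intro exI[of _ "insert u F"]) auto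
qed

text \<open>Generators are demanded inside the set \<open>U\<close> itself, not merely in the ideal
  that it spans. This makes it possible to choose, among the traces of all words, finitely many that
  generate the same ideal.\<close>

definition noetherian :: "'r::comm_ring_1 set \<Rightarrow> bool" where
  "noetherian B \<longleftrightarrow> (\<forall>U\<subseteq>B. \<exists>F. finite F \<and> F \<subseteq> U \<and> U \<subseteq> ideal_span B F)"

definition polys_over :: "'r::comm_ring_1 set \<Rightarrow> 'r poly set" where
  "polys_over B = {p. \<forall>i. coeff p i \<in> B}"

lemma unital_subring_polys_over:
  assumes "unital_subring B" shows "unital_subring (polys_over B)"
  unfolding unital_subring_def polys_over_def
  by (auto simp: coeff_mult unital_subringD[OF assms] intro!: unital_subring_sum[OF assms])

text \<open>Hilbert's argument. If the ideal \<open>J\<close> were not finitely generated, elements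
  of least degree outside the ideal of the earlier choices could be chosen forever. The ideal of
  their leading coefficients is finitely generated, so at some stage a combination of earlier
  choices cancels the leading term of the next one, against the minimality of its degree.\<close>

lemma noetherian_polys_over:
  fixes B :: "'r::comm_ring_1 set"
  assumes B: "unital_subring B" and noeth: "noetherian B"
  shows "noetherian (polys_over B)"
  unfolding noetherian_def
proof (intro allI impI)
  let ?BX = "polys_over B"
  note BX = unital_subring_polys_over[OF B]
  fix U :: "'r poly set" assume U: "U \<subseteq> ?BX"
  define J where "J = ideal_span ?BX U"
  have JB: "J \<subseteq> ?BX" using ideal_span_subset[OF BX U] by (auto simp: J_def)
  have "\<exists>F. finite F \<and> F \<subseteq> J \<and> J \<subseteq> ideal_span ?BX F"
  proof (rule ccontr)
    assume neg: "\<not> ?thesis"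
    define good where "good F p \<longleftrightarrow> p \<in> J - ideal_span ?BX F \<and>
      (\<forall>q\<in>J - ideal_span ?BX F. degree p \<le> degree q)" for F p
    have ex: "\<exists>p. good F p" if "finite F" "F \<subseteq> J" for F
    proof -
      have "\<exists>p. p \<in> J - ideal_span ?BX F" using neg that by auto
      from exists_least_iff[of "\<lambda>d. \<exists>p \<in> J - ideal_span ?BX F. degree p = d"] this
      show ?thesis unfolding good_def by (metis leI)
    qed
    define nxt where "nxt F = (SOME p. good F p)" for F
    have nxt: "good F (nxt F)" if "finite F" "F \<subseteq> J" for F
      unfolding nxt_def by (rule someI_ex[OF ex[OF that]])
    define g where "g = rec_nat {} (\<lambda>_ F. insert (nxt F) F)"
    define f where "f k = nxt (g k)" for k
    have g_Suc: "g (Suc k) = insert (f k) (g k)" and g_0: "g 0 = {}" for k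
      by (simp_all add: g_def f_def)
    have g_fin: "finite (g k) \<and> g k \<subseteq> J" for k
    proof (induction k)
      case (Suc k)
      then have "good (g k) (f k)" unfolding f_def by (intro nxt) auto
      with Suc show ?case by (auto simp: g_Suc good_def)
    qed (simp add: g_0)
    have f_good: "good (g k) (f k)" for k unfolding f_def using g_fin by (intro nxt) auto
    have g_eq: "g k = f ` {..<k}" for k
      by (induction k) (auto simp: g_0 g_Suc lessThan_Suc)
    have deg_mono: "degree (f i) \<le> degree (f k)" if "i < k" for i k
    proof -
      have "f k \<in> J - ideal_span ?BX (g i)"
        using f_good[of k] ideal_span_mono[of "f k" ?BX "g i" "g k"]
          image_mono[of "{..<i}" "{..<k}" f] that
        by (auto simp: good_def g_eq)
      with f_good[of i] show ?thesis by (auto simp: good_def)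
    qed
    define a where "a k = lead_coeff (f k)" for k
    have aB: "range a \<subseteq> B" using f_good JB by (auto simp: a_def good_def polys_over_def)
    then obtain F where F: "finite F" "F \<subseteq> range a" "range a \<subseteq> ideal_span B F"
      using noeth unfolding noetherian_def by meson
    from finite_subset_image[OF F(1,2)] obtain N where N: "finite N" "F = a ` N" by auto
    \<comment> \<open>\<open>m\<close> exceeds every index in \<open>N\<close>, so the leading
      coefficient of \<open>f m\<close> is a combination of those of its predecessors;
      \<open>insert 0\<close> covers an empty \<open>N\<close>.\<close>
    define m where "m = Suc (Max (insert 0 N))"
    have Nm: "N \<subseteq> {..<m}" using N(1) by (auto simp: m_def less_Suc_eq_le)
    define D where "D = degree (f m)"
    have "a m \<in> ideal_span B F" using F(3) by auto
    then have am: "a m \<in> ideal_span B (a ` {..<m})"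
      by (rule ideal_span_mono) (use N Nm in auto)
    \<comment> \<open>A combination of earlier leading coefficients lifts to one of the polynomials:
      powers of the variable bring all degrees up to \<open>D\<close>, as degrees do not decrease
      along the sequence.\<close>
    have "\<exists>q\<in>ideal_span ?BX (f ` {..<m}). coeff q D = x \<and> (\<forall>i>D. coeff q i = 0)"
      if "x \<in> ideal_span B (a ` {..<m})" for x
      using that
    proof (induction x rule: ideal_span.induct)
      case zero
      show ?case by (rule bexI[of _ 0]) (auto intro: ideal_span.zero)
    next
      case (step b u x)
      then obtain q i where q: "q \<in> ideal_span ?BX (f ` {..<m})" "coeff q D = x" "\<forall>i>D. coeff q i = 0"
        and i: "i < m" "u = a i" by auto
      have le: "degree (f i) \<le> D" using deg_mono[OF i(1)] by (simp add: D_def)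
      let ?q = "monom b (D - degree (f i)) * f i + q"
      have "?q \<in> ideal_span ?BX (f ` {..<m})"
        using q(1) i step(1) unital_subringD(2)[OF B]
        by (intro ideal_span.step) (auto simp: polys_over_def)
      moreover have "coeff ?q D = b * u + x"
        using le q(2) by (simp add: coeff_monom_mult i a_def)
      moreover have "coeff ?q j = 0" if "j > D" for j
      proof -
        have "degree (f i) < j - (D - degree (f i))" using that le by auto
        then show ?thesis using that q(3) by (simp add: coeff_monom_mult coeff_eq_0)
      qed
      ultimately show ?case by blast
    qed
    from this[OF am] obtain q where q: "q \<in> ideal_span ?BX (f ` {..<m})" "coeff q D = a m"
      "\<forall>i>D. coeff q i = 0" by auto
    \<comment> \<open>Like \<open>f m\<close>, the difference lies in \<open>J\<close> outside the
      ideal of the predecessors, but its degree is smaller.\<close>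
    define r where "r = f m - q"
    have fm: "f m \<in> J" "f m \<notin> ideal_span ?BX (f ` {..<m})"
      and min: "\<And>p. p \<in> J \<Longrightarrow> p \<notin> ideal_span ?BX (f ` {..<m}) \<Longrightarrow> D \<le> degree p"
      using f_good[of m] by (auto simp: good_def g_eq D_def)
    have mul: "- x \<in> ideal_span ?BX V" if "x \<in> ideal_span ?BX V" for x V
      using ideal_span_mult[OF BX unital_subringD(5)[OF BX unital_subringD(1)[OF BX]] that] by simp
    have qJ: "q \<in> J"
    proof -
      have "f ` {..<m} \<subseteq> ideal_span ?BX U" using g_fin[of m] by (auto simp: g_eq J_def)
      from ideal_span_trans[OF BX this q(1)] show ?thesis by (simp add: J_def)
    qed
    have rJ: "r \<in> J" using ideal_span_add[of "f m" ?BX U "-q"] fm(1) mul[of q U] qJ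
      by (auto simp: r_def J_def)
    have rn: "r \<notin> ideal_span ?BX (f ` {..<m})"
    proof
      assume "r \<in> ideal_span ?BX (f ` {..<m})"
      from ideal_span_add[OF this q(1)] fm(2) show False by (simp add: r_def)
    qed
    have cr: "coeff r i = 0" if "i \<ge> D" for i
      using that q(2,3) by (cases "i = D") (auto simp: r_def a_def D_def coeff_eq_0)
    have "r \<noteq> 0" using rn by (auto intro: ideal_span.zero)
    then have "coeff r (degree r) \<noteq> 0" by simp
    with cr have "degree r < D" by (meson not_le)
    with min[OF rJ rn] show False by simp
  qed
  then obtain F where F: "finite F" "F \<subseteq> J" "J \<subseteq> ideal_span ?BX F" by auto
  \<comment> \<open>Each generator of \<open>J\<close> is a combination of finitely many elements of
    \<open>U\<close>; these replace it.\<close>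
  have "\<forall>p\<in>F. \<exists>G. finite G \<and> G \<subseteq> U \<and> p \<in> ideal_span ?BX G"
    using F(2) ideal_span_finite unfolding J_def by blast
  then obtain G where G: "\<And>p. p \<in> F \<Longrightarrow> finite (G p) \<and> G p \<subseteq> U \<and> p \<in> ideal_span ?BX (G p)" by metis
  have "F \<subseteq> ideal_span ?BX (\<Union>p\<in>F. G p)"
    using G by (blast intro: ideal_span_mono)
  then have "U \<subseteq> ideal_span ?BX (\<Union>p\<in>F. G p)"
    using ideal_span_trans[OF BX] F(3) ideal_span_incl[OF BX] unfolding J_def by blast
  then show "\<exists>F. finite F \<and> F \<subseteq> U \<and> U \<subseteq> ideal_span ?BX F"
    using F(1) G by (intro exI[of _ "\<Union>p\<in>F. G p"]) auto
qed

definition adjoin :: "'r::comm_ring_1 set \<Rightarrow> 'r \<Rightarrow> 'r set" where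
  "adjoin B x = (\<lambda>p. poly p x) ` polys_over B"

lemma unital_subring_adjoin:
  assumes "unital_subring B" shows "unital_subring (adjoin B x)"
proof -
  note BX = unital_subring_polys_over[OF assms]
  show ?thesis unfolding unital_subring_def adjoin_def
    using unital_subringD[OF BX]
    by (auto simp: image_iff simp flip: poly_add poly_mult poly_minus) (metis poly_1)
qed

text \<open>Evaluation at \<open>x\<close> maps the polynomial ring onto \<open>adjoin B x\<close>,
  so generators of the preimage of \<open>U\<close> are mapped to generators of
  \<open>U\<close>.\<close>

theorem hilbert_basis:
  assumes "unital_subring B" "noetherian B"
  shows "noetherian (adjoin B x)"
  unfolding noetherian_def
proof (intro allI impI)
  fix U assume U: "U \<subseteq> adjoin B x"
  let ?e = "\<lambda>p. poly p x"
  define V where "V = {p \<in> polys_over B. ?e p \<in> U}"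
  have "V \<subseteq> polys_over B" by (auto simp: V_def)
  with noetherian_polys_over[OF assms] obtain F where
    F: "finite F" "F \<subseteq> V" "V \<subseteq> ideal_span (polys_over B) F" unfolding noetherian_def by meson
  have *: "?e p \<in> ideal_span (adjoin B x) (?e ` F)" if "p \<in> ideal_span (polys_over B) F" for p
    using that
    by (induction p rule: ideal_span.induct)
      (auto simp: adjoin_def intro!: ideal_span.intros)
  have "U \<subseteq> ideal_span (adjoin B x) (?e ` F)"
  proof
    fix u assume "u \<in> U"
    then obtain p where "p \<in> V" "u = ?e p" using U by (auto simp: adjoin_def V_def)
    with * F(3) show "u \<in> ideal_span (adjoin B x) (?e ` F)" by auto
  qed
  with F show "\<exists>F. finite F \<and> F \<subseteq> U \<and> U \<subseteq> ideal_span (adjoin B x) F"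
    by (intro exI[of _ "?e ` F"]) (auto simp: V_def)
qed

section \<open>Finitely generated algebras of functions\<close>

text \<open>Functions are total on a type, so that the pointwise ring operations of the type classes
  apply; representations enter only later, by restriction.\<close>

inductive_set falg :: "('y \<Rightarrow> complex) set \<Rightarrow> ('y \<Rightarrow> complex) set" for G where
  const: "(\<lambda>_. c) \<in> falg G"
| gen: "g \<in> G \<Longrightarrow> g \<in> falg G"
| add: "f \<in> falg G \<Longrightarrow> g \<in> falg G \<Longrightarrow> f + g \<in> falg G"
| mult: "f \<in> falg G \<Longrightarrow> g \<in> falg G \<Longrightarrow> f * g \<in> falg G"

lemma unital_subring_falg: "unital_subring (falg G)"
proof -
  have "- f \<in> falg G" if "f \<in> falg G" for f
    using falg.mult[OF falg.const[of "-1"] that] by (simp add: times_fun_def fun_Compl_def)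
  then show ?thesis
    using falg.const[of 1] by (auto simp: unital_subring_def one_fun_def intro: falg.intros)
qed

lemma falg_mono: "f \<in> falg G \<Longrightarrow> G \<subseteq> falg H \<Longrightarrow> f \<in> falg H"
  by (induction f rule: falg.induct) (auto intro: falg.intros)

lemma falg_cmult: "f \<in> falg G \<Longrightarrow> (\<lambda>x. c * f x) \<in> falg G"
  using falg.mult[OF falg.const[of c]] by (fastforce simp: times_fun_def)

lemma sum_fun_eval: "(\<Sum>i\<in>A. h i) y = (\<Sum>i\<in>A. h i y)"
  by (induction A rule: infinite_finite_induct) auto

lemma falg_sum: "(\<And>i. i \<in> A \<Longrightarrow> f i \<in> falg G) \<Longrightarrow> (\<lambda>x. \<Sum>i\<in>A. f i x) \<in> falg G"
proof (induction A rule: infinite_finite_induct)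
  case (insert a A)
  then have "f a + (\<lambda>x. \<Sum>i\<in>A. f i x) \<in> falg G" by (auto intro: falg.add)
  with insert show ?case by (simp add: plus_fun_def)
qed (auto intro: falg.const)

lemma falg_prod: "(\<And>i. i \<in> A \<Longrightarrow> f i \<in> falg G) \<Longrightarrow> (\<lambda>x. \<Prod>i\<in>A. f i x) \<in> falg G"
proof (induction A rule: infinite_finite_induct)
  case (insert a A)
  then have "f a * (\<lambda>x. \<Prod>i\<in>A. f i x) \<in> falg G" by (auto intro: falg.mult)
  with insert show ?case by (simp add: times_fun_def)
qed (auto intro: falg.const)

lemma falg_insert: "falg (insert g G) = adjoin (falg G) g"
proof
  note B = unital_subring_falg[of G]
  note C = unital_subringD[OF unital_subring_adjoin[OF B]]
  have c: "f \<in> adjoin (falg G) g" if "f \<in> falg G" for f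
    unfolding adjoin_def
    by (rule image_eqI[of _ _ "[:f:]"])
      (use that unital_subringD(2)[OF B] in \<open>auto simp: polys_over_def coeff_pCons split: nat.splits\<close>)
  have g: "g \<in> adjoin (falg G) g"
    unfolding adjoin_def
    by (rule image_eqI[of _ _ "[:0, 1:]"])
      (use unital_subringD(1,2)[OF B] in \<open>auto simp: polys_over_def coeff_pCons split: nat.splits\<close>)
  show "falg (insert g G) \<subseteq> adjoin (falg G) g"
  proof
    fix f assume "f \<in> falg (insert g G)"
    then show "f \<in> adjoin (falg G) g"
    proof (induction f rule: falg.induct)
      case (const c)
      show ?case by (rule c[OF falg.const])
    next
      case (gen h)
      then show ?case using g c[OF falg.gen] by auto
    next
      case (add f h) show ?case by (rule C(3)[OF add.IH])
    next
      case (mult f h) show ?case by (rule C(4)[OF mult.IH])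
    qed
  qed
  note D = unital_subring_falg[of "insert g G"]
  show "adjoin (falg G) g \<subseteq> falg (insert g G)"
  proof
    fix f assume "f \<in> adjoin (falg G) g"
    then obtain p where p: "f = poly p g" "\<And>i. coeff p i \<in> falg G"
      by (auto simp: adjoin_def polys_over_def)
    have "coeff p i \<in> falg (insert g G)" for i
      using falg_mono[OF p(2)[of i], of "insert g G"] by (auto intro: falg.gen)
    then show "f \<in> falg (insert g G)" unfolding p(1) poly_altdef
      by (intro unital_subring_sum[OF D] unital_subringD(4)[OF D] unital_subring_power[OF D])
        (auto intro: falg.gen)
  qed
qed

text \<open>Generators are adjoined one at a time. The base case consists of the constants, a field,
  where any nonzero element generates everything.\<close>

theorem noetherian_falg:
  assumes "finite G" shows "noetherian (falg G)"
  using assms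
proof (induction G rule: finite_induct)
  case empty
  have const: "f \<in> range (\<lambda>c _. c)" if "f \<in> falg {}" for f :: "'a \<Rightarrow> complex"
    using that by (induction f rule: falg.induct) (auto simp: plus_fun_def times_fun_def)
  show ?case unfolding noetherian_def
  proof (intro allI impI)
    fix U :: "('a \<Rightarrow> complex) set" assume U: "U \<subseteq> falg {}"
    show "\<exists>F. finite F \<and> F \<subseteq> U \<and> U \<subseteq> ideal_span (falg {}) F"
    proof (cases "U \<subseteq> {0}")
      case True
      then show ?thesis by (intro exI[of _ "{}"]) (auto intro: ideal_span.zero)
    next
      case False
      then obtain u where u: "u \<in> U" "u \<noteq> 0" by auto
      with U const obtain c where c: "u = (\<lambda>_. c)" by blast
      with u have "c \<noteq> 0" by (auto simp: zero_fun_def)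
      have "U \<subseteq> ideal_span (falg {}) {u}"
      proof
        fix v assume "v \<in> U"
        with U const obtain d where d: "v = (\<lambda>_. d)" by blast
        have "(\<lambda>_. d / c) * u \<in> ideal_span (falg {}) {u}"
          by (intro ideal_span_mult_incl falg.const) auto
        with \<open>c \<noteq> 0\<close> show "v \<in> ideal_span (falg {}) {u}" by (simp add: c d times_fun_def)
      qed
      then show ?thesis using u by (intro exI[of _ "{u}"]) auto
    qed
  qed
next
  case (insert g G)
  then show ?case using hilbert_basis[OF unital_subring_falg] by (simp add: falg_insert)
qed

section \<open>The Nullstellensatz for algebras of countable dimension\<close>

text \<open>Products of lists of generators are countably many and closed under multiplication, so
  they span the algebra over the constants.\<close>

lemma falg_countable_span:
  assumes "countable G"
  shows "\<exists>e :: nat \<Rightarrow> 'y \<Rightarrow> complex. \<forall>f\<in>falg G. \<exists>m c. f = (\<lambda>y. \<Sum>i<m. c i * e i y)"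
proof -
  define M where "M = prod_list ` lists G"
  let ?C = "range (\<lambda>(c::complex) (_::'y). c)"
  have M: "countable M" "M \<noteq> {}" using assms by (auto simp: M_def intro!: countable_lists)
  define e where "e = from_nat_into M"
  have e: "range e = M" unfolding e_def using M by (simp add: range_from_nat_into)
  have C: "unital_subring ?C"
    by (auto simp: unital_subring_def one_fun_def plus_fun_def times_fun_def fun_Compl_def)
  have MM: "u * v \<in> M" if "u \<in> M" "v \<in> M" for u v
  proof -
    obtain us vs where "u = prod_list us" "v = prod_list vs" "us \<in> lists G" "vs \<in> lists G"
      using \<open>u \<in> M\<close> \<open>v \<in> M\<close> unfolding M_def by blast
    then have "u * v = prod_list (us @ vs)" "us @ vs \<in> lists G" by auto
    then show ?thesis unfolding M_def by blast
  qed
  have "f \<in> ideal_span ?C M" if "f \<in> falg G" for f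
    using that
  proof (induction f rule: falg.induct)
    case (const c)
    have "1 \<in> M" unfolding M_def by (rule image_eqI[of _ _ "[]"]) auto
    then have "(\<lambda>_. c) * 1 \<in> ideal_span ?C M" by (intro ideal_span_mult_incl) auto
    then show ?case by simp
  next
    case (gen g)
    then have "g \<in> M" unfolding M_def by (intro image_eqI[of _ _ "[g]"]) auto
    then show ?case by (intro ideal_span_incl[OF C])
  next
    case (mult f g)
    have *: "u * y \<in> ideal_span ?C M" if "u \<in> M" "y \<in> ideal_span ?C M" for u y
      using that(2)
    proof (induction y rule: ideal_span.induct)
      case (step b v y)
      have "b * (u * v) + u * y \<in> ideal_span ?C M"
        using ideal_span.step[OF step(1) MM[OF that(1) step(2)] step(4)]
        by this
      moreover have "u * (b * v + y) = b * (u * v) + u * y"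
        by (simp only: distrib_left mult.left_commute)
      ultimately show ?case by (simp only:)
    qed (simp only: mult_zero_right ideal_span.zero)
    have "x * y \<in> ideal_span ?C M" if "x \<in> ideal_span ?C M" "y \<in> ideal_span ?C M" for x y
      using that(1)
    proof (induction x rule: ideal_span.induct)
      case (step b u x)
      have "b * (u * y) \<in> ideal_span ?C M"
        using *[OF step(2) that(2)] ideal_span_mult[OF C step(1)] by blast
      moreover have "(b * u + x) * y = b * (u * y) + x * y" by (simp only: distrib_right mult.assoc)
      ultimately show ?case using step(4) by (simp only: ideal_span_add)
    qed (simp only: mult_zero_left ideal_span.zero)
    from this[OF mult.IH] show ?case .
  qed (rule ideal_span_add)
  moreover have "\<exists>m c. f = (\<lambda>y. \<Sum>i<m. c i * e i y)" if "f \<in> ideal_span ?C M" for f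
    using that
  proof (induction f rule: ideal_span.induct)
    case zero
    show ?case by (intro exI[of _ 0]) (auto simp: zero_fun_def)
  next
    case (step b u x)
    then obtain m c d i where *: "x = (\<lambda>y. \<Sum>i<m. c i * e i y)" "b = (\<lambda>_. d)" "u = e i"
      using e by blast
    let ?m = "max m (Suc i)"
    \<comment> \<open>The vector \<open>e i\<close> may already occur among the first
      \<open>m\<close>, hence coefficients are added instead of overwritten.\<close>
    let ?c = "\<lambda>j. (if j < m then c j else 0) + (if j = i then d else 0)"
    have "(\<Sum>j<?m. ?c j * e j y) = b y * u y + x y" for y
    proof -
      have "(\<Sum>j<?m. (if j < m then c j else 0) * e j y) = (\<Sum>j<m. c j * e j y)"
        by (rule sum.mono_neutral_cong_right) auto
      moreover have "(\<Sum>j<?m. (if j = i then d else 0) * e j y) = (\<Sum>j<?m. if j = i then d * e j y else 0)"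
        by (rule sum.cong) auto
      then have "(\<Sum>j<?m. (if j = i then d else 0) * e j y) = d * e i y" by (simp add: sum.delta)
      ultimately show ?thesis by (simp add: * distrib_right sum.distrib)
    qed
    then show ?case by (intro exI[of _ ?m] exI[of _ ?c]) (auto simp: plus_fun_def times_fun_def)
  qed
  ultimately show ?thesis by blast
qed

text \<open>Gaussian elimination, one coordinate per step: the vector at \<open>c0\<close> is the
  pivot for the last coordinate, and its own coefficient is recovered at the end from the relation
  between the others.\<close>

lemma exists_linear_dependence:
  fixes a :: "'c \<Rightarrow> nat \<Rightarrow> 'f::field"
  assumes "finite C" "m < card C"
  shows "\<exists>l. (\<exists>c\<in>C. l c \<noteq> 0) \<and> (\<forall>i<m. (\<Sum>c\<in>C. l c * a c i) = 0)"
  using assms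
proof (induction m arbitrary: C a)
  case 0
  then have "C \<noteq> {}" by auto
  then show ?case by (intro exI[of _ "\<lambda>_. 1"]) auto
next
  case (Suc m)
  show ?case
  proof (cases "\<forall>c\<in>C. a c m = 0")
    case True
    from Suc.IH[of C a] Suc.prems obtain l where
      "\<exists>c\<in>C. l c \<noteq> 0" "\<forall>i<m. (\<Sum>c\<in>C. l c * a c i) = 0" by auto
    with True show ?thesis by (intro exI[of _ l]) (auto simp: less_Suc_eq)
  next
    case False
    then obtain c0 where c0: "c0 \<in> C" "a c0 m \<noteq> 0" by auto
    let ?C = "C - {c0}"
    let ?a = "\<lambda>c i. a c i - a c m / a c0 m * a c0 i"
    have "m < card ?C" using Suc.prems c0 by auto
    with Suc.IH[of ?C ?a] Suc.prems obtain l where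
      l: "\<exists>c\<in>?C. l c \<noteq> 0" "\<And>i. i < m \<Longrightarrow> (\<Sum>c\<in>?C. l c * ?a c i) = 0" by auto
    define k where "k = l(c0 := - (\<Sum>c\<in>?C. l c * (a c m / a c0 m)))"
    have eq: "(\<Sum>c\<in>C. k c * a c i) = (\<Sum>c\<in>?C. l c * ?a c i)" for i
    proof -
      have "(\<Sum>c\<in>C. k c * a c i) = k c0 * a c0 i + (\<Sum>c\<in>?C. k c * a c i)"
        using Suc.prems c0 by (simp add: sum.remove)
      also have "(\<Sum>c\<in>?C. k c * a c i) = (\<Sum>c\<in>?C. l c * a c i)"
        by (rule sum.cong) (auto simp: k_def)
      finally show ?thesis
        by (simp add: k_def right_diff_distrib sum_subtractf sum_distrib_right mult.assoc)
    qed
    have "(\<Sum>c\<in>C. k c * a c i) = 0" if "i < Suc m" for i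
    proof (cases "i = m")
      case True
      have "(\<Sum>c\<in>?C. l c * ?a c m) = 0" using c0 by (intro sum.neutral) auto
      with True eq show ?thesis by simp
    next
      case False
      with that l(2) eq show ?thesis by simp
    qed
    moreover have "\<exists>c\<in>C. k c \<noteq> 0" using l(1) by (auto simp: k_def)
    ultimately show ?thesis by blast
  qed
qed

text \<open>
  Amitsur's trick: the inverses of \<open>f - c\<close>, for uncountably many scalars \<open>c\<close>, cannot be linearly
  independent in an algebra of countable dimension, and a linear relation between them makes \<open>f\<close>
  algebraic over \<open>\<complex>\<close>.
\<close>

lemma residue_field_complex:
  fixes M :: "('y \<Rightarrow> complex) set"
  assumes G: "countable G"
    and sub: "M \<subseteq> falg G" and one: "1 \<notin> M"
    and add: "\<And>f g. f \<in> M \<Longrightarrow> g \<in> M \<Longrightarrow> f + g \<in> M"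
    and mult: "\<And>f g. f \<in> falg G \<Longrightarrow> g \<in> M \<Longrightarrow> f * g \<in> M"
    and max: "\<And>f. f \<in> falg G \<Longrightarrow> f \<notin> M \<Longrightarrow> \<exists>g\<in>falg G. g * f - 1 \<in> M"
    and f: "f \<in> falg G"
  shows "\<exists>c. f - (\<lambda>_. c) \<in> M"
proof (rule ccontr)
  assume "\<not> ?thesis"
  then have nf: "f - (\<lambda>_. c) \<notin> M" for c by auto
  note B = unital_subring_falg[of G] note BD = unital_subringD[OF B]
  have fB: "f - (\<lambda>_. c) \<in> falg G" for c using f by (intro BD falg.const)
  have um: "- g \<in> M" if "g \<in> M" for g
    using mult[OF BD(5)[OF BD(1)] that] by simp
  \<comment> \<open>An inverse of \<open>f - c\<close> modulo \<open>M\<close> allows this factor to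
    be cancelled.\<close>
  have prime: "h \<in> M" if "h \<in> falg G" "(f - (\<lambda>_. c)) * h \<in> M" for h c
  proof -
    obtain g where g: "g \<in> falg G" "g * (f - (\<lambda>_. c)) - 1 \<in> M" using max[OF fB nf] by blast
    have "g * ((f - (\<lambda>_. c)) * h) \<in> M" using g that mult by blast
    moreover have "h * (g * (f - (\<lambda>_. c)) - 1) \<in> M" using g that mult by blast
    ultimately have "g * ((f - (\<lambda>_. c)) * h) + - (h * (g * (f - (\<lambda>_. c)) - 1)) \<in> M"
      using add um by blast
    then show ?thesis by (simp add: algebra_simps)
  qed
  have polyB: "(\<lambda>y. poly q (f y)) \<in> falg G" for q
  proof (induction q)
    case 0 then show ?case by (simp add: falg.const)
  next
    case (pCons a q)
    have "(\<lambda>_. a) + f * (\<lambda>y. poly q (f y)) \<in> falg G"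
      by (rule falg.add[OF falg.const falg.mult[OF f pCons(2)]])
    then show ?case by (simp add: plus_fun_def times_fun_def)
  qed
  \<comment> \<open>\<open>f\<close> satisfies no nontrivial polynomial relation modulo
    \<open>M\<close>: a root of the polynomial yields a linear factor, which can be
    cancelled.\<close>
  have poly: "q = 0" if "(\<lambda>y. poly q (f y)) \<in> M" for q :: "complex poly"
    using that
  proof (induction "degree q" arbitrary: q rule: less_induct)
    case less
    show ?case
    proof (cases "degree q = 0")
      case True
      then obtain a where a: "q = [:a:]" by (metis degree_eq_zeroE)
      show ?thesis
      proof (rule ccontr)
        assume "q \<noteq> 0"
        then have "(\<lambda>_. inverse a) * (\<lambda>y. poly q (f y)) = 1"
          by (auto simp: a one_fun_def times_fun_def)
        with mult[OF falg.const less.prems, of "inverse a"] one show False by simp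
      qed
    next
      case False
      then have "\<not> constant (poly q)" by (simp add: constant_degree)
      then obtain r where "poly q r = 0" using fundamental_theorem_of_algebra by blast
      then obtain p where p: "q = [:-r, 1:] * p" by (metis poly_eq_0_iff_dvd dvdE)
      have "(f - (\<lambda>_. r)) * (\<lambda>y. poly p (f y)) \<in> M"
        using less.prems by (simp add: p times_fun_def fun_diff_def algebra_simps)
      from prime[OF polyB this] have pM: "(\<lambda>y. poly p (f y)) \<in> M" .
      have "p \<noteq> 0" using False p by auto
      then have "degree p < degree q" unfolding p by (subst degree_mult_eq) auto
      from less.hyps[OF this pM] \<open>p \<noteq> 0\<close> show ?thesis by simp
    qed
  qed
  obtain e :: "nat \<Rightarrow> 'y \<Rightarrow> complex" where
    e: "\<And>f. f \<in> falg G \<Longrightarrow> \<exists>m c. f = (\<lambda>y. \<Sum>i<m. c i * e i y)"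
    using falg_countable_span[OF G] by blast
  have "\<forall>c. \<exists>g m a. g \<in> falg G \<and> g * (f - (\<lambda>_. c)) - 1 \<in> M \<and> g = (\<lambda>y. \<Sum>i<m. a i * e i y)"
    using max[OF fB nf] e by meson
  then obtain g m a where g: "\<And>c. g c \<in> falg G" "\<And>c. g c * (f - (\<lambda>_. c)) - 1 \<in> M"
    "\<And>c. g c = (\<lambda>y. \<Sum>i<m c. a c i * e i y)" unfolding choice_iff by blast
  \<comment> \<open>Uncountably many scalars are distributed over countably many lengths
    \<open>m c\<close>, so some length belongs to infinitely many of them.\<close>
  have "\<exists>k. infinite {c. m c = k}"
  proof (rule ccontr)
    assume "\<not> ?thesis"
    then have "countable (\<Union>k. {c. m c = k})" by (intro countable_UN) (auto intro: countable_finite)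
    moreover have "(\<Union>k. {c. m c = k}) = (UNIV :: complex set)" by auto
    ultimately have "countable (UNIV :: complex set)" by simp
    then have "countable (range complex_of_real)" by (rule countable_subset[rotated]) auto
    then have "countable (UNIV :: real set)" by (rule countable_image_inj_on) (auto intro: injI)
    then show False using uncountable_UNIV_real by simp
  qed
  then obtain k where "infinite {c. m c = k}" by auto
  then obtain C where C: "C \<subseteq> {c. m c = k}" "finite C" "card C = Suc k"
    using infinite_arbitrarily_large by blast
  obtain l c0 where c0: "c0 \<in> C" "l c0 \<noteq> 0" and
    l: "\<And>i. i < k \<Longrightarrow> (\<Sum>c\<in>C. l c * a c i) = 0"
    using exists_linear_dependence[of C k a] C by auto
  \<comment> \<open>The numerator of the linear relation after multiplication by all factors
    \<open>f - d\<close> with \<open>d\<close> in \<open>C\<close>. At \<open>c0\<close> only its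
    own summand survives, so \<open>q\<close> is not zero.\<close>
  define q where "q = (\<Sum>c\<in>C. Polynomial.smult (l c) (\<Prod>d\<in>C-{c}. [:-d, 1:]))"
  have lin: "(\<Sum>c\<in>C. l c * g c y) = 0" for y
  proof -
    have "(\<Sum>c\<in>C. l c * g c y) = (\<Sum>c\<in>C. \<Sum>i<k. l c * a c i * e i y)"
      using C by (intro sum.cong) (auto simp: g(3) sum_distrib_left mult.assoc)
    also have "\<dots> = (\<Sum>i<k. (\<Sum>c\<in>C. l c * a c i) * e i y)"
      by (subst sum.swap) (simp add: sum_distrib_right)
    finally show ?thesis by (simp add: l)
  qed
  have MS: "(\<Sum>c\<in>A. h c) \<in> M" if "\<And>c. c \<in> A \<Longrightarrow> h c \<in> M" "finite A" "A \<noteq> {}" for h and A :: "complex set"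
    using that(2,3,1) by (induction A rule: finite_ne_induct) (auto intro: add)
  \<comment> \<open>Modulo \<open>M\<close> the product of \<open>g c\<close> and
    \<open>f - c\<close> is 1, so each summand is the difference of two expressions that agree
    modulo \<open>M\<close>.\<close>
  have summand: "(\<lambda>_. l c) * ((\<lambda>y. \<Prod>d\<in>C-{c}. f y - d) * (g c * (f - (\<lambda>_. c)) - 1)) \<in> M" for c
  proof -
    have "(\<lambda>y. \<Prod>d\<in>C-{c}. f y - d) \<in> falg G"
      using fB by (intro falg_prod) (auto simp: fun_diff_def)
    then show ?thesis using g(2)[of c] mult falg.const by blast
  qed
  have "(\<Sum>c\<in>C. (\<lambda>_. l c) * ((\<lambda>y. \<Prod>d\<in>C-{c}. f y - d) * (g c * (f - (\<lambda>_. c)) - 1))) \<in> M" (is "?s \<in> M")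
    using C c0 by (intro MS summand) auto
  moreover have "?s = - (\<lambda>y. poly q (f y))"
  proof
    fix y
    have "?s y = (\<Sum>c\<in>C. l c * ((\<Prod>d\<in>C-{c}. f y - d) * (g c y * (f y - c) - 1)))"
      by (simp add: sum_fun_eval)
    also have "\<dots> = (\<Sum>c\<in>C. (l c * g c y) * (\<Prod>d\<in>C. f y - d) - l c * (\<Prod>d\<in>C-{c}. f y - d))"
      using C(2) by (intro sum.cong) (auto simp: prod.remove algebra_simps)
    also have "\<dots> = - (\<Sum>c\<in>C. l c * (\<Prod>d\<in>C-{c}. f y - d))"
      by (simp add: sum_subtractf lin flip: sum_distrib_right)
    finally show "?s y = (- (\<lambda>y. poly q (f y))) y"
      by (simp add: q_def poly_sum poly_prod)
  qed
  ultimately have "(\<lambda>y. poly q (f y)) \<in> M" using um[of ?s] by simp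
  from poly[OF this] have "poly q c0 = 0" by simp
  moreover have "poly q c0 = l c0 * (\<Prod>d\<in>C-{c0}. c0 - d)"
  proof -
    have "poly q c0 = (\<Sum>c\<in>C. l c * (\<Prod>d\<in>C-{c}. c0 - d))" by (simp add: q_def poly_sum poly_prod)
    also have "\<dots> = (\<Sum>c\<in>{c0}. l c * (\<Prod>d\<in>C-{c}. c0 - d))"
      using C(2) c0 by (intro sum.mono_neutral_right) (auto simp: prod_zero_iff)
    finally show ?thesis by simp
  qed
  ultimately show False using c0 C(2) by (auto simp: prod_zero_iff)
qed

definition alg_hom :: "('y \<Rightarrow> complex) set \<Rightarrow> (('y \<Rightarrow> complex) \<Rightarrow> complex) \<Rightarrow> bool" where
  "alg_hom B \<chi> \<longleftrightarrow> (\<forall>c. \<chi> (\<lambda>_. c) = c) \<and>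
     (\<forall>f\<in>B. \<forall>g\<in>B. \<chi> (f + g) = \<chi> f + \<chi> g \<and> \<chi> (f * g) = \<chi> f * \<chi> g)"

text \<open>Zorn's lemma gives a maximal ideal above \<open>I\<close>. Its residue field is
  \<open>\<complex>\<close>, so sending \<open>f\<close> to the scalar congruent to it is a
  character.\<close>

theorem nullstellensatz_hom:
  fixes G :: "('y \<Rightarrow> complex) set"
  assumes G: "countable G" and I: "I \<subseteq> falg G" "1 \<notin> ideal_span (falg G) I"
  shows "\<exists>\<chi>. alg_hom (falg G) \<chi> \<and> (\<forall>f\<in>I. \<chi> f = 0)"
proof -
  note B = unital_subring_falg[of G] note BD = unital_subringD[OF B]
  define ID where "ID = {M. ideal_span (falg G) I \<subseteq> M \<and> M \<subseteq> falg G \<and> 1 \<notin> M \<and>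
    (\<forall>f\<in>M. \<forall>g\<in>M. f + g \<in> M) \<and> (\<forall>f\<in>falg G. \<forall>g\<in>M. f * g \<in> M)}"
  have I0: "ideal_span (falg G) I \<in> ID"
    using I ideal_span_subset[OF B I(1)] by (auto simp: ID_def intro: ideal_span_add ideal_span_mult[OF B])
  have "\<exists>M\<in>ID. \<forall>X\<in>ID. M \<subseteq> X \<longrightarrow> X = M"
  proof (rule subset_Zorn_nonempty)
    show "ID \<noteq> {}" using I0 by auto
    fix \<C> assume C: "\<C> \<noteq> {}" "subset.chain ID \<C>"
    then have CI: "\<C> \<subseteq> ID" and tot: "\<And>X Y. X \<in> \<C> \<Longrightarrow> Y \<in> \<C> \<Longrightarrow> X \<subseteq> Y \<or> Y \<subseteq> X"
      by (auto simp: subset_chain_def)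
    have "f + g \<in> \<Union>\<C>" if "f \<in> \<Union>\<C>" "g \<in> \<Union>\<C>" for f g
    proof -
      from that obtain X Y where "X \<in> \<C>" "Y \<in> \<C>" "f \<in> X" "g \<in> Y" by auto
      with tot[of X Y] obtain Z where "Z \<in> \<C>" "f \<in> Z" "g \<in> Z" by auto
      with CI show ?thesis by (auto simp: ID_def)
    qed
    moreover have "f * g \<in> \<Union>\<C>" if "f \<in> falg G" "g \<in> \<Union>\<C>" for f g
      using that CI by (fastforce simp: ID_def)
    moreover have "ideal_span (falg G) I \<subseteq> \<Union>\<C>" using C(1) CI by (fastforce simp: ID_def)
    moreover have "\<Union>\<C> \<subseteq> falg G" "1 \<notin> \<Union>\<C>" using CI by (fastforce simp: ID_def)+
    ultimately show "\<Union>\<C> \<in> ID" unfolding ID_def by blast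
  qed
  then obtain M where M: "M \<in> ID" and maxM: "\<And>X. X \<in> ID \<Longrightarrow> M \<subseteq> X \<Longrightarrow> X = M" by auto
  have MI: "I \<subseteq> M" using M ideal_span_incl[OF B] by (auto simp: ID_def)
  have sub: "M \<subseteq> falg G" and one: "1 \<notin> M" using M by (auto simp: ID_def)
  have add: "\<And>f g. f \<in> M \<Longrightarrow> g \<in> M \<Longrightarrow> f + g \<in> M" and
    mult: "\<And>f g. f \<in> falg G \<Longrightarrow> g \<in> M \<Longrightarrow> f * g \<in> M"
    using M by (auto simp: ID_def)
  have um: "- g \<in> M" if "g \<in> M" for g using mult[OF BD(5)[OF BD(1)] that] by simp
  have zero: "0 \<in> M" using M ideal_span.zero[of "falg G" I] by (auto simp: ID_def)
  have max: "\<exists>g\<in>falg G. g * f - 1 \<in> M" if "f \<in> falg G" "f \<notin> M" for f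
  proof (rule ccontr)
    assume neg: "\<not> ?thesis"
    \<comment> \<open>The ideal generated by \<open>M\<close> and \<open>f\<close>; by maximality of
      \<open>M\<close> it has to contain 1.\<close>
    define X where "X = {g * f + h | g h. g \<in> falg G \<and> h \<in> M}"
    have "M \<subseteq> X"
    proof
      fix h assume "h \<in> M"
      then show "h \<in> X" unfolding X_def using BD(2) by (intro CollectI exI[of _ 0] exI[of _ h]) auto
    qed
    moreover have "f \<in> X" unfolding X_def using BD(1) zero by (intro CollectI exI[of _ 1] exI[of _ 0]) auto
    moreover have "X \<in> ID"
    proof -
      have "1 \<notin> X"
      proof
        assume "1 \<in> X"
        then obtain g h where gh: "1 = g * f + h" "g \<in> falg G" "h \<in> M" by (auto simp: X_def)
        then have "g * f - 1 = - h" by (simp add: algebra_simps)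
        with gh um[of h] neg show False by auto
      qed
      moreover have "a + b \<in> X" if "a \<in> X" "b \<in> X" for a b
      proof -
        from that obtain g h g' h' where "a = g * f + h" "b = g' * f + h'" "g \<in> falg G" "h \<in> M"
          "g' \<in> falg G" "h' \<in> M" by (auto simp: X_def)
        then have "a + b = (g + g') * f + (h + h')" "g + g' \<in> falg G" "h + h' \<in> M"
          by (simp_all add: distrib_right BD(3) add)
        then show ?thesis unfolding X_def by blast
      qed
      moreover have "a * b \<in> X" if "a \<in> falg G" "b \<in> X" for a b
      proof -
        from that obtain g h where "b = g * f + h" "g \<in> falg G" "h \<in> M" by (auto simp: X_def)
        with that(1) have "a * b = (a * g) * f + a * h" "a * g \<in> falg G" "a * h \<in> M"
          by (simp_all add: distrib_left mult.assoc BD(4) mult)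
        then show ?thesis unfolding X_def by blast
      qed
      moreover have "X \<subseteq> falg G"
      proof
        fix a assume "a \<in> X"
        then obtain g h where "a = g * f + h" "g \<in> falg G" "h \<in> M" by (auto simp: X_def)
        with that(1) sub show "a \<in> falg G" by (auto intro!: BD(3,4))
      qed
      moreover have "ideal_span (falg G) I \<subseteq> X" using M \<open>M \<subseteq> X\<close> by (auto simp: ID_def)
      ultimately show ?thesis unfolding ID_def by blast
    qed
    ultimately show False using maxM[of X] that(2) by auto
  qed
  have res: "\<exists>c. f - (\<lambda>_. c) \<in> M" if "f \<in> falg G" for f
    using residue_field_complex[OF G sub one _ _ _ that] add mult max by blast
  define \<chi> where "\<chi> f = (SOME c. f - (\<lambda>_. c) \<in> M)" for f
  have chi: "f - (\<lambda>_. \<chi> f) \<in> M" if "f \<in> falg G" for f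
    unfolding \<chi>_def by (rule someI_ex[OF res]) (use that in auto)
  have uniq: "\<chi> f = c" if "f \<in> falg G" "f - (\<lambda>_. c) \<in> M" for f c
  proof (rule ccontr)
    assume ne: "\<chi> f \<noteq> c"
    let ?d = "inverse (\<chi> f - c)"
    have "(\<lambda>_. ?d) * ((f - (\<lambda>_. c)) + - (f - (\<lambda>_. \<chi> f))) \<in> M"
      by (intro mult falg.const add um that chi)
    moreover have "(\<lambda>_. ?d) * ((f - (\<lambda>_. c)) + - (f - (\<lambda>_. \<chi> f))) = 1"
      using ne by (auto simp: fun_eq_iff)
    ultimately show False using one by simp
  qed
  have "alg_hom (falg G) \<chi>" unfolding alg_hom_def
  proof (intro conjI allI ballI)
    fix c show "\<chi> (\<lambda>_. c) = c"
      using zero by (intro uniq falg.const) (simp add: fun_diff_def zero_fun_def)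
  next
    fix f g assume fg: "f \<in> falg G" "g \<in> falg G"
    show "\<chi> (f + g) = \<chi> f + \<chi> g"
    proof (intro uniq falg.add fg)
      have "(f - (\<lambda>_. \<chi> f)) + (g - (\<lambda>_. \<chi> g)) \<in> M" by (intro add chi fg)
      then show "f + g - (\<lambda>_. \<chi> f + \<chi> g) \<in> M"
        by (simp add: fun_diff_def plus_fun_def algebra_simps)
    qed
    show "\<chi> (f * g) = \<chi> f * \<chi> g"
    proof (intro uniq falg.mult fg)
      have "g * (f - (\<lambda>_. \<chi> f)) + (\<lambda>_. \<chi> f) * (g - (\<lambda>_. \<chi> g)) \<in> M"
        by (intro add mult chi fg falg.const)
      then show "f * g - (\<lambda>_. \<chi> f * \<chi> g) \<in> M"
        by (simp add: fun_diff_def plus_fun_def times_fun_def algebra_simps)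
    qed
  qed
  moreover have "\<chi> f = 0" if "f \<in> I" for f
    using that I MI by (intro uniq) (auto simp: fun_diff_def)
  ultimately show ?thesis by blast
qed

text \<open>Nakayama's lemma by elimination in place of a determinant. Multiplication by
  \<open>1 - \<mu> p p\<close> expresses the last function through the others, and the factors
  collected on the way multiply to \<open>1 - m\<close> with \<open>m\<close> in \<open>M\<close>.
  Here \<open>M\<close> is a ring without unit, and the equations hold on \<open>H\<close>
  alone.\<close>

lemma nakayama_pointwise:
  fixes b :: "nat \<Rightarrow> 'y \<Rightarrow> complex"
  assumes add: "\<And>f g. f \<in> M \<Longrightarrow> g \<in> M \<Longrightarrow> f + g \<in> M"
    and mult: "\<And>f g. f \<in> M \<Longrightarrow> g \<in> M \<Longrightarrow> f * g \<in> M" and um: "\<And>f. f \<in> M \<Longrightarrow> - f \<in> M" and zero: "0 \<in> M"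
    and mu: "\<And>j k. j < p \<Longrightarrow> k < p \<Longrightarrow> \<mu> j k \<in> M"
    and b: "\<And>j y. j < p \<Longrightarrow> y \<in> H \<Longrightarrow> b j y = (\<Sum>k<p. \<mu> j k y * b k y)"
  shows "\<exists>m\<in>M. \<forall>j<p. \<forall>y\<in>H. (1 - m y) * b j y = 0"
  using mu b
proof (induction p arbitrary: \<mu>)
  case 0
  then show ?case using zero by auto
next
  case (Suc p)
  let ?m = "\<mu> p p"
  let ?n = "\<lambda>j k. (1 - ?m) * \<mu> j k + \<mu> j p * \<mu> p k"
  \<comment> \<open>The extra \<open>?m\<close> on the diagonal turns an equation for
    \<open>(1 - ?m) * b j\<close> back into one for \<open>b j\<close>.\<close>
  let ?\<nu> = "\<lambda>j k. ?n j k + (if j = k then ?m else 0)"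
  have nu: "?\<nu> j k \<in> M" if "j < p" "k < p" for j k
  proof -
    have "?n j k = \<mu> j k + - (?m * \<mu> j k) + \<mu> j p * \<mu> p k" by (simp add: algebra_simps)
    also have "\<dots> \<in> M" using that by (intro add mult um Suc.prems(1)) auto
    finally have "?n j k \<in> M" .
    then show ?thesis using Suc.prems(1) zero by (cases "j = k") (auto intro: add simp del: times_fun_def)
  qed
  have last: "(1 - ?m y) * b p y = (\<Sum>k<p. \<mu> p k y * b k y)" if "y \<in> H" for y
    using Suc.prems(2)[of p y] that by (simp add: algebra_simps)
  have eq: "b j y = (\<Sum>k<p. ?\<nu> j k y * b k y)" if "j < p" "y \<in> H" for j y
  proof -
    have "(1 - ?m y) * b j y = (\<Sum>k<p. (1 - ?m y) * \<mu> j k y * b k y) + \<mu> j p y * ((1 - ?m y) * b p y)"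
      using Suc.prems(2)[of j y] that by (simp add: algebra_simps sum_distrib_left)
    also have "\<dots> = (\<Sum>k<p. ?n j k y * b k y)"
      unfolding last[OF that(2)] by (simp add: sum_distrib_left distrib_right sum.distrib mult.assoc)
    finally have 1: "(1 - ?m y) * b j y = (\<Sum>k<p. ?n j k y * b k y)" .
    have "(\<Sum>k<p. ?\<nu> j k y * b k y) = (\<Sum>k<p. ?n j k y * b k y) + (\<Sum>k<p. if j = k then ?m y * b k y else 0)"
      unfolding sum.distrib[symmetric] by (rule sum.cong) (auto simp: distrib_right)
    also have "(\<Sum>k<p. if j = k then ?m y * b k y else 0) = ?m y * b j y"
      using that by (simp add: sum.delta)
    finally show ?thesis unfolding 1[symmetric] by (simp add: algebra_simps)
  qed
  obtain m where m: "m \<in> M" "\<And>j y. j < p \<Longrightarrow> y \<in> H \<Longrightarrow> (1 - m y) * b j y = 0"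
    using Suc.IH[of ?\<nu>, OF nu eq] by auto
  \<comment> \<open>Chosen so that \<open>1 - ?m'\<close> is the product of \<open>1 - m\<close> and
    \<open>1 - ?m\<close>.\<close>
  let ?m' = "m + ?m + - (m * ?m)"
  have "?m' \<in> M" using m(1) Suc.prems(1) by (intro add mult um) auto
  moreover have fac: "1 - ?m' y = (1 - m y) * (1 - ?m y)" for y by (simp add: algebra_simps)
  have "(1 - ?m' y) * b j y = 0" if "j < Suc p" "y \<in> H" for j y
  proof (cases "j = p")
    case True
    have "(1 - ?m' y) * b p y = (1 - m y) * (\<Sum>k<p. \<mu> p k y * b k y)"
      unfolding fac mult.assoc last[OF that(2)] ..
    also have "\<dots> = (\<Sum>k<p. \<mu> p k y * ((1 - m y) * b k y))"
      by (simp add: sum_distrib_left mult.left_commute)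
    finally show ?thesis using m(2) that True by simp
  next
    case False
    have "(1 - ?m' y) * b j y = (1 - ?m y) * ((1 - m y) * b j y)" unfolding fac by simp
    also have "(1 - m y) * b j y = 0" using that False by (intro m(2)) auto
    finally show ?thesis by simp
  qed
  ultimately show ?case by blast
qed

section \<open>Averaging over a self-adjoint group\<close>

text \<open>Gram-Schmidt, by induction on the coordinates. The vectors of \<open>U\<close> that
  vanish at \<open>k0\<close> form a subspace covered by the induction hypothesis, and at most one
  direction of \<open>U\<close> is missing from it.\<close>

lemma orthogonal_projection:
  fixes T :: "'k \<Rightarrow> complex"
  assumes "finite K"
    and add: "\<And>v w. v \<in> U \<Longrightarrow> w \<in> U \<Longrightarrow> (\<lambda>k. v k + w k) \<in> U"
    and scale: "\<And>v c. v \<in> U \<Longrightarrow> (\<lambda>k. c * v k) \<in> U" and ne: "U \<noteq> {}"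
  shows "\<exists>u\<in>U. \<forall>w\<in>U. (\<Sum>k\<in>K. (T k - u k) * cnj (w k)) = 0"
  using assms
proof (induction K arbitrary: U T rule: finite_induct)
  case empty
  then show ?case by auto
next
  case (insert k0 K)
  let ?U = "{w\<in>U. w k0 = 0}"
  have U0: "?U \<noteq> {}" using insert.prems(2)[of _ 0] insert.prems(3) by fastforce
  have IH: "\<exists>u\<in>?U. \<forall>w\<in>?U. (\<Sum>k\<in>insert k0 K. (T k - u k) * cnj (w k)) = 0" for T
    using insert.IH[of ?U T] insert.prems U0 insert.hyps by simp
  show ?case
  proof (cases "?U = U")
    case True
    then show ?thesis using IH[of T] by simp
  next
    case False
    then obtain e where e: "e \<in> U" "e k0 \<noteq> 0" by auto
    from IH[of e] obtain u0 where u0: "u0 \<in> ?U"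
      "\<And>w. w \<in> ?U \<Longrightarrow> (\<Sum>k\<in>insert k0 K. (e k - u0 k) * cnj (w k)) = 0" by blast
    \<comment> \<open>The missing direction, made orthogonal to the vectors of \<open>U\<close> that
      vanish at \<open>k0\<close>.\<close>
    define d where "d = (\<lambda>k. e k + (-1) * u0 k)"
    have d: "d \<in> U" unfolding d_def using e u0 by (intro insert.prems(1,2)) auto
    have dk: "d k0 \<noteq> 0" using e u0 by (auto simp: d_def)
    have d_orth: "(\<Sum>k\<in>insert k0 K. d k * cnj (w k)) = 0" if "w \<in> ?U" for w
      using u0(2)[OF that] by (simp add: d_def)
    have d_orth': "(\<Sum>k\<in>insert k0 K. w k * cnj (d k)) = 0" if "w \<in> ?U" for w
    proof -
      have "cnj (\<Sum>k\<in>insert k0 K. d k * cnj (w k)) = 0" using d_orth[OF that] by simp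
      then show ?thesis by (simp add: cnj_sum mult.commute)
    qed
    define N where "N = (\<Sum>k\<in>insert k0 K. d k * cnj (d k))"
    have "N \<noteq> 0"
    proof
      assume "N = 0"
      have "N = complex_of_real (\<Sum>k\<in>insert k0 K. (cmod (d k))\<^sup>2)"
        by (simp only: N_def complex_mult_cnj cmod_power2 of_real_sum of_real_add of_real_power)
      with \<open>N = 0\<close> have "(\<Sum>k\<in>insert k0 K. (cmod (d k))\<^sup>2) = 0" by (simp only: of_real_eq_0_iff)
      then have "(cmod (d k0))\<^sup>2 = 0"
        using insert.hyps by (subst (asm) sum_nonneg_eq_0_iff) auto
      with dk show False by simp
    qed
    from IH[of T] obtain u1 where u1: "u1 \<in> ?U"
      "\<And>w. w \<in> ?U \<Longrightarrow> (\<Sum>k\<in>insert k0 K. (T k - u1 k) * cnj (w k)) = 0" by blast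
    define c where "c = (\<Sum>k\<in>insert k0 K. (T k - u1 k) * cnj (d k)) / N"
    define u where "u = (\<lambda>k. u1 k + c * d k)"
    have uU: "u \<in> U" unfolding u_def using u1 d by (intro insert.prems(1,2)) auto
    have split: "(\<Sum>k\<in>insert k0 K. (T k - u k) * cnj (w k)) =
      (\<Sum>k\<in>insert k0 K. (T k - u1 k) * cnj (w k)) - c * (\<Sum>k\<in>insert k0 K. d k * cnj (w k))" for w
      unfolding sum_distrib_left sum_subtractf[symmetric]
      by (rule sum.cong) (auto simp: u_def algebra_simps)
    have "(\<Sum>k\<in>insert k0 K. (T k - u k) * cnj (w k)) = 0" if w: "w \<in> U" for w
    proof -
      \<comment> \<open>Subtracting \<open>s\<close> times \<open>d\<close> from \<open>w\<close>
        makes the value at \<open>k0\<close> vanish.\<close>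
      define s where "s = w k0 / d k0"
      define v where "v = (\<lambda>k. w k + (- s) * d k)"
      have v: "v \<in> ?U" using insert.prems(1)[OF w insert.prems(2)[OF d, of "- s"]] dk
        by (auto simp: v_def s_def)
      have "(\<Sum>k\<in>insert k0 K. (T k - u k) * cnj (w k)) =
        (\<Sum>k\<in>insert k0 K. (T k - u k) * cnj (v k)) + cnj s * (\<Sum>k\<in>insert k0 K. (T k - u k) * cnj (d k))"
        unfolding sum_distrib_left sum.distrib[symmetric]
        by (rule sum.cong) (auto simp: v_def algebra_simps)
      also have "(\<Sum>k\<in>insert k0 K. (T k - u k) * cnj (v k)) = 0"
        unfolding split using u1(2)[OF v] d_orth[OF v] by simp
      also have "(\<Sum>k\<in>insert k0 K. (T k - u k) * cnj (d k)) = 0"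
        unfolding split using \<open>N \<noteq> 0\<close> by (simp only: N_def[symmetric] c_def) simp
      finally show ?thesis by simp
    qed
    with uU show ?thesis by blast
  qed
qed

text \<open>
  The fixed vector is the component of \<open>T\<close> orthogonal to the span \<open>U\<close> of all \<open>gT - T\<close>.  It stays
  orthogonal to \<open>U\<close> under the group because the adjoint of each group element maps \<open>U\<close> to itself.
\<close>

lemma self_adjoint_averaging:
  fixes T :: "'k \<Rightarrow> complex" and B :: "'g \<Rightarrow> 'k \<Rightarrow> 'k \<Rightarrow> complex"
  assumes K: "finite K"
    and one: "e \<in> G" "\<And>s t. s \<in> K \<Longrightarrow> t \<in> K \<Longrightarrow> B e s t = (if s = t then 1 else 0)"
    and mult: "\<And>g h. g \<in> G \<Longrightarrow> h \<in> G \<Longrightarrow> m g h \<in> G"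
      "\<And>g h s t. g \<in> G \<Longrightarrow> h \<in> G \<Longrightarrow> s \<in> K \<Longrightarrow> t \<in> K \<Longrightarrow>
        B (m g h) s t = (\<Sum>r\<in>K. B g s r * B h r t)"
    and adj: "\<And>g. g \<in> G \<Longrightarrow> a g \<in> G"
      "\<And>g s t. g \<in> G \<Longrightarrow> s \<in> K \<Longrightarrow> t \<in> K \<Longrightarrow> B (a g) s t = cnj (B g t s)"
  shows "\<exists>xs :: (complex \<times> 'g) list. snd ` set xs \<subseteq> G \<and> sum_list (map fst xs) = 1 \<and>
    (\<forall>h\<in>G. \<forall>t\<in>K.
      (\<Sum>s\<in>K. (\<Sum>(c, g)\<leftarrow>xs. c * (\<Sum>r\<in>K. T r * B g r s)) * B h s t) =
      (\<Sum>(c, g)\<leftarrow>xs. c * (\<Sum>r\<in>K. T r * B g r t)))"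
proof -
  define act where "act T g t = (\<Sum>r\<in>K. T r * B g r t)" for T :: "'k \<Rightarrow> complex" and g t
  \<comment> \<open>Combinations of translates are kept as lists of coefficients and group elements,
    because the list found for \<open>T\<close> is later applied to other functions as well.\<close>
  define lc where "lc xs t = (\<Sum>(c, g)\<leftarrow>xs. c * act T g t)" for xs :: "(complex \<times> 'g) list" and t
  define U where "U = {lc xs | xs. snd ` set xs \<subseteq> G \<and> sum_list (map fst xs) = 0}"
  have U_I: "lc ys \<in> U" if "snd ` set ys \<subseteq> G" "sum_list (map fst ys) = 0" for ys
    unfolding U_def using that by blast
  have lc_app: "lc (xs @ ys) t = lc xs t + lc ys t" for xs ys t by (simp add: lc_def)
  have lc_sc: "lc (map (\<lambda>(c, g). (d * c, g)) xs) t = d * lc xs t" for d xs t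
    by (induction xs) (auto simp: lc_def algebra_simps)
  have fst_sc: "sum_list (map fst (map (\<lambda>(c, g). (d * c, g)) xs)) = d * sum_list (map fst xs)"
    for d :: complex and xs :: "(complex \<times> 'g) list"
    by (induction xs) (auto simp: algebra_simps)
  have act_act: "act (act T g) h t = act T (m g h) t" if "g \<in> G" "h \<in> G" "t \<in> K" for g h t
  proof -
    have "act (act T g) h t = (\<Sum>r\<in>K. \<Sum>s\<in>K. T s * B g s r * B h r t)"
      by (simp add: act_def sum_distrib_right)
    also have "\<dots> = (\<Sum>s\<in>K. T s * (\<Sum>r\<in>K. B g s r * B h r t))"
      by (subst sum.swap) (simp add: sum_distrib_left mult.assoc)
    also have "\<dots> = act T (m g h) t" unfolding act_def
      by (rule sum.cong) (auto simp: mult(2) that)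
    finally show ?thesis .
  qed
  have act_lc: "act (lc xs) h t = lc (map (\<lambda>(c, g). (c, m g h)) xs) t"
    if "snd ` set xs \<subseteq> G" "h \<in> G" "t \<in> K" for xs h t
    using that(1)
  proof (induction xs)
    case Nil
    then show ?case by (simp add: act_def lc_def)
  next
    case (Cons x xs)
    obtain c g where x: "x = (c, g)" by (cases x)
    have "act (lc (x # xs)) h t = c * act (act T g) h t + act (lc xs) h t"
    proof -
      have "lc (x # xs) r = c * act T g r + lc xs r" for r by (simp add: x lc_def)
      then show ?thesis
        unfolding act_def[of "lc (x # xs)"] act_def[of "lc xs"] act_def[of "act T g"]
        by (simp add: distrib_right sum.distrib sum_distrib_left mult.assoc)
    qed
    moreover have "g \<in> G" "snd ` set xs \<subseteq> G" using Cons.prems x by auto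
    moreover have "lc ((c, k) # ys) t = c * act T k t + lc ys t" for k ys by (simp add: lc_def)
    ultimately show ?case
      using Cons.IH act_act[of g h t] that(2,3) by (simp only: x list.map prod.case)
  qed
  have "\<exists>u\<in>U. \<forall>w\<in>U. (\<Sum>k\<in>K. (T k - u k) * cnj (w k)) = 0"
  proof (rule orthogonal_projection[OF K])
    fix v w assume "v \<in> U" "w \<in> U"
    then obtain xs ys where "v = lc xs" "w = lc ys" "snd ` set xs \<subseteq> G" "sum_list (map fst xs) = 0"
      "snd ` set ys \<subseteq> G" "sum_list (map fst ys) = 0" unfolding U_def by blast
    then show "(\<lambda>k. v k + w k) \<in> U" unfolding U_def
      by (intro CollectI exI[of _ "xs @ ys"]) (auto simp: lc_app)
  next
    fix v c assume "v \<in> U"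
    then obtain xs where "v = lc xs" "snd ` set xs \<subseteq> G" "sum_list (map fst xs) = 0"
      unfolding U_def by blast
    then show "(\<lambda>k. c * v k) \<in> U" unfolding U_def
      by (intro CollectI exI[of _ "map (\<lambda>(d, g). (c * d, g)) xs"])
        (auto simp: lc_sc fst_sc fun_eq_iff simp del: map_map)
  next
    have "lc [] \<in> U" unfolding U_def by (intro CollectI exI[of _ "[]"]) auto
    then show "U \<noteq> {}" by auto
  qed
  then obtain u where u: "u \<in> U" "\<And>w. w \<in> U \<Longrightarrow> (\<Sum>k\<in>K. (T k - u k) * cnj (w k)) = 0" by blast
  from u(1) obtain zs where zs: "snd ` set zs \<subseteq> G" "sum_list (map fst zs) = 0" and "u = lc zs"
    unfolding U_def by blast
  with u(2) have orth: "\<And>w. w \<in> U \<Longrightarrow> (\<Sum>k\<in>K. (T k - lc zs k) * cnj (w k)) = 0" by simp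
  \<comment> \<open>\<open>T\<close> minus its projection to \<open>U\<close>, as a list:
    coefficient 1 at the unit, then the negated list of the projection, whose coefficients add up to
    0.\<close>
  define xs where "xs = (1, e) # map (\<lambda>(c, g). (- 1 * c, g)) zs"
  have xsG: "snd ` set xs \<subseteq> G" using zs one by (auto simp: xs_def)
  have xs1: "sum_list (map fst xs) = 1"
    unfolding xs_def list.map sum_list.Cons fst_sc zs(2) by simp
  have "act T e t = T t" if "t \<in> K" for t
  proof -
    have "act T e t = (\<Sum>r\<in>K. if r = t then T r else 0)"
      unfolding act_def by (rule sum.cong) (auto simp: one(2) that)
    then show ?thesis using K that by simp
  qed
  then have xs_eq: "lc xs t = T t - lc zs t" if "t \<in> K" for t
    using that lc_sc[of "-1" zs t] by (simp add: xs_def lc_def)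
  have orth': "(\<Sum>k\<in>K. lc xs k * cnj (w k)) = 0" if "w \<in> U" for w
    using orth[OF that] by (simp add: xs_eq cong: sum.cong)
  have fixed: "act (lc xs) h t = lc xs t" if h: "h \<in> G" and t: "t \<in> K" for h t
  proof -
    define d where "d t = act (lc xs) h t - lc xs t" for t
    have snd_h: "snd ` set (map (\<lambda>(c, g). (c, m g h)) ys) \<subseteq> G" if "snd ` set ys \<subseteq> G" "h \<in> G"
      for ys :: "(complex \<times> 'g) list" and h
      using that mult(1) by fastforce
    have fst_h: "map fst (map (\<lambda>(c, g). (c, m g h)) ys) = map fst ys" for ys :: "(complex \<times> 'g) list" and h
      by (induction ys) auto
    define ds where "ds = map (\<lambda>(c, g). (c, m g h)) xs @ map (\<lambda>(c, g). (- 1 * c, g)) xs"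
    have ds: "lc ds \<in> U"
    proof -
      have "snd ` set ds \<subseteq> G" using snd_h[OF xsG h] xsG by (auto simp: ds_def)
      moreover have "sum_list (map fst ds) = 0"
        unfolding ds_def map_append sum_list_append fst_h fst_sc by simp
      ultimately show ?thesis unfolding U_def by blast
    qed
    have d_ds: "d t = lc ds t" if "t \<in> K" for t
      using lc_sc[of "-1" xs t] act_lc[OF xsG h that] by (simp add: d_def ds_def lc_app)
    \<comment> \<open>The matrix of \<open>h\<close> moves to the other factor as its adjoint, which
      maps \<open>U\<close> to itself.\<close>
    have adjU: "(\<Sum>t\<in>K. act (lc xs) h t * cnj (lc ds t)) = 0"
    proof -
      have dsG: "snd ` set ds \<subseteq> G" and ds0: "sum_list (map fst ds) = 0"
        using snd_h[OF xsG h] xsG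
        unfolding ds_def map_append sum_list_append fst_h fst_sc by auto
      have "(\<Sum>t\<in>K. act (lc xs) h t * cnj (lc ds t)) = (\<Sum>t\<in>K. \<Sum>s\<in>K. lc xs s * B h s t * cnj (lc ds t))"
        by (simp add: act_def sum_distrib_right)
      also have "\<dots> = (\<Sum>s\<in>K. \<Sum>t\<in>K. lc xs s * B h s t * cnj (lc ds t))" by (rule sum.swap)
      also have "\<dots> = (\<Sum>s\<in>K. lc xs s * cnj (act (lc ds) (a h) s))"
        by (rule sum.cong) (auto simp: act_def cnj_sum sum_distrib_left adj(2) h intro!: sum.cong)
      also have "\<dots> = (\<Sum>s\<in>K. lc xs s * cnj (lc (map (\<lambda>(c, g). (c, m g (a h))) ds) s))"
        by (rule sum.cong) (auto simp: act_lc[OF dsG adj(1)[OF h]])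
      also have "\<dots> = 0"
      proof (rule orth')
        show "lc (map (\<lambda>(c, g). (c, m g (a h))) ds) \<in> U"
        proof -
          have "sum_list (map fst (map (\<lambda>(c, g). (c, m g (a h))) ds)) = 0" by (simp only: fst_h ds0)
          with snd_h[OF dsG adj(1)[OF h]] have
            "snd ` set (map (\<lambda>(c, g). (c, m g (a h))) ds) \<subseteq> G \<and>
              sum_list (map fst (map (\<lambda>(c, g). (c, m g (a h))) ds)) = 0" by (rule conjI)
          then show ?thesis by (intro U_I) auto
        qed
      qed
      finally show ?thesis .
    qed
    \<comment> \<open>\<open>d\<close> agrees on \<open>K\<close> with an element of
      \<open>U\<close> and is orthogonal to \<open>U\<close>, hence has norm 0.\<close>
    have "(\<Sum>t\<in>K. d t * cnj (d t)) = (\<Sum>t\<in>K. act (lc xs) h t * cnj (lc ds t)) - (\<Sum>t\<in>K. lc xs t * cnj (lc ds t))"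
      unfolding sum_subtractf[symmetric]
      by (rule sum.cong) (auto simp: d_ds[symmetric] d_def algebra_simps)
    also have "\<dots> = 0" using adjU orth'[OF ds] by simp
    finally have "(\<Sum>t\<in>K. d t * cnj (d t)) = 0" .
    moreover have "(\<Sum>t\<in>K. d t * cnj (d t)) = complex_of_real (\<Sum>t\<in>K. (cmod (d t))\<^sup>2)"
      by (simp only: complex_mult_cnj cmod_power2 of_real_sum of_real_add of_real_power)
    ultimately have "(\<Sum>t\<in>K. (cmod (d t))\<^sup>2) = 0" by (simp only: of_real_eq_0_iff)
    then have "(cmod (d t))\<^sup>2 = 0" using K t by (subst (asm) sum_nonneg_eq_0_iff) auto
    then show ?thesis by (simp add: d_def)
  qed
  show ?thesis
    by (rule exI[of _ xs]) (use xsG xs1 fixed in \<open>auto simp: lc_def act_def\<close>)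
qed

section \<open>Matrix preliminaries\<close>

lemma index_mult_mat_sum:
  assumes "A \<in> carrier_mat n m" "B \<in> carrier_mat m p" "i < n" "j < p"
  shows "(A * B) $$ (i, j) = (\<Sum>k<m. A $$ (i, k) * B $$ (k, j))"
  using assms by (auto simp: scalar_prod_def atLeast0LessThan intro!: sum.cong)

lemma index_mult_mat_vec_sum:
  assumes "A \<in> carrier_mat n m" "v \<in> carrier_vec m" "i < n"
  shows "(A *\<^sub>v v) $ i = (\<Sum>k<m. A $$ (i, k) * v $ k)"
  using assms by (auto simp: scalar_prod_def atLeast0LessThan intro!: sum.cong)

lemma smult_smult_times: "a \<cdot>\<^sub>m (b \<cdot>\<^sub>m A) = (a * b :: complex) \<cdot>\<^sub>m A"
  by (intro eq_matI) auto

text \<open>The inverse is carried along with the matrix: the action on coordinates is polynomial in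
  the entries of both, and adjoints are taken of both.\<close>

definition inv_pair :: "nat \<Rightarrow> complex mat \<Rightarrow> complex mat \<Rightarrow> bool" where
  "inv_pair n g h \<longleftrightarrow> g \<in> carrier_mat n n \<and> h \<in> carrier_mat n n \<and> g * h = 1\<^sub>m n \<and> h * g = 1\<^sub>m n"

lemma inv_pair_of_det:
  assumes "A \<in> carrier_mat n n" "det A \<noteq> 0"
  shows "\<exists>B. inv_pair n A B"
  using det_non_zero_imp_unit[OF assms, of "()"]
  by (auto simp: Units_def ring_mat_def inv_pair_def)

lemma inv_pair_sym: "inv_pair n g h \<Longrightarrow> inv_pair n h g"
  by (auto simp: inv_pair_def)

lemma inv_pair_one: "inv_pair n (1\<^sub>m n) (1\<^sub>m n)"
  by (auto simp: inv_pair_def)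

lemma inv_pair_mult:
  assumes "inv_pair n g h" "inv_pair n g' h'"
  shows "inv_pair n (g * g') (h' * h)"
proof -
  have c: "g \<in> carrier_mat n n" "h \<in> carrier_mat n n" "g' \<in> carrier_mat n n" "h' \<in> carrier_mat n n"
    using assms by (auto simp: inv_pair_def)
  have 1: "g' * (h' * h) = h" "h * (g * g') = g'"
    using c assms by (auto simp: inv_pair_def simp flip: assoc_mult_mat[of _ n n _ n _ n])
  have "(g * g') * (h' * h) = g * h"
    using c by (simp add: assoc_mult_mat[of _ n n _ n _ n] 1)
  moreover have "(h' * h) * (g * g') = h' * g'"
    using c by (simp add: assoc_mult_mat[of _ n n _ n _ n] 1)
  ultimately show ?thesis using c assms by (auto simp: inv_pair_def)
qed

definition vsub :: "nat \<Rightarrow> complex vec set \<Rightarrow> bool" where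
  "vsub n W \<longleftrightarrow> W \<subseteq> carrier_vec n \<and> 0\<^sub>v n \<in> W \<and> (\<forall>v\<in>W. \<forall>w\<in>W. v + w \<in> W) \<and>
     (\<forall>c. \<forall>v\<in>W. c \<cdot>\<^sub>v v \<in> W)"

lemma mult_unit_vec:
  assumes "(A :: complex mat) \<in> carrier_mat n m" "k < m"
  shows "A *\<^sub>v unit_vec m k = col A k"
  using assms by (intro eq_vecI) (auto simp: scalar_prod_right_unit)

text \<open>As many leading columns of an invertible \<open>P\<close> as possible are placed in
  \<open>W\<close>. A vector of \<open>W\<close> with a nonzero coordinate beyond these would allow
  one column more.\<close>

lemma adapted_basis:
  assumes W: "vsub n W"
  shows "\<exists>d\<le>n. \<exists>P Q. inv_pair n P Q \<and>
    (\<forall>v\<in>carrier_vec n. P *\<^sub>v v \<in> W \<longleftrightarrow> (\<forall>i. d \<le> i \<longrightarrow> i < n \<longrightarrow> v $ i = 0))"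
proof -
  define good where "good d \<longleftrightarrow> d \<le> n \<and> (\<exists>P Q. inv_pair n P Q \<and> (\<forall>i<d. P *\<^sub>v unit_vec n i \<in> W))" for d
  have good0: "good 0" unfolding good_def using inv_pair_one by blast
  have bound: "\<And>y. good y \<Longrightarrow> y \<le> n" by (simp add: good_def)
  define d where "d = (GREATEST d. good d)"
  have gd: "good d" unfolding d_def by (rule GreatestI_nat[where P = good, OF good0 bound])
  have ngd: "\<not> good (Suc d)" using Greatest_le_nat[of good "Suc d" n] bound unfolding d_def by fastforce
  from gd obtain P Q where PQ: "inv_pair n P Q" "\<And>i. i < d \<Longrightarrow> P *\<^sub>v unit_vec n i \<in> W" and dn: "d \<le> n"
    by (auto simp: good_def)
  have P: "P \<in> carrier_mat n n" using PQ by (auto simp: inv_pair_def)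
  have add: "\<And>v w. v \<in> W \<Longrightarrow> w \<in> W \<Longrightarrow> v + w \<in> W" and sc: "\<And>c v. v \<in> W \<Longrightarrow> c \<cdot>\<^sub>v v \<in> W"
    and z: "0\<^sub>v n \<in> W" using W by (auto simp: vsub_def)
  have "P *\<^sub>v v \<in> W \<longleftrightarrow> (\<forall>i. d \<le> i \<longrightarrow> i < n \<longrightarrow> v $ i = 0)" if v: "v \<in> carrier_vec n" for v
  proof
    assume zero: "\<forall>i. d \<le> i \<longrightarrow> i < n \<longrightarrow> v $ i = 0"
    have "P *\<^sub>v vec n (\<lambda>i. if i < k then v $ i else 0) \<in> W" if "k \<le> d" for k
      using that
    proof (induction k)
      case 0
      have "vec n (\<lambda>i. if i < 0 then v $ i else 0) = 0\<^sub>v n" by auto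
      with P z show ?case by (auto simp: mult_mat_vec_def)
    next
      case (Suc k)
      have "vec n (\<lambda>i. if i < Suc k then v $ i else 0) =
        vec n (\<lambda>i. if i < k then v $ i else 0) + v $ k \<cdot>\<^sub>v unit_vec n k"
        using Suc.prems dn by (intro eq_vecI) (auto simp: less_Suc_eq)
      then have "P *\<^sub>v vec n (\<lambda>i. if i < Suc k then v $ i else 0) =
        P *\<^sub>v vec n (\<lambda>i. if i < k then v $ i else 0) + v $ k \<cdot>\<^sub>v (P *\<^sub>v unit_vec n k)"
        using P by (simp add: mult_add_distrib_mat_vec[of _ n n] mult_mat_vec[of _ n n])
      moreover have "\<dots> \<in> W" using Suc PQ(2)[of k] by (intro add sc) auto
      ultimately show ?case by simp
    qed
    moreover have "vec n (\<lambda>i. if i < d then v $ i else 0) = v" using v zero by (intro eq_vecI) auto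
    ultimately show "P *\<^sub>v v \<in> W" by fastforce
  next
    assume PvW: "P *\<^sub>v v \<in> W"
    show "\<forall>i. d \<le> i \<longrightarrow> i < n \<longrightarrow> v $ i = 0"
    proof (rule ccontr)
      assume "\<not> ?thesis"
      then obtain j where j: "d \<le> j" "j < n" "v $ j \<noteq> 0" by auto
      \<comment> \<open>Column \<open>d\<close> becomes \<open>v\<close>; if \<open>j\<close>
        differs from \<open>d\<close>, column \<open>j\<close> takes over the unit vector at
        \<open>d\<close>. As \<open>v\<close> has a nonzero entry at \<open>j\<close>, the matrix
        stays invertible.\<close>
      define E where "E = mat n n (\<lambda>(i, k). if k = d then v $ i else
        if k = j then (if i = d then 1 else 0) else if i = k then 1 else 0)"
      have E: "E \<in> carrier_mat n n" by (simp add: E_def)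
      have "det E \<noteq> 0"
      proof
        assume "det E = 0"
        then obtain x where x: "x \<in> carrier_vec n" "x \<noteq> 0\<^sub>v n" "E *\<^sub>v x = 0\<^sub>v n"
          using det_0_iff_vec_prod_zero[OF E] by auto
        have eq: "(\<Sum>k<n. E $$ (i, k) * x $ k) = 0" if "i < n" for i
          using index_mult_mat_vec_sum[OF E x(1) that] x(3) that by simp
        have "(\<Sum>k<n. E $$ (j, k) * x $ k) = (\<Sum>k<n. if k = d then v $ j * x $ d else 0)"
          by (rule sum.cong) (use j in \<open>auto simp: E_def\<close>)
        with eq[OF j(2)] j have xd: "x $ d = 0" by auto
        have "x $ i = 0" if i: "i < n" for i
        proof (cases "i = d")
          case True
          with xd show ?thesis by simp
        next
          case ne: False
          define i' where "i' = (if i = j then d else i)"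
          have "(\<Sum>k<n. E $$ (i', k) * x $ k) = (\<Sum>k<n. if k = i then x $ i else 0)"
            by (rule sum.cong) (use j i ne xd in \<open>auto simp: E_def i'_def\<close>)
          with eq[of i'] i j show ?thesis by (auto simp: i'_def split: if_splits)
        qed
        with x(1,2) show False by auto
      qed
      then obtain F where F: "inv_pair n E F" using inv_pair_of_det[OF E] by auto
      have "(P * E) *\<^sub>v unit_vec n i \<in> W" if "i < Suc d" for i
      proof -
        have "i < n" using that j by auto
        then have "(P * E) *\<^sub>v unit_vec n i = P *\<^sub>v col E i"
          using P E by (simp add: assoc_mult_mat_vec[of _ n n _ n] mult_unit_vec[OF E])
        moreover have "col E i = (if i = d then v else unit_vec n i)"
          using that \<open>i < n\<close> j v by (intro eq_vecI) (auto simp: E_def)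
        ultimately show ?thesis using that PQ(2)[of i] PvW by auto
      qed
      then have "good (Suc d)" unfolding good_def using inv_pair_mult[OF PQ(1) F] j by auto
      with ngd show False by simp
    qed
  qed
  with PQ(1) dn show ?thesis by blast
qed

section \<open>Families of matrices and their degenerations\<close>

definition fam :: "nat \<Rightarrow> 'i set \<Rightarrow> ('i \<Rightarrow> complex mat) \<Rightarrow> bool" where
  "fam n I X \<longleftrightarrow> (\<forall>l\<in>I. X l \<in> carrier_mat n n)"

definition irred :: "'i set \<Rightarrow> nat \<Rightarrow> ('i \<Rightarrow> complex mat) \<Rightarrow> bool" where
  "irred I n X \<longleftrightarrow> fam n I X \<and> 0 < n \<and>
     (\<forall>W. vsub n W \<and> (\<forall>l\<in>I. \<forall>w\<in>W. X l *\<^sub>v w \<in> W) \<longrightarrow> W = {0\<^sub>v n} \<or> W = carrier_vec n)"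

definition blk :: "('i \<Rightarrow> complex mat) \<Rightarrow> ('i \<Rightarrow> complex mat) \<Rightarrow> 'i \<Rightarrow> complex mat" where
  "blk X Y = (\<lambda>l. four_block_mat (X l) (0\<^sub>m (dim_row (X l)) (dim_col (Y l)))
                    (0\<^sub>m (dim_row (Y l)) (dim_col (X l))) (Y l))"

text \<open>Each summand carries its dimension, which cannot be read off a family on an empty index
  set and which determines the value of the empty word.\<close>

definition dsum :: "(nat \<times> ('i \<Rightarrow> complex mat)) list \<Rightarrow> 'i \<Rightarrow> complex mat" where
  "dsum L = (\<lambda>l. diag_block_mat (map (\<lambda>(m, \<sigma>). \<sigma> l) L))"

definition dims :: "(nat \<times> 'x) list \<Rightarrow> nat" where
  "dims L = sum_list (map fst L)"

lemma dims_simps [simp]: "dims [] = 0" "dims (p # L) = fst p + dims L" "dims (L @ M) = dims L + dims M"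
  by (simp_all add: dims_def)

lemma dsum_Nil: "dsum [] l = 0\<^sub>m 0 0" by (simp add: dsum_def)

lemma dsum_Cons: "dsum ((m, X) # L) = blk X (dsum L)"
  by (simp add: dsum_def blk_def Let_def fun_eq_iff)

lemma dsum_append: "dsum (L @ M) = blk (dsum L) (dsum M)"
  by (simp add: dsum_def blk_def Let_def fun_eq_iff diag_block_mat_append)

lemma fam_blk: "fam d I X \<Longrightarrow> fam e I Y \<Longrightarrow> fam (d + e) I (blk X Y)"
  by (auto simp: fam_def blk_def)

lemma fam_dsum: "\<forall>(m, \<sigma>)\<in>set L. fam m I \<sigma> \<Longrightarrow> fam (dims L) I (dsum L)"
  by (induction L) (auto simp: dsum_Cons fam_blk, auto simp: fam_def dsum_Nil)

text \<open>\<open>rels T E n X\<close> says that \<open>X\<close> respects the partial multiplication table \<open>T\<close> and units \<open>E\<close>.\<close>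

definition rels :: "('i \<times> 'i \<times> 'i) set \<Rightarrow> 'i set \<Rightarrow> nat \<Rightarrow> ('i \<Rightarrow> complex mat) \<Rightarrow> bool" where
  "rels T E n X \<longleftrightarrow> (\<forall>(l, m, p)\<in>T. X l * X m = X p) \<and> (\<forall>e\<in>E. X e = 1\<^sub>m n)"

text \<open>Sequential continuity in the entries over \<open>I\<close>. A limit of conjugates has
  the same value as the original under every such function that is conjugation invariant; this
  replaces statements about orbit closures.\<close>

definition cont_on_fams :: "'i set \<Rightarrow> nat \<Rightarrow> (('i \<Rightarrow> complex mat) \<Rightarrow> complex) \<Rightarrow> bool" where
  "cont_on_fams I n f \<longleftrightarrow>
     (\<forall>Xs X. (\<forall>k. fam n I (Xs k)) \<and> fam n I X \<and>
        (\<forall>l\<in>I. \<forall>i<n. \<forall>j<n. (\<lambda>k::nat. Xs k l $$ (i, j)) \<longlonglongrightarrow> X l $$ (i, j)) \<longrightarrow>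
        (\<lambda>k. f (Xs k)) \<longlonglongrightarrow> f X)"

definition conj_inv :: "'i set \<Rightarrow> nat \<Rightarrow> (('i \<Rightarrow> complex mat) \<Rightarrow> complex) \<Rightarrow> bool" where
  "conj_inv I n f \<longleftrightarrow>
     (\<forall>X g h. fam n I X \<and> inv_pair n g h \<longrightarrow> f (\<lambda>l. g * X l * h) = f X)"

text \<open>The constant sequence \<open>X\<close> converges to \<open>Y\<close>, because
  convergence is tested on \<open>I\<close> only.\<close>

lemma cont_on_fams_cong:
  assumes "cont_on_fams I n f" "fam n I X" "\<And>l. l \<in> I \<Longrightarrow> X l = Y l"
  shows "f X = f Y"
proof -
  have "fam n I Y" using assms by (auto simp: fam_def)
  with assms have "(\<lambda>k. f X) \<longlonglongrightarrow> f Y"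
    unfolding cont_on_fams_def by (auto dest!: spec[of _ "\<lambda>_. X"] spec[of _ Y])
  then show ?thesis by (simp add: LIMSEQ_const_iff)
qed

lemma cont_on_fams_blk1:
  assumes "cont_on_fams I (d + e) f" "fam e I Y"
  shows "cont_on_fams I d (\<lambda>X. f (blk X Y))"
  unfolding cont_on_fams_def
proof (intro allI impI)
  fix Xs :: "nat \<Rightarrow> _" and X
  assume *: "(\<forall>k. fam d I (Xs k)) \<and> fam d I X \<and>
    (\<forall>l\<in>I. \<forall>i<d. \<forall>j<d. (\<lambda>k. Xs k l $$ (i, j)) \<longlonglongrightarrow> X l $$ (i, j))"
  have Yc: "Y l \<in> carrier_mat e e" and Xc: "X l \<in> carrier_mat d d" and
    Xsc: "Xs k l \<in> carrier_mat d d" if "l \<in> I" for l k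
    using that assms(2) * by (auto simp: fam_def)
  have "(\<lambda>k. blk (Xs k) Y l $$ (i, j)) \<longlonglongrightarrow> blk X Y l $$ (i, j)"
    if "l \<in> I" "i < d + e" "j < d + e" for l i j
    using that Yc[OF that(1)] Xc[OF that(1)] *
    by (auto simp: blk_def carrier_matD[OF Xsc[OF that(1)]])
  then show "(\<lambda>k. f (blk (Xs k) Y)) \<longlonglongrightarrow> f (blk X Y)"
    using assms * unfolding cont_on_fams_def
    by (auto dest!: spec[of _ "\<lambda>k. blk (Xs k) Y"] spec[of _ "blk X Y"] simp: fam_blk)
qed

lemma cont_on_fams_blk2:
  assumes "cont_on_fams I (d + e) f" "fam d I Y"
  shows "cont_on_fams I e (\<lambda>X. f (blk Y X))"
  unfolding cont_on_fams_def
proof (intro allI impI)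
  fix Xs :: "nat \<Rightarrow> _" and X
  assume *: "(\<forall>k. fam e I (Xs k)) \<and> fam e I X \<and>
    (\<forall>l\<in>I. \<forall>i<e. \<forall>j<e. (\<lambda>k. Xs k l $$ (i, j)) \<longlonglongrightarrow> X l $$ (i, j))"
  have Yc: "Y l \<in> carrier_mat d d" and Xc: "X l \<in> carrier_mat e e" and
    Xsc: "Xs k l \<in> carrier_mat e e" if "l \<in> I" for l k
    using that assms(2) * by (auto simp: fam_def)
  have "(\<lambda>k. blk Y (Xs k) l $$ (i, j)) \<longlonglongrightarrow> blk Y X l $$ (i, j)"
    if "l \<in> I" "i < d + e" "j < d + e" for l i j
    using that Yc[OF that(1)] Xc[OF that(1)] *
    by (auto simp: blk_def carrier_matD[OF Xsc[OF that(1)]])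
  then show "(\<lambda>k. f (blk Y (Xs k))) \<longlonglongrightarrow> f (blk Y X)"
    using assms * unfolding cont_on_fams_def
    by (auto dest!: spec[of _ "\<lambda>k. blk Y (Xs k)"] spec[of _ "blk Y X"] simp: fam_blk)
qed

abbreviation fbd :: "complex mat \<Rightarrow> complex mat \<Rightarrow> complex mat" where
  "fbd A D \<equiv> four_block_mat A (0\<^sub>m (dim_row A) (dim_col D)) (0\<^sub>m (dim_row D) (dim_col A)) D"

lemma fbd_mult:
  assumes "A \<in> carrier_mat d d" "D \<in> carrier_mat e e" "A' \<in> carrier_mat d d" "D' \<in> carrier_mat e e"
  shows "fbd A D * fbd A' D' = fbd (A * A') (D * D')"
  using assms by (subst mult_four_block_mat[of _ d d _ e _ e _ _ d _ e]) auto

lemma fbd_one: "fbd (1\<^sub>m d) (1\<^sub>m e) = 1\<^sub>m (d + e)"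
  by (intro eq_matI) auto

lemma inv_pair_fbd:
  assumes "inv_pair d g h" "inv_pair e g' h'"
  shows "inv_pair (d + e) (fbd g g') (fbd h h')"
  using assms by (auto simp: inv_pair_def fbd_mult[of _ d _ e] fbd_one)

lemma blk_conj:
  assumes "inv_pair d g h" "inv_pair e g' h'" "X l \<in> carrier_mat d d" "Y l \<in> carrier_mat e e"
  shows "fbd g g' * blk X Y l * fbd h h' = blk (\<lambda>l. g * X l * h) (\<lambda>l. g' * Y l * h') l"
proof -
  have "fbd g g' * blk X Y l = fbd (g * X l) (g' * Y l)"
    using assms unfolding blk_def inv_pair_def by (intro fbd_mult) auto
  also have "\<dots> * fbd h h' = fbd (g * X l * h) (g' * Y l * h')"
    using assms unfolding inv_pair_def by (intro fbd_mult) auto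
  finally show ?thesis by (simp add: blk_def)
qed

text \<open>Conjugating by \<open>diag(c, \<dots>, c, 1, \<dots>, 1)\<close> multiplies the upper right block by \<open>c\<close>.\<close>

lemma triangular_degeneration:
  assumes f: "cont_on_fams I (d + e) f" "conj_inv I (d + e) f"
    and X: "\<And>l. l \<in> I \<Longrightarrow> X l = four_block_mat (A l) (B l) (0\<^sub>m e d) (D l)"
    and c: "fam d I A" "fam e I D" "\<And>l. l \<in> I \<Longrightarrow> B l \<in> carrier_mat d e"
  shows "f X = f (blk A D)"
proof -
  \<comment> \<open>Nonzero scalars tending to 0: every member of the sequence is a conjugate of
    \<open>X\<close>, and the limit is block diagonal.\<close>
  define s :: "nat \<Rightarrow> complex" where "s k = of_real (inverse (real (Suc k)))" for k
  have s0: "s k \<noteq> 0" for k unfolding s_def of_real_eq_0_iff by simp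
  have slim: "s \<longlonglongrightarrow> 0"
    unfolding s_def using tendsto_of_real[OF LIMSEQ_inverse_real_of_nat, where 'a = complex]
    by (simp only: of_real_0)
  define Y where "Y k l = four_block_mat (A l) (s k \<cdot>\<^sub>m B l) (0\<^sub>m e d) (D l)" for k l
  have Xf: "fam (d + e) I X" using c X by (auto simp: fam_def)
  have Yf: "fam (d + e) I (Y k)" for k using c by (auto simp: fam_def Y_def)
  have "f (Y k) = f X" for k
  proof -
    define g h where "g = fbd (s k \<cdot>\<^sub>m 1\<^sub>m d) (1\<^sub>m e)" and "h = fbd (inverse (s k) \<cdot>\<^sub>m 1\<^sub>m d) (1\<^sub>m e)"
    have p1: "inv_pair d (s k \<cdot>\<^sub>m 1\<^sub>m d) (inverse (s k) \<cdot>\<^sub>m 1\<^sub>m d)"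
      using s0[of k] by (auto simp: inv_pair_def smult_smult_times)
    have "inv_pair (d + e) g h"
      using inv_pair_fbd[OF p1 inv_pair_one[of e]] unfolding g_def h_def by simp
    then have "f (\<lambda>l. g * X l * h) = f X" using f(2) Xf by (auto simp: conj_inv_def)
    moreover have "g * X l * h = Y k l" if l: "l \<in> I" for l
    proof -
      have cc: "A l \<in> carrier_mat d d" "D l \<in> carrier_mat e e" "B l \<in> carrier_mat d e"
        using c l by (auto simp: fam_def)
      have "g * X l = four_block_mat (s k \<cdot>\<^sub>m A l) (s k \<cdot>\<^sub>m B l) (0\<^sub>m e d) (D l)"
        unfolding g_def X[OF l] using cc
        by (subst mult_four_block_mat[of _ d d _ e _ e _ _ d _ e])
          (auto simp: mult_smult_assoc_mat[of _ d d])
      also have "\<dots> * h = Y k l"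
        unfolding h_def Y_def using cc s0[of k]
        by (subst mult_four_block_mat[of _ d d _ e _ e _ _ d _ e])
          (auto simp: mult_smult_assoc_mat[of _ d d] mult_smult_distrib[of _ d d] smult_smult_times)
      finally show ?thesis .
    qed
    ultimately show ?thesis
      using cont_on_fams_cong[OF f(1) Yf[of k], of "\<lambda>l. g * X l * h"] by simp
  qed
  moreover have "(\<lambda>k. f (Y k)) \<longlonglongrightarrow> f (blk A D)"
  proof -
    have "(\<lambda>k. Y k l $$ (i, j)) \<longlonglongrightarrow> blk A D l $$ (i, j)" if "l \<in> I" "i < d + e" "j < d + e" for l i j
    proof -
      have cc: "A l \<in> carrier_mat d d" "D l \<in> carrier_mat e e" "B l \<in> carrier_mat d e"
        using c that by (auto simp: fam_def)
      have "(\<lambda>k. s k * B l $$ (i, j - d)) \<longlonglongrightarrow> 0" using tendsto_mult_left_zero[OF slim] .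
      then show ?thesis using that cc by (auto simp: Y_def blk_def)
    qed
    then show ?thesis using f(1) Yf fam_blk[OF c(1,2)] unfolding cont_on_fams_def by blast
  qed
  ultimately show ?thesis by (simp add: LIMSEQ_const_iff)
qed

lemma conj_inv_blk1:
  assumes "cont_on_fams I (d + e) f" "conj_inv I (d + e) f" "fam e I Y"
  shows "conj_inv I d (\<lambda>X. f (blk X Y))"
  unfolding conj_inv_def
proof (intro allI impI)
  fix X g h assume *: "fam d I X \<and> inv_pair d g h"
  have "f (\<lambda>l. fbd g (1\<^sub>m e) * blk X Y l * fbd h (1\<^sub>m e)) = f (blk X Y)"
    using * assms(3)
    by (intro assms(2)[unfolded conj_inv_def, rule_format] conjI fam_blk inv_pair_fbd inv_pair_one) auto
  moreover have "f (blk (\<lambda>l. g * X l * h) Y) = f (\<lambda>l. fbd g (1\<^sub>m e) * blk X Y l * fbd h (1\<^sub>m e))"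
  proof (rule cont_on_fams_cong[OF assms(1)])
    show "fam (d + e) I (blk (\<lambda>l. g * X l * h) Y)"
      using * assms(3) by (intro fam_blk) (auto simp: fam_def inv_pair_def)
    fix l assume "l \<in> I"
    then have "X l \<in> carrier_mat d d" "Y l \<in> carrier_mat e e" using * assms(3) by (auto simp: fam_def)
    then show "blk (\<lambda>l. g * X l * h) Y l = fbd g (1\<^sub>m e) * blk X Y l * fbd h (1\<^sub>m e)"
      using blk_conj[of d g h e "1\<^sub>m e" "1\<^sub>m e" X l Y] * inv_pair_one by (auto simp: blk_def)
  qed
  ultimately show "f (blk (\<lambda>l. g * X l * h) Y) = f (blk X Y)" by simp
qed

lemma conj_inv_blk2:
  assumes "cont_on_fams I (d + e) f" "conj_inv I (d + e) f" "fam d I Y"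
  shows "conj_inv I e (\<lambda>X. f (blk Y X))"
  unfolding conj_inv_def
proof (intro allI impI)
  fix X g h assume *: "fam e I X \<and> inv_pair e g h"
  have "f (\<lambda>l. fbd (1\<^sub>m d) g * blk Y X l * fbd (1\<^sub>m d) h) = f (blk Y X)"
    using * assms(3)
    by (intro assms(2)[unfolded conj_inv_def, rule_format] conjI fam_blk inv_pair_fbd inv_pair_one) auto
  moreover have "f (blk Y (\<lambda>l. g * X l * h)) = f (\<lambda>l. fbd (1\<^sub>m d) g * blk Y X l * fbd (1\<^sub>m d) h)"
  proof (rule cont_on_fams_cong[OF assms(1)])
    show "fam (d + e) I (blk Y (\<lambda>l. g * X l * h))"
      using * assms(3) by (intro fam_blk) (auto simp: fam_def inv_pair_def)
    fix l assume "l \<in> I"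
    then have "X l \<in> carrier_mat e e" "Y l \<in> carrier_mat d d" using * assms(3) by (auto simp: fam_def)
    then show "blk Y (\<lambda>l. g * X l * h) l = fbd (1\<^sub>m d) g * blk Y X l * fbd (1\<^sub>m d) h"
      using blk_conj[of d "1\<^sub>m d" "1\<^sub>m d" e g h Y l X] * inv_pair_one by (auto simp: blk_def)
  qed
  ultimately show "f (blk Y (\<lambda>l. g * X l * h)) = f (blk Y X)" by simp
qed

lemma rels_conj:
  assumes "rels T E n X" "inv_pair n g h" "fam n I X" "T \<subseteq> I \<times> I \<times> I"
  shows "rels T E n (\<lambda>l. g * X l * h)"
proof -
  have gh: "g \<in> carrier_mat n n" "h \<in> carrier_mat n n" "h * g = 1\<^sub>m n" "g * h = 1\<^sub>m n"
    using assms by (auto simp: inv_pair_def)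
  have "(g * X l * h) * (g * X m * h) = g * X p * h" if "(l, m, p) \<in> T" for l m p
  proof -
    have c: "X l \<in> carrier_mat n n" "X m \<in> carrier_mat n n" and eq: "X l * X m = X p"
      using that assms by (auto simp: fam_def rels_def)
    have 1: "h * (g * (X m * h)) = X m * h"
      using gh(1,2) c(2) by (subst assoc_mult_mat[symmetric, of h n n g n _ n]) (auto simp: gh(3))
    have "(g * X l * h) * (g * X m * h) = g * (X l * (h * (g * (X m * h))))"
      using gh(1,2) c by (simp add: assoc_mult_mat[of _ n n _ n _ n])
    also have "\<dots> = g * (X l * X m) * h"
      unfolding 1 using gh(1,2) c by (simp add: assoc_mult_mat[of _ n n _ n _ n])
    finally show ?thesis by (simp add: eq)
  qed
  moreover have "g * X e * h = 1\<^sub>m n" if "e \<in> E" for e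
    using that assms(1) gh by (auto simp: rels_def)
  ultimately show ?thesis by (auto simp: rels_def)
qed

text \<open>Block triangular matrices multiply blockwise on the diagonal. So the diagonal blocks of
  a representation are representations, and the relations survive degeneration.\<close>

lemma rels_triangular:
  assumes "rels T E (d + e) X" "T \<subseteq> I \<times> I \<times> I" "E \<subseteq> I"
    and X: "\<And>l. l \<in> I \<Longrightarrow> X l = four_block_mat (A l) (B l) (0\<^sub>m e d) (D l)"
    and c: "fam d I A" "fam e I D" "\<And>l. l \<in> I \<Longrightarrow> B l \<in> carrier_mat d e"
  shows "rels T E d A" "rels T E e D"
proof -
  have inj: "A1 = A2 \<and> D1 = D2" if "four_block_mat A1 B1 C1 D1 = four_block_mat A2 B2 C2 D2"
    "A1 \<in> carrier_mat d d" "A2 \<in> carrier_mat d d" "D1 \<in> carrier_mat e e" "D2 \<in> carrier_mat e e"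
    for A1 A2 B1 B2 C1 C2 D1 D2 :: "complex mat"
  proof (intro conjI eq_matI)
    fix i j assume "i < dim_row A2" "j < dim_col A2"
    then show "A1 $$ (i, j) = A2 $$ (i, j)"
      using arg_cong[OF that(1), of "\<lambda>M. M $$ (i, j)"] that(2-) by simp
  next
    fix i j assume "i < dim_row D2" "j < dim_col D2"
    then show "D1 $$ (i, j) = D2 $$ (i, j)"
      using arg_cong[OF that(1), of "\<lambda>M. M $$ (i + d, j + d)"] that(2-) by simp
  qed (use that(2-) in auto)
  have "A l * A m = A p \<and> D l * D m = D p" if T: "(l, m, p) \<in> T" for l m p
  proof -
    have I: "l \<in> I" "m \<in> I" "p \<in> I" using T assms(2) by auto
    have cc: "A k \<in> carrier_mat d d" "D k \<in> carrier_mat e e" "B k \<in> carrier_mat d e" if "k \<in> I" for k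
      using c that by (auto simp: fam_def)
    have "X l * X m = X p" using T assms(1) by (auto simp: rels_def)
    moreover have "X l * X m = four_block_mat (A l * A m) (A l * B m + B l * D m) (0\<^sub>m e d) (D l * D m)"
      unfolding X[OF I(1)] X[OF I(2)] using cc[OF I(1)] cc[OF I(2)]
      by (subst mult_four_block_mat[of _ d d _ e _ e _ _ d _ e]) auto
    ultimately have "four_block_mat (A l * A m) (A l * B m + B l * D m) (0\<^sub>m e d) (D l * D m) =
        four_block_mat (A p) (B p) (0\<^sub>m e d) (D p)" by (simp add: X[OF I(3)])
    then show ?thesis by (rule inj) (use cc[OF I(1)] cc[OF I(2)] cc[OF I(3)] in auto)
  qed
  moreover have "A k = 1\<^sub>m d \<and> D k = 1\<^sub>m e" if "k \<in> E" for k
  proof -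
    have I: "k \<in> I" using that assms(3) by auto
    have "four_block_mat (A k) (B k) (0\<^sub>m e d) (D k) = fbd (1\<^sub>m d) (1\<^sub>m e)"
      using assms(1) that unfolding fbd_one by (simp add: rels_def X[OF I, symmetric])
    then show ?thesis by (rule inj) (use c(1,2) I in \<open>auto simp: fam_def\<close>)
  qed
  ultimately show "rels T E d A" "rels T E e D" by (auto simp: rels_def)
qed

text \<open>A proper invariant subspace makes \<open>X\<close> block triangular in an adapted basis,
  degeneration removes the upper right block, and both diagonal blocks are smaller. An invariant
  function of the whole tuple restricts to an invariant function of one block while the other is
  held fixed.\<close>

theorem jordan_hoelder_degeneration:
  fixes X :: "'i \<Rightarrow> complex mat"
  assumes "fam n I X" "rels T E n X" and TE: "T \<subseteq> I \<times> I \<times> I" "E \<subseteq> I"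
  shows "\<exists>L. (\<forall>(m, \<sigma>)\<in>set L. irred I m \<sigma> \<and> rels T E m \<sigma>) \<and> dims L = n \<and>
    (\<forall>f. cont_on_fams I n f \<and> conj_inv I n f \<longrightarrow> f X = f (dsum L))"
  using assms(1,2)
proof (induction n arbitrary: X rule: less_induct)
  case (less n)
  note X = less.prems(1)
  consider "n = 0" | "irred I n X" | "0 < n" "\<not> irred I n X" by auto
  then show ?case
  proof cases
    case 1
    have "f X = f (dsum [])" if "cont_on_fams I n f" for f
      using 1 X by (intro cont_on_fams_cong[OF that X] eq_matI) (auto simp: dsum_Nil fam_def)
    with 1 show ?thesis by (intro exI[of _ "[]"]) auto
  next
    case 2
    have "dsum [(n, X)] = X" unfolding dsum_def by (simp only: list.map prod.case diag_block_mat_singleton)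
    with 2 less.prems show ?thesis by (intro exI[of _ "[(n, X)]"]) (auto simp: irred_def)
  next
    case 3
    then obtain W where W: "vsub n W" "\<And>l w. l \<in> I \<Longrightarrow> w \<in> W \<Longrightarrow> X l *\<^sub>v w \<in> W"
      "W \<noteq> {0\<^sub>v n}" "W \<noteq> carrier_vec n" using X by (auto simp: irred_def)
    from adapted_basis[OF W(1)] obtain d P Q where dn: "d \<le> n" and PQ: "inv_pair n P Q"
      and PW: "\<And>v. v \<in> carrier_vec n \<Longrightarrow> P *\<^sub>v v \<in> W \<longleftrightarrow> (\<forall>i. d \<le> i \<longrightarrow> i < n \<longrightarrow> v $ i = 0)" by blast
    have c: "P \<in> carrier_mat n n" "Q \<in> carrier_mat n n" and PQ1: "P * Q = 1\<^sub>m n" "Q * P = 1\<^sub>m n"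
      using PQ by (auto simp: inv_pair_def)
    have WP: "w = P *\<^sub>v (Q *\<^sub>v w)" "Q *\<^sub>v w \<in> carrier_vec n" if "w \<in> carrier_vec n" for w
      using that c PQ1 by (auto simp flip: assoc_mult_mat_vec[of _ n n _ n])
    have d0: "d \<noteq> 0"
    proof
      assume d: "d = 0"
      have "w = 0\<^sub>v n" if "w \<in> W" for w
      proof -
        have w: "w \<in> carrier_vec n" using that W(1) by (auto simp: vsub_def)
        then have "P *\<^sub>v (Q *\<^sub>v w) \<in> W" using that WP(1)[OF w] by simp
        then have "Q *\<^sub>v w = 0\<^sub>v n" using PW[OF WP(2)[OF w]] d WP(2)[OF w] c by (intro eq_vecI) auto
        moreover have "P *\<^sub>v 0\<^sub>v n = 0\<^sub>v n" using c by (intro eq_vecI) (auto simp: scalar_prod_def)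
        ultimately show ?thesis using WP(1)[OF w] by simp
      qed
      with W(1,3) show False by (auto simp: vsub_def)
    qed
    have dn': "d \<noteq> n"
    proof
      assume "d = n"
      then have "w \<in> W" if "w \<in> carrier_vec n" for w
        using PW[OF WP(2)[OF that]] WP(1)[OF that] by auto
      with W(1,4) show False by (auto simp: vsub_def)
    qed
    define e where "e = n - d"
    have n: "n = d + e" and lt: "d < n" "e < n" using dn dn' d0 by (auto simp: e_def)
    define Y where "Y = (\<lambda>l. Q * X l * P)"
    have Xc: "X l \<in> carrier_mat n n" if "l \<in> I" for l using X that by (auto simp: fam_def)
    have Yc: "Y l \<in> carrier_mat n n" if "l \<in> I" for l using Xc[OF that] c by (auto simp: Y_def)
    \<comment> \<open>The first \<open>d\<close> basis vectors span the invariant subspace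
      \<open>W\<close>, so the lower left block vanishes.\<close>
    have Y0: "Y l $$ (i, j) = 0" if l: "l \<in> I" and "d \<le> i" "i < n" "j < d" for l i j
    proof -
      have jn: "j < n" using that lt by simp
      have "P *\<^sub>v unit_vec n j \<in> W" using PW[of "unit_vec n j"] that by auto
      then have "X l *\<^sub>v (P *\<^sub>v unit_vec n j) \<in> W" using W(2) l by auto
      moreover have "P *\<^sub>v (Y l *\<^sub>v unit_vec n j) = X l *\<^sub>v (P *\<^sub>v unit_vec n j)"
      proof -
        have "P * Y l = (P * Q) * (X l * P)" unfolding Y_def using c Xc[OF l]
          by (simp add: assoc_mult_mat[of _ n n _ n _ n])
        then have "P * Y l = X l * P" using c Xc[OF l] by (simp add: PQ1)
        moreover have "P *\<^sub>v (Y l *\<^sub>v unit_vec n j) = (P * Y l) *\<^sub>v unit_vec n j"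
          using c Yc[OF l] by (simp add: assoc_mult_mat_vec[of _ n n _ n])
        ultimately show ?thesis using c Xc[OF l] by (simp add: assoc_mult_mat_vec[of _ n n _ n])
      qed
      ultimately have "(Y l *\<^sub>v unit_vec n j) $ i = 0"
        using PW[of "Y l *\<^sub>v unit_vec n j"] Yc[OF l] that by auto
      then show ?thesis using mult_unit_vec[OF Yc[OF l] jn] that Yc[OF l] jn by auto
    qed
    define A where "A = (\<lambda>l. mat d d (\<lambda>(i, j). Y l $$ (i, j)))"
    define B where "B = (\<lambda>l. mat d e (\<lambda>(i, j). Y l $$ (i, j + d)))"
    define D where "D = (\<lambda>l. mat e e (\<lambda>(i, j). Y l $$ (i + d, j + d)))"
    have blocks: "Y l = four_block_mat (A l) (B l) (0\<^sub>m e d) (D l)" if "l \<in> I" for l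
      using Yc[OF that] Y0[OF that] n by (intro eq_matI) (auto simp: A_def B_def D_def)
    have fam: "fam d I A" "fam e I D" "\<And>l. B l \<in> carrier_mat d e"
      by (auto simp: fam_def A_def B_def D_def)
    have "rels T E (d + e) Y"
      using rels_conj[OF less.prems(2) inv_pair_sym[OF PQ] X TE(1)] unfolding Y_def n .
    note rel = rels_triangular[OF this TE blocks fam(1,2,3)]
    from less.IH[OF lt(1) fam(1)] rel obtain L1 where
      L1: "\<forall>(m, \<sigma>)\<in>set L1. irred I m \<sigma> \<and> rels T E m \<sigma>" "dims L1 = d"
      "\<And>f. cont_on_fams I d f \<Longrightarrow> conj_inv I d f \<Longrightarrow> f A = f (dsum L1)" by blast
    from less.IH[OF lt(2) fam(2)] rel obtain L2 where
      L2: "\<forall>(m, \<sigma>)\<in>set L2. irred I m \<sigma> \<and> rels T E m \<sigma>" "dims L2 = e"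
      "\<And>f. cont_on_fams I e f \<Longrightarrow> conj_inv I e f \<Longrightarrow> f D = f (dsum L2)" by blast
    have fL1: "fam d I (dsum L1)" using L1 fam_dsum[of L1 I] by (auto simp: irred_def)
    have "f X = f (dsum (L1 @ L2))" if f: "cont_on_fams I n f" "conj_inv I n f" for f
    proof -
      note f' = f[unfolded n]
      have "f X = f Y" using f(2) X inv_pair_sym[OF PQ] unfolding Y_def by (auto simp: conj_inv_def)
      also have "\<dots> = f (blk A D)" by (rule triangular_degeneration[OF f' blocks fam])
      also have "\<dots> = f (blk (dsum L1) D)"
        using L1(3)[OF cont_on_fams_blk1[OF f'(1) fam(2)] conj_inv_blk1[OF f' fam(2)]] .
      also have "\<dots> = f (blk (dsum L1) (dsum L2))"
        using L2(3)[OF cont_on_fams_blk2[OF f'(1) fL1] conj_inv_blk2[OF f' fL1]] .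
      finally show ?thesis by (simp add: dsum_append)
    qed
    with L1(1,2) L2(1,2) n show ?thesis by (intro exI[of _ "L1 @ L2"]) auto
  qed
qed

definition block_conj_inv :: "'i set \<Rightarrow> nat list \<Rightarrow> (('i \<Rightarrow> complex mat) \<Rightarrow> complex) \<Rightarrow> bool" where
  "block_conj_inv I ds f \<longleftrightarrow>
     (\<forall>X gs hs. fam (sum_list ds) I X \<and> length gs = length ds \<and> length hs = length ds \<and>
        (\<forall>i<length ds. inv_pair (ds ! i) (gs ! i) (hs ! i)) \<longrightarrow>
        f (\<lambda>l. diag_block_mat gs * X l * diag_block_mat hs) = f X)"

lemma inv_pair_ones: "diag_block_mat (map 1\<^sub>m ds) = (1\<^sub>m (sum_list ds) :: complex mat)"
  by (induction ds) (auto simp: Let_def fbd_one)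

text \<open>Each block is degenerated separately, since the functions in question are invariant
  under the block group only. The lists \<open>Ls\<close> remember which summands came from which
  block, so the resulting type refines the given one.\<close>

theorem block_degeneration:
  fixes \<Xi> :: "(nat \<times> ('i \<Rightarrow> complex mat)) list"
  assumes "\<forall>(m, X)\<in>set \<Xi>. fam m I X \<and> rels T E m X" and TE: "T \<subseteq> I \<times> I \<times> I" "E \<subseteq> I"
  shows "\<exists>Ls. list_all2 (\<lambda>p L. dims L = fst p) \<Xi> Ls \<and>
    (\<forall>(m, \<sigma>)\<in>set (concat Ls). irred I m \<sigma> \<and> rels T E m \<sigma>) \<and>
    (\<forall>f. cont_on_fams I (dims \<Xi>) f \<and> block_conj_inv I (map fst \<Xi>) f \<longrightarrow> f (dsum \<Xi>) = f (dsum (concat Ls)))"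
  using assms(1)
proof (induction \<Xi>)
  case Nil
  then show ?case by (intro exI[of _ "[]"]) auto
next
  case (Cons p \<Xi>)
  obtain m X where p: "p = (m, X)" by (cases p)
  have X: "fam m I X" "rels T E m X" using Cons.prems p by auto
  from Cons obtain Ls where Ls: "list_all2 (\<lambda>p L. dims L = fst p) \<Xi> Ls"
    "\<forall>(m, \<sigma>)\<in>set (concat Ls). irred I m \<sigma> \<and> rels T E m \<sigma>"
    "\<And>f. cont_on_fams I (dims \<Xi>) f \<Longrightarrow> block_conj_inv I (map fst \<Xi>) f \<Longrightarrow> f (dsum \<Xi>) = f (dsum (concat Ls))"
    by auto
  from jordan_hoelder_degeneration[OF X TE] obtain L1 where
    L1: "\<forall>(m, \<sigma>)\<in>set L1. irred I m \<sigma> \<and> rels T E m \<sigma>" "dims L1 = m"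
    "\<And>f. cont_on_fams I m f \<Longrightarrow> conj_inv I m f \<Longrightarrow> f X = f (dsum L1)" by blast
  have fL1: "fam m I (dsum L1)" using L1 fam_dsum[of L1 I] by (auto simp: irred_def)
  have f\<Xi>: "fam (dims \<Xi>) I (dsum \<Xi>)" using fam_dsum[of \<Xi> I] Cons.prems by auto
  let ?ds = "map fst \<Xi>"
  have sds: "sum_list ?ds = dims \<Xi>" by (simp add: dims_def)
  have "f (dsum (p # \<Xi>)) = f (dsum (concat (L1 # Ls)))"
    if f: "cont_on_fams I (dims (p # \<Xi>)) f" "block_conj_inv I (map fst (p # \<Xi>)) f" for f
  proof -
    have fc: "cont_on_fams I (m + dims \<Xi>) f" using f(1) p by simp
    have fi: "f (\<lambda>l. fbd g (diag_block_mat gs) * Z l * fbd h (diag_block_mat hs)) = f Z"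
      if "fam (m + dims \<Xi>) I Z" "inv_pair m g h" "length gs = length ?ds" "length hs = length ?ds"
        "\<And>i. i < length ?ds \<Longrightarrow> inv_pair (?ds ! i) (gs ! i) (hs ! i)" for Z g h gs hs
    proof -
      have "f (\<lambda>l. diag_block_mat (g # gs) * Z l * diag_block_mat (h # hs)) = f Z"
        using f(2)[unfolded block_conj_inv_def, rule_format, of Z "g # gs" "h # hs"] that p
        by (auto simp: sds nth_Cons split: nat.splits)
      then show ?thesis by (simp add: Let_def)
    qed
    have "conj_inv I m (\<lambda>Z. f (blk Z (dsum \<Xi>)))"
      unfolding conj_inv_def
    proof (intro allI impI)
      fix Z g h assume *: "fam m I Z \<and> inv_pair m g h"
      let ?o = "diag_block_mat (map 1\<^sub>m ?ds) :: complex mat"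
      have "f (blk Z (dsum \<Xi>)) = f (\<lambda>l. fbd g ?o * blk Z (dsum \<Xi>) l * fbd h ?o)"
        using * f\<Xi> by (intro fi[symmetric]) (auto simp: fam_blk inv_pair_one)
      also have "\<dots> = f (blk (\<lambda>l. g * Z l * h) (dsum \<Xi>))"
      proof (rule cont_on_fams_cong[OF fc, symmetric])
        show "fam (m + dims \<Xi>) I (blk (\<lambda>l. g * Z l * h) (dsum \<Xi>))"
          using * f\<Xi> by (intro fam_blk) (auto simp: fam_def inv_pair_def)
        fix l assume "l \<in> I"
        then have "Z l \<in> carrier_mat m m" "dsum \<Xi> l \<in> carrier_mat (dims \<Xi>) (dims \<Xi>)"
          using * f\<Xi> by (auto simp: fam_def)
        then show "blk (\<lambda>l. g * Z l * h) (dsum \<Xi>) l = fbd g ?o * blk Z (dsum \<Xi>) l * fbd h ?o"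
          unfolding inv_pair_ones sds
          using blk_conj[of m g h "dims \<Xi>" "1\<^sub>m (dims \<Xi>)" "1\<^sub>m (dims \<Xi>)" Z l "dsum \<Xi>"] * inv_pair_one
          by (auto simp: blk_def)
      qed
      finally show "f (blk (\<lambda>l. g * Z l * h) (dsum \<Xi>)) = f (blk Z (dsum \<Xi>))" by simp
    qed
    from L1(3)[OF cont_on_fams_blk1[OF fc f\<Xi>] this]
    have 1: "f (blk X (dsum \<Xi>)) = f (blk (dsum L1) (dsum \<Xi>))" .
    have "block_conj_inv I ?ds (\<lambda>Z. f (blk (dsum L1) Z))"
      unfolding block_conj_inv_def sds
    proof (intro allI impI)
      fix Z gs hs
      assume *: "fam (dims \<Xi>) I Z \<and> length gs = length ?ds \<and> length hs = length ?ds \<and>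
        (\<forall>i<length ?ds. inv_pair (?ds ! i) (gs ! i) (hs ! i))"
      have ip: "inv_pair (sum_list ds) (diag_block_mat gs) (diag_block_mat hs)"
        if "length gs = length ds" "length hs = length ds"
          "\<forall>i<length ds. inv_pair (ds ! i) (gs ! i) (hs ! i)" for gs hs ds
        using that
      proof (induction ds arbitrary: gs hs)
        case Nil then show ?case by (auto simp: inv_pair_def)
      next
        case (Cons d ds)
        then obtain g gs' h hs' where gh: "gs = g # gs'" "hs = h # hs'" by (cases gs; cases hs; auto)
        have "inv_pair (sum_list ds) (diag_block_mat gs') (diag_block_mat hs')"
          using Cons.prems by (intro Cons.IH) (auto simp: gh)
        moreover have "inv_pair d g h" using Cons.prems(3) by (auto simp: gh)
        ultimately show ?case using inv_pair_fbd[of d g h] by (simp add: gh Let_def)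
      qed
      note ip = ip[of gs ?ds hs, unfolded sds]
      have "f (blk (dsum L1) Z) = f (\<lambda>l. fbd (1\<^sub>m m) (diag_block_mat gs) * blk (dsum L1) Z l * fbd (1\<^sub>m m) (diag_block_mat hs))"
        using * fL1 by (intro fi[symmetric]) (auto simp: fam_blk inv_pair_one)
      also have "\<dots> = f (blk (dsum L1) (\<lambda>l. diag_block_mat gs * Z l * diag_block_mat hs))"
      proof (rule cont_on_fams_cong[OF fc, symmetric])
        show "fam (m + dims \<Xi>) I (blk (dsum L1) (\<lambda>l. diag_block_mat gs * Z l * diag_block_mat hs))"
          using * fL1 ip by (intro fam_blk) (auto simp: fam_def inv_pair_def)
        fix l assume "l \<in> I"
        then have "dsum L1 l \<in> carrier_mat m m" "Z l \<in> carrier_mat (dims \<Xi>) (dims \<Xi>)"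
          using * fL1 by (auto simp: fam_def)
        then show "blk (dsum L1) (\<lambda>l. diag_block_mat gs * Z l * diag_block_mat hs) l =
            fbd (1\<^sub>m m) (diag_block_mat gs) * blk (dsum L1) Z l * fbd (1\<^sub>m m) (diag_block_mat hs)"
          using blk_conj[of m "1\<^sub>m m" "1\<^sub>m m" "dims \<Xi>" "diag_block_mat gs" "diag_block_mat hs" "dsum L1" l Z]
            * ip inv_pair_one[of m] by (auto simp: blk_def)
      qed
      finally show "f (blk (dsum L1) (\<lambda>l. diag_block_mat gs * Z l * diag_block_mat hs)) = f (blk (dsum L1) Z)"
        by simp
    qed
    from Ls(3)[OF cont_on_fams_blk2[OF fc fL1] this] 1
    show ?thesis by (simp add: p dsum_Cons dsum_append)
  qed
  with Ls(1,2) L1(1,2) p show ?case by (intro exI[of _ "L1 # Ls"]) auto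
qed

section \<open>Traces\<close>

definition tr :: "complex mat \<Rightarrow> complex" where
  "tr A = (\<Sum>i<dim_row A. A $$ (i, i))"

lemma tr_comm:
  assumes "A \<in> carrier_mat n m" "B \<in> carrier_mat m n"
  shows "tr (A * B) = tr (B * A)"
proof -
  have "tr (A * B) = (\<Sum>i<n. \<Sum>k<m. A $$ (i, k) * B $$ (k, i))"
    using assms by (auto simp: tr_def index_mult_mat_sum[OF assms] simp del: index_mult_mat(1) intro!: sum.cong)
  also have "\<dots> = (\<Sum>k<m. \<Sum>i<n. B $$ (k, i) * A $$ (i, k))"
    by (subst sum.swap) (simp add: mult.commute)
  also have "\<dots> = tr (B * A)"
    using assms by (auto simp: tr_def index_mult_mat_sum[OF assms(2,1)] simp del: index_mult_mat(1) intro!: sum.cong)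
  finally show ?thesis .
qed

lemma inv_pair_cancel:
  assumes "inv_pair n g h" "M \<in> carrier_mat n k"
  shows "h * (g * M) = M"
proof -
  have c: "g \<in> carrier_mat n n" "h \<in> carrier_mat n n" "h * g = 1\<^sub>m n"
    using assms by (auto simp: inv_pair_def)
  have "h * (g * M) = h * g * M" using c(1,2) assms(2) by (simp add: assoc_mult_mat[of _ n n _ n _ k])
  then show ?thesis using c assms(2) by simp
qed

lemma tr_conj:
  assumes "inv_pair n g h" "A \<in> carrier_mat n n"
  shows "tr (g * A * h) = tr A"
proof -
  have c: "g \<in> carrier_mat n n" "h \<in> carrier_mat n n" "h * g = 1\<^sub>m n"
    using assms by (auto simp: inv_pair_def)
  have "tr (g * A * h) = tr (h * (g * A))" using c assms(2) by (intro tr_comm) auto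
  then show ?thesis using inv_pair_cancel[OF assms] by simp
qed

lemma tr_one: "tr (1\<^sub>m n) = of_nat n"
  by (simp add: tr_def)

lemma tr_zero [simp]: "tr (0\<^sub>m n n) = 0"
  by (simp add: tr_def)

lemma tr_add: "A \<in> carrier_mat n n \<Longrightarrow> B \<in> carrier_mat n n \<Longrightarrow> tr (A + B) = tr A + tr B"
  by (auto simp: tr_def sum.distrib)

lemma tr_smult: "tr (c \<cdot>\<^sub>m A) = c * tr A" if "A \<in> carrier_mat n n"
  using that by (auto simp: tr_def sum_distrib_left)

lemma tr_fbd:
  assumes "A \<in> carrier_mat d d" "D \<in> carrier_mat e e"
  shows "tr (fbd A D) = tr A + tr D"
proof -
  have "tr (fbd A D) = (\<Sum>i<d + e. if i < d then A $$ (i, i) else D $$ (i - d, i - d))"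
    using assms by (auto simp: tr_def intro!: sum.cong)
  also have "{..<d + e} = {..<d} \<union> (\<lambda>i. i + d) ` {..<e}"
  proof -
    have "x \<in> (\<lambda>i. i + d) ` {..<e}" if "\<not> x < d" "x < d + e" for x
      using that by (intro image_eqI[of _ _ "x - d"]) auto
    then show ?thesis by auto
  qed
  also have "(\<Sum>i\<in>\<dots>. if i < d then A $$ (i, i) else D $$ (i - d, i - d)) =
    (\<Sum>i<d. A $$ (i, i)) + (\<Sum>i\<in>(\<lambda>i. i + d) ` {..<e}. D $$ (i - d, i - d))"
    by (subst sum.union_disjoint) (auto intro!: arg_cong2[of _ _ _ _ "(+)"] sum.cong)
  also have "(\<Sum>i\<in>(\<lambda>i. i + d) ` {..<e}. D $$ (i - d, i - d)) = (\<Sum>i<e. D $$ (i, i))"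
    by (subst sum.reindex) (auto simp: inj_on_def)
  finally show ?thesis using assms by (simp add: tr_def)
qed

lemma upper_triangular_mult:
  assumes "A \<in> carrier_mat n n" "B \<in> carrier_mat n n" "upper_triangular A" "upper_triangular (B :: complex mat)"
  shows "upper_triangular (A * B)" "\<And>i. i < n \<Longrightarrow> (A * B) $$ (i, i) = A $$ (i, i) * B $$ (i, i)"
proof -
  have z: "A $$ (i, k) * B $$ (k, j) = 0" if "i < n" "k < n" "j \<le> i" "k \<noteq> i \<or> j < i" for i j k
  proof (cases "k < i")
    case True
    then have "A $$ (i, k) = 0" using upper_triangularD[OF assms(3)] assms(1) that by auto
    then show ?thesis by simp
  next
    case False
    then have "j < k" using that by auto
    then have "B $$ (k, j) = 0" using upper_triangularD[OF assms(4)] assms(2) that by auto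
    then show ?thesis by simp
  qed
  show "upper_triangular (A * B)"
  proof
    fix i j assume "j < i" "i < dim_row (A * B)"
    then have "(A * B) $$ (i, j) = (\<Sum>k<n. A $$ (i, k) * B $$ (k, j))"
      using assms by (intro index_mult_mat_sum[OF assms(1,2)]) auto
    also have "\<dots> = 0" using \<open>j < i\<close> \<open>i < dim_row (A * B)\<close> assms z by (intro sum.neutral) auto
    finally show "(A * B) $$ (i, j) = 0" .
  qed
  show "(A * B) $$ (i, i) = A $$ (i, i) * B $$ (i, i)" if "i < n" for i
  proof -
    have "(A * B) $$ (i, i) = (\<Sum>k<n. A $$ (i, k) * B $$ (k, i))"
      using that by (intro index_mult_mat_sum[OF assms(1,2)]) auto
    also have "\<dots> = (\<Sum>k\<in>{i}. A $$ (i, k) * B $$ (k, i))"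
      using that z by (intro sum.mono_neutral_right) auto
    finally show ?thesis by simp
  qed
qed

lemma upper_triangular_power:
  assumes "B \<in> carrier_mat n n" "upper_triangular (B :: complex mat)"
  shows "upper_triangular (B ^\<^sub>m k) \<and> (\<forall>i<n. (B ^\<^sub>m k) $$ (i, i) = B $$ (i, i) ^ k)"
proof (induction k)
  case 0
  then show ?case using assms by (auto simp: upper_triangular_def)
next
  case (Suc k)
  have "B ^\<^sub>m k \<in> carrier_mat n n" using assms by simp
  from upper_triangular_mult[OF this assms(1) _ assms(2)] Suc show ?case by (auto simp: mult.commute)
qed

text \<open>\<open>es\<close> is the diagonal of a Schur triangular form. A nonzero fixed vector
  makes 1 an eigenvalue, hence an entry of this diagonal.\<close>

lemma trace_of_powers:
  assumes N: "N \<in> carrier_mat n n"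
  shows "\<exists>es. (\<forall>k. tr (N ^\<^sub>m k) = (\<Sum>e\<leftarrow>es. e ^ k)) \<and>
    (\<forall>v\<in>carrier_vec n. v \<noteq> 0\<^sub>v n \<and> N *\<^sub>v v = v \<longrightarrow> 1 \<in> set es)"
proof -
  obtain as where as: "char_poly N = (\<Prod>a\<leftarrow>as. [:- a, 1:])" using char_poly_factorized[OF N] by auto
  obtain B where B: "B \<in> carrier_mat n n" "upper_triangular B" "similar_mat N B"
    using schur_decomposition_exists[OF N as] by auto
  from similar_matD[OF B(3)] obtain n' P Q where
    "{N, B, P, Q} \<subseteq> carrier_mat n' n'" "P * Q = 1\<^sub>m n'" "Q * P = 1\<^sub>m n'" and NB: "N = P * B * Q" by blast
  moreover from this(1) N have "n' = n" by auto
  ultimately have PQ: "inv_pair n P Q" "N = P * B * Q" unfolding inv_pair_def by auto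
  have c: "P \<in> carrier_mat n n" "Q \<in> carrier_mat n n" "Q * P = 1\<^sub>m n" "P * Q = 1\<^sub>m n"
    using PQ by (auto simp: inv_pair_def)
  have pow: "N ^\<^sub>m k = P * (B ^\<^sub>m k) * Q" for k
  proof (induction k)
    case 0
    then show ?case using c N B by simp
  next
    case (Suc k)
    define C where "C = B ^\<^sub>m k"
    have Bk: "C \<in> carrier_mat n n" using B by (simp add: C_def)
    have 1: "Q * (P * (B * Q)) = B * Q"
      using c(1,2) B(1) by (subst assoc_mult_mat[symmetric, of Q n n P n _ n]) (auto simp: c(3))
    have "N ^\<^sub>m Suc k = P * C * Q * (P * B * Q)" by (simp add: Suc PQ(2)[symmetric] C_def)
    also have "\<dots> = P * (C * (Q * (P * (B * Q))))"
      using c(1,2) B(1) Bk by (simp add: assoc_mult_mat[of _ n n _ n _ n])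
    also have "\<dots> = P * (C * B) * Q"
      unfolding 1 using c(1,2) B(1) Bk by (simp add: assoc_mult_mat[of _ n n _ n _ n])
    finally show ?case by (simp add: C_def)
  qed
  define es where "es = diag_mat B"
  have es: "es = map (\<lambda>i. B $$ (i, i)) [0..<n]" using B by (simp add: es_def diag_mat_def)
  have "tr (N ^\<^sub>m k) = (\<Sum>e\<leftarrow>es. e ^ k)" for k
  proof -
    have Bk: "B ^\<^sub>m k \<in> carrier_mat n n" using B by simp
    have "tr (N ^\<^sub>m k) = tr (B ^\<^sub>m k)" unfolding pow by (rule tr_conj[OF PQ(1) Bk])
    also have "\<dots> = (\<Sum>i<n. B $$ (i, i) ^ k)"
      using upper_triangular_power[OF B(1,2), of k] Bk by (auto simp: tr_def)
    also have "\<dots> = (\<Sum>e\<leftarrow>es. e ^ k)"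
      by (simp add: es o_def sum_list_sum_nth atLeast0LessThan)
    finally show ?thesis .
  qed
  moreover have "1 \<in> set es" if "v \<in> carrier_vec n" "v \<noteq> 0\<^sub>v n" "N *\<^sub>v v = v" for v
  proof -
    have "eigenvalue N 1" unfolding eigenvalue_def eigenvector_def using that N by auto
    then have "poly (char_poly N) 1 = 0" using eigenvalue_root_char_poly[OF N] by simp
    also have "char_poly N = char_poly B" using char_poly_similar[OF B(3)] .
    also have "\<dots> = (\<Prod>a\<leftarrow>es. [:- a, 1:])" unfolding es_def using char_poly_upper_triangular[OF B(1,2)] .
    finally show ?thesis by (auto simp: poly_prod_list prod_list_zero_iff)
  qed
  ultimately show ?thesis by blast
qed

text \<open>Vanishing power sums give vanishing sums of \<open>e * poly q e\<close> for every
  polynomial \<open>q\<close>. A \<open>q\<close> that vanishes at all entries other than 1 isolates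
  the multiplicity of 1, which is nonzero in characteristic 0.\<close>

lemma power_sums_zero:
  fixes E :: "complex list"
  assumes "\<And>k. (\<Sum>e\<leftarrow>E. e ^ Suc k) = 0"
  shows "1 \<notin> set E"
proof
  assume 1: "1 \<in> set E"
  have poly: "(\<Sum>e\<leftarrow>E. e * poly q e) = 0" for q
  proof -
    have "(\<Sum>e\<leftarrow>E. e * poly q e) = (\<Sum>e\<leftarrow>E. \<Sum>i\<le>degree q. coeff q i * e ^ Suc i)"
      by (simp add: poly_altdef sum_distrib_left mult.left_commute)
    also have "\<dots> = (\<Sum>i\<le>degree q. coeff q i * (\<Sum>e\<leftarrow>E. e ^ Suc i))"
      by (induction E) (simp_all add: sum.distrib distrib_left)
    finally show ?thesis by (simp only: assms) simp
  qed
  define q where "q = (\<Prod>a\<in>set E - {1}. [:- a, 1:])"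
  have z: "poly q e = 0" if "e \<in> set E" "e \<noteq> 1" for e
    using that by (auto simp: q_def poly_prod prod_zero_iff)
  have "(\<Sum>e\<leftarrow>E. e * poly q e) = (\<Sum>e\<leftarrow>E. if e = 1 then poly q 1 else 0)"
    using z by (intro arg_cong[of _ _ sum_list] map_cong) auto
  also have "\<dots> = of_nat (count_list E 1) * poly q 1"
    by (induction E) (auto simp: algebra_simps)
  finally have "of_nat (count_list E 1) * poly q 1 = 0" using poly[of q] by simp
  moreover have "count_list E 1 \<noteq> 0" using 1 by (simp add: count_list_0_iff)
  moreover have "poly q 1 \<noteq> 0" by (auto simp: q_def poly_prod prod_zero_iff)
  ultimately show False by simp
qed

section \<open>Characters determine the dimensions of the irreducible summands\<close>

primrec wd :: "nat \<Rightarrow> ('i \<Rightarrow> complex mat) \<Rightarrow> 'i list \<Rightarrow> complex mat" where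
  "wd n X [] = 1\<^sub>m n"
| "wd n X (l # w) = X l * wd n X w"

lemma wd_carrier [intro]: "fam n I X \<Longrightarrow> w \<in> lists I \<Longrightarrow> wd n X w \<in> carrier_mat n n"
  by (induction w) (auto simp: fam_def)

lemma wd_append:
  assumes X: "fam n I X" and v: "v \<in> lists I"
  shows "u \<in> lists I \<Longrightarrow> wd n X (u @ v) = wd n X u * wd n X v"
proof (induction u)
  case Nil
  then show ?case using wd_carrier[OF X v] by simp
next
  case (Cons l u)
  have "X l \<in> carrier_mat n n" using Cons.prems X by (auto simp: fam_def)
  then show ?case using Cons wd_carrier[OF X v] wd_carrier[OF X, of u] by simp
qed

lemma wd_cong: "(\<And>l. l \<in> set w \<Longrightarrow> X l = Y l) \<Longrightarrow> wd n X w = wd n Y w"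
  by (induction w) auto

lemma wd_conj:
  assumes X: "fam n I X" and gh: "inv_pair n g h"
  shows "w \<in> lists I \<Longrightarrow> wd n (\<lambda>l. g * X l * h) w = g * wd n X w * h"
proof (induction w)
  case Nil
  then show ?case using gh by (auto simp: inv_pair_def)
next
  case (Cons l w)
  have c: "g \<in> carrier_mat n n" "h \<in> carrier_mat n n" "h * g = 1\<^sub>m n" using gh by (auto simp: inv_pair_def)
  have d: "X l \<in> carrier_mat n n" "wd n X w \<in> carrier_mat n n" using Cons.prems X by (auto simp: fam_def)
  have 1: "h * (g * (wd n X w * h)) = wd n X w * h"
    using c(1,2) d by (subst assoc_mult_mat[symmetric, of h n n g n _ n]) (auto simp: c(3))
  have "wd n (\<lambda>l. g * X l * h) (l # w) = g * X l * h * (g * wd n X w * h)" using Cons by simp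
  also have "\<dots> = g * (X l * (h * (g * (wd n X w * h))))"
    using c(1,2) d by (simp add: assoc_mult_mat[of _ n n _ n _ n])
  also have "\<dots> = g * wd n X (l # w) * h"
    unfolding 1 using c(1,2) d by (simp add: assoc_mult_mat[of _ n n _ n _ n])
  finally show ?case .
qed

lemma wd_blk:
  assumes "fam d I X" "fam e I Y"
  shows "w \<in> lists I \<Longrightarrow> wd (d + e) (blk X Y) w = fbd (wd d X w) (wd e Y w)"
proof (induction w)
  case Nil
  then show ?case by (simp add: fbd_one)
next
  case (Cons l w)
  have "X l \<in> carrier_mat d d" "Y l \<in> carrier_mat e e" "wd d X w \<in> carrier_mat d d" "wd e Y w \<in> carrier_mat e e"
    using Cons.prems assms by (auto simp: fam_def)
  from fbd_mult[OF this(1,2,3,4)] Cons show ?case by (simp add: blk_def)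
qed

lemma tr_wd_dsum:
  assumes w: "w \<in> lists I"
  shows "\<forall>(m, \<sigma>)\<in>set L. fam m I \<sigma> \<Longrightarrow>
    tr (wd (dims L) (dsum L) w) = (\<Sum>(m, \<sigma>)\<leftarrow>L. tr (wd m \<sigma> w))"
proof (induction L)
  case Nil
  have "wd 0 (dsum ([] :: (nat \<times> ('a \<Rightarrow> complex mat)) list)) w \<in> carrier_mat 0 0"
    by (rule wd_carrier[OF _ w]) (auto simp: fam_def dsum_Nil)
  then show ?case by (auto simp: tr_def)
next
  case (Cons p L)
  obtain m \<sigma> where p: "p = (m, \<sigma>)" by (cases p)
  have f: "fam m I \<sigma>" "fam (dims L) I (dsum L)" using Cons.prems p fam_dsum[of L I] by auto
  have "tr (wd (dims (p # L)) (dsum (p # L)) w) = tr (fbd (wd m \<sigma> w) (wd (dims L) (dsum L) w))"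
    using wd_blk[OF f w] by (simp add: p dsum_Cons)
  also have "\<dots> = tr (wd m \<sigma> w) + tr (wd (dims L) (dsum L) w)"
    using wd_carrier[OF f(1) w] wd_carrier[OF f(2) w] by (rule tr_fbd)
  finally show ?case using Cons p by simp
qed

text \<open>Formal linear combinations of words, that is, elements of the free algebra on \<open>I\<close>.\<close>

type_synonym 'i felem = "(complex \<times> 'i list) list"

definition FE :: "'i set \<Rightarrow> 'i felem set" where
  "FE I = {x. snd ` set x \<subseteq> lists I}"

primrec ev :: "nat \<Rightarrow> ('i \<Rightarrow> complex mat) \<Rightarrow> 'i felem \<Rightarrow> complex mat" where
  "ev n X [] = 0\<^sub>m n n"
| "ev n X (p # x) = fst p \<cdot>\<^sub>m wd n X (snd p) + ev n X x"

definition fmul :: "'i felem \<Rightarrow> 'i felem \<Rightarrow> 'i felem" where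
  "fmul x y = concat (map (\<lambda>p. map (\<lambda>q. (fst p * fst q, snd p @ snd q)) y) x)"

primrec fpow :: "'i felem \<Rightarrow> nat \<Rightarrow> 'i felem" where
  "fpow x 0 = [(1, [])]"
| "fpow x (Suc k) = fmul (fpow x k) x"

lemma fmul_FE: "x \<in> FE I \<Longrightarrow> y \<in> FE I \<Longrightarrow> fmul x y \<in> FE I"
  unfolding FE_def fmul_def by fastforce

lemma fpow_FE: "x \<in> FE I \<Longrightarrow> fpow x k \<in> FE I"
  by (induction k) (auto simp: fmul_FE, auto simp: FE_def)

lemma append_FE: "x \<in> FE I \<Longrightarrow> y \<in> FE I \<Longrightarrow> x @ y \<in> FE I"
  by (auto simp: FE_def)

lemma Cons_FE: "p # x \<in> FE I \<longleftrightarrow> snd p \<in> lists I \<and> x \<in> FE I"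
  by (auto simp: FE_def)

context
  fixes n I and X :: "'i \<Rightarrow> complex mat"
  assumes X: "fam n I X"
begin

lemma ev_carrier: "x \<in> FE I \<Longrightarrow> ev n X x \<in> carrier_mat n n"
  by (induction x) (auto simp: Cons_FE intro!: add_carrier_mat wd_carrier[OF X])

lemma ev_append: "x \<in> FE I \<Longrightarrow> y \<in> FE I \<Longrightarrow> ev n X (x @ y) = ev n X x + ev n X y"
proof (induction x)
  case Nil
  then show ?case using ev_carrier[of y] by simp
next
  case (Cons p x)
  then have "wd n X (snd p) \<in> carrier_mat n n" "ev n X x \<in> carrier_mat n n" "ev n X y \<in> carrier_mat n n"
    using ev_carrier wd_carrier[OF X] by (auto simp: Cons_FE)
  with Cons show ?case by (simp add: Cons_FE assoc_add_mat[of _ n n])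
qed

lemma ev_fmul:
  assumes y: "y \<in> FE I"
  shows "x \<in> FE I \<Longrightarrow> ev n X (fmul x y) = ev n X x * ev n X y"
proof (induction x)
  case Nil
  then show ?case using ev_carrier[OF y] by (simp add: fmul_def)
next
  case (Cons p x)
  define z where "z = map (\<lambda>q. (fst p * fst q, snd p @ snd q)) y"
  have p: "snd p \<in> lists I" and x: "x \<in> FE I" using Cons.prems by (auto simp: Cons_FE)
  have pc: "wd n X (snd p) \<in> carrier_mat n n" using wd_carrier[OF X p] .
  have "snd r \<in> lists I" if "r \<in> set z" for r
  proof -
    from that obtain q where q: "q \<in> set y" "r = (fst p * fst q, snd p @ snd q)" by (auto simp: z_def)
    have "snd q \<in> lists I" using y q(1) by (auto simp: FE_def)
    with p q(2) show ?thesis by simp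
  qed
  then have zF: "z \<in> FE I" by (auto simp: FE_def simp del: in_lists_conv_set)
  have "ev n X (map (\<lambda>q. (fst p * fst q, snd p @ snd q)) y) = fst p \<cdot>\<^sub>m (wd n X (snd p) * ev n X y)"
    using y
  proof (induction y)
    case Nil
    then show ?case using pc by simp
  next
    case (Cons q y)
    then have q: "snd q \<in> lists I" and y: "y \<in> FE I" by (auto simp: Cons_FE)
    have c: "wd n X (snd q) \<in> carrier_mat n n" "ev n X y \<in> carrier_mat n n"
      using wd_carrier[OF X q] ev_carrier[OF y] .
    have "ev n X (map (\<lambda>q. (fst p * fst q, snd p @ snd q)) (q # y)) =
      (fst p * fst q) \<cdot>\<^sub>m (wd n X (snd p) * wd n X (snd q)) + fst p \<cdot>\<^sub>m (wd n X (snd p) * ev n X y)"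
      using Cons.IH[OF y] wd_append[OF X q p] by simp
    also have "\<dots> = fst p \<cdot>\<^sub>m (wd n X (snd p) * ev n X (q # y))"
      using pc c by (simp add: mult_add_distrib_mat[of _ n n _ n] mult_smult_distrib[of _ n n _ n]
          add_smult_distrib_left_mat[of _ n n] smult_smult_times)
    finally show ?case .
  qed
  then have z: "ev n X z = (fst p \<cdot>\<^sub>m wd n X (snd p)) * ev n X y"
    using pc ev_carrier[OF y] by (simp add: z_def mult_smult_assoc_mat[of _ n n])
  have "ev n X (fmul (p # x) y) = ev n X z + ev n X (fmul x y)"
    using ev_append[OF zF fmul_FE[OF x y]] by (simp add: fmul_def z_def)
  also have "\<dots> = (fst p \<cdot>\<^sub>m wd n X (snd p)) * ev n X y + ev n X x * ev n X y"
    using z Cons.IH[OF x] by simp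
  also have "\<dots> = ev n X (p # x) * ev n X y"
    using pc ev_carrier[OF x] ev_carrier[OF y] by (simp add: add_mult_distrib_mat[of _ n n])
  finally show ?case .
qed

lemma ev_fpow: "x \<in> FE I \<Longrightarrow> ev n X (fpow x k) = ev n X x ^\<^sub>m k"
proof (induction k)
  case 0
  then show ?case using ev_carrier[of x] by (simp add: smult_smult_times) (auto intro!: eq_matI)
qed (simp add: ev_fmul fpow_FE)

lemma tr_ev: "x \<in> FE I \<Longrightarrow> tr (ev n X x) = (\<Sum>p\<leftarrow>x. fst p * tr (wd n X (snd p)))"
proof (induction x)
  case (Cons p x)
  then have "wd n X (snd p) \<in> carrier_mat n n" "ev n X x \<in> carrier_mat n n"
    using ev_carrier wd_carrier[OF X] by (auto simp: Cons_FE)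
  with Cons show ?case by (simp add: tr_add[of _ n] tr_smult[of _ n] Cons_FE)
qed simp

end

lemma ev_one: "ev n X [(1, [])] = 1\<^sub>m n"
  by (auto simp: smult_smult_times intro!: eq_matI)

lemma ev_letter: "X l \<in> carrier_mat n n \<Longrightarrow> ev n X [(1, [l])] = X l"
  by (auto intro!: eq_matI)

text \<open>Lists stand for formal sums, so appending is addition; scalars are covered by
  multiplication with multiples of the empty word.\<close>

definition left_ideal :: "'i set \<Rightarrow> 'i felem set \<Rightarrow> bool" where
  "left_ideal I L \<longleftrightarrow> L \<subseteq> FE I \<and> [] \<in> L \<and> (\<forall>x\<in>L. \<forall>y\<in>L. x @ y \<in> L) \<and>
     (\<forall>y\<in>FE I. \<forall>x\<in>L. fmul y x \<in> L)"

lemma left_ideal_FE: "left_ideal I (FE I)"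
  by (auto simp: left_ideal_def fmul_FE append_FE) (auto simp: FE_def)

text \<open>The vectors obtained from \<open>v\<close> by applying a left ideal form an invariant
  subspace, which by irreducibility is everything as soon as it is nonzero.\<close>

lemma left_ideal_orbit:
  assumes X: "irred I n X" and L: "left_ideal I L" and v: "v \<in> carrier_vec n"
    and x: "x \<in> L" "ev n X x *\<^sub>v v \<noteq> 0\<^sub>v n" and u: "u \<in> carrier_vec n"
  shows "\<exists>y\<in>L. ev n X y *\<^sub>v v = u"
proof -
  have f: "fam n I X" using X by (simp add: irred_def)
  have LF: "\<And>y. y \<in> L \<Longrightarrow> y \<in> FE I" and nil: "[] \<in> L"
    and app: "\<And>x y. x \<in> L \<Longrightarrow> y \<in> L \<Longrightarrow> x @ y \<in> L"
    and mul: "\<And>x y. y \<in> FE I \<Longrightarrow> x \<in> L \<Longrightarrow> fmul y x \<in> L"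
    using L by (auto simp: left_ideal_def)
  define W where "W = (\<lambda>y. ev n X y *\<^sub>v v) ` L"
  have c: "ev n X y \<in> carrier_mat n n" if "y \<in> FE I" for y using ev_carrier[OF f that] .
  have mulv: "ev n X (fmul y x) *\<^sub>v v = ev n X y *\<^sub>v (ev n X x *\<^sub>v v)" if "y \<in> FE I" "x \<in> L" for x y
    using ev_fmul[OF f LF[OF that(2)] that(1)] c[OF that(1)] c[OF LF[OF that(2)]] v
    by (simp add: assoc_mult_mat_vec[of _ n n _ n])
  have "vsub n W" unfolding vsub_def
  proof (intro conjI ballI allI)
    show "W \<subseteq> carrier_vec n" using mult_mat_vec_carrier[OF c[OF LF] v] by (auto simp: W_def)
    show "0\<^sub>v n \<in> W" unfolding W_def
      by (rule image_eqI[OF _ nil]) (use v in \<open>auto intro!: eq_vecI\<close>)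
  next
    fix a b assume "a \<in> W" "b \<in> W"
    then obtain y z where yz: "y \<in> L" "z \<in> L" "a = ev n X y *\<^sub>v v" "b = ev n X z *\<^sub>v v" by (auto simp: W_def)
    have "a + b = ev n X (y @ z) *\<^sub>v v"
      using yz c LF v by (simp add: ev_append[OF f] add_mult_distrib_mat_vec[of _ n n])
    then show "a + b \<in> W" using app[OF yz(1,2)] by (auto simp: W_def)
  next
    fix k a assume "a \<in> W"
    then obtain y where y: "y \<in> L" "a = ev n X y *\<^sub>v v" by (auto simp: W_def)
    have kF: "[(k, [])] \<in> FE I" by (simp add: FE_def)
    have ac: "a \<in> carrier_vec n" using y c[OF LF[OF y(1)]] v by simp
    have "ev n X [(k, [])] *\<^sub>v a = k \<cdot>\<^sub>v a" using ac by (auto intro!: eq_vecI)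
    then have "k \<cdot>\<^sub>v a = ev n X (fmul [(k, [])] y) *\<^sub>v v" using mulv[OF kF y(1)] y(2) by simp
    then show "k \<cdot>\<^sub>v a \<in> W" using mul[OF kF y(1)] by (auto simp: W_def)
  qed
  moreover have "X l *\<^sub>v w \<in> W" if "l \<in> I" "w \<in> W" for l w
  proof -
    from that obtain y where y: "y \<in> L" "w = ev n X y *\<^sub>v v" by (auto simp: W_def)
    have lF: "[(1, [l])] \<in> FE I" using that by (simp add: FE_def)
    have "X l \<in> carrier_mat n n" using f that by (auto simp: fam_def)
    then have "X l *\<^sub>v w = ev n X (fmul [(1, [l])] y) *\<^sub>v v"
      using mulv[OF lF y(1)] y(2) ev_letter[of X l n] by simp
    then show ?thesis using mul[OF lF y(1)] by (auto simp: W_def)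
  qed
  moreover have "W \<noteq> {0\<^sub>v n}" using x by (auto simp: W_def)
  ultimately have "W = carrier_vec n" using X by (auto simp: irred_def)
  with u have "u \<in> W" by simp
  then show ?thesis by (auto simp: W_def)
qed

text \<open>
  If \<open>x\<close> acted nontrivially on a summand, irreducibility would give \<open>y\<close> such that \<open>yx\<close> has the
  eigenvalue \<open>1\<close>, against the vanishing of all power sums of the eigenvalues.
\<close>

lemma trace_radical:
  assumes L: "\<forall>(m, \<sigma>)\<in>set L. irred I m \<sigma>" and x: "x \<in> FE I"
    and tr0: "\<And>y k. y \<in> FE I \<Longrightarrow> (\<Sum>(m, \<sigma>)\<leftarrow>L. tr (ev m \<sigma> (fpow (fmul y x) (Suc k)))) = 0"
    and s: "(m, \<sigma>) \<in> set L"
  shows "ev m \<sigma> x = 0\<^sub>m m m"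
proof (rule ccontr)
  assume ne: "ev m \<sigma> x \<noteq> 0\<^sub>m m m"
  have irr: "irred I m \<sigma>" using L s by auto
  then have f: "fam m I \<sigma>" by (simp add: irred_def)
  note xc = ev_carrier[OF f x]
  have "\<exists>j<m. col (ev m \<sigma> x) j \<noteq> 0\<^sub>v m"
  proof (rule ccontr)
    assume "\<not> ?thesis"
    then have z: "col (ev m \<sigma> x) j = 0\<^sub>v m" if "j < m" for j using that by auto
    have "ev m \<sigma> x = 0\<^sub>m m m"
    proof (intro eq_matI)
      fix i j assume "i < dim_row (0\<^sub>m m m :: complex mat)" "j < dim_col (0\<^sub>m m m :: complex mat)"
      then show "ev m \<sigma> x $$ (i, j) = 0\<^sub>m m m $$ (i, j)"
        using arg_cong[OF z[of j], of "\<lambda>v. v $ i"] xc by auto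
    qed (use xc in auto)
    with ne show False by simp
  qed
  then obtain j where j: "j < m" "col (ev m \<sigma> x) j \<noteq> 0\<^sub>v m" by auto
  define w where "w = ev m \<sigma> x *\<^sub>v unit_vec m j"
  have w: "w \<noteq> 0\<^sub>v m" "w \<in> carrier_vec m" using j xc mult_unit_vec[OF xc j(1)] by (auto simp: w_def)
  have one: "[(1, [])] \<in> FE I" by (simp add: FE_def)
  have "ev m \<sigma> [(1, [])] *\<^sub>v w \<noteq> 0\<^sub>v m" unfolding ev_one using w by simp
  \<comment> \<open>Irreducibility brings \<open>w\<close> back to the basis vector from which it
    came, so \<open>fmul y x\<close> fixes that vector.\<close>
  from left_ideal_orbit[OF irr left_ideal_FE w(2) one this, of "unit_vec m j"]
  obtain y where y: "y \<in> FE I" "ev m \<sigma> y *\<^sub>v w = unit_vec m j" by auto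
  define z where "z = fmul y x"
  have z: "z \<in> FE I" using y x by (simp add: z_def fmul_FE)
  have fixd: "ev m \<sigma> z *\<^sub>v unit_vec m j = unit_vec m j"
    using y ev_fmul[OF f x y(1)] ev_carrier[OF f y(1)] xc
    by (simp add: z_def w_def assoc_mult_mat_vec[of _ m m _ m])
  have "\<forall>p\<in>set L. \<exists>es. (\<forall>k. tr (ev (fst p) (snd p) z ^\<^sub>m k) = (\<Sum>e\<leftarrow>es. e ^ k)) \<and>
    (\<forall>v\<in>carrier_vec (fst p). v \<noteq> 0\<^sub>v (fst p) \<and> ev (fst p) (snd p) z *\<^sub>v v = v \<longrightarrow> 1 \<in> set es)"
  proof
    fix p assume "p \<in> set L"
    then have "fam (fst p) I (snd p)" using L by (auto simp: irred_def)
    from trace_of_powers[OF ev_carrier[OF this z]]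
    show "\<exists>es. (\<forall>k. tr (ev (fst p) (snd p) z ^\<^sub>m k) = (\<Sum>e\<leftarrow>es. e ^ k)) \<and>
      (\<forall>v\<in>carrier_vec (fst p). v \<noteq> 0\<^sub>v (fst p) \<and> ev (fst p) (snd p) z *\<^sub>v v = v \<longrightarrow> 1 \<in> set es)" .
  qed
  from bchoice[OF this] obtain es where
    es: "\<And>p k. p \<in> set L \<Longrightarrow> tr (ev (fst p) (snd p) z ^\<^sub>m k) = (\<Sum>e\<leftarrow>es p. e ^ k)" and
    es1: "\<And>p v. p \<in> set L \<Longrightarrow> v \<in> carrier_vec (fst p) \<Longrightarrow> v \<noteq> 0\<^sub>v (fst p) \<Longrightarrow>
      ev (fst p) (snd p) z *\<^sub>v v = v \<Longrightarrow> 1 \<in> set (es p)" by blast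
  \<comment> \<open>The eigenvalues on all summands together; their power sums are the sums of
    traces of powers.\<close>
  define E where "E = concat (map es L)"
  have "(\<Sum>e\<leftarrow>E. e ^ Suc k) = 0" for k
  proof -
    have "(\<Sum>e\<leftarrow>E. e ^ Suc k) = (\<Sum>p\<leftarrow>L. \<Sum>e\<leftarrow>es p. e ^ Suc k)"
      unfolding E_def by (induction L) (auto simp del: power_Suc)
    also have "\<dots> = (\<Sum>p\<leftarrow>L. tr (ev (fst p) (snd p) (fpow z (Suc k))))"
    proof (intro arg_cong[of _ _ sum_list] map_cong[OF HOL.refl])
      fix p assume p: "p \<in> set L"
      then have "fam (fst p) I (snd p)" using L by (auto simp: irred_def)
      from ev_fpow[OF this z, of "Suc k"]
      show "(\<Sum>e\<leftarrow>es p. e ^ Suc k) = tr (ev (fst p) (snd p) (fpow z (Suc k)))"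
        using es[OF p, of "Suc k"] by simp
    qed
    also have "\<dots> = 0" using tr0[OF y(1), of k] unfolding z_def by (simp only: case_prod_beta')
    finally show ?thesis .
  qed
  from power_sums_zero[OF this] have "1 \<notin> set E" .
  moreover have "1 \<in> set (es (m, \<sigma>))"
  proof (rule es1[OF s])
    show "unit_vec m j \<noteq> 0\<^sub>v (fst (m, \<sigma>))"
      using j(1) by (auto dest!: arg_cong[of _ _ "\<lambda>v. v $ j"])
  qed (use fixd in auto)
  ultimately show False using s by (auto simp: E_def)
qed

lemma ev_lincomb:
  assumes g: "fam n I X" and F: "x \<in> FE I" "y \<in> FE I" and a: "a \<in> carrier_vec n"
  shows "ev n X (x @ fmul [(c, [])] y) *\<^sub>v a = ev n X x *\<^sub>v a + c \<cdot>\<^sub>v (ev n X y *\<^sub>v a)"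
proof -
  let ?c = "[(c, [])] :: 'a felem"
  have cF: "?c \<in> FE I" by (simp add: FE_def)
  note cc = ev_carrier[OF g F(1)] ev_carrier[OF g F(2)] ev_carrier[OF g cF] ev_carrier[OF g fmul_FE[OF cF F(2)]]
  have evc: "ev n X ?c *\<^sub>v b = c \<cdot>\<^sub>v b" if "b \<in> carrier_vec n" for b
    using that by (auto intro!: eq_vecI)
  have "ev n X (x @ fmul ?c y) *\<^sub>v a = ev n X x *\<^sub>v a + ev n X (fmul ?c y) *\<^sub>v a"
    unfolding ev_append[OF g F(1) fmul_FE[OF cF F(2)]]
    using cc a by (simp add: add_mult_distrib_mat_vec[of _ n n])
  also have "ev n X (fmul ?c y) *\<^sub>v a = ev n X ?c *\<^sub>v (ev n X y *\<^sub>v a)"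
    unfolding ev_fmul[OF g F(2) cF] using cc a by (simp add: assoc_mult_mat_vec[of _ n n _ n])
  also have "\<dots> = c \<cdot>\<^sub>v (ev n X y *\<^sub>v a)" using cc a by (intro evc) auto
  finally show ?thesis .
qed

text \<open>Schur's lemma: the kernel of \<open>A\<close> is an invariant subspace and not
  everything, hence 0. So \<open>A\<close> is invertible and conjugates one family into the
  other.\<close>

lemma intertwining_surjection_traces:
  fixes X :: "'i \<Rightarrow> complex mat" and v :: "complex vec"
  assumes irr: "irred I m \<sigma>" and fX: "fam n I X" and A: "A \<in> carrier_mat n m"
    and inter: "\<And>l a. l \<in> I \<Longrightarrow> a \<in> carrier_vec m \<Longrightarrow> A *\<^sub>v (\<sigma> l *\<^sub>v a) = X l *\<^sub>v (A *\<^sub>v a)"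
    and surj: "\<And>b. b \<in> carrier_vec n \<Longrightarrow> \<exists>a\<in>carrier_vec m. A *\<^sub>v a = b"
    and v: "v \<in> carrier_vec n" "v \<noteq> 0\<^sub>v n"
  shows "m = n \<and> (\<forall>u\<in>lists I. tr (wd m \<sigma> u) = tr (wd n X u))"
proof -
  have f: "fam m I \<sigma>" using irr by (simp add: irred_def)
  define K where "K = {a \<in> carrier_vec m. A *\<^sub>v a = 0\<^sub>v n}"
  have A0: "A *\<^sub>v 0\<^sub>v m = 0\<^sub>v n" using A by (auto intro!: eq_vecI simp: scalar_prod_def)
  have "vsub m K" unfolding vsub_def K_def
    using A A0 by (auto simp: mult_add_distrib_mat_vec[of _ n m] mult_mat_vec[of _ n m])
  moreover have "\<sigma> l *\<^sub>v a \<in> K" if l: "l \<in> I" and a: "a \<in> K" for l a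
  proof -
    have c: "\<sigma> l \<in> carrier_mat m m" "X l \<in> carrier_mat n n" using l f fX by (auto simp: fam_def)
    have "X l *\<^sub>v 0\<^sub>v n = 0\<^sub>v n" using c by (auto intro!: eq_vecI simp: scalar_prod_def)
    then show ?thesis using inter[OF l, of a] a c by (auto simp: K_def)
  qed
  moreover have "K \<noteq> carrier_vec m"
  proof
    assume "K = carrier_vec m"
    then have "A *\<^sub>v a = 0\<^sub>v n" if "a \<in> carrier_vec m" for a using that by (auto simp: K_def)
    with surj[OF v(1)] v(2) show False by auto
  qed
  ultimately have K0: "K = {0\<^sub>v m}" using irr by (auto simp: irred_def)
  have "\<forall>j. \<exists>b. j < n \<longrightarrow> b \<in> carrier_vec m \<and> A *\<^sub>v b = unit_vec n j"
    using surj[of "unit_vec n _"] by fastforce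
  from choice[OF this] obtain bs where bs: "\<And>j. j < n \<Longrightarrow> bs j \<in> carrier_vec m"
    "\<And>j. j < n \<Longrightarrow> A *\<^sub>v bs j = unit_vec n j" by blast
  \<comment> \<open>The columns are preimages of the unit vectors, which gives a right inverse;
    injectivity of \<open>A\<close> makes it a left inverse as well.\<close>
  define R where "R = mat m n (\<lambda>(i, j). bs j $ i)"
  have R: "R \<in> carrier_mat m n" by (simp add: R_def)
  have AR: "A * R = 1\<^sub>m n"
  proof (intro eq_matI)
    fix i j assume ij: "i < dim_row (1\<^sub>m n :: complex mat)" "j < dim_col (1\<^sub>m n :: complex mat)"
    have "col R j = bs j" using ij bs(1)[of j] by (auto simp: R_def)
    then have "(A * R) $$ (i, j) = (A *\<^sub>v bs j) $ i" using ij A R by simp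
    also have "\<dots> = 1\<^sub>m n $$ (i, j)" using bs(2)[of j] ij by simp
    finally show "(A * R) $$ (i, j) = 1\<^sub>m n $$ (i, j)" .
  qed (use A R in auto)
  have inj: "a = b" if "a \<in> carrier_vec m" "b \<in> carrier_vec m" "A *\<^sub>v a = A *\<^sub>v b" for a b
  proof -
    have "A *\<^sub>v (a - b) = 0\<^sub>v n"
      using that A by (simp add: mult_minus_distrib_mat_vec[of _ n m])
    then have "a - b \<in> K" using that by (simp add: K_def)
    with K0 have ab: "a - b = 0\<^sub>v m" by simp
    show ?thesis
    proof (intro eq_vecI)
      fix i assume "i < dim_vec b"
      then show "a $ i = b $ i" using arg_cong[OF ab, of "\<lambda>v. v $ i"] that by simp
    qed (use that in auto)
  qed
  have RA: "R * A = 1\<^sub>m m"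
  proof (intro eq_matI)
    fix i j assume ij: "i < dim_row (1\<^sub>m m :: complex mat)" "j < dim_col (1\<^sub>m m :: complex mat)"
    have "A *\<^sub>v (R *\<^sub>v (A *\<^sub>v unit_vec m j)) = (A * R) *\<^sub>v (A *\<^sub>v unit_vec m j)"
      using A R by (simp add: assoc_mult_mat_vec[of _ n m _ n])
    also have "\<dots> = A *\<^sub>v unit_vec m j" unfolding AR using A by simp
    finally have eq: "A *\<^sub>v (R *\<^sub>v (A *\<^sub>v unit_vec m j)) = A *\<^sub>v unit_vec m j" .
    have "R *\<^sub>v (A *\<^sub>v unit_vec m j) = unit_vec m j"
      by (rule inj[OF mult_mat_vec_carrier[OF R mult_mat_vec_carrier[OF A unit_vec_carrier]] unit_vec_carrier eq])
    then have "(R * A) *\<^sub>v unit_vec m j = unit_vec m j"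
      using A R by (simp add: assoc_mult_mat_vec[of _ m n _ m])
    then have "col (R * A) j = unit_vec m j"
      using mult_unit_vec[of "R * A" m m j] A R ij by simp
    then have "col (R * A) j $ i = unit_vec m j $ i" by (simp only:)
    then show "(R * A) $$ (i, j) = 1\<^sub>m m $$ (i, j)"
      using A R ij by (simp add: col_def)
  qed (use A R in auto)
  \<comment> \<open>Both dimensions are traces of identity matrices, namely of \<open>A * R\<close>
    and \<open>R * A\<close>.\<close>
  have "of_nat n = (of_nat m :: complex)"
    using tr_comm[OF A R] unfolding AR RA tr_one .
  then have nm: "m = n" by simp
  have wdA: "A * wd m \<sigma> u = wd n X u * A" if "u \<in> lists I" for u
    using that
  proof (induction u)
    case Nil
    then show ?case using A by simp
  next
    case (Cons l u)
    have c: "\<sigma> l \<in> carrier_mat m m" "X l \<in> carrier_mat n n" using Cons f fX by (auto simp: fam_def)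
    have d: "wd m \<sigma> u \<in> carrier_mat m m" "wd n X u \<in> carrier_mat n n"
      using Cons wd_carrier[OF f] wd_carrier[OF fX] by auto
    have AX: "A * \<sigma> l = X l * A"
    proof (intro eq_matI)
      fix i j assume "i < dim_row (X l * A)" "j < dim_col (X l * A)"
      then have ij: "i < n" "j < m" using A c by auto
      have "(A * \<sigma> l) *\<^sub>v unit_vec m j = (X l * A) *\<^sub>v unit_vec m j"
        using inter[of l "unit_vec m j"] Cons A c
        by (simp add: assoc_mult_mat_vec[of _ n m _ m] assoc_mult_mat_vec[of _ n n _ m])
      then have "col (A * \<sigma> l) j = col (X l * A) j"
        using mult_unit_vec[of "A * \<sigma> l" n m j] mult_unit_vec[of "X l * A" n m j] A c ij by simp
      then have "col (A * \<sigma> l) j $ i = col (X l * A) j $ i" by (simp only:)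
      then show "(A * \<sigma> l) $$ (i, j) = (X l * A) $$ (i, j)"
        using A c ij by (simp add: col_def)
    qed (use A c in auto)
    have "A * wd m \<sigma> (l # u) = (A * \<sigma> l) * wd m \<sigma> u"
      using A c d by (simp add: assoc_mult_mat[of _ n m _ m _ m])
    also have "\<dots> = X l * (A * wd m \<sigma> u)"
      unfolding AX using A c d by (simp add: assoc_mult_mat[of _ n n _ m _ m])
    also have "\<dots> = wd n X (l # u) * A"
      using Cons A c d by (simp add: assoc_mult_mat[of _ n n _ n _ m])
    finally show ?case .
  qed
  have "tr (wd m \<sigma> u) = tr (wd n X u)" if u: "u \<in> lists I" for u
  proof -
    have d: "wd m \<sigma> u \<in> carrier_mat m m" "wd n X u \<in> carrier_mat n n"
      using u wd_carrier[OF f] wd_carrier[OF fX] by auto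
    have "tr (wd n X u) = tr ((wd n X u * A) * R)"
      using A R d AR by (simp add: assoc_mult_mat[of _ n n _ m _ n])
    also have "\<dots> = tr (A * (wd m \<sigma> u * R))"
      unfolding wdA[OF u, symmetric] using A R d by (simp add: assoc_mult_mat[of _ n m _ m _ n])
    also have "\<dots> = tr ((wd m \<sigma> u * R) * A)" using A R d by (intro tr_comm) auto
    also have "(wd m \<sigma> u * R) * A = wd m \<sigma> u"
      using A R d RA by (simp add: assoc_mult_mat[of _ m m _ n _ m])
    finally show ?thesis by simp
  qed
  with nm show ?thesis by auto
qed

text \<open>
  The kernel hypothesis produces a linear bijection \<open>x w \<mapsto> x v\<close> between two of the modules, where
  \<open>x\<close> ranges over the annihilator of all earlier vectors of the list.
\<close>

lemma common_constituent_aux: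
  fixes X :: "'i \<Rightarrow> complex mat"
  assumes s: "irred I n X" and v: "v \<in> carrier_vec n" "v \<noteq> 0\<^sub>v n"
    and ws: "\<forall>(m, \<sigma>, w)\<in>set ws. irred I m \<sigma> \<and> w \<in> carrier_vec m"
    and ker: "\<forall>x\<in>FE I. (\<forall>(m, \<sigma>, w)\<in>set ws. ev m \<sigma> x *\<^sub>v w = 0\<^sub>v m) \<longrightarrow> ev n X x *\<^sub>v v = 0\<^sub>v n"
  shows "\<exists>(m, \<sigma>, w)\<in>set ws. m = n \<and> (\<forall>u\<in>lists I. tr (wd m \<sigma> u) = tr (wd n X u))"
  using ws ker
proof (induction ws)
  case Nil
  have "[(1, [])] \<in> FE I" by (simp add: FE_def)
  with Nil have "ev n X [(1, [])] *\<^sub>v v = 0\<^sub>v n" by auto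
  with v show ?case unfolding ev_one by simp
next
  case (Cons q ws)
  obtain m \<sigma> w where q: "q = (m, \<sigma>, w)" by (cases q) auto
  have irr: "irred I m \<sigma>" and w: "w \<in> carrier_vec m" using Cons.prems(1) q by auto
  have f: "fam m I \<sigma>" and fX: "fam n I X" using irr s by (auto simp: irred_def)
  \<comment> \<open>The annihilator of the remaining vectors \<open>ws\<close>, a left
    ideal.\<close>
  define L where "L = {x \<in> FE I. \<forall>(m, \<sigma>, w)\<in>set ws. ev m \<sigma> x *\<^sub>v w = 0\<^sub>v m}"
  show ?case
  \<comment> \<open>If this annihilator kills \<open>v\<close>, the induction hypothesis finds the
    constituent in \<open>ws\<close>; otherwise it is the head of the list.\<close>
  proof (cases "\<forall>x\<in>L. ev n X x *\<^sub>v v = 0\<^sub>v n")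
    case True
    have "\<exists>(m, \<sigma>, w)\<in>set ws. m = n \<and> (\<forall>u\<in>lists I. tr (wd m \<sigma> u) = tr (wd n X u))"
      using Cons.prems(1) True by (intro Cons.IH) (auto simp: L_def)
    then show ?thesis by auto
  next
    case False
    then obtain x0 where x0: "x0 \<in> L" "ev n X x0 *\<^sub>v v \<noteq> 0\<^sub>v n" by auto
    have L: "left_ideal I L" unfolding left_ideal_def
    proof (intro conjI ballI)
      show "L \<subseteq> FE I" by (auto simp: L_def)
      show "[] \<in> L" using Cons.prems(1) by (fastforce simp: L_def FE_def intro!: eq_vecI)
    next
      fix x y assume xy: "x \<in> L" "y \<in> L"
      have "ev m' \<sigma>' (x @ y) *\<^sub>v w' = 0\<^sub>v m'" if t: "(m', \<sigma>', w') \<in> set ws" for m' \<sigma>' w'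
      proof -
        have g: "fam m' I \<sigma>'" "w' \<in> carrier_vec m'" using t Cons.prems(1) by (auto simp: irred_def)
        have z: "x \<in> FE I" "y \<in> FE I" "ev m' \<sigma>' x *\<^sub>v w' = 0\<^sub>v m'" "ev m' \<sigma>' y *\<^sub>v w' = 0\<^sub>v m'"
          using xy t by (auto simp: L_def)
        show ?thesis using ev_append[OF g(1) z(1,2)] ev_carrier[OF g(1) z(1)] ev_carrier[OF g(1) z(2)] z(3,4) g(2)
          by (simp add: add_mult_distrib_mat_vec[of _ m' m'])
      qed
      then show "x @ y \<in> L" using xy by (auto simp: L_def append_FE)
    next
      fix y x assume y: "y \<in> FE I" and x: "x \<in> L"
      have "ev m' \<sigma>' (fmul y x) *\<^sub>v w' = 0\<^sub>v m'" if t: "(m', \<sigma>', w') \<in> set ws" for m' \<sigma>' w'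
      proof -
        have g: "fam m' I \<sigma>'" "w' \<in> carrier_vec m'" using t Cons.prems(1) by (auto simp: irred_def)
        have z: "x \<in> FE I" "ev m' \<sigma>' x *\<^sub>v w' = 0\<^sub>v m'" using x t by (auto simp: L_def)
        have "ev m' \<sigma>' (fmul y x) *\<^sub>v w' = ev m' \<sigma>' y *\<^sub>v 0\<^sub>v m'"
          using ev_fmul[OF g(1) z(1) y] ev_carrier[OF g(1) z(1)] ev_carrier[OF g(1) y] z(2) g(2)
          by (simp add: assoc_mult_mat_vec[of _ m' m' _ m'])
        then show ?thesis using ev_carrier[OF g(1) y] by (auto intro!: eq_vecI simp: scalar_prod_def)
      qed
      then show "fmul y x \<in> L" using x y by (auto simp: L_def fmul_FE)
    qed
    have LF: "\<And>x. x \<in> L \<Longrightarrow> x \<in> FE I" by (auto simp: L_def)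
    have ann: "ev n X x *\<^sub>v v = 0\<^sub>v n" if "x \<in> L" "ev m \<sigma> x *\<^sub>v w = 0\<^sub>v m" for x
      using that Cons.prems(2) by (auto simp: L_def q)
    have "ev m \<sigma> x0 *\<^sub>v w \<noteq> 0\<^sub>v m" using ann x0 by auto
    note orb = left_ideal_orbit[OF irr L w x0(1) this]
    have "\<forall>j. \<exists>x. j < m \<longrightarrow> x \<in> L \<and> ev m \<sigma> x *\<^sub>v w = unit_vec m j"
      using orb[of "unit_vec m _"] by fastforce
    from choice[OF this] obtain xs where
      xs: "\<And>j. j < m \<Longrightarrow> xs j \<in> L" "\<And>j. j < m \<Longrightarrow> ev m \<sigma> (xs j) *\<^sub>v w = unit_vec m j" by blast
    \<comment> \<open>The linear map that sends \<open>x w\<close> to \<open>x v\<close> for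
      \<open>x\<close> in \<open>L\<close>, prescribed on unit vectors; \<open>ann\<close> is the
      reason why it is well defined.\<close>
    define A where "A = mat n m (\<lambda>(i, j). (ev n X (xs j) *\<^sub>v v) $ i)"
    have A: "A \<in> carrier_mat n m" by (simp add: A_def)
    have cX: "ev n X x *\<^sub>v v \<in> carrier_vec n" if "x \<in> FE I" for x
      using ev_carrier[OF fX that] v by simp
    have cs: "ev m \<sigma> x *\<^sub>v w \<in> carrier_vec m" if "x \<in> FE I" for x
      using ev_carrier[OF f that] w by simp
    have lapp: "\<And>x y. x \<in> L \<Longrightarrow> y \<in> L \<Longrightarrow> x @ y \<in> L" and lmul: "\<And>y x. y \<in> FE I \<Longrightarrow> x \<in> L \<Longrightarrow> fmul y x \<in> L"
      and lnil: "[] \<in> L" using L by (auto simp: left_ideal_def)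
    \<comment> \<open>Combinations of the elements \<open>xs j\<close>, built up one unit vector at
      a time, realize a truncated vector \<open>u\<close> and its image under \<open>A\<close> by
      the same element of \<open>L\<close>.\<close>
    have comb: "\<exists>y\<in>L. (\<forall>i<m. (ev m \<sigma> y *\<^sub>v w) $ i = (if i < k then u $ i else 0)) \<and>
        (\<forall>i<n. (ev n X y *\<^sub>v v) $ i = (\<Sum>j<k. A $$ (i, j) * u $ j))" if "k \<le> m" for k and u :: "complex vec"
      using that
    proof (induction k)
      case 0
      show ?case by (rule bexI[OF _ lnil]) (use v w in auto)
    next
      case (Suc k)
      then obtain y where y: "y \<in> L" "\<And>i. i < m \<Longrightarrow> (ev m \<sigma> y *\<^sub>v w) $ i = (if i < k then u $ i else 0)"
        "\<And>i. i < n \<Longrightarrow> (ev n X y *\<^sub>v v) $ i = (\<Sum>j<k. A $$ (i, j) * u $ j)" by auto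
      have k: "k < m" using Suc.prems by simp
      define z where "z = y @ fmul [(u $ k, [])] (xs k)"
      have zL: "z \<in> L" using y(1) xs(1)[OF k] by (simp add: z_def lapp lmul FE_def)
      have ev_z: "ev N Y z *\<^sub>v a = ev N Y y *\<^sub>v a + u $ k \<cdot>\<^sub>v (ev N Y (xs k) *\<^sub>v a)"
        if g: "fam N I Y" "a \<in> carrier_vec N" for N Y a
        unfolding z_def by (rule ev_lincomb[OF g(1) LF[OF y(1)] LF[OF xs(1)[OF k]] g(2)])
      have "(ev m \<sigma> z *\<^sub>v w) $ i = (if i < Suc k then u $ i else 0)" if "i < m" for i
        using ev_z[OF f w] y(2)[OF that] that k xs(2)[OF k] cs[OF LF[OF y(1)]] by (auto simp: less_Suc_eq)
      moreover have "(ev n X z *\<^sub>v v) $ i = (\<Sum>j<Suc k. A $$ (i, j) * u $ j)" if "i < n" for i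
        using ev_z[OF fX v(1)] y(3)[OF that] that k cX[OF LF[OF y(1)]] cX[OF LF[OF xs(1)[OF k]]]
          carrier_matD(1)[OF ev_carrier[OF fX LF[OF xs(1)[OF k]]]]
        by (auto simp: A_def mult.commute)
      ultimately show ?case using zL by blast
    qed
    have Aact: "ev n X x *\<^sub>v v = A *\<^sub>v (ev m \<sigma> x *\<^sub>v w)" if x: "x \<in> L" for x
    proof -
      define u where "u = ev m \<sigma> x *\<^sub>v w"
      have u: "u \<in> carrier_vec m" using cs[OF LF[OF x]] by (simp add: u_def)
      from comb[of m u] obtain y where y: "y \<in> L" "\<And>i. i < m \<Longrightarrow> (ev m \<sigma> y *\<^sub>v w) $ i = u $ i"
        "\<And>i. i < n \<Longrightarrow> (ev n X y *\<^sub>v v) $ i = (\<Sum>j<m. A $$ (i, j) * u $ j)" by auto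
      \<comment> \<open>\<open>z\<close> is the formal difference of \<open>x\<close> and
        \<open>y\<close>; it kills \<open>w\<close>, hence by \<open>ann\<close> also
        \<open>v\<close>.\<close>
      define z where "z = x @ fmul [(-1, [])] y"
      have zL: "z \<in> L" using y(1) x by (simp add: z_def lapp lmul FE_def)
      have ev_z: "ev N Y z *\<^sub>v a = ev N Y x *\<^sub>v a + (-1) \<cdot>\<^sub>v (ev N Y y *\<^sub>v a)"
        if g: "fam N I Y" "a \<in> carrier_vec N" for N Y a
        unfolding z_def by (rule ev_lincomb[OF g(1) LF[OF x] LF[OF y(1)] g(2)])
      have "ev m \<sigma> z *\<^sub>v w = 0\<^sub>v m"
        unfolding ev_z[OF f w] using y(2) cs[OF LF[OF y(1)]] u
          carrier_matD(1)[OF ev_carrier[OF f LF[OF y(1)]]]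
        by (intro eq_vecI) (auto simp: u_def[symmetric])
      from ann[OF zL this] have z0: "ev n X x *\<^sub>v v + (-1) \<cdot>\<^sub>v (ev n X y *\<^sub>v v) = 0\<^sub>v n"
        unfolding ev_z[OF fX v(1)] .
      have "ev n X x *\<^sub>v v = A *\<^sub>v u"
      proof (intro eq_vecI)
        fix i assume "i < dim_vec (A *\<^sub>v u)"
        then have i: "i < n" using A by simp
        have "(ev n X x *\<^sub>v v) $ i = (ev n X y *\<^sub>v v) $ i"
          using arg_cong[OF z0, of "\<lambda>a. a $ i"] i cX[OF LF[OF y(1)]] cX[OF LF[OF x]]
            carrier_matD(1)[OF ev_carrier[OF fX LF[OF y(1)]]] carrier_matD(1)[OF ev_carrier[OF fX LF[OF x]]]
          by simp
        then show "(ev n X x *\<^sub>v v) $ i = (A *\<^sub>v u) $ i"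
          using y(3)[OF i] index_mult_mat_vec_sum[OF A u i] by simp
      qed (use A ev_carrier[OF fX LF[OF x]] in auto)
      then show ?thesis by (simp add: u_def)
    qed
    have surj: "\<exists>a\<in>carrier_vec m. A *\<^sub>v a = b" if b: "b \<in> carrier_vec n" for b
    proof -
      from left_ideal_orbit[OF s L v(1) x0 b] obtain y where "y \<in> L" "ev n X y *\<^sub>v v = b" by auto
      then show ?thesis using Aact[of y] cs[OF LF[of y]] by auto
    qed
    have pre: "\<exists>x\<in>L. ev m \<sigma> x *\<^sub>v w = a" if "a \<in> carrier_vec m" for a using orb[OF that] .
    have inter: "A *\<^sub>v (\<sigma> l *\<^sub>v a) = X l *\<^sub>v (A *\<^sub>v a)" if l: "l \<in> I" and a: "a \<in> carrier_vec m" for l a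
    proof -
      from pre[OF a] obtain x where x: "x \<in> L" "ev m \<sigma> x *\<^sub>v w = a" by auto
      have lF: "[(1, [l])] \<in> FE I" using l by (simp add: FE_def)
      have c: "\<sigma> l \<in> carrier_mat m m" "X l \<in> carrier_mat n n" using l f fX by (auto simp: fam_def)
      have 1: "ev N Y (fmul [(1, [l])] x) *\<^sub>v b = Y l *\<^sub>v (ev N Y x *\<^sub>v b)"
        if "fam N I Y" "b \<in> carrier_vec N" for N Y b
      proof -
        have "Y l \<in> carrier_mat N N" using that l by (auto simp: fam_def)
        then show ?thesis
          using ev_fmul[OF that(1) LF[OF x(1)] lF] ev_letter[of Y l N] ev_carrier[OF that(1) LF[OF x(1)]] that
          by (simp del: ev.simps add: assoc_mult_mat_vec[of _ N N _ N])
      qed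
      have "X l *\<^sub>v (A *\<^sub>v a) = ev n X (fmul [(1, [l])] x) *\<^sub>v v"
        using 1[OF fX v(1)] Aact[OF x(1)] x(2) by simp
      also have "\<dots> = A *\<^sub>v (ev m \<sigma> (fmul [(1, [l])] x) *\<^sub>v w)"
        using Aact[OF lmul[OF lF x(1)]] .
      also have "\<dots> = A *\<^sub>v (\<sigma> l *\<^sub>v a)" using 1[OF f w] x(2) by simp
      finally show ?thesis by simp
    qed
    from intertwining_surjection_traces[OF irr fX A inter surj v] show ?thesis using q by auto
  qed
qed

text \<open>The preceding lemma is applied to the basis vectors of all summands: an element that
  kills them acts as 0 on each summand.\<close>

lemma common_constituent:
  assumes s: "irred I n X" and L: "\<forall>(m, \<sigma>)\<in>set L. irred I m \<sigma>"
    and ker: "\<And>x. x \<in> FE I \<Longrightarrow> (\<forall>(m, \<sigma>)\<in>set L. ev m \<sigma> x = 0\<^sub>m m m) \<Longrightarrow> ev n X x = 0\<^sub>m n n"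
  shows "\<exists>(m, \<sigma>)\<in>set L. m = n \<and> (\<forall>u\<in>lists I. tr (wd m \<sigma> u) = tr (wd n X u))"
proof -
  define ws where "ws = concat (map (\<lambda>(m, \<sigma>). map (\<lambda>j. (m, \<sigma>, unit_vec m j :: complex vec)) [0..<m]) L)"
  have n: "0 < n" using s by (simp add: irred_def)
  have set_ws: "(m, \<sigma>, w) \<in> set ws \<longleftrightarrow> (m, \<sigma>) \<in> set L \<and> (\<exists>j<m. w = unit_vec m j)" for m \<sigma> w
    by (force simp: ws_def)
  have "\<exists>(m, \<sigma>, w)\<in>set ws. m = n \<and> (\<forall>u\<in>lists I. tr (wd m \<sigma> u) = tr (wd n X u))"
  proof (rule common_constituent_aux[OF s])
    show "unit_vec n 0 \<in> carrier_vec n" by simp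
    show "unit_vec n 0 \<noteq> (0\<^sub>v n :: complex vec)"
      using n by (auto dest!: arg_cong[of _ _ "\<lambda>v. v $ 0"])
    show "\<forall>(m, \<sigma>, w)\<in>set ws. irred I m \<sigma> \<and> w \<in> carrier_vec m"
      using L by (auto simp: set_ws)
    show "\<forall>x\<in>FE I. (\<forall>(m, \<sigma>, w)\<in>set ws. ev m \<sigma> x *\<^sub>v w = 0\<^sub>v m) \<longrightarrow> ev n X x *\<^sub>v unit_vec n 0 = 0\<^sub>v n"
    proof (intro ballI impI)
      fix x assume x: "x \<in> FE I" and 0: "\<forall>(m, \<sigma>, w)\<in>set ws. ev m \<sigma> x *\<^sub>v w = 0\<^sub>v m"
      have "ev m \<sigma> x = 0\<^sub>m m m" if "(m, \<sigma>) \<in> set L" for m \<sigma>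
      proof -
        have f: "fam m I \<sigma>" using L that by (auto simp: irred_def)
        note c = ev_carrier[OF f x]
        show ?thesis
        proof (intro eq_matI)
          fix i j assume ij: "i < dim_row (0\<^sub>m m m :: complex mat)" "j < dim_col (0\<^sub>m m m :: complex mat)"
          have "(m, \<sigma>, unit_vec m j) \<in> set ws" using that ij by (auto simp: set_ws)
          then have "ev m \<sigma> x *\<^sub>v unit_vec m j = 0\<^sub>v m" using 0 by auto
          then have "col (ev m \<sigma> x) j = 0\<^sub>v m" using mult_unit_vec[OF c] ij by simp
          then have "col (ev m \<sigma> x) j $ i = 0\<^sub>v m $ i" by (simp only:)
          then show "ev m \<sigma> x $$ (i, j) = 0\<^sub>m m m $$ (i, j)" using c ij by simp
        qed (use c in auto)
      qed
      then have "ev n X x = 0\<^sub>m n n" using ker[OF x] by auto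
      then show "ev n X x *\<^sub>v unit_vec n 0 = 0\<^sub>v n" by (auto intro!: eq_vecI)
    qed
  qed
  then show ?thesis by (auto simp: set_ws)
qed

text \<open>An element that acts as 0 on all of \<open>M\<close> has vanishing traces, as have all
  powers of its multiples, so by \<open>trace_radical\<close> it acts as 0 on every summand of
  \<open>L\<close>. Hence the head of \<open>L\<close> shares its dimension and character with a
  summand of \<open>M\<close>, and both can be removed.\<close>

theorem character_determines_dims:
  fixes L M :: "(nat \<times> ('a \<Rightarrow> complex mat)) list"
  assumes "\<forall>(m, \<sigma>)\<in>set L. irred I m \<sigma>" "\<forall>(m, \<sigma>)\<in>set M. irred I m \<sigma>"
    and "\<And>w. w \<in> lists I \<Longrightarrow> (\<Sum>(m, \<sigma>)\<leftarrow>L. tr (wd m \<sigma> w)) = (\<Sum>(m, \<sigma>)\<leftarrow>M. tr (wd m \<sigma> w))"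
  shows "mset (map fst L) = mset (map fst M)"
  using assms
proof (induction L arbitrary: M)
  case Nil
  have "(\<Sum>(m, \<sigma>)\<leftarrow>M. tr (wd m \<sigma> [])) = of_nat (dims M)"
    by (induction M) (auto simp: tr_one)
  moreover have "(\<Sum>(m, \<sigma>)\<leftarrow>M. tr (wd m \<sigma> [])) = 0" using Nil.prems(3)[of "[]"] by simp
  ultimately have "dims M = 0" by (metis of_nat_eq_0_iff)
  then have "\<forall>p\<in>set M. fst p = 0" by (simp add: dims_def)
  with Nil.prems(2) have "M = []" by (cases M) (auto simp: irred_def)
  then show ?case by simp
next
  case (Cons p L)
  obtain n X where p: "p = (n, X)" by (cases p)
  have irr: "irred I n X" using Cons.prems(1) p by auto
  have tr_sum: "(\<Sum>(m, \<sigma>)\<leftarrow>N. tr (ev m \<sigma> x)) = (\<Sum>q\<leftarrow>x. fst q * (\<Sum>(m, \<sigma>)\<leftarrow>N. tr (wd m \<sigma> (snd q))))"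
    if "x \<in> FE I" "\<forall>(m, \<sigma>)\<in>set N. irred I m \<sigma>" for x and N :: "(nat \<times> ('a \<Rightarrow> complex mat)) list"
    using that(2)
  proof (induction N)
    case (Cons r N)
    have "tr (ev (fst r) (snd r) x) = (\<Sum>q\<leftarrow>x. fst q * tr (wd (fst r) (snd r) (snd q)))"
      using Cons.prems by (intro tr_ev[OF _ that(1)]) (auto simp: irred_def)
    with Cons show ?case by (simp add: case_prod_beta' distrib_left sum_list_addf)
  qed simp
  have eq: "(\<Sum>(m, \<sigma>)\<leftarrow>p # L. tr (ev m \<sigma> x)) = (\<Sum>(m, \<sigma>)\<leftarrow>M. tr (ev m \<sigma> x))" if "x \<in> FE I" for x
    unfolding tr_sum[OF that Cons.prems(1)] tr_sum[OF that Cons.prems(2)]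
  proof (intro arg_cong[of _ _ sum_list] map_cong[OF HOL.refl])
    fix q assume "q \<in> set x"
    then have "snd q \<in> lists I" using that by (auto simp: FE_def)
    from Cons.prems(3)[OF this]
    show "fst q * (\<Sum>(m, \<sigma>)\<leftarrow>p # L. tr (wd m \<sigma> (snd q))) = fst q * (\<Sum>(m, \<sigma>)\<leftarrow>M. tr (wd m \<sigma> (snd q)))"
      by simp
  qed
  have "\<exists>(m, \<sigma>)\<in>set M. m = n \<and> (\<forall>u\<in>lists I. tr (wd m \<sigma> u) = tr (wd n X u))"
  proof (rule common_constituent[OF irr Cons.prems(2)])
    fix x assume x: "x \<in> FE I" and 0: "\<forall>(m, \<sigma>)\<in>set M. ev m \<sigma> x = 0\<^sub>m m m"
    show "ev n X x = 0\<^sub>m n n"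
    proof (rule trace_radical[OF Cons.prems(1) x])
      show "(n, X) \<in> set (p # L)" by (simp add: p)
      fix y :: "'a felem" and k assume y: "y \<in> FE I"
      note yx = fmul_FE[OF y x]
      have "tr (ev m \<sigma> (fpow (fmul y x) (Suc k))) = 0" if "(m, \<sigma>) \<in> set M" for m \<sigma>
      proof -
        have f: "fam m I \<sigma>" using that Cons.prems(2) by (auto simp: irred_def)
        have "ev m \<sigma> (fmul y x) = 0\<^sub>m m m"
          using ev_fmul[OF f x y] 0 that ev_carrier[OF f y] by auto
        then have "ev m \<sigma> (fpow (fmul y x) (Suc k)) = 0\<^sub>m m m"
          using ev_fmul[OF f yx fpow_FE[OF yx]] ev_carrier[OF f fpow_FE[OF yx]]
          by (simp add: right_mult_zero_mat[of _ m m])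
        then show ?thesis by simp
      qed
      then have "(\<Sum>(m, \<sigma>)\<leftarrow>M. tr (ev m \<sigma> (fpow (fmul y x) (Suc k)))) = (\<Sum>q\<leftarrow>M. 0)"
        by (intro arg_cong[of _ _ sum_list] map_cong) auto
      then show "(\<Sum>(m, \<sigma>)\<leftarrow>p # L. tr (ev m \<sigma> (fpow (fmul y x) (Suc k)))) = 0"
        unfolding eq[OF fpow_FE[OF yx]] by simp
    qed
  qed
  then obtain \<sigma> where s: "(n, \<sigma>) \<in> set M" "\<And>u. u \<in> lists I \<Longrightarrow> tr (wd n \<sigma> u) = tr (wd n X u)" by auto
  define M' where "M' = remove1 (n, \<sigma>) M"
  have mM: "mset M = add_mset (n, \<sigma>) (mset M')" using s(1) by (simp add: M'_def)
  have sumM: "(\<Sum>q\<leftarrow>M. f q) = f (n, \<sigma>) + (\<Sum>q\<leftarrow>M'. f q)" for f :: "_ \<Rightarrow> complex"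
    using sum_list_map_remove1[OF s(1)] unfolding M'_def .
  have "mset (map fst L) = mset (map fst M')"
  proof (rule Cons.IH)
    show "\<forall>(m, \<sigma>)\<in>set L. irred I m \<sigma>" using Cons.prems(1) by simp
    show "\<forall>(m, \<sigma>)\<in>set M'. irred I m \<sigma>" using Cons.prems(2) notin_set_remove1[of _ M] unfolding M'_def by blast
    fix w assume w: "w \<in> lists I"
    show "(\<Sum>(m, \<sigma>)\<leftarrow>L. tr (wd m \<sigma> w)) = (\<Sum>(m, \<sigma>)\<leftarrow>M'. tr (wd m \<sigma> w))"
      using Cons.prems(3)[OF w] sumM[of "\<lambda>(m, \<sigma>). tr (wd m \<sigma> w)"] s(2)[OF w] by (simp add: p)
  qed
  then show ?case using mM by (simp add: p)
qed

text \<open>Multiples of a letter, and their positive powers, are combinations of nonempty words,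
  whose traces vanish. So \<open>trace_radical\<close> applies to each letter.\<close>

lemma traceless_irreds_zero:
  fixes L :: "(nat \<times> ('a \<Rightarrow> complex mat)) list"
  assumes L: "\<forall>(m, \<sigma>)\<in>set L. irred I m \<sigma>"
    and 0: "\<And>w. w \<in> lists I \<Longrightarrow> w \<noteq> [] \<Longrightarrow> (\<Sum>(m, \<sigma>)\<leftarrow>L. tr (wd m \<sigma> w)) = 0"
    and s: "(m, \<sigma>) \<in> set L" and l: "l \<in> I"
  shows "\<sigma> l = 0\<^sub>m m m"
proof -
  have lF: "[(1, [l])] \<in> FE I" using l by (simp add: FE_def)
  have ne: "\<forall>q\<in>set (fmul x y). snd q \<noteq> []" if "\<forall>q\<in>set y. snd q \<noteq> []" for x y :: "'a felem"
    using that by (auto simp: fmul_def)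
  have "ev m \<sigma> [(1, [l])] = 0\<^sub>m m m"
  proof (rule trace_radical[OF L lF _ s])
    fix y :: "'a felem" and k assume y: "y \<in> FE I"
    define z where "z = fpow (fmul y [(1, [l])]) (Suc k)"
    have z: "z \<in> FE I" using y lF by (simp add: z_def fpow_FE fmul_FE del: fpow.simps)
    have zne: "\<forall>q\<in>set z. snd q \<noteq> []" unfolding z_def fpow.simps by (intro ne) simp
    have "(\<Sum>(m, \<sigma>)\<leftarrow>N. tr (ev m \<sigma> z)) = (\<Sum>q\<leftarrow>z. fst q * (\<Sum>(m, \<sigma>)\<leftarrow>N. tr (wd m \<sigma> (snd q))))"
      if "\<forall>(m, \<sigma>)\<in>set N. irred I m \<sigma>" for N :: "(nat \<times> ('a \<Rightarrow> complex mat)) list"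
      using that
    proof (induction N)
      case (Cons r N)
      have "tr (ev (fst r) (snd r) z) = (\<Sum>q\<leftarrow>z. fst q * tr (wd (fst r) (snd r) (snd q)))"
        using Cons.prems by (intro tr_ev[OF _ z]) (auto simp: irred_def)
      with Cons show ?case by (simp add: case_prod_beta' distrib_left sum_list_addf)
    qed simp
    from this[OF L] have "(\<Sum>(m, \<sigma>)\<leftarrow>L. tr (ev m \<sigma> z)) = (\<Sum>q\<leftarrow>z. fst q * (\<Sum>(m, \<sigma>)\<leftarrow>L. tr (wd m \<sigma> (snd q))))" .
    also have "\<dots> = (\<Sum>q\<leftarrow>z. 0)"
    proof (intro arg_cong[of _ _ sum_list] map_cong[OF HOL.refl])
      fix q assume q: "q \<in> set z"
      then have "snd q \<in> lists I" "snd q \<noteq> []" using z zne by (auto simp: FE_def)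
      from 0[OF this] show "fst q * (\<Sum>(m, \<sigma>)\<leftarrow>L. tr (wd m \<sigma> (snd q))) = 0" by simp
    qed
    finally show "(\<Sum>(m, \<sigma>)\<leftarrow>L. tr (ev m \<sigma> (fpow (fmul y [(1, [l])]) (Suc k)))) = 0"
      by (simp add: z_def)
  qed
  moreover have "\<sigma> l \<in> carrier_mat m m" using L s l by (auto simp: irred_def fam_def)
  ultimately show ?thesis using ev_letter[of \<sigma> l m] by simp
qed

section \<open>Invariant polynomials on block diagonal tuples\<close>

text \<open>Removed from the simpset where functions have to stay intact as ring elements.\<close>

lemmas fun_ap = plus_fun_apply times_fun_apply zero_fun_apply

section \<open>Block diagonal matrices and the projection onto them\<close>

primrec blkidx :: "nat list \<Rightarrow> nat \<Rightarrow> nat" where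
  "blkidx [] i = 0"
| "blkidx (d # ds) i = (if i < d then 0 else Suc (blkidx ds (i - d)))"

text \<open>Given by vanishing entries instead of a list of blocks; closure under products and
  adjoints is then a matter of entries, and the coordinates of block diagonal tuples are a subset of
  all entries.\<close>

definition bd :: "nat list \<Rightarrow> complex mat set" where
  "bd ds = {M \<in> carrier_mat (sum_list ds) (sum_list ds).
     \<forall>i<sum_list ds. \<forall>j<sum_list ds. blkidx ds i \<noteq> blkidx ds j \<longrightarrow> M $$ (i, j) = 0}"

lemma bd_carrier: "M \<in> bd ds \<Longrightarrow> M \<in> carrier_mat (sum_list ds) (sum_list ds)"
  by (simp add: bd_def)

lemma bd_zero: "M \<in> bd ds \<Longrightarrow> i < sum_list ds \<Longrightarrow> j < sum_list ds \<Longrightarrow> blkidx ds i \<noteq> blkidx ds j \<Longrightarrow> M $$ (i, j) = 0"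
  by (simp add: bd_def)

lemma bd_mult:
  assumes "M \<in> bd ds" "N \<in> bd ds" shows "M * N \<in> bd ds"
proof -
  let ?n = "sum_list ds"
  note c = bd_carrier[OF assms(1)] bd_carrier[OF assms(2)]
  have "(M * N) $$ (i, j) = 0" if "i < ?n" "j < ?n" "blkidx ds i \<noteq> blkidx ds j" for i j
  proof -
    have "(M * N) $$ (i, j) = (\<Sum>k<?n. M $$ (i, k) * N $$ (k, j))"
      using that by (intro index_mult_mat_sum[OF c]) auto
    also have "\<dots> = 0"
    proof (intro sum.neutral ballI)
      fix k assume "k \<in> {..<?n}"
      then show "M $$ (i, k) * N $$ (k, j) = 0"
        using that bd_zero[OF assms(1), of i k] bd_zero[OF assms(2), of k j]
        by (cases "blkidx ds i = blkidx ds k") auto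
    qed
    finally show ?thesis .
  qed
  then show ?thesis using c by (auto simp: bd_def)
qed

lemma bd_one: "1\<^sub>m (sum_list ds) \<in> bd ds"
  by (auto simp: bd_def)

lemma bd_Cons_blocks:
  assumes "M \<in> bd (d # ds)"
  defines "A \<equiv> mat d d (\<lambda>(i, j). M $$ (i, j))"
    and "D \<equiv> mat (sum_list ds) (sum_list ds) (\<lambda>(i, j). M $$ (i + d, j + d))"
  shows "M = fbd A D" "D \<in> bd ds"
proof -
  have c: "M \<in> carrier_mat (d + sum_list ds) (d + sum_list ds)" using bd_carrier[OF assms(1)] by simp
  have z: "M $$ (i, j) = 0" if "i < d + sum_list ds" "j < d + sum_list ds" "(i < d) \<noteq> (j < d)" for i j
    using bd_zero[OF assms(1), of i j] that by auto
  show "M = fbd A D" using c z by (intro eq_matI) (auto simp: A_def D_def)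
  show "D \<in> bd ds"
    unfolding bd_def D_def using bd_zero[OF assms(1)] by auto
qed

lemma diag_block_bd:
  assumes "length Ms = length ds" "\<And>i. i < length ds \<Longrightarrow> Ms ! i \<in> carrier_mat (ds ! i) (ds ! i)"
  shows "diag_block_mat Ms \<in> bd ds"
  using assms
proof (induction ds arbitrary: Ms)
  case Nil
  then show ?case by (auto simp: bd_def)
next
  case (Cons d ds)
  then obtain M Ms' where Ms: "Ms = M # Ms'" by (cases Ms) auto
  have M: "M \<in> carrier_mat d d" using Cons.prems(2)[of 0] Ms by simp
  have "Ms' ! i \<in> carrier_mat (ds ! i) (ds ! i)" if "i < length ds" for i
    using Cons.prems(2)[of "Suc i"] Ms that by simp
  then have D: "diag_block_mat Ms' \<in> bd ds"
    using Cons.prems(1) Ms by (intro Cons.IH) auto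
  have "fbd M (diag_block_mat Ms') \<in> bd (d # ds)"
    using M bd_carrier[OF D] bd_zero[OF D] by (auto simp: bd_def)
  then show ?case by (simp add: Ms Let_def)
qed

lemma bd_family_decomp:
  fixes X :: "'i \<Rightarrow> complex mat"
  assumes "\<And>l. l \<in> I \<Longrightarrow> X l \<in> bd ds"
  shows "\<exists>\<Xi>. map fst \<Xi> = ds \<and> (\<forall>(m, Y)\<in>set \<Xi>. fam m I Y) \<and> (\<forall>l\<in>I. X l = dsum \<Xi> l)"
  using assms
proof (induction ds arbitrary: X)
  case Nil
  have "X l = 0\<^sub>m 0 0" if "l \<in> I" for l
    using bd_carrier[OF Nil[OF that]] by (intro eq_matI) auto
  then show ?case by (intro exI[of _ "[]"]) (auto simp: dsum_Nil)
next
  case (Cons d ds)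
  define A where "A = (\<lambda>l. mat d d (\<lambda>(i, j). X l $$ (i, j)))"
  define D where "D = (\<lambda>l. mat (sum_list ds) (sum_list ds) (\<lambda>(i, j). X l $$ (i + d, j + d)))"
  have "D l \<in> bd ds" if "l \<in> I" for l
    unfolding D_def by (rule bd_Cons_blocks(2)[OF Cons.prems[OF that]])
  from Cons.IH[of D, OF this] obtain \<Xi> where X: "map fst \<Xi> = ds" "\<forall>(m, Y)\<in>set \<Xi>. fam m I Y"
    "\<forall>l\<in>I. D l = dsum \<Xi> l" by blast
  have "X l = dsum ((d, A) # \<Xi>) l" if "l \<in> I" for l
    using bd_Cons_blocks(1)[OF Cons.prems[OF that]]
    by (simp add: dsum_Cons blk_def X(3)[rule_format, OF that, symmetric] A_def D_def)
  moreover have "fam d I A" by (simp add: fam_def A_def)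
  ultimately show ?case using X(1,2) by (intro exI[of _ "(d, A) # \<Xi>"]) auto
qed

definition cadj :: "complex mat \<Rightarrow> complex mat" where
  "cadj M = mat (dim_col M) (dim_row M) (\<lambda>(i, j). cnj (M $$ (j, i)))"

lemma cadj_mult:
  assumes "M \<in> carrier_mat n n" "N \<in> carrier_mat n n"
  shows "cadj (M * N) = cadj N * cadj M"
proof (intro eq_matI)
  fix i j assume "i < dim_row (cadj N * cadj M)" "j < dim_col (cadj N * cadj M)"
  then have ij: "i < n" "j < n" using assms by (auto simp: cadj_def)
  have c: "cadj M \<in> carrier_mat n n" "cadj N \<in> carrier_mat n n" using assms by (auto simp: cadj_def)
  have "cadj (M * N) $$ (i, j) = cnj ((M * N) $$ (j, i))"
    using ij assms by (simp add: cadj_def del: index_mult_mat(1))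
  also have "\<dots> = (\<Sum>k<n. cnj (M $$ (j, k)) * cnj (N $$ (k, i)))"
    unfolding index_mult_mat_sum[OF assms ij(2,1)] by simp
  also have "\<dots> = (\<Sum>k<n. cadj N $$ (i, k) * cadj M $$ (k, j))"
    using ij assms by (intro sum.cong) (auto simp: cadj_def mult.commute)
  also have "\<dots> = (cadj N * cadj M) $$ (i, j)"
    using index_mult_mat_sum[OF c(2,1) ij] by simp
  finally show "cadj (M * N) $$ (i, j) = (cadj N * cadj M) $$ (i, j)" .
qed (use assms in \<open>auto simp: cadj_def\<close>)

lemma cadj_bd: "M \<in> bd ds \<Longrightarrow> cadj M \<in> bd ds"
  by (auto simp: bd_def cadj_def)

lemma cadj_one: "cadj (1\<^sub>m n) = 1\<^sub>m n"
  by (auto simp: cadj_def intro!: eq_matI)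

definition bdpairs :: "nat list \<Rightarrow> (complex mat \<times> complex mat) set" where
  "bdpairs ds = {(g, h). inv_pair (sum_list ds) g h \<and> g \<in> bd ds \<and> h \<in> bd ds}"

text \<open>Families may carry matrices of any size. Projecting first makes \<open>bact\<close>
  meaningful for all of them, and polynomials in the block coordinates cannot tell a family from its
  projection.\<close>

definition prbd :: "nat list \<Rightarrow> ('i \<Rightarrow> complex mat) \<Rightarrow> 'i \<Rightarrow> complex mat" where
  "prbd ds X = (\<lambda>l. mat (sum_list ds) (sum_list ds)
     (\<lambda>(i, j). if blkidx ds i = blkidx ds j then X l $$ (i, j) else 0))"

lemma prbd_bd: "prbd ds X l \<in> bd ds"
  by (auto simp: prbd_def bd_def)

lemma prbd_id: "X l \<in> bd ds \<Longrightarrow> prbd ds X l = X l"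
  by (intro eq_matI) (auto simp: prbd_def bd_def)

lemma fam_prbd: "fam (sum_list ds) I (prbd ds X)"
  by (simp add: fam_def prbd_def)

definition bact :: "nat list \<Rightarrow> complex mat \<times> complex mat \<Rightarrow> ('i \<Rightarrow> complex mat) \<Rightarrow> 'i \<Rightarrow> complex mat" where
  "bact ds g X = (\<lambda>l. fst g * prbd ds X l * snd g)"

lemma bact_bd: "g \<in> bdpairs ds \<Longrightarrow> bact ds g X l \<in> bd ds"
  by (auto simp: bact_def bdpairs_def intro!: bd_mult prbd_bd)

lemma prbd_bact: "g \<in> bdpairs ds \<Longrightarrow> prbd ds (bact ds g X) = bact ds g X"
  by (rule ext) (rule prbd_id, erule bact_bd)

text \<open>Block diagonal factors mix only entries that lie in the same pair of blocks, so
  conjugation by them commutes with the projection.\<close>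

lemma prbd_conj:
  assumes "g \<in> bd ds" "h \<in> bd ds" "X l \<in> carrier_mat (sum_list ds) (sum_list ds)"
  shows "prbd ds (\<lambda>l. g * X l * h) l = g * prbd ds X l * h"
proof (intro eq_matI)
  let ?n = "sum_list ds"
  note c = bd_carrier[OF assms(1)] bd_carrier[OF assms(2)]
  have pc: "prbd ds X l \<in> carrier_mat ?n ?n" by (rule bd_carrier[OF prbd_bd])
  have ent: "(g * M * h) $$ (i, j) = (\<Sum>b<?n. (\<Sum>a<?n. g $$ (i, a) * M $$ (a, b)) * h $$ (b, j))"
    if "M \<in> carrier_mat ?n ?n" "i < ?n" "j < ?n" for M i j
  proof -
    have "(g * M * h) $$ (i, j) = (\<Sum>b<?n. (g * M) $$ (i, b) * h $$ (b, j))"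
      using that c by (intro index_mult_mat_sum) auto
    also have "\<dots> = (\<Sum>b<?n. (\<Sum>a<?n. g $$ (i, a) * M $$ (a, b)) * h $$ (b, j))"
    proof (intro sum.cong HOL.refl)
      fix b assume "b \<in> {..<?n}"
      then show "(g * M) $$ (i, b) * h $$ (b, j) = (\<Sum>a<?n. g $$ (i, a) * M $$ (a, b)) * h $$ (b, j)"
        using index_mult_mat_sum[OF c(1) that(1,2), of b] by simp
    qed
    finally show ?thesis .
  qed
  fix i j assume "i < dim_row (g * prbd ds X l * h)" "j < dim_col (g * prbd ds X l * h)"
  then have ij: "i < ?n" "j < ?n" using c by auto
  show "prbd ds (\<lambda>l. g * X l * h) l $$ (i, j) = (g * prbd ds X l * h) $$ (i, j)"
  proof (cases "blkidx ds i = blkidx ds j")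
    case True
    have "(g * X l * h) $$ (i, j) = (g * prbd ds X l * h) $$ (i, j)"
      unfolding ent[OF assms(3) ij] ent[OF pc ij]
    proof (intro sum.cong HOL.refl)
      fix b assume b: "b \<in> {..<?n}"
      show "(\<Sum>a<?n. g $$ (i, a) * X l $$ (a, b)) * h $$ (b, j) =
        (\<Sum>a<?n. g $$ (i, a) * prbd ds X l $$ (a, b)) * h $$ (b, j)"
      proof (cases "blkidx ds b = blkidx ds j")
        case bj: True
        have "(\<Sum>a<?n. g $$ (i, a) * X l $$ (a, b)) = (\<Sum>a<?n. g $$ (i, a) * prbd ds X l $$ (a, b))"
        proof (intro sum.cong HOL.refl)
          fix a assume "a \<in> {..<?n}"
          then show "g $$ (i, a) * X l $$ (a, b) = g $$ (i, a) * prbd ds X l $$ (a, b)"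
            using b bj True bd_zero[OF assms(1), of i a] ij
            by (cases "blkidx ds i = blkidx ds a") (auto simp: prbd_def)
        qed
        then show ?thesis by simp
      next
        case False
        then show ?thesis using bd_zero[OF assms(2), of b j] b ij by simp
      qed
    qed
    then show ?thesis using True ij by (simp add: prbd_def)
  next
    case False
    have "g * prbd ds X l * h \<in> bd ds" by (intro bd_mult assms prbd_bd)
    then show ?thesis using bd_zero[of "g * prbd ds X l * h" ds i j] ij False
      by (simp add: prbd_def)
  qed
qed (use bd_carrier[OF assms(1)] bd_carrier[OF assms(2)] in \<open>auto simp: prbd_def\<close>)

section \<open>Matrices of the action on monomials\<close>

type_synonym 'i coord = "'i \<times> nat \<times> nat"

definition co :: "'i coord \<Rightarrow> ('i \<Rightarrow> complex mat) \<Rightarrow> complex" where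
  "co k X = X (fst k) $$ snd k"

text \<open>Monomials are indexed by words in the coordinates, with order and repetition. Degree
  \<open>k\<close> then behaves like a tensor power: the matrices \<open>breps\<close> are products
  of entries of \<open>brep\<close>, and adjoints can be computed factor by factor.\<close>

definition cmon :: "'i coord list \<Rightarrow> ('i \<Rightarrow> complex mat) \<Rightarrow> complex" where
  "cmon xs X = (\<Prod>k\<leftarrow>xs. co k X)"

lemma cmon_simps [simp]: "cmon [] X = 1" "cmon (k # xs) X = co k X * cmon xs X" "cmon (xs @ ys) X = cmon xs X * cmon ys X"
  by (simp_all add: cmon_def)

text \<open>The Kronecker product that describes left multiplication by the first component and
  right multiplication by the second.\<close>

definition brep :: "complex mat \<times> complex mat \<Rightarrow> 'i coord \<Rightarrow> 'i coord \<Rightarrow> complex" where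
  "brep g k k' = (if fst k = fst k' then fst g $$ (fst (snd k), fst (snd k')) * snd g $$ (snd (snd k'), snd (snd k)) else 0)"

fun breps :: "complex mat \<times> complex mat \<Rightarrow> 'i coord list \<Rightarrow> 'i coord list \<Rightarrow> complex" where
  "breps g [] [] = 1"
| "breps g (x # xs) (y # ys) = brep g x y * breps g xs ys"
| "breps g _ _ = 0"

definition bmul :: "complex mat \<times> complex mat \<Rightarrow> complex mat \<times> complex mat \<Rightarrow> complex mat \<times> complex mat" where
  "bmul g g' = (fst g * fst g', snd g' * snd g)"

definition badj :: "complex mat \<times> complex mat \<Rightarrow> complex mat \<times> complex mat" where
  "badj g = (cadj (fst g), cadj (snd g))"

lemma bmul_bdpairs: "g \<in> bdpairs ds \<Longrightarrow> g' \<in> bdpairs ds \<Longrightarrow> bmul g g' \<in> bdpairs ds"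
  by (auto simp: bmul_def bdpairs_def intro!: bd_mult inv_pair_mult)

lemma one_bdpairs: "(1\<^sub>m (sum_list ds), 1\<^sub>m (sum_list ds)) \<in> bdpairs ds"
  by (auto simp: bdpairs_def inv_pair_one bd_one)

text \<open>The adjoint of the inverse is the inverse of the adjoint. This stability under adjoints
  takes the place of a compact subgroup over which one would integrate.\<close>

lemma badj_bdpairs: "g \<in> bdpairs ds \<Longrightarrow> badj g \<in> bdpairs ds"
  by (auto simp: badj_def bdpairs_def inv_pair_def cadj_bd cadj_mult[symmetric] cadj_one)
    (auto simp: cadj_def)

locale tuples =
  fixes S :: "'i set" and ds :: "nat list"
  assumes finS: "finite S"
begin

abbreviation "n \<equiv> sum_list ds"
abbreviation "\<beta> \<equiv> blkidx ds"
abbreviation "G \<equiv> bdpairs ds"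

definition coords :: "'i coord set" where
  "coords = {k \<in> S \<times> {..<n} \<times> {..<n}. \<beta> (fst (snd k)) = \<beta> (snd (snd k))}"

definition P :: "(('i \<Rightarrow> complex mat) \<Rightarrow> complex) set" where
  "P = falg (co ` coords)"

definition Lk :: "nat \<Rightarrow> 'i coord list set" where
  "Lk k = {xs. set xs \<subseteq> coords \<and> length xs = k}"

definition hpol :: "nat \<Rightarrow> (('i \<Rightarrow> complex mat) \<Rightarrow> complex) set" where
  "hpol k = range (\<lambda>T X. \<Sum>xs\<in>Lk k. T xs * cmon xs X)"

definition invar :: "(('i \<Rightarrow> complex mat) \<Rightarrow> complex) \<Rightarrow> bool" where
  "invar p \<longleftrightarrow> (\<forall>g\<in>G. \<forall>X. p (bact ds g X) = p X)"

lemma fin_coords: "finite coords"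
  using finS by (simp add: coords_def)

lemma fin_Lk: "finite (Lk k)"
  unfolding Lk_def by (rule finite_lists_length_eq[OF fin_coords])

lemma P_subring: "unital_subring P"
  unfolding P_def by (rule unital_subring_falg)

lemmas PD = unital_subringD[OF P_subring]

lemma P_noetherian: "noetherian P"
  unfolding P_def by (rule noetherian_falg) (simp add: fin_coords)

lemma P_const: "(\<lambda>_. c) \<in> P"
  unfolding P_def by (rule falg.const)

lemma Lk_0: "Lk 0 = {[]}"
  by (auto simp: Lk_def)

lemma sum_Lk_Suc: "(\<Sum>xs\<in>Lk (Suc k). F xs) = (\<Sum>x\<in>coords. \<Sum>xs\<in>Lk k. F (x # xs))"
proof -
  have "Lk (Suc k) = (\<lambda>(x, xs). x # xs) ` (coords \<times> Lk k)"
    by (auto simp: Lk_def length_Suc_conv image_iff)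
  moreover have "inj_on (\<lambda>(x, xs). x # xs) (coords \<times> Lk k)" by (auto simp: inj_on_def)
  ultimately show ?thesis
    by (simp add: sum.reindex sum.cartesian_product case_prod_beta')
qed

lemma sum_coords:
  "(\<Sum>k\<in>coords. F k) = (\<Sum>l\<in>S. \<Sum>a<n. \<Sum>b<n. if \<beta> a = \<beta> b then F (l, a, b) else 0)"
proof -
  have "(\<Sum>k\<in>coords. F k) = (\<Sum>k\<in>S \<times> {..<n} \<times> {..<n}. if \<beta> (fst (snd k)) = \<beta> (snd (snd k)) then F k else 0)"
    unfolding coords_def using finS by (subst sum.inter_filter) auto
  then show ?thesis by (simp add: sum.cartesian_product case_prod_beta' cong: if_cong)
qed

lemma co_bact:
  assumes g: "g \<in> G" and k: "k \<in> coords"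
  shows "co k (bact ds g X) = (\<Sum>k'\<in>coords. brep g k k' * co k' X)"
proof -
  obtain l i j where k': "k = (l, i, j)" by (cases k) auto
  have lij: "l \<in> S" "i < n" "j < n" using k by (auto simp: coords_def k')
  have c: "fst g \<in> carrier_mat n n" "snd g \<in> carrier_mat n n"
    using g by (auto simp: bdpairs_def inv_pair_def)
  have pc: "prbd ds X l \<in> carrier_mat n n" by (rule bd_carrier[OF prbd_bd])
  have "co k (bact ds g X) = (\<Sum>b<n. (fst g * prbd ds X l) $$ (i, b) * snd g $$ (b, j))"
    unfolding co_def bact_def k' fst_conv snd_conv
    using lij c pc by (intro index_mult_mat_sum) auto
  also have "\<dots> = (\<Sum>b<n. \<Sum>a<n. fst g $$ (i, a) * prbd ds X l $$ (a, b) * snd g $$ (b, j))"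
  proof (intro sum.cong HOL.refl)
    fix b assume "b \<in> {..<n}"
    then show "(fst g * prbd ds X l) $$ (i, b) * snd g $$ (b, j) =
      (\<Sum>a<n. fst g $$ (i, a) * prbd ds X l $$ (a, b) * snd g $$ (b, j))"
      using index_mult_mat_sum[OF c(1) pc lij(2), of b] by (simp add: sum_distrib_right)
  qed
  also have "\<dots> = (\<Sum>a<n. \<Sum>b<n. fst g $$ (i, a) * prbd ds X l $$ (a, b) * snd g $$ (b, j))"
    by (rule sum.swap)
  also have "\<dots> = (\<Sum>a<n. \<Sum>b<n. if \<beta> a = \<beta> b then brep g k (l, a, b) * co (l, a, b) X else 0)"
    by (intro sum.cong HOL.refl) (auto simp: prbd_def brep_def k' co_def)
  also have "\<dots> = (\<Sum>l'\<in>S. if l' = l then \<Sum>a<n. \<Sum>b<n. if \<beta> a = \<beta> b then brep g k (l, a, b) * co (l, a, b) X else 0 else 0)"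
    using finS lij by simp
  also have "\<dots> = (\<Sum>l'\<in>S. \<Sum>a<n. \<Sum>b<n. if \<beta> a = \<beta> b then brep g k (l', a, b) * co (l', a, b) X else 0)"
    by (intro sum.cong HOL.refl) (auto simp: brep_def k' intro!: sum.neutral)
  finally show ?thesis unfolding sum_coords .
qed

lemma cmon_bact:
  assumes g: "g \<in> G"
  shows "xs \<in> Lk k \<Longrightarrow> cmon xs (bact ds g X) = (\<Sum>ys\<in>Lk k. breps g xs ys * cmon ys X)"
proof (induction k arbitrary: xs)
  case 0
  then show ?case by (simp add: Lk_0)
next
  case (Suc k)
  then obtain x xs' where xs: "xs = x # xs'" "x \<in> coords" "xs' \<in> Lk k"
    by (auto simp: Lk_def length_Suc_conv)
  show ?case
    by (simp add: xs(1) co_bact[OF g xs(2)] Suc.IH[OF xs(3)] sum_Lk_Suc sum_product mult.assoc mult.left_commute)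
qed

lemma brep_bmul:
  assumes g: "g \<in> G" and g': "g' \<in> G" and k: "k \<in> coords" "k'' \<in> coords"
  shows "brep (bmul g g') k k'' = (\<Sum>k'\<in>coords. brep g k k' * brep g' k' k'')"
proof -
  obtain l i j l2 a c where kk: "k = (l, i, j)" "k'' = (l2, a, c)" by (cases k; cases k'') auto
  have b: "l \<in> S" "i < n" "j < n" "a < n" "c < n" "\<beta> i = \<beta> j" using k by (auto simp: coords_def kk)
  have cg: "fst g \<in> carrier_mat n n" "snd g \<in> carrier_mat n n" "fst g' \<in> carrier_mat n n" "snd g' \<in> carrier_mat n n"
    and bdg: "fst g \<in> bd ds" "snd g \<in> bd ds"
    using g g' by (auto simp: bdpairs_def inv_pair_def)
  let ?t = "\<lambda>l' e f. brep g k (l', e, f) * brep g' (l', e, f) k''"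
  have "(\<Sum>k'\<in>coords. brep g k k' * brep g' k' k'') =
    (\<Sum>l'\<in>S. \<Sum>e<n. \<Sum>f<n. if \<beta> e = \<beta> f then ?t l' e f else 0)" by (rule sum_coords)
  \<comment> \<open>The sum over coordinates extends to all index pairs: as \<open>g\<close> is
    block diagonal and \<open>k\<close> lies in a block, pairs that join different blocks contribute
    0.\<close>
  also have "\<dots> = (\<Sum>l'\<in>S. \<Sum>e<n. \<Sum>f<n. ?t l' e f)"
  proof (intro sum.cong HOL.refl)
    fix l' e f assume ef: "e \<in> {..<n}" "f \<in> {..<n}"
    show "(if \<beta> e = \<beta> f then ?t l' e f else 0) = ?t l' e f"
    proof (cases "\<beta> e = \<beta> f")
      case False
      then have "\<beta> i \<noteq> \<beta> e \<or> \<beta> f \<noteq> \<beta> j" using b by auto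
      then have "fst g $$ (i, e) = 0 \<or> snd g $$ (f, j) = 0"
        using bd_zero[OF bdg(1), of i e] bd_zero[OF bdg(2), of f j] b ef by blast
      then have "brep g k (l', e, f) = 0" by (auto simp: brep_def kk)
      then show ?thesis by simp
    qed simp
  qed
  also have "\<dots> = (\<Sum>l'\<in>S. if l' = l then \<Sum>e<n. \<Sum>f<n. ?t l e f else 0)"
    by (intro sum.cong HOL.refl) (auto simp: brep_def kk intro!: sum.neutral)
  also have "\<dots> = (\<Sum>e<n. \<Sum>f<n. ?t l e f)" using finS b by simp
  also have "\<dots> = brep (bmul g g') k k''"
  proof (cases "l = l2")
    case True
    have "(\<Sum>e<n. \<Sum>f<n. ?t l e f) =
      (\<Sum>e<n. \<Sum>f<n. (fst g $$ (i, e) * fst g' $$ (e, a)) * (snd g' $$ (c, f) * snd g $$ (f, j)))"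
      by (intro sum.cong HOL.refl) (simp add: brep_def kk True mult_ac)
    also have "\<dots> = (\<Sum>e<n. fst g $$ (i, e) * fst g' $$ (e, a)) * (\<Sum>f<n. snd g' $$ (c, f) * snd g $$ (f, j))"
      by (simp add: sum_product)
    also have "\<dots> = (fst g * fst g') $$ (i, a) * (snd g' * snd g) $$ (c, j)"
      using index_mult_mat_sum[OF cg(1,3) b(2,4)] index_mult_mat_sum[OF cg(4,2) b(5,3)] by simp
    finally show ?thesis by (simp add: brep_def bmul_def kk True)
  next
    case False
    then show ?thesis by (auto simp: brep_def kk intro!: sum.neutral)
  qed
  finally show ?thesis by simp
qed

lemma breps_bmul:
  assumes g: "g \<in> G" and g': "g' \<in> G"
  shows "xs \<in> Lk k \<Longrightarrow> zs \<in> Lk k \<Longrightarrow> breps (bmul g g') xs zs = (\<Sum>ys\<in>Lk k. breps g xs ys * breps g' ys zs)"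
proof (induction k arbitrary: xs zs)
  case 0
  then show ?case by (simp add: Lk_0)
next
  case (Suc k)
  then obtain x xs' z zs' where xs: "xs = x # xs'" "x \<in> coords" "xs' \<in> Lk k"
    and zs: "zs = z # zs'" "z \<in> coords" "zs' \<in> Lk k"
    by (auto simp: Lk_def length_Suc_conv)
  show ?case
    by (simp add: xs(1) zs(1) brep_bmul[OF g g' xs(2) zs(2)] Suc.IH[OF xs(3) zs(3)] sum_Lk_Suc sum_product
        mult.assoc mult.left_commute)
qed

lemma breps_one: "xs \<in> Lk k \<Longrightarrow> ys \<in> Lk k \<Longrightarrow> breps (1\<^sub>m n, 1\<^sub>m n) xs ys = (if xs = ys then 1 else 0)"
proof (induction k arbitrary: xs ys)
  case 0
  then show ?case by (simp add: Lk_0)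
next
  case (Suc k)
  then obtain x xs' z zs' where xs: "xs = x # xs'" "x \<in> coords" "xs' \<in> Lk k"
    and zs: "ys = z # zs'" "z \<in> coords" "zs' \<in> Lk k"
    by (auto simp: Lk_def length_Suc_conv)
  have "brep (1\<^sub>m n, 1\<^sub>m n) x z = (if x = z then 1 else 0)"
    using xs(2) zs(2) by (cases x; cases z) (auto simp: brep_def coords_def)
  then show ?case using Suc.IH[OF xs(3) zs(3)] by (simp add: xs zs)
qed

lemma breps_badj:
  assumes g: "g \<in> G"
  shows "xs \<in> Lk k \<Longrightarrow> ys \<in> Lk k \<Longrightarrow> breps (badj g) xs ys = cnj (breps g ys xs)"
proof (induction k arbitrary: xs ys)
  case 0
  then show ?case by (simp add: Lk_0)
next
  case (Suc k)
  then obtain x xs' z zs' where xs: "xs = x # xs'" "x \<in> coords" "xs' \<in> Lk k"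
    and zs: "ys = z # zs'" "z \<in> coords" "zs' \<in> Lk k"
    by (auto simp: Lk_def length_Suc_conv)
  have "fst g \<in> carrier_mat n n" "snd g \<in> carrier_mat n n"
    using g by (auto simp: bdpairs_def inv_pair_def)
  then have "brep (badj g) x z = cnj (brep g z x)"
    using xs(2) zs(2) by (cases x; cases z) (auto simp: brep_def coords_def badj_def cadj_def)
  then show ?case using Suc.IH[OF xs(3) zs(3)] by (simp add: xs zs)
qed

section \<open>Homogeneous polynomials and the grading\<close>

lemma hpolI: "(\<lambda>X. \<Sum>xs\<in>Lk k. T xs * cmon xs X) \<in> hpol k"
  by (auto simp: hpol_def)

lemma hpol_zero: "0 \<in> hpol k"
  using hpolI[where T = "\<lambda>_. 0"] by (simp add: zero_fun_def)

lemma hpol_add: "p \<in> hpol k \<Longrightarrow> q \<in> hpol k \<Longrightarrow> p + q \<in> hpol k"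
proof -
  assume "p \<in> hpol k" "q \<in> hpol k"
  then obtain T U where "p = (\<lambda>X. \<Sum>xs\<in>Lk k. T xs * cmon xs X)" "q = (\<lambda>X. \<Sum>xs\<in>Lk k. U xs * cmon xs X)"
    by (auto simp: hpol_def)
  then have "p + q = (\<lambda>X. \<Sum>xs\<in>Lk k. (T xs + U xs) * cmon xs X)"
    by (simp add: plus_fun_def distrib_right sum.distrib)
  then show ?thesis using hpolI by simp
qed

lemma hpol_scale: "p \<in> hpol k \<Longrightarrow> (\<lambda>X. c * p X) \<in> hpol k"
proof -
  assume "p \<in> hpol k"
  then obtain T where "p = (\<lambda>X. \<Sum>xs\<in>Lk k. T xs * cmon xs X)" by (auto simp: hpol_def)
  then have "(\<lambda>X. c * p X) = (\<lambda>X. \<Sum>xs\<in>Lk k. (c * T xs) * cmon xs X)"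
    by (simp add: sum_distrib_left mult.assoc)
  then show ?thesis using hpolI by simp
qed

lemma hpol_sum: "(\<And>i. i \<in> A \<Longrightarrow> f i \<in> hpol k) \<Longrightarrow> (\<Sum>i\<in>A. f i) \<in> hpol k"
  by (induction A rule: infinite_finite_induct) (auto intro: hpol_zero hpol_add)

lemma hpol_mult: "p \<in> hpol i \<Longrightarrow> q \<in> hpol j \<Longrightarrow> p * q \<in> hpol (i + j)"
proof -
  assume "p \<in> hpol i" "q \<in> hpol j"
  then obtain T U where pq: "p = (\<lambda>X. \<Sum>xs\<in>Lk i. T xs * cmon xs X)" "q = (\<lambda>X. \<Sum>xs\<in>Lk j. U xs * cmon xs X)"
    by (auto simp: hpol_def)
  have bij: "bij_betw (\<lambda>(xs, ys). xs @ ys) (Lk i \<times> Lk j) (Lk (i + j))"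
    by (rule bij_betw_byWitness[where f' = "\<lambda>zs. (take i zs, drop i zs)"])
      (auto simp: Lk_def dest: in_set_takeD in_set_dropD)
  have "p * q = (\<lambda>X. \<Sum>zs\<in>Lk (i + j). (T (take i zs) * U (drop i zs)) * cmon zs X)"
  proof
    fix X
    have "(p * q) X = (\<Sum>(xs, ys)\<in>Lk i \<times> Lk j. (T xs * cmon xs X) * (U ys * cmon ys X))"
      by (simp add: pq sum_product sum.cartesian_product)
    also have "\<dots> = (\<Sum>(xs, ys)\<in>Lk i \<times> Lk j. (\<lambda>zs. (T (take i zs) * U (drop i zs)) * cmon zs X) (xs @ ys))"
      by (intro sum.cong) (auto simp: Lk_def mult_ac)
    also have "\<dots> = (\<Sum>zs\<in>Lk (i + j). (T (take i zs) * U (drop i zs)) * cmon zs X)"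
      using sum.reindex_bij_betw[OF bij, of "\<lambda>zs. (T (take i zs) * U (drop i zs)) * cmon zs X"]
      by (simp add: case_prod_beta')
    finally show "(p * q) X = (\<Sum>zs\<in>Lk (i + j). (T (take i zs) * U (drop i zs)) * cmon zs X)" .
  qed
  then show ?thesis using hpolI by simp
qed

lemma hpol_const: "(\<lambda>_. c) \<in> hpol 0"
  using hpolI[where T = "\<lambda>_. c" and k = 0] by (simp add: Lk_0)

lemma hpol_one: "1 \<in> hpol 0"
  using hpol_const[of 1] by (simp add: one_fun_def)

lemma hpol_cmon: "xs \<in> Lk k \<Longrightarrow> cmon xs \<in> hpol k"
proof -
  assume xs: "xs \<in> Lk k"
  have "(\<Sum>ys\<in>Lk k. (if ys = xs then 1 else 0) * cmon ys X) = cmon xs X" for X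
  proof -
    have "(\<Sum>ys\<in>Lk k. (if ys = xs then 1 else 0) * cmon ys X) = (\<Sum>ys\<in>Lk k. if ys = xs then cmon ys X else 0)"
      by (intro sum.cong) auto
    then show ?thesis using xs fin_Lk by simp
  qed
  then show ?thesis using hpolI[where T = "\<lambda>ys. if ys = xs then 1 else 0" and k = k] by simp
qed

lemma hpol_co: "k \<in> coords \<Longrightarrow> co k \<in> hpol 1"
  using hpol_cmon[of "[k]" 1] by (simp add: Lk_def cmon_def[abs_def])

lemma cmon_P: "set xs \<subseteq> coords \<Longrightarrow> cmon xs \<in> P"
proof (induction xs)
  case Nil
  have "cmon [] = (\<lambda>_ :: 'i \<Rightarrow> complex mat. 1)" by auto
  then show ?case using P_const[of 1] by simp
next
  case (Cons k xs)
  then have "co k * cmon xs \<in> P" using PD(4)[of "co k" "cmon xs"] by (auto simp: P_def falg.gen)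
  then show ?case by (simp add: times_fun_def)
qed

lemma hpol_P: "p \<in> hpol k \<Longrightarrow> p \<in> P"
proof -
  assume "p \<in> hpol k"
  then obtain T where p: "p = (\<lambda>X. \<Sum>xs\<in>Lk k. T xs * cmon xs X)" by (auto simp: hpol_def)
  show ?thesis unfolding p P_def
    by (intro falg_sum falg_cmult) (use cmon_P in \<open>auto simp: Lk_def P_def\<close>)
qed

lemma P_decomp:
  assumes "p \<in> P"
  shows "\<exists>D q. (\<forall>k. q k \<in> hpol k) \<and> (\<forall>k\<ge>D. q k = 0) \<and> p = (\<Sum>k<D. q k)"
  using assms unfolding P_def
proof (induction p rule: falg.induct)
  case (const c)
  show ?case
    by (rule exI[of _ 1], rule exI[of _ "\<lambda>k. if k = 0 then (\<lambda>_. c) else 0"])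
      (auto intro: hpol_const hpol_zero)
next
  case (gen f)
  then have f: "f \<in> hpol 1" using hpol_co by auto
  show ?case
    by (rule exI[of _ 2], rule exI[of _ "\<lambda>k. if k = 1 then f else 0"])
      (use f in \<open>auto intro: hpol_zero simp: numeral_2_eq_2\<close>)
next
  case (add f g)
  then obtain D q E r where q: "\<And>k. q k \<in> hpol k" "\<And>k. k \<ge> D \<Longrightarrow> q k = 0" "f = (\<Sum>k<D. q k)"
    and r: "\<And>k. r k \<in> hpol k" "\<And>k. k \<ge> E \<Longrightarrow> r k = 0" "g = (\<Sum>k<E. r k)" by blast
  have "(\<Sum>k<D. q k) = (\<Sum>k<max D E. q k)" by (rule sum.mono_neutral_left) (auto simp: q(2))
  moreover have "(\<Sum>k<E. r k) = (\<Sum>k<max D E. r k)" by (rule sum.mono_neutral_left) (auto simp: r(2))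
  ultimately have "f + g = (\<Sum>k<max D E. q k + r k)" by (simp add: q(3) r(3) sum.distrib)
  moreover have "\<forall>k. q k + r k \<in> hpol k" using q(1) r(1) hpol_add by blast
  moreover have "\<forall>k\<ge>max D E. q k + r k = 0" using q(2) r(2) by simp
  ultimately show ?case by (intro exI conjI) assumption+
next
  case (mult f g)
  then obtain D q E r where q: "\<And>k. q k \<in> hpol k" "\<And>k. k \<ge> D \<Longrightarrow> q k = 0" "f = (\<Sum>k<D. q k)"
    and r: "\<And>k. r k \<in> hpol k" "\<And>k. k \<ge> E \<Longrightarrow> r k = 0" "g = (\<Sum>k<E. r k)" by blast
  \<comment> \<open>The Cauchy product of the homogeneous components.\<close>
  let ?s = "\<lambda>k. \<Sum>i\<in>{..k}. q i * r (k - i)"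
  have s1: "?s k \<in> hpol k" for k
  proof (rule hpol_sum)
    fix i assume "i \<in> {..k}"
    then show "q i * r (k - i) \<in> hpol k" using hpol_mult[OF q(1)[of i] r(1)[of "k - i"]] by simp
  qed
  have s2: "?s k = 0" if "k \<ge> D + E" for k
  proof (intro sum.neutral ballI)
    fix i assume "i \<in> {..k}"
    then show "q i * r (k - i) = 0" using that q(2)[of i] r(2)[of "k - i"] by (cases "i \<ge> D") auto
  qed
  have s3: "f * g = (\<Sum>k<D + E. ?s k)"
  proof -
    have "f * g = (\<Sum>i<D. \<Sum>j<E. q i * r j)" by (simp only: q(3) r(3) sum_product)
    also have "\<dots> = (\<Sum>(i, j)\<in>{..<D} \<times> {..<E}. q i * r j)" by (simp add: sum.cartesian_product)
    also have "\<dots> = (\<Sum>(i, j)\<in>{(i, j). i + j < D + E}. q i * r j)"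
    proof (rule sum.mono_neutral_left)
      have "{(i, j). i + j < D + E} \<subseteq> {..<D + E} \<times> {..<D + E}" by auto
      then show "finite {(i, j). i + j < D + E}" by (rule finite_subset) auto
      show "{..<D} \<times> {..<E} \<subseteq> {(i, j). i + j < D + E}" by auto
      show "\<forall>x\<in>{(i, j). i + j < D + E} - {..<D} \<times> {..<E}. (case x of (i, j) \<Rightarrow> q i * r j) = 0"
        using q(2) r(2) by (auto simp: not_less)
    qed
    also have "\<dots> = (\<Sum>k<D + E. ?s k)" by (rule sum.triangle_reindex)
    finally show ?thesis .
  qed
  show ?case
    by (rule exI[of _ "D + E"], rule exI[of _ ?s], intro conjI allI impI, rule s1, erule s2, rule s3)
qed

definition scl :: "complex \<Rightarrow> ('i \<Rightarrow> complex mat) \<Rightarrow> 'i \<Rightarrow> complex mat" where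
  "scl c X = (\<lambda>l. mat n n (\<lambda>(i, j). c * X l $$ (i, j)))"

lemma hpol_scl:
  assumes "p \<in> hpol k" shows "p (scl c X) = c ^ k * p X"
proof -
  from assms obtain T where p: "p = (\<lambda>X. \<Sum>xs\<in>Lk k. T xs * cmon xs X)" by (auto simp: hpol_def)
  have "cmon xs (scl c X) = c ^ length xs * cmon xs X" if "set xs \<subseteq> coords" for xs
    using that by (induction xs) (auto simp: co_def scl_def coords_def)
  then show ?thesis unfolding p by (auto simp: sum_distrib_left Lk_def mult_ac intro!: sum.cong)
qed

text \<open>Evaluation at a scaled tuple turns the sum into a polynomial in the scalar whose
  coefficients are the values of the components; it vanishes everywhere, hence identically.\<close>

lemma hpol_unique:
  assumes q: "\<And>k. q k \<in> hpol k" and 0: "(\<Sum>k<D. q k) = 0" and k: "k < D"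
  shows "q k = 0"
proof
  fix X
  let ?p = "\<Sum>j<D. monom (q j X) j"
  have "poly ?p c = 0" for c
  proof -
    have "poly ?p c = (\<Sum>j<D. q j (scl c X))"
      by (simp add: poly_sum poly_monom hpol_scl[OF q] mult.commute)
    also have "\<dots> = (\<Sum>j<D. q j) (scl c X)" by (simp add: sum_fun_eval)
    finally show ?thesis by (simp add: 0)
  qed
  then have "?p = 0" using poly_all_0_iff_0 by blast
  then have "coeff ?p k = 0" by simp
  then show "q k X = 0 X" using k by (simp add: coeff_sum)
qed

lemma P_prbd: "p \<in> P \<Longrightarrow> p (prbd ds X) = p X"
  unfolding P_def
proof (induction p rule: falg.induct)
  case (gen g)
  then show ?case by (auto simp: co_def prbd_def coords_def)
qed auto

text \<open>Properties that all affine combinations of translates share and that are stable under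
  composition. By the last clause vanishing on a stable set is inherited, so averaging is possible
  modulo the functions that vanish on such a set.\<close>

definition averaging :: "((('i \<Rightarrow> complex mat) \<Rightarrow> complex) \<Rightarrow> (('i \<Rightarrow> complex mat) \<Rightarrow> complex)) \<Rightarrow> bool" where
  "averaging E \<longleftrightarrow> (\<forall>p q. E (p + q) = E p + E q) \<and> (\<forall>a p. invar a \<longrightarrow> E (a * p) = a * E p) \<and>
     (\<forall>a. invar a \<longrightarrow> E a = a) \<and> (\<forall>k. \<forall>p\<in>hpol k. E p \<in> hpol k) \<and>
     (\<forall>Z p. (\<forall>g\<in>G. \<forall>X\<in>Z. bact ds g X \<in> Z) \<and> (\<forall>X\<in>Z. p X = 0) \<longrightarrow> (\<forall>X\<in>Z. E p X = 0))"

lemma averagingD: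
  assumes "averaging E"
  shows "E (p + q) = E p + E q" "invar a \<Longrightarrow> E (a * p) = a * E p" "invar a \<Longrightarrow> E a = a"
    "p \<in> hpol k \<Longrightarrow> E p \<in> hpol k"
    "\<lbrakk>\<And>g X. g \<in> G \<Longrightarrow> X \<in> Z \<Longrightarrow> bact ds g X \<in> Z; \<And>X. X \<in> Z \<Longrightarrow> p X = 0; X \<in> Z\<rbrakk> \<Longrightarrow> E p X = 0"
proof -
  note A = assms[unfolded averaging_def]
  note A1 = A[THEN conjunct1] and A2 = A[THEN conjunct2, THEN conjunct1]
    and A3 = A[THEN conjunct2, THEN conjunct2, THEN conjunct1]
    and A4 = A[THEN conjunct2, THEN conjunct2, THEN conjunct2, THEN conjunct1]
    and A5 = A[THEN conjunct2, THEN conjunct2, THEN conjunct2, THEN conjunct2]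
  show "E (p + q) = E p + E q" by (rule A1[rule_format])
  show "invar a \<Longrightarrow> E (a * p) = a * E p" by (rule A2[rule_format])
  show "invar a \<Longrightarrow> E a = a" by (rule A3[rule_format])
  show "p \<in> hpol k \<Longrightarrow> E p \<in> hpol k" by (rule A4[rule_format])
  show "\<lbrakk>\<And>g X. g \<in> G \<Longrightarrow> X \<in> Z \<Longrightarrow> bact ds g X \<in> Z; \<And>X. X \<in> Z \<Longrightarrow> p X = 0; X \<in> Z\<rbrakk> \<Longrightarrow> E p X = 0"
    by (rule A5[rule_format]) auto
qed

lemma averaging_comp:
  assumes "averaging E" "averaging F" shows "averaging (\<lambda>p. F (E p))"
  unfolding averaging_def
proof (intro conjI allI impI ballI)
  note E = averagingD[OF assms(1)] note F = averagingD[OF assms(2)]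
  fix p q :: "('i \<Rightarrow> complex mat) \<Rightarrow> complex" show "F (E (p + q)) = F (E p) + F (E q)" by (simp only: E(1) F(1))
  fix a :: "('i \<Rightarrow> complex mat) \<Rightarrow> complex" assume a: "invar a"
  show "F (E (a * p)) = a * F (E p)" by (simp only: E(2)[OF a] F(2)[OF a])
  show "F (E a) = a" by (simp only: E(3)[OF a] F(3)[OF a])
next
  note E = averagingD[OF assms(1)] note F = averagingD[OF assms(2)]
  fix k and p :: "('i \<Rightarrow> complex mat) \<Rightarrow> complex" assume "p \<in> hpol k"
  then show "F (E p) \<in> hpol k" by (intro E(4) F(4))
next
  note E = averagingD[OF assms(1)] note F = averagingD[OF assms(2)]
  fix Z and p :: "('i \<Rightarrow> complex mat) \<Rightarrow> complex" and X
  assume *: "(\<forall>g\<in>G. \<forall>X\<in>Z. bact ds g X \<in> Z) \<and> (\<forall>X\<in>Z. p X = 0)" and X: "X \<in> Z"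
  show "F (E p) X = 0"
  proof (rule F(5)[OF _ _ X])
    show "bact ds g Y \<in> Z" if "g \<in> G" "Y \<in> Z" for g Y using * that by blast
    show "E p Y = 0" if "Y \<in> Z" for Y by (rule E(5)[OF _ _ that]) (use * in blast)+
  qed
qed

lemma averaging_id: "averaging (\<lambda>p. p)"
  by (simp add: averaging_def)

text \<open>\<open>self_adjoint_averaging\<close> is applied to the coefficient vector of
  \<open>p\<close>. The list of group elements that it returns defines an operator on all
  functions.\<close>

lemma averaging_hpol:
  assumes p: "p \<in> hpol k"
  shows "\<exists>E. averaging E \<and> invar (E p)"
proof -
  from p obtain T where pT: "p = (\<lambda>X. \<Sum>xs\<in>Lk k. T xs * cmon xs X)" by (auto simp: hpol_def)
  have "\<exists>zs :: (complex \<times> complex mat \<times> complex mat) list. snd ` set zs \<subseteq> G \<and> sum_list (map fst zs) = 1 \<and>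
    (\<forall>h\<in>G. \<forall>t\<in>Lk k.
      (\<Sum>s\<in>Lk k. (\<Sum>(c, g)\<leftarrow>zs. c * (\<Sum>r\<in>Lk k. T r * breps g r s)) * breps h s t) =
      (\<Sum>(c, g)\<leftarrow>zs. c * (\<Sum>r\<in>Lk k. T r * breps g r t)))"
    by (rule self_adjoint_averaging[where e = "(1\<^sub>m n, 1\<^sub>m n)" and m = bmul and a = badj])
      (rule fin_Lk one_bdpairs breps_one bmul_bdpairs breps_bmul badj_bdpairs breps_badj; assumption)+
  then obtain zs :: "(complex \<times> complex mat \<times> complex mat) list" where
    zs: "snd ` set zs \<subseteq> G" "sum_list (map fst zs) = 1" and
    fixed: "\<And>h t. h \<in> G \<Longrightarrow> t \<in> Lk k \<Longrightarrow>
      (\<Sum>s\<in>Lk k. (\<Sum>(c, g)\<leftarrow>zs. c * (\<Sum>r\<in>Lk k. T r * breps g r s)) * breps h s t) =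
      (\<Sum>(c, g)\<leftarrow>zs. c * (\<Sum>r\<in>Lk k. T r * breps g r t))"
    by blast
  define E :: "(('i \<Rightarrow> complex mat) \<Rightarrow> complex) \<Rightarrow> (('i \<Rightarrow> complex mat) \<Rightarrow> complex)"
    where "E p = (\<lambda>X. \<Sum>(c, g)\<leftarrow>zs. c * p (bact ds g X))" for p
  have zG: "g \<in> G" if "(c, g) \<in> set zs" for c g using zs(1) that by force
  \<comment> \<open>In every degree \<open>j\<close>, not only in that of \<open>p\<close>, the
    operator acts on coefficient vectors through \<open>breps\<close>.\<close>
  have Ehom: "E (\<lambda>X. \<Sum>xs\<in>Lk j. U xs * cmon xs X) =
    (\<lambda>X. \<Sum>s\<in>Lk j. (\<Sum>(c, g)\<leftarrow>zs. c * (\<Sum>r\<in>Lk j. U r * breps g r s)) * cmon s X)" for U j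
  proof
    fix X
    have act: "(\<Sum>xs\<in>Lk j. U xs * cmon xs (bact ds g X)) = (\<Sum>s\<in>Lk j. (\<Sum>r\<in>Lk j. U r * breps g r s) * cmon s X)"
      if "g \<in> G" for g
    proof -
      have "(\<Sum>xs\<in>Lk j. U xs * cmon xs (bact ds g X)) = (\<Sum>r\<in>Lk j. \<Sum>s\<in>Lk j. U r * breps g r s * cmon s X)"
        by (intro sum.cong) (auto simp: cmon_bact[OF that] sum_distrib_left mult.assoc)
      also have "\<dots> = (\<Sum>s\<in>Lk j. \<Sum>r\<in>Lk j. U r * breps g r s * cmon s X)" by (rule sum.swap)
      finally show ?thesis by (simp add: sum_distrib_right)
    qed
    have "E (\<lambda>X. \<Sum>xs\<in>Lk j. U xs * cmon xs X) X =
      (\<Sum>(c, g)\<leftarrow>zs. c * (\<Sum>s\<in>Lk j. (\<Sum>r\<in>Lk j. U r * breps g r s) * cmon s X))"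
      unfolding E_def using zG act by (intro arg_cong[of _ _ sum_list] map_cong) auto
    also have "\<dots> = (\<Sum>s\<in>Lk j. (\<Sum>(c, g)\<leftarrow>zs. c * (\<Sum>r\<in>Lk j. U r * breps g r s)) * cmon s X)"
    proof -
      have "(\<Sum>(c, g)\<leftarrow>zs. c * (\<Sum>s\<in>A. V g s * w s)) = (\<Sum>s\<in>A. (\<Sum>(c, g)\<leftarrow>zs. c * V g s) * w s)"
        for A :: "'i coord list set" and V w
        by (induction zs) (auto simp: sum.distrib distrib_right sum_distrib_left mult.assoc)
      then show ?thesis .
    qed
    finally show "E (\<lambda>X. \<Sum>xs\<in>Lk j. U xs * cmon xs X) X =
      (\<Sum>s\<in>Lk j. (\<Sum>(c, g)\<leftarrow>zs. c * (\<Sum>r\<in>Lk j. U r * breps g r s)) * cmon s X)" .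
  qed
  have "averaging E"
    unfolding averaging_def
  proof (intro conjI allI impI ballI)
    fix p q :: "('i \<Rightarrow> complex mat) \<Rightarrow> complex" show "E (p + q) = E p + E q"
      by (auto simp: E_def fun_eq_iff distrib_left sum_list_addf case_prod_beta')
  next
    fix a p :: "('i \<Rightarrow> complex mat) \<Rightarrow> complex" assume "invar a"
    then have "a (bact ds g X) = a X" if "(c, g) \<in> set zs" for c g X
      using zG[OF that] by (auto simp: invar_def)
    then have "(\<Sum>(c, g)\<leftarrow>zs. c * (a (bact ds g X) * p (bact ds g X))) = (\<Sum>(c, g)\<leftarrow>zs. a X * (c * p (bact ds g X)))" for X
      by (intro arg_cong[of _ _ sum_list] map_cong) auto
    then show "E (a * p) = a * E p"
      by (auto simp: E_def fun_eq_iff case_prod_beta' sum_list_const_mult)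
  next
    fix a :: "('i \<Rightarrow> complex mat) \<Rightarrow> complex" assume "invar a"
    then have "a (bact ds g X) = a X" if "(c, g) \<in> set zs" for c g X
      using zG[OF that] by (auto simp: invar_def)
    then have "(\<Sum>(c, g)\<leftarrow>zs. c * a (bact ds g X)) = (\<Sum>(c, g)\<leftarrow>zs. c * a X)" for X
      by (intro arg_cong[of _ _ sum_list] map_cong) auto
    also have "(\<Sum>(c, g)\<leftarrow>zs. c * a X) = sum_list (map fst zs) * a X" for X
      by (simp add: case_prod_beta' sum_list_mult_const)
    finally show "E a = a" by (simp add: E_def zs(2) fun_eq_iff)
  next
    fix j and p :: "('i \<Rightarrow> complex mat) \<Rightarrow> complex" assume "p \<in> hpol j"
    then obtain U where "p = (\<lambda>X. \<Sum>xs\<in>Lk j. U xs * cmon xs X)" by (auto simp: hpol_def)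
    then show "E p \<in> hpol j" using hpolI by (simp add: Ehom)
  next
    fix Z and p :: "('i \<Rightarrow> complex mat) \<Rightarrow> complex" and X assume *: "(\<forall>g\<in>G. \<forall>X\<in>Z. bact ds g X \<in> Z) \<and> (\<forall>X\<in>Z. p X = 0)" and X: "X \<in> Z"
    have "(\<Sum>(c, g)\<leftarrow>zs. c * p (bact ds g X)) = (\<Sum>q\<leftarrow>zs. 0)"
      using * X zG by (intro arg_cong[of _ _ sum_list] map_cong) auto
    then show "E p X = 0" by (simp add: E_def)
  qed
  moreover have "invar (E p)" unfolding invar_def
  proof (intro ballI allI)
    fix h X assume h: "h \<in> G"
    let ?V = "\<lambda>s. \<Sum>(c, g)\<leftarrow>zs. c * (\<Sum>r\<in>Lk k. T r * breps g r s)"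
    have "E p (bact ds h X) = (\<Sum>s\<in>Lk k. ?V s * cmon s (bact ds h X))" unfolding pT Ehom ..
    also have "\<dots> = (\<Sum>s\<in>Lk k. \<Sum>t\<in>Lk k. ?V s * breps h s t * cmon t X)"
      by (intro sum.cong) (auto simp: cmon_bact[OF h] sum_distrib_left mult.assoc)
    also have "\<dots> = (\<Sum>t\<in>Lk k. \<Sum>s\<in>Lk k. ?V s * breps h s t * cmon t X)" by (rule sum.swap)
    also have "\<dots> = (\<Sum>t\<in>Lk k. ?V t * cmon t X)"
      by (intro sum.cong HOL.refl) (simp only: sum_distrib_right[symmetric] fixed[OF h])
    also have "\<dots> = E p X" unfolding pT Ehom ..
    finally show "E p (bact ds h X) = E p X" .
  qed
  ultimately show ?thesis by blast
qed

lemma invar_add: "invar a \<Longrightarrow> invar b \<Longrightarrow> invar (a + b)"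
  by (simp add: invar_def)

lemma invar_mult: "invar a \<Longrightarrow> invar b \<Longrightarrow> invar (a * b)"
  by (simp add: invar_def)

lemma invar_const: "invar (\<lambda>_. c)"
  by (simp add: invar_def)

lemma invar_zero: "invar 0" using invar_const[of 0] by (simp add: zero_fun_def)

lemma averaging_zero: "averaging E \<Longrightarrow> E 0 = 0"
  by (rule averagingD(3)[OF _ invar_zero])

lemma averaging_P:
  assumes E: "averaging E" and p: "p \<in> P" shows "E p \<in> P"
proof -
  from P_decomp[OF p] obtain D q where q: "\<And>k. q k \<in> hpol k" "p = (\<Sum>k<D. q k)" by blast
  have "E (\<Sum>k<m. q k) \<in> P" for m
  proof (induction m)
    case 0
    then show ?case using averaging_zero[OF E] PD(2) by (simp del: fun_ap)
  next
    case (Suc m)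
    have "E (q m) \<in> P" by (rule hpol_P[OF averagingD(4)[OF E q(1)]])
    with Suc show ?case using PD(3) by (simp add: averagingD(1)[OF E] del: fun_ap)
  qed
  then show ?thesis by (simp add: q(2))
qed

text \<open>The homogeneous components are made invariant one after the other; each new operator
  fixes the part that is invariant already.\<close>

lemma exists_averaging:
  assumes p: "p \<in> P"
  shows "\<exists>E. averaging E \<and> invar (E p)"
proof -
  from P_decomp[OF p] obtain D q where q: "\<And>k. q k \<in> hpol k" "p = (\<Sum>k<D. q k)" by blast
  have "\<exists>E. averaging E \<and> invar (E (\<Sum>k<m. q k))" for m
  proof (induction m)
    case 0
    then show ?case using averaging_id invar_zero by (intro exI[of _ "\<lambda>p. p"]) (auto simp del: fun_ap)
  next
    case (Suc m)
    then obtain E where E: "averaging E" "invar (E (\<Sum>k<m. q k))" by blast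
    from averaging_hpol[OF averagingD(4)[OF E(1) q(1)[of m]]] obtain F where
      F: "averaging F" "invar (F (E (q m)))" by blast
    have "F (E (\<Sum>k<Suc m. q k)) = E (\<Sum>k<m. q k) + F (E (q m))"
      by (simp add: averagingD(1)[OF E(1)] averagingD(1)[OF F(1)] averagingD(3)[OF F(1) E(2)])
    then have "invar (F (E (\<Sum>k<Suc m. q k)))" using invar_add[OF E(2) F(2)] by simp
    then show ?case using averaging_comp[OF E(1) F(1)] by blast
  qed
  then show ?thesis by (simp add: q(2))
qed

text \<open>Averaging is linear over the invariant generators, so it replaces coefficients in
  \<open>P\<close> by invariant ones. It may change \<open>x\<close>, which is harmless where only
  values on a stable set matter.\<close>

lemma averaging_ideal_span:
  assumes x: "x \<in> ideal_span P U" and U: "\<And>u. u \<in> U \<Longrightarrow> invar u"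
  shows "\<exists>E. averaging E \<and> E x \<in> ideal_span {p \<in> P. invar p} U"
  using x
proof (induction x rule: ideal_span.induct)
  case zero
  show ?case using averaging_id by (intro exI[of _ "\<lambda>p. p"]) (auto intro: ideal_span.zero simp del: fun_ap)
next
  case (step b u x)
  then obtain E where E: "averaging E" "E x \<in> ideal_span {p \<in> P. invar p} U" by blast
  have Eb: "E b \<in> P" using averaging_P[OF E(1) step(1)] .
  from exists_averaging[OF Eb] obtain F where F: "averaging F" "invar (F (E b))" by blast
  have invar_span: "invar y" if "y \<in> ideal_span {p \<in> P. invar p} U" for y
    using that by (induction y rule: ideal_span.induct) (auto intro: invar_zero invar_add invar_mult U simp del: fun_ap)
  have "F (E (b * u + x)) = F (E b) * u + E x"
    using averagingD(2)[OF E(1) U[OF step(2)], of b] averagingD(2)[OF F(1) U[OF step(2)], of "E b"]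
    by (simp add: averagingD(1)[OF E(1)] averagingD(1)[OF F(1)] averagingD(3)[OF F(1) invar_span[OF E(2)]] mult.commute)
  moreover have "F (E b) * u + E x \<in> ideal_span {p \<in> P. invar p} U"
    using F(2) averaging_P[OF F(1) Eb] step(2) E(2) by (intro ideal_span.step) auto
  ultimately have "F (E (b * u + x)) \<in> ideal_span {p \<in> P. invar p} U" by (simp only:)
  then show ?case using averaging_comp[OF E(1) F(1)] by (intro exI[of _ "\<lambda>p. F (E p)"] conjI)
qed

text \<open>A span with degrees recorded: a generator of degree \<open>e\<close> receives
  coefficients of degree \<open>k - e\<close>. The parameter \<open>Q\<close> is the graded ring of
  coefficients, either all polynomials or the invariant ones.\<close>

inductive gspan :: "(nat \<Rightarrow> (('i \<Rightarrow> complex mat) \<Rightarrow> complex) set) \<Rightarrow> ((('i \<Rightarrow> complex mat) \<Rightarrow> complex) \<times> nat) set \<Rightarrow>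
    nat \<Rightarrow> (('i \<Rightarrow> complex mat) \<Rightarrow> complex) \<Rightarrow> bool" for Q V k where
  zero: "gspan Q V k 0"
| step: "\<lbrakk>(u, e) \<in> V; e \<le> k; r \<in> Q (k - e); gspan Q V k x\<rbrakk> \<Longrightarrow> gspan Q V k (r * u + x)"

lemma gspan_hpol:
  assumes V: "\<And>u e. (u, e) \<in> V \<Longrightarrow> u \<in> hpol e"
  shows "gspan hpol V k x \<Longrightarrow> x \<in> hpol k"
proof (induction rule: gspan.induct)
  case (step u e r x)
  then have "r * u \<in> hpol (k - e + e)" using V by (intro hpol_mult) auto
  with step show ?case by (auto intro: hpol_add simp del: fun_ap)
qed (rule hpol_zero)

text \<open>Terms are collected by degree, which writes \<open>x\<close> as a sum of homogeneous
  combinations; by uniqueness of components the one of degree \<open>k\<close> is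
  \<open>x\<close>.\<close>

lemma ideal_span_graded:
  assumes V: "\<And>u e. (u, e) \<in> V \<Longrightarrow> u \<in> hpol e"
    and x: "x \<in> ideal_span P (fst ` V)" and k: "x \<in> hpol k"
  shows "gspan hpol V k x"
proof -
  have "\<exists>D y. (\<forall>k. gspan hpol V k (y k)) \<and> (\<forall>k\<ge>D. y k = 0) \<and> x = (\<Sum>k<D. y k)"
    using x
  proof (induction x rule: ideal_span.induct)
    case zero
    show ?case by (rule exI[of _ 0], rule exI[of _ "\<lambda>_. 0"]) (auto intro: gspan.zero simp del: fun_ap)
  next
    case (step b u x)
    then obtain e where ue: "(u, e) \<in> V" by auto
    from step obtain D y where y: "\<And>k. gspan hpol V k (y k)" "\<And>k. k \<ge> D \<Longrightarrow> y k = 0" "x = (\<Sum>k<D. y k)"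
      by blast
    from P_decomp[OF step(1)] obtain C q where q: "\<And>k. q k \<in> hpol k" "\<And>k. k \<ge> C \<Longrightarrow> q k = 0" "b = (\<Sum>k<C. q k)"
      by blast
    define z where "z k = (if e \<le> k then q (k - e) * u else 0) + y k" for k
    have "e \<le> k \<Longrightarrow> gspan hpol V k (q (k - e) * u + y k)" for k
      by (rule gspan.step[OF ue _ q(1) y(1)])
    then have "gspan hpol V k (z k)" for k
      using y(1)[of k] by (cases "e \<le> k") (simp_all add: z_def del: fun_ap)
    moreover have "z k = 0" if "k \<ge> max D (C + e)" for k
      using that y(2)[of k] q(2)[of "k - e"] by (auto simp: z_def)
    moreover have "b * u + x = (\<Sum>k<max D (C + e). z k)"
    proof -
      have "b * u = (\<Sum>k<C. q k * u)" by (simp add: q(3) sum_distrib_right)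
      also have "\<dots> = (\<Sum>k\<in>(\<lambda>k. k + e) ` {..<C}. q (k - e) * u)"
        by (subst sum.reindex) (auto simp: inj_on_def)
      also have "\<dots> = (\<Sum>k\<in>(\<lambda>k. k + e) ` {..<C}. if e \<le> k then q (k - e) * u else 0)"
        by (intro sum.cong) auto
      also have "\<dots> = (\<Sum>k<max D (C + e). if e \<le> k then q (k - e) * u else 0)"
      proof (rule sum.mono_neutral_left)
        show "\<forall>i\<in>{..<max D (C + e)} - (\<lambda>k. k + e) ` {..<C}. (if e \<le> i then q (i - e) * u else 0) = 0"
        proof
          fix i assume i: "i \<in> {..<max D (C + e)} - (\<lambda>k. k + e) ` {..<C}"
          have "q (i - e) = 0" if "e \<le> i"
          proof (rule q(2), rule ccontr)
            assume "\<not> C \<le> i - e"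
            then have "i \<in> (\<lambda>k. k + e) ` {..<C}" using that by (intro image_eqI[of _ _ "i - e"]) auto
            with i show False by simp
          qed
          then show "(if e \<le> i then q (i - e) * u else 0) = 0" by simp
        qed
      qed auto
      finally have "b * u = (\<Sum>k<max D (C + e). if e \<le> k then q (k - e) * u else 0)" .
      moreover have "x = (\<Sum>k<max D (C + e). y k)"
        unfolding y(3) by (rule sum.mono_neutral_left) (auto simp: y(2))
      ultimately show ?thesis by (simp only: z_def sum.distrib)
    qed
    ultimately show ?case by blast
  qed
  then obtain D y where y: "\<And>k. gspan hpol V k (y k)" "\<And>k. k \<ge> D \<Longrightarrow> y k = 0" "x = (\<Sum>k<D. y k)" by blast
  \<comment> \<open>The components of zero, written as the decomposition found for \<open>x\<close>
    minus \<open>x\<close> itself in degree \<open>k\<close>.\<close>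
  define z where "z j = y j + (if j = k then (\<lambda>X. (-1) * x X) else 0)" for j
  have z: "z j \<in> hpol j" for j
    unfolding z_def using gspan_hpol[OF V y(1)] hpol_scale[OF k, of "-1"] hpol_zero by (intro hpol_add) auto
  have "(\<Sum>j<max D (Suc k). z j) = 0"
  proof -
    have "(\<Sum>j<max D (Suc k). y j) = x"
      unfolding y(3) by (rule sum.mono_neutral_right) (auto simp: y(2))
    moreover have "(\<Sum>j<max D (Suc k). if j = k then (\<lambda>X. (-1) * x X) else 0) = (\<lambda>X. (-1) * x X)"
      by (subst sum.delta) auto
    ultimately have "(\<Sum>j<max D (Suc k). z j) = x + (\<lambda>X. (-1) * x X)" unfolding z_def sum.distrib by simp
    then show ?thesis by (simp add: fun_eq_iff)
  qed
  from hpol_unique[of z, OF z this, of k] have "z k = 0" by simp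
  then have "y k = x" by (auto simp: z_def fun_eq_iff)
  with y(1)[of k] show ?thesis by simp
qed

text \<open>Averaging the coefficients of an invariant element changes neither the element nor the
  degrees. If the generators have positive degree, the coefficients have smaller degree than
  \<open>x\<close>, which drives the inductions in the finiteness theorem.\<close>

lemma graded_invariant_coefficients:
  assumes V: "\<And>u e. (u, e) \<in> V \<Longrightarrow> u \<in> hpol e \<and> invar u"
    and x: "x \<in> ideal_span P (fst ` V)" "x \<in> hpol k" "invar x"
  shows "gspan (\<lambda>k. {p \<in> hpol k. invar p}) V k x"
proof -
  have gi: "invar y" if "gspan (\<lambda>k. {p \<in> hpol k. invar p}) V k y" for y
    using that by (induction rule: gspan.induct) (use V in \<open>auto intro: invar_zero invar_add invar_mult simp del: fun_ap\<close>)
  have "gspan hpol V k x" using ideal_span_graded[of V x k] V x by blast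
  then have "\<exists>E. averaging E \<and> gspan (\<lambda>k. {p \<in> hpol k. invar p}) V k (E x)"
  proof (induction rule: gspan.induct)
    case zero
    show ?case using averaging_id by (intro exI[of _ "\<lambda>p. p"]) (auto intro: gspan.zero simp del: fun_ap)
  next
    case (step u e r x)
    then obtain E where E: "averaging E" "gspan (\<lambda>k. {p \<in> hpol k. invar p}) V k (E x)" by blast
    have Er: "E r \<in> hpol (k - e)" using averagingD(4)[OF E(1) step(3)] .
    from averaging_hpol[OF Er] obtain F where F: "averaging F" "invar (F (E r))" by blast
    have u: "invar u" using V step(1) by blast
    have "F (E (r * u + x)) = F (E r) * u + E x"
      using averagingD(2)[OF E(1) u, of r] averagingD(2)[OF F(1) u, of "E r"]
      by (simp add: averagingD(1)[OF E(1)] averagingD(1)[OF F(1)] averagingD(3)[OF F(1) gi[OF E(2)]] mult.commute)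
    moreover have "gspan (\<lambda>k. {p \<in> hpol k. invar p}) V k (F (E r) * u + E x)"
      by (rule gspan.step[OF step(1,2) _ E(2)]) (use F(2) averagingD(4)[OF F(1) Er] in simp)
    ultimately have "gspan (\<lambda>k. {p \<in> hpol k. invar p}) V k (F (E (r * u + x)))" by (simp only:)
    then show ?case using averaging_comp[OF E(1) F(1)] by (intro exI[of _ "\<lambda>p. F (E p)"] conjI)
  qed
  then obtain E where "averaging E" "gspan (\<lambda>k. {p \<in> hpol k. invar p}) V k (E x)" by blast
  then show ?thesis using averagingD(3)[of E, OF _ x(3)] by simp
qed

end

section \<open>Invariants and traces\<close>

lemma ideal_span_finite_sum:
  assumes R: "unital_subring R" and B: "finite B" and x: "x \<in> ideal_span R B"
  shows "\<exists>s. (\<forall>b\<in>B. s b \<in> R) \<and> x = (\<Sum>b\<in>B. s b * b)"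
  using x
proof (induction x rule: ideal_span.induct)
  case zero
  show ?case by (rule exI[of _ "\<lambda>_. 0"]) (simp add: unital_subringD[OF R])
next
  case (step c u x)
  then obtain s where s: "\<And>b. b \<in> B \<Longrightarrow> s b \<in> R" "x = (\<Sum>b\<in>B. s b * b)" by blast
  have "(\<Sum>b\<in>B. (s b + (if b = u then c else 0)) * b) = (\<Sum>b\<in>B. s b * b) + (\<Sum>b\<in>B. if b = u then c * b else 0)"
    unfolding sum.distrib[symmetric] by (rule sum.cong) (auto simp: distrib_right)
  also have "\<dots> = c * u + x" using B step(2) by (simp add: s(2))
  finally have "c * u + x = (\<Sum>b\<in>B. (s b + (if b = u then c else 0)) * b)" by simp
  moreover have "\<forall>b\<in>B. s b + (if b = u then c else 0) \<in> R"
    using s(1) step(1) unital_subringD[OF R] by simp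
  ultimately show ?case by (intro exI conjI) assumption+
qed

lemma ideal_span_union:
  assumes B: "unital_subring B" and x: "x \<in> ideal_span B (U \<union> V)"
    and V: "\<And>v w. v \<in> V \<Longrightarrow> w \<in> V \<Longrightarrow> v + w \<in> V" "\<And>b v. b \<in> B \<Longrightarrow> v \<in> V \<Longrightarrow> b * v \<in> V" "0 \<in> V"
  shows "\<exists>z\<in>ideal_span B U. \<exists>y\<in>V. x = z + y"
  using x
proof (induction x rule: ideal_span.induct)
  case zero
  show ?case by (intro bexI[of _ 0] V(3) ideal_span.zero) simp
next
  case (step b u x)
  then obtain z y where zy: "z \<in> ideal_span B U" "y \<in> V" "x = z + y" by blast
  show ?case
  proof (cases "u \<in> U")
    case True
    have "b * u + x = (b * u + z) + y" by (simp only: zy(3) add.assoc)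
    then show ?thesis using ideal_span.step[OF step(1) True zy(1)] zy(2) by blast
  next
    case False
    then have "u \<in> V" using step(2) by simp
    then have "b * u + y \<in> V" using V step(1) zy(2) by blast
    moreover have "b * u + x = z + (b * u + y)" by (simp only: zy(3) add.left_commute)
    ultimately show ?thesis using zy(1) by blast
  qed
qed

lemma power_fun_apply: "(f ^ k) x = f x ^ k" for f :: "'y \<Rightarrow> complex"
  by (induction k) auto

lemma inv_pair_diag_block:
  assumes "length gs = length ds" "length hs = length ds"
    "\<forall>i<length ds. inv_pair (ds ! i) (gs ! i) (hs ! i)"
  shows "inv_pair (sum_list ds) (diag_block_mat gs) (diag_block_mat hs)"
  using assms
proof (induction ds arbitrary: gs hs)
  case Nil then show ?case by (auto simp: inv_pair_def)
next
  case (Cons d ds)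
  then obtain g gs' h hs' where gh: "gs = g # gs'" "hs = h # hs'" by (cases gs; cases hs; auto)
  have "inv_pair (sum_list ds) (diag_block_mat gs') (diag_block_mat hs')"
    using Cons.prems by (intro Cons.IH) (auto simp: gh)
  moreover have "inv_pair d g h" using Cons.prems(3) by (auto simp: gh)
  ultimately show ?case using inv_pair_fbd[of d g h] by (simp add: gh Let_def)
qed

context tuples
begin

lemma P_cong: "p \<in> P \<Longrightarrow> (\<And>l. l \<in> S \<Longrightarrow> X l = Y l) \<Longrightarrow> p X = p Y"
  unfolding P_def by (induction p rule: falg.induct) (auto simp: co_def coords_def)

lemma alg_hom_point:
  assumes "alg_hom P \<chi>"
  defines "X \<equiv> (\<lambda>l. mat n n (\<lambda>(i, j). if (l, i, j) \<in> coords then \<chi> (co (l, i, j)) else 0))"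
  shows "p \<in> P \<Longrightarrow> \<chi> p = p X"
  unfolding P_def
proof (induction p rule: falg.induct)
  case (const c)
  then show ?case using assms(1) by (simp add: alg_hom_def)
next
  case (gen g)
  then obtain l i j where "g = co (l, i, j)" "(l, i, j) \<in> coords" by (metis imageE prod_cases3)
  then have "X l $$ (i, j) = \<chi> (co (l, i, j))" by (simp add: X_def coords_def)
  then show ?case by (simp add: \<open>g = co (l, i, j)\<close> co_def[of "(l, i, j)" X])
next
  case (add f g)
  have "\<chi> (f + g) = \<chi> f + \<chi> g" using assms(1) add.hyps unfolding alg_hom_def P_def by blast
  then have "\<chi> (f + g) = (f + g) X" using add.IH by (subst plus_fun_apply) simp
  then show ?case .
next
  case (mult f g)
  have "\<chi> (f * g) = \<chi> f * \<chi> g" using assms(1) mult.hyps unfolding alg_hom_def P_def by blast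
  then have "\<chi> (f * g) = (f * g) X" using mult.IH by (subst times_fun_apply) simp
  then show ?case .
qed

text \<open>The trick of Rabinowitsch: the second component of the pair plays the role of \<open>1/u\<close>.\<close>

lemma nullstellensatz_radical:
  assumes T: "T \<subseteq> P" and u: "u \<in> P" and van: "\<And>X. (\<forall>t\<in>T. t X = 0) \<Longrightarrow> u X = 0"
  shows "\<exists>N. u ^ N \<in> ideal_span P T"
proof -
  define lift :: "(('i \<Rightarrow> complex mat) \<Rightarrow> complex) \<Rightarrow> ('i \<Rightarrow> complex mat) \<times> complex \<Rightarrow> complex"
    where "lift p = (\<lambda>Y. p (fst Y))" for p
  define G' where "G' = insert snd (lift ` co ` coords)"
  define w where "w = (\<lambda>Y. 1 - snd Y * u (fst Y))"
  define J where "J = insert w (lift ` T)"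
  have lift: "lift p \<in> falg G'" if "p \<in> P" for p
    using that unfolding P_def
  proof (induction p rule: falg.induct)
    case (const c) show ?case unfolding lift_def by (rule falg.const)
  next
    case (gen g) then show ?case by (intro falg.gen) (auto simp: G'_def)
  next
    case (add f g)
    then have "lift f + lift g \<in> falg G'" by (intro falg.add)
    then show ?case by (simp add: lift_def plus_fun_def)
  next
    case (mult f g)
    then have "lift f * lift g \<in> falg G'" by (intro falg.mult)
    then show ?case by (simp add: lift_def times_fun_def)
  qed
  note B' = unital_subring_falg[of G'] note BD' = unital_subringD[OF B']
  have sG: "snd \<in> falg G'" by (intro falg.gen) (simp add: G'_def)
  have w_eq: "w = 1 - snd * lift u" by (auto simp: w_def lift_def)
  have wG: "w \<in> falg G'" unfolding w_eq by (intro BD' sG lift u)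
  have JG: "J \<subseteq> falg G'" using wG lift T by (auto simp: J_def)
  have one: "1 \<in> ideal_span (falg G') J"
  proof (rule ccontr)
    assume "1 \<notin> ideal_span (falg G') J"
    moreover have "countable G'" using fin_coords by (auto simp: G'_def intro!: countable_finite)
    ultimately obtain \<chi> where \<chi>: "alg_hom (falg G') \<chi>" "\<And>f. f \<in> J \<Longrightarrow> \<chi> f = 0"
      using nullstellensatz_hom[of G' J] JG by blast
    have "alg_hom P (\<lambda>p. \<chi> (lift p))" unfolding alg_hom_def
    proof (intro conjI allI ballI)
      fix c show "\<chi> (lift (\<lambda>_. c)) = c" using \<chi>(1) by (simp add: alg_hom_def lift_def)
    next
      fix p q assume "p \<in> P" "q \<in> P"
      moreover have "lift (p + q) = lift p + lift q" "lift (p * q) = lift p * lift q"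
        by (auto simp: lift_def)
      ultimately show "\<chi> (lift (p + q)) = \<chi> (lift p) + \<chi> (lift q)" "\<chi> (lift (p * q)) = \<chi> (lift p) * \<chi> (lift q)"
        using \<chi>(1) lift by (simp_all add: alg_hom_def)
    qed
    from alg_hom_point[OF this] obtain X where X: "\<And>p. p \<in> P \<Longrightarrow> \<chi> (lift p) = p X" by blast
    have "t X = 0" if "t \<in> T" for t using X[of t] \<chi>(2)[of "lift t"] that T by (auto simp: J_def)
    then have "u X = 0" using van by blast
    have "w + snd * lift u = (\<lambda>_. 1)" by (auto simp: w_eq)
    then have "\<chi> (w + snd * lift u) = 1" using \<chi>(1) by (simp add: alg_hom_def)
    also have "\<chi> (w + snd * lift u) = \<chi> w + \<chi> snd * \<chi> (lift u)"
      using \<chi>(1) wG sG lift[OF u] BD'(4)[OF sG lift[OF u]] by (simp add: alg_hom_def)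
    finally show False using \<chi>(2)[of w] X[OF u] \<open>u X = 0\<close> by (simp add: J_def)
  qed
  \<comment> \<open>Substitution of \<open>1 / u\<close> for the extra variable, followed by
    multiplication with a power of \<open>u\<close> that clears denominators.\<close>
  have clear: "\<exists>N. \<exists>q\<in>P. \<forall>X. u X \<noteq> 0 \<longrightarrow> q X = u X ^ N * b (X, 1 / u X)" if "b \<in> falg G'" for b
    using that
  proof (induction b rule: falg.induct)
    case (const c)
    show ?case by (rule exI[of _ 0], rule bexI[OF _ P_const[of c]]) simp
  next
    case (gen g)
    consider "g = snd" | k where "k \<in> coords" "g = lift (co k)" using gen by (auto simp: G'_def)
    then show ?case
    proof cases
      case 1
      then show ?thesis by (intro exI[of _ 1] bexI[OF _ P_const[of 1]]) auto
    next
      case 2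
      then have "co k \<in> P" unfolding P_def by (intro falg.gen) auto
      with 2 show ?thesis by (intro exI[of _ 0] bexI[of _ "co k"]) (auto simp: lift_def)
    qed
  next
    case (add f g)
    then obtain N q M r where *: "q \<in> P" "\<And>X. u X \<noteq> 0 \<Longrightarrow> q X = u X ^ N * f (X, 1 / u X)"
      "r \<in> P" "\<And>X. u X \<noteq> 0 \<Longrightarrow> r X = u X ^ M * g (X, 1 / u X)" by blast
    have "u ^ M * q + u ^ N * r \<in> P"
      using * u by (intro PD(3,4) unital_subring_power[OF P_subring])
    moreover have "(u ^ M * q + u ^ N * r) X = u X ^ (N + M) * (f + g) (X, 1 / u X)" if "u X \<noteq> 0" for X
      using *(2)[OF that] *(4)[OF that] by (simp add: power_fun_apply power_add algebra_simps)
    ultimately show ?case by blast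
  next
    case (mult f g)
    then obtain N q M r where *: "q \<in> P" "\<And>X. u X \<noteq> 0 \<Longrightarrow> q X = u X ^ N * f (X, 1 / u X)"
      "r \<in> P" "\<And>X. u X \<noteq> 0 \<Longrightarrow> r X = u X ^ M * g (X, 1 / u X)" by blast
    have "q * r \<in> P" using * by (intro PD(4))
    moreover have "(q * r) X = u X ^ (N + M) * (f * g) (X, 1 / u X)" if "u X \<noteq> 0" for X
      using *(2)[OF that] *(4)[OF that] by (simp add: power_add algebra_simps)
    ultimately show ?case by blast
  qed
  have "\<exists>N. \<exists>y\<in>ideal_span P T. \<forall>X. u X \<noteq> 0 \<longrightarrow> y X = u X ^ N * x (X, 1 / u X)"
    if "x \<in> ideal_span (falg G') J" for x
    using that
  proof (induction x rule: ideal_span.induct)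
    case zero
    show ?case by (rule exI[of _ 0], rule bexI[OF _ ideal_span.zero]) simp
  next
    case (step b v x)
    then obtain M y where y: "y \<in> ideal_span P T" "\<And>X. u X \<noteq> 0 \<Longrightarrow> y X = u X ^ M * x (X, 1 / u X)" by blast
    from clear[OF step(1)] obtain N q where q: "q \<in> P" "\<And>X. u X \<noteq> 0 \<Longrightarrow> q X = u X ^ N * b (X, 1 / u X)" by blast
    consider "v = w" | t where "t \<in> T" "v = lift t" using step(2) by (auto simp: J_def)
    then show ?case
    proof cases
      case 1
      have "y X = u X ^ M * (b * v + x) (X, 1 / u X)" if "u X \<noteq> 0" for X
        using y(2)[OF that] that by (simp add: 1 w_def)
      with y(1) show ?thesis by blast
    next
      case 2
      have "(u ^ M * q) * t + u ^ N * y \<in> ideal_span P T"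
        using 2(1) q(1) y(1) u
        by (intro ideal_span.step ideal_span_mult[OF P_subring] PD(4) unital_subring_power[OF P_subring])
      moreover have "((u ^ M * q) * t + u ^ N * y) X = u X ^ (N + M) * (b * v + x) (X, 1 / u X)" if "u X \<noteq> 0" for X
        using q(2)[OF that] y(2)[OF that]
        by (simp add: 2(2) lift_def power_fun_apply power_add algebra_simps)
      ultimately show ?thesis by blast
    qed
  qed
  from this[OF one] obtain N y where y: "y \<in> ideal_span P T" "\<And>X. u X \<noteq> 0 \<Longrightarrow> y X = u X ^ N" by auto
  \<comment> \<open>One more factor \<open>u\<close> makes the identity hold also where
    \<open>u\<close> vanishes.\<close>
  have "u * y \<in> ideal_span P T" by (rule ideal_span_mult[OF P_subring u y(1)])
  moreover have "u * y = u ^ Suc N"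
  proof
    fix X show "(u * y) X = (u ^ Suc N) X"
      using y(2)[of X] by (cases "u X = 0") (auto simp: power_fun_apply)
  qed
  ultimately show ?thesis by metis
qed

section \<open>Traces of words and the nullcone\<close>

definition tw :: "'i list \<Rightarrow> ('i \<Rightarrow> complex mat) \<Rightarrow> complex" where
  "tw w X = tr (wd n (prbd ds X) w)"

lemma wd_entry_hpol:
  "w \<in> lists S \<Longrightarrow> i < n \<Longrightarrow> j < n \<Longrightarrow> (\<lambda>X. wd n (prbd ds X) w $$ (i, j)) \<in> hpol (length w)"
proof (induction w arbitrary: i j)
  case Nil
  then show ?case using hpol_const[of "1\<^sub>m n $$ (i, j)"] by simp
next
  case (Cons l w)
  have e1: "(\<lambda>X. prbd ds X l $$ (i, k)) \<in> hpol 1" if "k < n" for k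
  proof (cases "\<beta> i = \<beta> k")
    case True
    have "(\<lambda>X :: 'i \<Rightarrow> complex mat. prbd ds X l $$ (i, k)) = co (l, i, k)"
      using Cons.prems that True by (auto simp: prbd_def co_def)
    then show ?thesis using hpol_co[of "(l, i, k)"] Cons.prems that True by (auto simp: coords_def)
  next
    case False
    have "(\<lambda>X :: 'i \<Rightarrow> complex mat. prbd ds X l $$ (i, k)) = 0"
      using Cons.prems that False by (auto simp: prbd_def fun_eq_iff)
    then show ?thesis using hpol_zero by simp
  qed
  have "(\<lambda>X. wd n (prbd ds X) (l # w) $$ (i, j)) =
    (\<Sum>k<n. (\<lambda>X. prbd ds X l $$ (i, k)) * (\<lambda>X. wd n (prbd ds X) w $$ (k, j)))"
  proof
    fix X :: "'i \<Rightarrow> complex mat"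
    have "wd n (prbd ds X) w \<in> carrier_mat n n" using wd_carrier[OF fam_prbd, of w S] Cons.prems by auto
    then have "wd n (prbd ds X) (l # w) $$ (i, j) = (\<Sum>k<n. prbd ds X l $$ (i, k) * wd n (prbd ds X) w $$ (k, j))"
      using index_mult_mat_sum[OF bd_carrier[OF prbd_bd] _ Cons.prems(2,3)] by simp
    then show "wd n (prbd ds X) (l # w) $$ (i, j) =
      (\<Sum>k<n. (\<lambda>X. prbd ds X l $$ (i, k)) * (\<lambda>X. wd n (prbd ds X) w $$ (k, j))) X"
      by (simp add: sum_fun_eval)
  qed
  also have "\<dots> \<in> hpol (length (l # w))"
  proof (rule hpol_sum)
    fix k assume "k \<in> {..<n}"
    then show "(\<lambda>X. prbd ds X l $$ (i, k)) * (\<lambda>X. wd n (prbd ds X) w $$ (k, j)) \<in> hpol (length (l # w))"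
      using hpol_mult[OF e1 Cons.IH[of k j], of k] Cons.prems by simp
  qed
  finally show ?case .
qed

lemma tw_hpol: "w \<in> lists S \<Longrightarrow> tw w \<in> hpol (length w)"
proof -
  assume w: "w \<in> lists S"
  have "tw w = (\<Sum>i<n. (\<lambda>X. wd n (prbd ds X) w $$ (i, i)))"
  proof
    fix X
    have "wd n (prbd ds X) w \<in> carrier_mat n n" by (rule wd_carrier[OF fam_prbd w])
    then show "tw w X = (\<Sum>i<n. (\<lambda>X. wd n (prbd ds X) w $$ (i, i))) X"
      by (simp add: tw_def tr_def sum_fun_eval)
  qed
  moreover have "(\<Sum>i<n. (\<lambda>X. wd n (prbd ds X) w $$ (i, i))) \<in> hpol (length w)"
    by (rule hpol_sum) (use wd_entry_hpol[OF w] in auto)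
  ultimately show ?thesis by simp
qed

lemma tw_invar: "w \<in> lists S \<Longrightarrow> invar (tw w)"
  unfolding invar_def
proof (intro ballI allI)
  fix g X assume w: "w \<in> lists S" and g: "g \<in> G"
  then have ip: "inv_pair n (fst g) (snd g)" by (auto simp: bdpairs_def)
  have "tw w (bact ds g X) = tr (wd n (bact ds g X) w)"
    by (simp add: tw_def prbd_bact[OF g])
  also have "\<dots> = tr (fst g * wd n (prbd ds X) w * snd g)"
    unfolding bact_def by (simp only: wd_conj[OF fam_prbd ip w])
  also have "\<dots> = tw w X" unfolding tw_def by (rule tr_conj[OF ip wd_carrier[OF fam_prbd w]])
  finally show "tw w (bact ds g X) = tw w X" .
qed

lemma P_cont:
  assumes I: "S \<subseteq> I" shows "p \<in> P \<Longrightarrow> cont_on_fams I n p"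
  unfolding P_def
proof (induction p rule: falg.induct)
  case (gen g)
  then show ?case using I by (auto simp: cont_on_fams_def co_def coords_def)
next
  case (add f g)
  then show ?case unfolding cont_on_fams_def plus_fun_apply by (intro allI impI tendsto_add) auto
next
  case (mult f g)
  then show ?case unfolding cont_on_fams_def times_fun_apply by (intro allI impI tendsto_mult) auto
qed (simp add: cont_on_fams_def)

lemma P_invar_block_conj_inv:
  assumes p: "p \<in> P" "invar p" and I: "S \<subseteq> I" shows "block_conj_inv I ds p"
  unfolding block_conj_inv_def
proof (intro allI impI)
  fix X gs hs
  assume *: "fam n I X \<and> length gs = length ds \<and> length hs = length ds \<and>
    (\<forall>i<length ds. inv_pair (ds ! i) (gs ! i) (hs ! i))"
  let ?g = "diag_block_mat gs" and ?h = "diag_block_mat hs"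
  have gb: "?g \<in> bd ds" "?h \<in> bd ds"
    using * by (auto intro!: diag_block_bd simp: inv_pair_def)
  have gG: "(?g, ?h) \<in> G" using inv_pair_diag_block[of gs ds hs] * gb by (simp add: bdpairs_def)
  have p_cong: "p X = p Y" if "\<And>l. l \<in> S \<Longrightarrow> prbd ds X l = prbd ds Y l" for X Y
    using P_cong[OF p(1), of "prbd ds X" "prbd ds Y"] that by (simp add: P_prbd[OF p(1)])
  have "p (\<lambda>l. ?g * X l * ?h) = p (bact ds (?g, ?h) X)"
  proof (rule p_cong)
    fix l assume "l \<in> S"
    then have "X l \<in> carrier_mat n n" using * I by (auto simp: fam_def)
    from prbd_conj[of ?g ds ?h X, OF gb this]
    show "prbd ds (\<lambda>l. ?g * X l * ?h) l = prbd ds (bact ds (?g, ?h) X) l"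
      by (simp add: prbd_bact[OF gG]) (simp add: bact_def)
  qed
  then show "p (\<lambda>l. ?g * X l * ?h) = p X" using p(2) gG by (simp add: invar_def)
qed

lemma tr_wd_cont:
  assumes w: "w \<in> lists S"
  shows "cont_on_fams S n (\<lambda>Y. tr (wd n Y w))"
  unfolding cont_on_fams_def
proof (intro allI impI)
  fix Xs :: "nat \<Rightarrow> 'i \<Rightarrow> complex mat" and X
  assume *: "(\<forall>k. fam n S (Xs k)) \<and> fam n S X \<and>
    (\<forall>l\<in>S. \<forall>i<n. \<forall>j<n. (\<lambda>k. Xs k l $$ (i, j)) \<longlonglongrightarrow> X l $$ (i, j))"
  have "(\<lambda>k. wd n (Xs k) w $$ (i, j)) \<longlonglongrightarrow> wd n X w $$ (i, j)" if "i < n" "j < n" for i j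
    using w that
  proof (induction w arbitrary: i j)
    case Nil
    then show ?case by simp
  next
    case (Cons l w)
    have e: "wd n Y (l # w) $$ (i, j) = (\<Sum>a<n. Y l $$ (i, a) * wd n Y w $$ (a, j))"
      if "fam n S Y" for Y
      using index_mult_mat_sum[of "Y l" n n "wd n Y w" n i j] wd_carrier[OF that] that Cons
      by (auto simp: fam_def)
    have "(\<lambda>k. \<Sum>a<n. Xs k l $$ (i, a) * wd n (Xs k) w $$ (a, j)) \<longlonglongrightarrow>
      (\<Sum>a<n. X l $$ (i, a) * wd n X w $$ (a, j))"
      using * Cons by (intro tendsto_sum tendsto_mult) auto
    then show ?case using e * by simp
  qed
  then have "(\<lambda>k. \<Sum>i<n. wd n (Xs k) w $$ (i, i)) \<longlonglongrightarrow> (\<Sum>i<n. wd n X w $$ (i, i))"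
    by (intro tendsto_sum) auto
  moreover have "tr (wd n Y w) = (\<Sum>i<n. wd n Y w $$ (i, i))" if "fam n S Y" for Y
    using wd_carrier[OF that w] by (simp add: tr_def)
  ultimately show "(\<lambda>k. tr (wd n (Xs k) w)) \<longlonglongrightarrow> tr (wd n X w)" using * by simp
qed

lemma tr_wd_block_conj_inv:
  assumes w: "w \<in> lists S"
  shows "block_conj_inv S ds (\<lambda>Y. tr (wd n Y w))"
  unfolding block_conj_inv_def
proof (intro allI impI)
  fix X :: "'i \<Rightarrow> complex mat" and gs hs
  assume *: "fam n S X \<and> length gs = length ds \<and> length hs = length ds \<and>
    (\<forall>i<length ds. inv_pair (ds ! i) (gs ! i) (hs ! i))"
  have "inv_pair n (diag_block_mat gs) (diag_block_mat hs)" using * by (intro inv_pair_diag_block) auto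
  moreover have "fam n S X" using * by simp
  ultimately show "tr (wd n (\<lambda>l. diag_block_mat gs * X l * diag_block_mat hs) w) = tr (wd n X w)"
    by (simp only: wd_conj[OF _ _ w] tr_conj[OF _ wd_carrier[OF _ w]])
qed

text \<open>The tuple degenerates to a semisimple one with the same traces. These vanish on nonempty
  words, so all summands are zero, and \<open>u\<close> takes the value that it has at the zero
  tuple. Positive degree makes this value 0.\<close>

lemma nullcone:
  assumes u: "u \<in> hpol e" "invar u" "0 < e"
    and 0: "\<And>w. w \<in> lists S \<Longrightarrow> w \<noteq> [] \<Longrightarrow> tw w X = 0"
  shows "u X = 0"
proof -
  have uP: "u \<in> P" by (rule hpol_P[OF u(1)])
  from bd_family_decomp[of S "prbd ds X" ds, OF prbd_bd] obtain \<Xi> where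
    \<Xi>: "map fst \<Xi> = ds" "\<forall>(m, Y)\<in>set \<Xi>. fam m S Y" "\<And>l. l \<in> S \<Longrightarrow> prbd ds X l = dsum \<Xi> l" by blast
  have dX: "dims \<Xi> = n" by (simp add: dims_def \<Xi>(1))
  \<comment> \<open>Plain tuples are subject to no relations, hence the empty multiplication
    table.\<close>
  have "\<forall>(m, Y)\<in>set \<Xi>. fam m S Y \<and> rels {} {} m Y" using \<Xi>(2) by (auto simp: rels_def)
  from block_degeneration[OF this, of] obtain Ls where
    Ls: "list_all2 (\<lambda>p L. dims L = fst p) \<Xi> Ls" "\<forall>(m, \<sigma>)\<in>set (concat Ls). irred S m \<sigma> \<and> rels {} {} m \<sigma>"
    "\<And>f. cont_on_fams S n f \<Longrightarrow> block_conj_inv S ds f \<Longrightarrow> f (dsum \<Xi>) = f (dsum (concat Ls))"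
    unfolding dX \<Xi>(1) by blast
  define L where "L = concat Ls"
  have irr: "\<forall>(m, \<sigma>)\<in>set L. irred S m \<sigma>" using Ls(2) by (auto simp: L_def)
  have dL: "dims L = n"
  proof -
    have "dims (concat Ls) = dims \<Xi>" using Ls(1) by (induction rule: list_all2_induct) auto
    then show ?thesis by (simp add: L_def dX)
  qed
  have sum0: "(\<Sum>(m, \<sigma>)\<leftarrow>L. tr (wd m \<sigma> w)) = 0" if w: "w \<in> lists S" "w \<noteq> []" for w
  proof -
    have "\<forall>(m, \<sigma>)\<in>set L. fam m S \<sigma>" using irr by (auto simp: irred_def)
    from tr_wd_dsum[OF w(1) this]
    have "(\<Sum>(m, \<sigma>)\<leftarrow>L. tr (wd m \<sigma> w)) = tr (wd n (dsum L) w)" by (simp only: dL)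
    also have "\<dots> = tr (wd n (dsum \<Xi>) w)"
      using Ls(3)[OF tr_wd_cont[OF w(1)] tr_wd_block_conj_inv[OF w(1)]] by (simp add: L_def)
    also have "\<dots> = tr (wd n (prbd ds X) w)"
      using w(1) \<Xi>(3) by (intro arg_cong[of _ _ tr] wd_cong) auto
    finally show ?thesis using 0[OF w] by (simp add: tw_def)
  qed
  have zero: "\<sigma> l = 0\<^sub>m m m" if "(m, \<sigma>) \<in> set L" "l \<in> S" for m \<sigma> l
    by (rule traceless_irreds_zero[OF irr sum0 that])
  have dz: "dsum M l = 0\<^sub>m (dims M) (dims M)" if "l \<in> S" "set M \<subseteq> set L" for l M
    using that(2)
  proof (induction M)
    case Nil
    then show ?case by (simp add: dsum_Nil)
  next
    case (Cons q M)
    then obtain m \<sigma> where q: "q = (m, \<sigma>)" "(m, \<sigma>) \<in> set L" by (cases q) auto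
    show ?case using zero[OF q(2) that(1)] Cons by (auto simp: q(1) dsum_Cons blk_def intro!: eq_matI)
  qed
  have "u X = u (prbd ds X)" by (simp add: P_prbd[OF uP])
  also have "\<dots> = u (dsum \<Xi>)"
    by (rule cont_on_fams_cong[OF P_cont[OF subset_refl uP] fam_prbd \<Xi>(3)])
  also have "\<dots> = u (dsum L)"
    using Ls(3)[OF P_cont[OF subset_refl uP] P_invar_block_conj_inv[OF uP u(2) subset_refl]] by (simp add: L_def)
  also have "\<dots> = u (scl 0 X)"
  proof (rule cont_on_fams_cong[OF P_cont[OF subset_refl uP]])
    show "fam n S (dsum L)" using fam_dsum[of L S] irr dL by (auto simp: irred_def)
    show "dsum L l = scl 0 X l" if "l \<in> S" for l
      using dz[OF that subset_refl] dL by (auto simp: scl_def intro!: eq_matI)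
  qed
  also have "\<dots> = 0" using hpol_scl[OF u(1), of 0 X] u(3) by simp
  finally show ?thesis .
qed

definition TR :: "'i list set \<Rightarrow> (('i \<Rightarrow> complex mat) \<Rightarrow> complex) set" where
  "TR W = falg (tw ` W)"

lemma hpol_bact: "p \<in> hpol k \<Longrightarrow> g \<in> G \<Longrightarrow> (\<lambda>X. p (bact ds g X)) \<in> hpol k"
proof -
  assume "p \<in> hpol k" and g: "g \<in> G"
  then obtain T where p: "p = (\<lambda>X. \<Sum>xs\<in>Lk k. T xs * cmon xs X)" by (auto simp: hpol_def)
  have "p (bact ds g X) = (\<Sum>ys\<in>Lk k. (\<Sum>xs\<in>Lk k. T xs * breps g xs ys) * cmon ys X)" for X
  proof -
    have "p (bact ds g X) = (\<Sum>xs\<in>Lk k. \<Sum>ys\<in>Lk k. T xs * breps g xs ys * cmon ys X)"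
      unfolding p by (intro sum.cong) (auto simp: cmon_bact[OF g] sum_distrib_left mult.assoc)
    also have "\<dots> = (\<Sum>ys\<in>Lk k. \<Sum>xs\<in>Lk k. T xs * breps g xs ys * cmon ys X)" by (rule sum.swap)
    finally show ?thesis by (simp add: sum_distrib_right)
  qed
  then show ?thesis using hpolI by simp
qed

text \<open>The action preserves degrees, so uniqueness of components applies to the difference of
  the polynomial and its translate.\<close>

lemma invar_component:
  assumes q: "\<And>k. q k \<in> hpol k" and inv: "invar (\<Sum>k<D. q k)" and k: "k < D"
  shows "invar (q k)"
  unfolding invar_def
proof (intro ballI allI)
  fix g X assume g: "g \<in> G"
  define z where "z k = (\<lambda>X. q k (bact ds g X)) + (\<lambda>X. (-1) * q k X)" for k
  have "z k \<in> hpol k" for k unfolding z_def using q g by (intro hpol_add hpol_bact hpol_scale)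
  moreover have "(\<Sum>k<D. z k) = 0"
  proof
    fix X
    have "(\<Sum>k<D. z k) X = (\<Sum>k<D. q k) (bact ds g X) - (\<Sum>k<D. q k) X"
      by (simp add: z_def sum_fun_eval sum.distrib sum_negf)
    then show "(\<Sum>k<D. z k) X = 0 X" using inv g by (simp add: invar_def)
  qed
  ultimately have "z k = 0" using hpol_unique[of z D k] k by blast
  then have "z k X = 0" by simp
  then show "q k (bact ds g X) = q k X" by (simp add: z_def)
qed

text \<open>The ideal of the homogeneous invariants of positive degree has a finite set
  \<open>V\<close> of generators among them, and products of elements of \<open>V\<close> span all
  invariants. By \<open>nullcone\<close> and the Nullstellensatz a power of each element of
  \<open>V\<close> lies in the ideal of the traces. So a long product is a combination of traces
  with invariant coefficients of smaller degree, and only the short products \<open>B\<close> remain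
  as module generators.\<close>

theorem invariants_finite_over_traces:
  "\<exists>W B. finite W \<and> W \<subseteq> lists S \<and> finite B \<and> B \<subseteq> {p \<in> P. invar p} \<and>
    (\<forall>p\<in>P. invar p \<longrightarrow> p \<in> ideal_span (TR W) B)"
proof -
  let ?H = "\<lambda>k. {p \<in> hpol k. invar p}"
  let ?C = "range (\<lambda>(c::complex) (_::'i \<Rightarrow> complex mat). c)"
  have C: "unital_subring ?C"
    by (auto simp: unital_subring_def one_fun_def plus_fun_def times_fun_def fun_Compl_def)
  let ?w = "\<lambda>w. (tw w, length w)"
  have "tw ` (lists S - {[]}) \<subseteq> P" using hpol_P[OF tw_hpol] by auto
  with P_noetherian obtain F where F: "finite F" "F \<subseteq> tw ` (lists S - {[]})"
    "tw ` (lists S - {[]}) \<subseteq> ideal_span P F" unfolding noetherian_def by meson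
  from finite_subset_image[OF F(1,2)] obtain W where
    W: "W \<subseteq> lists S - {[]}" "finite W" "F = tw ` W" by blast
  define T0 where "T0 = ?w ` W"
  have T0: "fst ` T0 = tw ` W" by (auto simp: T0_def image_image)
  have T0h: "u \<in> hpol e \<and> invar u \<and> 0 < e" if "(u, e) \<in> T0" for u e
  proof -
    from that obtain w where w: "w \<in> W" "u = tw w" "e = length w" by (auto simp: T0_def)
    with W(1) have "w \<in> lists S" "w \<noteq> []" by blast+
    then show ?thesis using tw_hpol[of w] tw_invar[of w] w by simp
  qed
  define Vs where "Vs = {(f, k). f \<in> hpol k \<and> invar f \<and> 0 < k}"
  have "fst ` Vs \<subseteq> P" using hpol_P by (auto simp: Vs_def)
  with P_noetherian obtain F' where F': "finite F'" "F' \<subseteq> fst ` Vs" "fst ` Vs \<subseteq> ideal_span P F'"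
    unfolding noetherian_def by meson
  from finite_subset_image[OF F'(1,2)] obtain V where V: "V \<subseteq> Vs" "finite V" "F' = fst ` V" by blast
  have Vh: "u \<in> hpol e \<and> invar u \<and> 0 < e" if "(u, e) \<in> V" for u e
    using that V(1) by (auto simp: Vs_def)
  \<comment> \<open>Products are indexed by lists of generators with their degrees, so that degrees
    and multiplicities can be counted on the list.\<close>
  define pr where "pr js = prod_list (map fst js)" for js :: "((('i \<Rightarrow> complex mat) \<Rightarrow> complex) \<times> nat) list"
  have pr_hi: "pr js \<in> hpol (sum_list (map snd js)) \<and> invar (pr js)" if "js \<in> lists V" for js
    using that
  proof (induction js)
    case Nil
    have "invar 1" using invar_const[of 1] by (simp add: one_fun_def)
    then show ?case using hpol_one by (simp add: pr_def del: fun_ap one_fun_apply)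
  next
    case (Cons v js)
    then have "fst v \<in> hpol (snd v)" "invar (fst v)" using Vh[of "fst v" "snd v"] by auto
    with Cons show ?case using hpol_mult[of "fst v" "snd v" "pr js"] invar_mult
      by (simp add: pr_def del: fun_ap one_fun_apply)
  qed
  define Pr where "Pr k = pr ` {js \<in> lists V. sum_list (map snd js) = k}" for k
  \<comment> \<open>Hilbert's finiteness theorem: expressing \<open>f\<close> through
    \<open>V\<close> leaves invariant coefficients of smaller degree, to which the same
    applies.\<close>
  have step1: "f \<in> ideal_span ?C (Pr k)" if "f \<in> ?H k" for f k
    using that
  proof (induction k arbitrary: f rule: less_induct)
    case (less k)
    show ?case
    proof (cases "k = 0")
      case True
      then obtain T where "f = (\<lambda>X. T [] * 1)" using less.prems by (auto simp: hpol_def Lk_0)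
      moreover have "1 \<in> Pr k" unfolding Pr_def
        by (rule image_eqI[of _ _ "[]"]) (auto simp: pr_def True)
      then have "(\<lambda>_. T []) * 1 \<in> ideal_span ?C (Pr k)" by (intro ideal_span_mult_incl) auto
      ultimately show ?thesis by (simp add: times_fun_def)
    next
      case False
      then have "(f, k) \<in> Vs" using less.prems by (auto simp: Vs_def)
      then have "f \<in> ideal_span P (fst ` V)" using F'(3) V(3) by force
      then have "gspan ?H V k f"
        using less.prems Vh by (intro graded_invariant_coefficients) blast+
      then show ?thesis
      proof (induction rule: gspan.induct)
        case zero
        show ?case by (rule ideal_span.zero)
      next
        case (step u e r x)
        have "0 < e" using Vh step(1) by blast
        then have r: "r \<in> ideal_span ?C (Pr (k - e))" using step(2,3) by (intro less.IH) auto
        have "y * u \<in> ideal_span ?C (Pr k)" if "y \<in> ideal_span ?C (Pr (k - e))" for y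
          using that
        proof (induction y rule: ideal_span.induct)
          case zero
          show ?case by (simp only: mult_zero_left ideal_span.zero)
        next
          case (step b v y)
          then obtain js where js: "v = pr js" "js \<in> lists V" "sum_list (map snd js) = k - e" by (auto simp: Pr_def)
          have "pr ((u, e) # js) \<in> Pr k" unfolding Pr_def
            using js \<open>(u, e) \<in> V\<close> \<open>e \<le> k\<close> by (intro imageI) auto
          then have "b * pr ((u, e) # js) + y * u \<in> ideal_span ?C (Pr k)"
            by (rule ideal_span.step[OF step(1) _ step(4)])
          moreover have "(b * v + y) * u = b * pr ((u, e) # js) + y * u"
            by (simp only: js(1) pr_def list.map fst_conv prod_list.Cons distrib_right distrib_left mult_ac)
          ultimately show ?case by (simp only:)
        qed
        from ideal_span_add[OF this[OF r] step(5)] show ?case .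
      qed
    qed
  qed
  have "\<exists>N. fst v ^ N \<in> ideal_span P (tw ` W)" if v: "v \<in> V" for v
  proof (rule nullstellensatz_radical)
    have h: "fst v \<in> hpol (snd v)" "invar (fst v)" "0 < snd v" using Vh[of "fst v" "snd v"] v by auto
    show "tw ` W \<subseteq> P" using W(1) hpol_P[OF tw_hpol] by auto
    show "fst v \<in> P" by (rule hpol_P[OF h(1)])
    fix X assume X: "\<forall>t\<in>tw ` W. t X = 0"
    show "fst v X = 0"
    proof (rule nullcone[OF h])
      fix w assume "w \<in> lists S" "w \<noteq> []"
      then have "tw w \<in> ideal_span P (tw ` W)" using F(3) W(3) by auto
      then show "tw w X = 0" by (induction rule: ideal_span.induct) (use X in auto)
    qed
  qed
  then obtain Nf where Nf: "\<And>v. v \<in> V \<Longrightarrow> fst v ^ Nf v \<in> ideal_span P (tw ` W)" by metis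
  \<comment> \<open>One exponent that works for all elements of \<open>V\<close>.\<close>
  define N where "N = (\<Sum>v\<in>V. Nf v)"
  have step2: "fst v ^ N \<in> ideal_span P (tw ` W)" if v: "v \<in> V" for v
  proof -
    have le: "Nf v \<le> N" unfolding N_def using V(2) v by (intro member_le_sum) auto
    have "fst v \<in> P" using Vh[of "fst v" "snd v"] v hpol_P by auto
    then have "fst v ^ (N - Nf v) * fst v ^ Nf v \<in> ideal_span P (tw ` W)"
      using Nf[OF v] by (intro ideal_span_mult[OF P_subring] unital_subring_power[OF P_subring])
    then show ?thesis using le by (simp flip: power_add)
  qed
  \<comment> \<open>The bound comes from the pigeonhole principle: a product with more than
    \<open>card V * N\<close> factors contains some element of \<open>V\<close> at least
    \<open>N\<close> times.\<close>
  define B where "B = pr ` {js. set js \<subseteq> V \<and> length js \<le> card V * N}"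
  have finB: "finite B" unfolding B_def using finite_lists_length_le[OF V(2)] by simp
  have BP: "B \<subseteq> {p \<in> P. invar p}"
  proof
    fix b assume "b \<in> B"
    then obtain js where "b = pr js" "js \<in> lists V" by (auto simp: B_def)
    then show "b \<in> {p \<in> P. invar p}" using pr_hi hpol_P by blast
  qed
  have TRs: "unital_subring (TR W)" unfolding TR_def by (rule unital_subring_falg)
  have step3: "f \<in> ideal_span (TR W) B" if "f \<in> ?H k" for f k
    using that
  proof (induction k arbitrary: f rule: less_induct)
    case (less k)
    have prod: "pr js \<in> ideal_span (TR W) B" if js: "js \<in> lists V" "sum_list (map snd js) = k" for js
    proof (cases "length js \<le> card V * N")
      case True
      then have "pr js \<in> B" unfolding B_def using js(1) by (intro imageI) auto
      then show ?thesis by (rule ideal_span_incl[OF TRs])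
    next
      case False
      have "\<exists>v\<in>V. N \<le> count_list js v"
      proof (rule ccontr)
        assume "\<not> ?thesis"
        then have "(\<Sum>v\<in>V. count_list js v) \<le> (\<Sum>v\<in>V. N)" by (intro sum_mono) auto
        moreover have "(\<Sum>v\<in>V. count_list js v) = length js"
          using js(1) V(2) by (intro sum_count_set) auto
        ultimately show False using False by simp
      qed
      then obtain v where v: "v \<in> V" "N \<le> count_list js v" by auto
      have fac: "\<exists>q\<in>P. pr js = fst v ^ m * q" if "js \<in> lists V" "m \<le> count_list js v" for m js
        using that
      proof (induction js arbitrary: m)
        case Nil
        then show ?case using PD(1) by (intro bexI[of _ 1]) (auto simp: pr_def)
      next
        case (Cons a js)
        have aP: "fst a \<in> P" using Cons.hyps Vh[of "fst a" "snd a"] hpol_P by auto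
        show ?case
        proof (cases "m \<le> count_list js v")
          case True
          then obtain q where q: "q \<in> P" "pr js = fst v ^ m * q" using Cons.IH[of m] by blast
          have "pr (a # js) = fst v ^ m * (fst a * q)"
            using q(2) by (simp only: pr_def list.map prod_list.Cons mult.left_commute)
          then show ?thesis using PD(4)[OF aP q(1)] by blast
        next
          case False
          with Cons.prems have a: "a = v" and m: "m = Suc (count_list js v)" by (auto split: if_splits)
          obtain q where q: "q \<in> P" "pr js = fst v ^ (count_list js v) * q"
            using Cons.IH[of "count_list js v"] by blast
          have "pr (a # js) = fst v ^ m * q"
            using q(2) by (simp only: pr_def list.map prod_list.Cons a m power_Suc mult.assoc)
          then show ?thesis using q(1) by blast
        qed
      qed
      from fac[OF js(1) v(2)] obtain q where q: "q \<in> P" "pr js = fst v ^ N * q" by auto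
      have "q * fst v ^ N \<in> ideal_span P (tw ` W)" by (rule ideal_span_mult[OF P_subring q(1) step2[OF v(1)]])
      then have "pr js \<in> ideal_span P (fst ` T0)" unfolding T0 by (simp only: q(2) mult.commute)
      \<comment> \<open>The product is invariant and lies in the ideal of the traces, so its
        coefficients can be taken invariant. The chosen words are nonempty, hence these coefficients
        have smaller degree and fall under the induction hypothesis.\<close>
      then have "gspan ?H T0 k (pr js)"
        using pr_hi[OF js(1)] js(2) T0h by (intro graded_invariant_coefficients) blast+
      then show ?thesis
      proof (induction rule: gspan.induct)
        case zero
        show ?case by (rule ideal_span.zero)
      next
        case (step t e r x)
        have "0 < e" "t \<in> TR W" using T0h[OF step(1)] step(1)
          by (auto simp: TR_def T0_def intro: falg.gen)
        moreover have "r \<in> ideal_span (TR W) B" using step(2,3) \<open>0 < e\<close> by (intro less.IH[of "k - e"]) auto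
        ultimately have "t * r \<in> ideal_span (TR W) B" by (intro ideal_span_mult[OF TRs])
        then have "r * t \<in> ideal_span (TR W) B" by (simp only: mult.commute)
        from ideal_span_add[OF this step(5)] show ?case .
      qed
    qed
    from step1[OF less.prems] show ?case
    proof (induction f rule: ideal_span.induct)
      case zero
      show ?case by (rule ideal_span.zero)
    next
      case (step b u x)
      have "b \<in> TR W" using step(1) by (auto simp: TR_def intro: falg.const)
      moreover have "u \<in> ideal_span (TR W) B" using step(2) prod by (auto simp: Pr_def)
      ultimately have "b * u \<in> ideal_span (TR W) B" by (intro ideal_span_mult[OF TRs])
      from ideal_span_add[OF this step(4)] show ?case .
    qed
  qed
  have "p \<in> ideal_span (TR W) B" if p: "p \<in> P" "invar p" for p
  proof -
    from P_decomp[OF p(1)] obtain D q where q: "\<And>k. q k \<in> hpol k" "p = (\<Sum>k<D. q k)" by blast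
    have "q k \<in> ideal_span (TR W) B" if "k < D" for k
      using invar_component[of q D k] q p(2) that by (intro step3[of _ k]) auto
    then show ?thesis unfolding q(2) by (intro ideal_span_sum) auto
  qed
  then show ?thesis using W(1,2) finB BP by (intro exI[of _ W] exI[of _ B]) auto
qed

text \<open>
  Averaging moves the coefficients of a relation \<open>1 = \<Sum> m\<^sub>i r\<^sub>i\<close> on \<open>H\<close> into the invariants, which
  are finite over the traces; Nakayama's lemma then moves the relation into \<open>M\<close> itself.
\<close>

theorem lying_over:
  assumes MP: "M \<subseteq> {p \<in> P. invar p}" and M0: "0 \<in> M"
    and add: "\<And>f g. f \<in> M \<Longrightarrow> g \<in> M \<Longrightarrow> f + g \<in> M"
    and mult: "\<And>f g. f \<in> M \<Longrightarrow> g \<in> M \<Longrightarrow> f * g \<in> M" and um: "\<And>f. f \<in> M \<Longrightarrow> - f \<in> M"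
    and TRM: "\<And>t f. t \<in> TR (lists S) \<Longrightarrow> f \<in> M \<Longrightarrow> t * f \<in> M"
    and H: "\<And>g X. g \<in> G \<Longrightarrow> X \<in> H \<Longrightarrow> bact ds g X \<in> H"
  shows "(\<exists>m\<in>M. \<forall>X\<in>H. m X = 1) \<or>
    (\<exists>X. (\<forall>l. X l \<in> bd ds) \<and> (\<forall>p\<in>M. p X = 0) \<and> (\<forall>p\<in>P. (\<forall>Y\<in>H. p Y = 0) \<longrightarrow> p X = 0))"
proof -
  \<comment> \<open>If \<open>M\<close> and the functions that vanish on \<open>H\<close> do not
    generate 1, a common zero of both is the point of the second alternative.\<close>
  define J where "J = {p \<in> P. \<forall>Y\<in>H. p Y = 0}"
  show ?thesis
  proof (cases "1 \<in> ideal_span P (M \<union> J)")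
    case False
    have "M \<union> J \<subseteq> P" using MP by (auto simp: J_def)
    moreover have "countable (co ` coords)" using fin_coords by (intro countable_finite) simp
    ultimately obtain \<chi> where \<chi>: "alg_hom P \<chi>" "\<And>f. f \<in> M \<union> J \<Longrightarrow> \<chi> f = 0"
      using nullstellensatz_hom[of "co ` coords" "M \<union> J"] False unfolding P_def by blast
    define X where "X = (\<lambda>l. mat n n (\<lambda>(i, j). if (l, i, j) \<in> coords then \<chi> (co (l, i, j)) else 0))"
    have X: "\<chi> p = p X" if "p \<in> P" for p using alg_hom_point[OF \<chi>(1) that] by (simp add: X_def)
    have "X l \<in> bd ds" for l by (auto simp: X_def bd_def coords_def)
    moreover have "p X = 0" if "p \<in> M" for p using X[of p] \<chi>(2)[of p] that MP by auto
    moreover have "p X = 0" if "p \<in> P" "\<forall>Y\<in>H. p Y = 0" for p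
      using X[of p] \<chi>(2)[of p] that by (auto simp: J_def)
    ultimately show ?thesis by blast
  next
    case True
    have "\<exists>z\<in>ideal_span P M. \<exists>y\<in>J. 1 = z + y"
      by (rule ideal_span_union[OF P_subring True]) (simp_all add: J_def PD)
    then obtain z y where z: "z \<in> ideal_span P M" and y: "y \<in> J" and zy: "1 = z + y" by blast
    have "invar m" if "m \<in> M" for m using MP that by auto
    \<comment> \<open>The relation \<open>1 = z + y\<close> is averaged. As \<open>H\<close> is
      stable, the average of \<open>y\<close> still vanishes on \<open>H\<close>, so that of
      \<open>z\<close> is 1 there, now with invariant coefficients.\<close>
    from averaging_ideal_span[OF z this] obtain E where
      E: "averaging E" "E z \<in> ideal_span {p \<in> P. invar p} M" by blast
    have i1: "invar 1" using invar_const[of 1] by (simp add: one_fun_def)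
    have "1 = E z + E y" using averagingD(3)[OF E(1) i1] averagingD(1)[OF E(1), of z y] by (simp only: zy[symmetric])
    moreover have "E y X = 0" if "X \<in> H" for X
      using averagingD(5)[OF E(1) H _ that] y by (auto simp: J_def)
    ultimately have Ez: "E z X = 1" if "X \<in> H" for X
      using that by (metis add_0_right one_fun_apply plus_fun_apply)
    from invariants_finite_over_traces obtain W B where WB: "finite W" "W \<subseteq> lists S" "finite B"
      "B \<subseteq> {p \<in> P. invar p}" "\<And>p. p \<in> P \<Longrightarrow> invar p \<Longrightarrow> p \<in> ideal_span (TR W) B" by blast
    have TRs: "unital_subring (TR W)" unfolding TR_def by (rule unital_subring_falg)
    from ex_bij_betw_nat_finite[OF WB(3)] obtain b where b: "bij_betw b {0..<card B} B" by blast
    let ?p = "card B"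
    have TRW: "t \<in> TR (lists S)" if "t \<in> TR W" for t
      using falg_mono[of t "tw ` W" "tw ` lists S"] that WB(2) by (auto simp: TR_def intro: falg.gen)
    have expand: "\<exists>s. (\<forall>k<?p. s k \<in> TR W) \<and> p = (\<Sum>k<?p. s k * b k)" if "p \<in> P" "invar p" for p
    proof -
      from ideal_span_finite_sum[OF TRs WB(3) WB(5)[OF that]] obtain s where
        s: "\<And>c. c \<in> B \<Longrightarrow> s c \<in> TR W" "p = (\<Sum>c\<in>B. s c * c)" by blast
      have "(\<Sum>c\<in>B. s c * c) = (\<Sum>k\<in>{0..<?p}. s (b k) * b k)"
        using sum.reindex_bij_betw[OF b, of "\<lambda>c. s c * c"] by simp
      moreover have "s (b k) \<in> TR W" if "k < ?p" for k
        using s(1) bij_betwE[OF b] that by auto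
      ultimately show ?thesis using s(2) by (intro exI[of _ "\<lambda>k. s (b k)"]) (simp add: atLeast0LessThan)
    qed
    have bP: "b j \<in> P" "invar (b j)" if "j < ?p" for j
      using bij_betwE[OF b] WB(4) that by auto
    \<comment> \<open>Invariant factors are expanded over the traces, and \<open>M\<close> absorbs
      traces. Thus multiplication by an element of the ideal that \<open>M\<close> generates in the
      invariants has a matrix with entries in \<open>M\<close>.\<close>
    have "\<exists>\<mu>. (\<forall>k<?p. \<mu> k \<in> M) \<and> x * b j = (\<Sum>k<?p. \<mu> k * b k)"
      if "x \<in> ideal_span {p \<in> P. invar p} M" "j < ?p" for x j
      using that(1)
    proof (induction x rule: ideal_span.induct)
      case zero
      show ?case using M0 by (intro exI[of _ "\<lambda>_. 0"]) (simp del: fun_ap)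
    next
      case (step r m x)
      then obtain \<mu> where \<mu>: "\<And>k. k < ?p \<Longrightarrow> \<mu> k \<in> M" "x * b j = (\<Sum>k<?p. \<mu> k * b k)" by blast
      have "r * b j \<in> P" "invar (r * b j)" using step(1) bP[OF that(2)] PD(4) invar_mult by auto
      from expand[OF this] obtain s where s: "\<And>k. k < ?p \<Longrightarrow> s k \<in> TR W" "r * b j = (\<Sum>k<?p. s k * b k)" by blast
      have "(r * m + x) * b j = m * (r * b j) + x * b j" by (simp only: distrib_right distrib_left mult_ac)
      also have "\<dots> = (\<Sum>k<?p. (s k * m + \<mu> k) * b k)"
        unfolding s(2) \<mu>(2) sum_distrib_left sum.distrib[symmetric]
        by (rule sum.cong) (simp_all only: distrib_right distrib_left mult_ac)
      finally have "(r * m + x) * b j = (\<Sum>k<?p. (s k * m + \<mu> k) * b k)" .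
      moreover have "\<forall>k<?p. s k * m + \<mu> k \<in> M" using \<mu>(1) TRM[OF TRW[OF s(1)] step(2)] add by blast
      ultimately show ?case by (intro exI conjI) assumption+
    qed
    from this[OF E(2)] have "\<forall>j. \<exists>\<mu>. j < ?p \<longrightarrow> (\<forall>k<?p. \<mu> k \<in> M) \<and> E z * b j = (\<Sum>k<?p. \<mu> k * b k)" by blast
    from choice[OF this] obtain \<mu> where \<mu>: "\<And>j k. j < ?p \<Longrightarrow> k < ?p \<Longrightarrow> \<mu> j k \<in> M"
      "\<And>j. j < ?p \<Longrightarrow> E z * b j = (\<Sum>k<?p. \<mu> j k * b k)" by blast
    have "\<exists>m\<in>M. \<forall>j<?p. \<forall>X\<in>H. (1 - m X) * b j X = 0"
    proof (rule nakayama_pointwise[OF add mult um M0 \<mu>(1)])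
      fix j X assume j: "j < ?p" and X: "X \<in> H"
      have "(E z * b j) X = (\<Sum>k<?p. \<mu> j k * b k) X" by (simp only: \<mu>(2)[OF j])
      then show "b j X = (\<Sum>k<?p. \<mu> j k X * b k X)" using Ez[OF X] by (simp add: sum_fun_eval)
    qed
    then obtain m where m: "m \<in> M" "\<And>j X. j < ?p \<Longrightarrow> X \<in> H \<Longrightarrow> (1 - m X) * b j X = 0" by blast
    \<comment> \<open>The constant 1 is itself a combination of the functions \<open>b k\<close>, so
      \<open>1 - m\<close>, which annihilates them on \<open>H\<close>, vanishes there.\<close>
    from expand[OF PD(1) i1] obtain s where s: "(1 :: ('i \<Rightarrow> complex mat) \<Rightarrow> complex) = (\<Sum>k<?p. s k * b k)" by blast
    have "m X = 1" if X: "X \<in> H" for X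
    proof -
      have "1 - m X = (1 - m X) * (\<Sum>k<?p. s k X * b k X)"
        using arg_cong[OF s, of "\<lambda>f. f X"] by (simp add: sum_fun_eval)
      also have "\<dots> = (\<Sum>k<?p. s k X * ((1 - m X) * b k X))"
        by (simp add: sum_distrib_left mult.left_commute)
      also have "\<dots> = 0" using m(2)[OF _ X] by (intro sum.neutral) auto
      finally show ?thesis by simp
    qed
    then show ?thesis using m(1) by blast
  qed
qed

end

section \<open>The coordinate ring of the representation variety\<close>

lemma presentation_rel_words:
  "(u, v) \<in> presentation_rel m R \<Longrightarrow> u \<in> words m \<and> v \<in> words m"
  by (induction rule: presentation_rel.induct) (auto simp: words_def)

lemma presentation_rel_append_right:
  "(u, v) \<in> presentation_rel m R \<Longrightarrow> x \<in> words m \<Longrightarrow> (u @ x, v @ x) \<in> presentation_rel m R"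
proof (induction rule: presentation_rel.induct)
  case (refl w)
  then show ?case by (intro presentation_rel.refl) (auto simp: words_def)
next
  case (trans u v w)
  then show ?case by (blast intro: presentation_rel.trans)
next
  case (cancel u v i b)
  then have "v @ x \<in> words m" by (auto simp: words_def)
  from presentation_rel.cancel[OF cancel(1) this cancel(3)] show ?case by simp
next
  case (relator u v r)
  then have "v @ x \<in> words m" by (auto simp: words_def)
  from presentation_rel.relator[OF relator(1) this relator(3,4)] show ?case by simp
qed (blast intro: presentation_rel.sym)

lemma presentation_rel_append_left:
  "(u, v) \<in> presentation_rel m R \<Longrightarrow> x \<in> words m \<Longrightarrow> (x @ u, x @ v) \<in> presentation_rel m R"
proof (induction rule: presentation_rel.induct)
  case (refl w)
  then show ?case by (intro presentation_rel.refl) (auto simp: words_def)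
next
  case (trans u v w)
  then show ?case by (blast intro: presentation_rel.trans)
next
  case (cancel u v i b)
  then have "x @ u \<in> words m" by (auto simp: words_def)
  from presentation_rel.cancel[OF this cancel(2,3)] show ?case by simp
next
  case (relator u v r)
  then have "x @ u \<in> words m" by (auto simp: words_def)
  from presentation_rel.relator[OF this relator(2-4)] show ?case by simp
qed (blast intro: presentation_rel.sym)

lemma presented_group_mult:
  assumes "u \<in> words m" "v \<in> words m"
  shows "presentation_rel m R `` {u} \<otimes>\<^bsub>presented_group m R\<^esub> presentation_rel m R `` {v} =
    presentation_rel m R `` {u @ v}"
proof -
  have eq: "presentation_rel m R `` {u' @ v'} = presentation_rel m R `` {u @ v}"
    if "(u, u') \<in> presentation_rel m R" "(v, v') \<in> presentation_rel m R" for u' v'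
  proof -
    have "(u @ v, u' @ v') \<in> presentation_rel m R"
      using presentation_rel_append_right[OF that(1) assms(2)]
        presentation_rel_append_left[OF that(2)] presentation_rel_words[OF that(1)]
      by (blast intro: presentation_rel.trans)
    then show ?thesis by (auto intro: presentation_rel.trans presentation_rel.sym)
  qed
  have "u \<in> presentation_rel m R `` {u}" "v \<in> presentation_rel m R `` {v}"
    using assms by (auto intro: presentation_rel.refl)
  then have "(\<Union>u'\<in>presentation_rel m R `` {u}. \<Union>v'\<in>presentation_rel m R `` {v}.
      presentation_rel m R `` {u' @ v'}) = presentation_rel m R `` {u @ v}"
    using eq by blast
  then show ?thesis by (simp add: presented_group_def)
qed

definition evalw :: "('a, 'b) monoid_scheme \<Rightarrow> 'a list \<Rightarrow> 'a" where
  "evalw \<Gamma> w = foldr (\<otimes>\<^bsub>\<Gamma>\<^esub>) w \<one>\<^bsub>\<Gamma>\<^esub>"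

lemma evalw_simps [simp]:
  "evalw \<Gamma> [] = \<one>\<^bsub>\<Gamma>\<^esub>" "evalw \<Gamma> (s # w) = s \<otimes>\<^bsub>\<Gamma>\<^esub> evalw \<Gamma> w"
  by (simp_all add: evalw_def)

text \<open>\<open>S\<close> consists of the preimages of the classes of single letters. Formal
  inverses count as letters, so plain products reach every element.\<close>

lemma finitely_presented_generators:
  assumes "finitely_presented \<Gamma>"
  shows "\<exists>S. finite S \<and> S \<subseteq> carrier \<Gamma> \<and> (\<forall>\<gamma>\<in>carrier \<Gamma>. \<exists>w\<in>lists S. \<gamma> = evalw \<Gamma> w)"
proof -
  obtain m R \<phi> where G: "group \<Gamma>" and \<phi>: "\<phi> \<in> iso \<Gamma> (presented_group m R)"
    using assms by (auto simp: finitely_presented_def is_iso_def)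
  interpret group \<Gamma> by (rule G)
  define cl where "cl w = presentation_rel m R `` {w}" for w
  define S where "S = {s \<in> carrier \<Gamma>. \<phi> s \<in> (\<lambda>x. cl [x]) ` ({..<m} \<times> UNIV)}"
  have bij: "bij_betw \<phi> (carrier \<Gamma>) (words m // presentation_rel m R)"
    and hom: "\<And>x y. x \<in> carrier \<Gamma> \<Longrightarrow> y \<in> carrier \<Gamma> \<Longrightarrow>
      \<phi> (x \<otimes>\<^bsub>\<Gamma>\<^esub> y) = \<phi> x \<otimes>\<^bsub>presented_group m R\<^esub> \<phi> y"
  proof -
    have "bij_betw \<phi> (carrier \<Gamma>) (carrier (presented_group m R))" and h: "\<phi> \<in> hom \<Gamma> (presented_group m R)"
      using \<phi> by (simp_all add: iso_def)
    then show "bij_betw \<phi> (carrier \<Gamma>) (words m // presentation_rel m R)" by (simp add: presented_group_def)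
    show "\<phi> (x \<otimes>\<^bsub>\<Gamma>\<^esub> y) = \<phi> x \<otimes>\<^bsub>presented_group m R\<^esub> \<phi> y"
      if "x \<in> carrier \<Gamma>" "y \<in> carrier \<Gamma>" for x y
      by (rule hom_mult[OF h that])
  qed
  note inj = bij_betw_imp_inj_on[OF bij]
  have surj: "\<exists>\<gamma>\<in>carrier \<Gamma>. \<phi> \<gamma> = cl w" if "w \<in> words m" for w
  proof -
    have "cl w \<in> \<phi> ` carrier \<Gamma>"
      unfolding bij_betw_imp_surj_on[OF bij] cl_def using that by (rule quotientI)
    then show ?thesis by (auto simp: image_iff)
  qed
  have clm: "cl u \<otimes>\<^bsub>presented_group m R\<^esub> cl v = cl (u @ v)" if "u \<in> words m" "v \<in> words m" for u v
    using presented_group_mult[OF that] by (simp add: cl_def)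
  have "finite S"
  proof (rule finite_imageD)
    show "finite (\<phi> ` S)"
      by (rule finite_subset[of _ "(\<lambda>x. cl [x]) ` ({..<m} \<times> UNIV)"]) (auto simp: S_def)
    show "inj_on \<phi> S" by (rule inj_on_subset[OF inj]) (auto simp: S_def)
  qed
  have "S \<subseteq> carrier \<Gamma>" by (auto simp: S_def)
  have gen: "\<exists>u\<in>lists S. \<gamma> = evalw \<Gamma> u"
    if "w \<in> words m" "\<gamma> \<in> carrier \<Gamma>" "\<phi> \<gamma> = cl w" for w \<gamma>
    using that
  proof (induction w arbitrary: \<gamma>)
    case Nil
    \<comment> \<open>The class of the empty word is idempotent, and the unit is the only idempotent
      of a group.\<close>
    have "\<phi> (\<gamma> \<otimes>\<^bsub>\<Gamma>\<^esub> \<gamma>) = \<phi> \<gamma>" using Nil clm[of "[]" "[]"] by (simp add: hom words_def)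
    then have "\<gamma> \<otimes>\<^bsub>\<Gamma>\<^esub> \<gamma> = \<gamma>" by (rule inj_onD[OF inj]) (simp_all add: Nil(2))
    then have "\<gamma> = \<one>\<^bsub>\<Gamma>\<^esub>" using Nil(2) by simp
    then show ?case by (intro bexI[of _ "[]"]) auto
  next
    case (Cons x w)
    have w: "[x] \<in> words m" "w \<in> words m" using Cons.prems(1) by (auto simp: words_def)
    obtain s \<delta> where s: "s \<in> carrier \<Gamma>" "\<phi> s = cl [x]" and d: "\<delta> \<in> carrier \<Gamma>" "\<phi> \<delta> = cl w"
      using surj[OF w(1)] surj[OF w(2)] by metis
    obtain u where u: "u \<in> lists S" "\<delta> = evalw \<Gamma> u" using Cons.IH[OF w(2) d] by blast
    have "\<phi> (s \<otimes>\<^bsub>\<Gamma>\<^esub> \<delta>) = \<phi> \<gamma>" using clm[OF w] Cons.prems(3) by (simp add: hom s d)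
    then have "s \<otimes>\<^bsub>\<Gamma>\<^esub> \<delta> = \<gamma>" by (rule inj_onD[OF inj]) (simp_all add: Cons.prems(2) s(1) d(1))
    moreover have "s \<in> S" using s w(1) by (auto simp: S_def words_def)
    ultimately show ?case using u by (intro bexI[of _ "s # u"]) simp_all
  qed
  have words: "\<exists>w\<in>lists S. \<gamma> = evalw \<Gamma> w" if g: "\<gamma> \<in> carrier \<Gamma>" for \<gamma>
  proof -
    have "\<phi> \<gamma> \<in> words m // presentation_rel m R" by (rule bij_betwE[OF bij, rule_format, OF g])
    then obtain w where "w \<in> words m" "\<phi> \<gamma> = cl w" unfolding cl_def by (rule quotientE)
    then show ?thesis using gen[OF _ g] by blast
  qed
  show ?thesis by (intro exI[of _ S] conjI ballI words) fact+
qed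

text \<open>The bridge between two styles of rings: elements are extensional on \<open>Y\<close>, as
  in \<open>function_ring\<close>, while the operations are written pointwise.\<close>

definition fun_subalgebra :: "'y set \<Rightarrow> ('y \<Rightarrow> complex) set \<Rightarrow> bool" where
  "fun_subalgebra Y A \<longleftrightarrow> A \<subseteq> extensional Y \<and> (\<forall>c. (\<lambda>y\<in>Y. c) \<in> A) \<and>
     (\<forall>f\<in>A. \<forall>g\<in>A. (\<lambda>y\<in>Y. f y + g y) \<in> A \<and> (\<lambda>y\<in>Y. f y * g y) \<in> A)"

lemma fun_subalgebraD:
  assumes "fun_subalgebra Y A"
  shows "A \<subseteq> extensional Y" "(\<lambda>y\<in>Y. c) \<in> A"
    "f \<in> A \<Longrightarrow> g \<in> A \<Longrightarrow> (\<lambda>y\<in>Y. f y + g y) \<in> A" "f \<in> A \<Longrightarrow> g \<in> A \<Longrightarrow> (\<lambda>y\<in>Y. f y * g y) \<in> A"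
  using assms by (auto simp: fun_subalgebra_def)

lemma fun_subalgebra_scale:
  assumes A: "fun_subalgebra Y A" and f: "f \<in> A"
  shows "(\<lambda>y\<in>Y. c * f y) \<in> A"
  using fun_subalgebraD(4)[OF A fun_subalgebraD(2)[OF A, of c] f]
  by (simp cong: restrict_cong)

lemma fun_subalgebra_diff:
  assumes A: "fun_subalgebra Y A" and f: "f \<in> A"
  shows "(\<lambda>y\<in>Y. f y - c) \<in> A"
  using fun_subalgebraD(3)[OF A f fun_subalgebraD(2)[OF A, of "-c"]]
  by (simp cong: restrict_cong)

lemma fun_subalgebra_cring:
  assumes A: "fun_subalgebra Y A"
  shows "cring (function_ring Y\<lparr>carrier := A\<rparr>)"
proof (rule cringI)
  have ext: "restrict f Y = f" if "f \<in> A" for f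
    using fun_subalgebraD(1)[OF A] that by (auto intro: extensional_restrict)
  show "abelian_group (function_ring Y\<lparr>carrier := A\<rparr>)"
  proof (rule abelian_groupI, goal_cases)
    case (6 x)
    have "(\<lambda>y\<in>Y. (-1) * x y) \<in> A" using 6 A by (intro fun_subalgebra_scale) (auto simp: function_ring_def)
    then show ?case
      by (intro bexI[of _ "\<lambda>y\<in>Y. (-1) * x y"]) (auto simp: function_ring_def cong: restrict_cong)
  qed (use fun_subalgebraD(1,3)[OF A] fun_subalgebraD(2)[OF A, of 0] ext
      in \<open>auto simp: function_ring_def add.assoc add.commute cong: restrict_cong\<close>)
  show "Group.comm_monoid (function_ring Y\<lparr>carrier := A\<rparr>)"
    by (rule comm_monoidI)
      (use fun_subalgebraD(1,4)[OF A] fun_subalgebraD(2)[OF A, of 1] ext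
      in \<open>auto simp: function_ring_def mult.assoc mult.commute cong: restrict_cong\<close>)
qed (auto simp: function_ring_def distrib_right cong: restrict_cong)

lemma fun_subalgebra_uminus:
  assumes A: "fun_subalgebra Y A" and f: "f \<in> A"
  shows "\<ominus>\<^bsub>function_ring Y\<lparr>carrier := A\<rparr>\<^esub> f = (\<lambda>y\<in>Y. - f y)"
proof -
  interpret cring "function_ring Y\<lparr>carrier := A\<rparr>" by (rule fun_subalgebra_cring[OF A])
  have "(\<lambda>y\<in>Y. - f y) \<in> A" using fun_subalgebra_scale[OF A f, of "-1"] by simp
  then show ?thesis
    by (intro minus_equality) (use f in \<open>auto simp: function_ring_def cong: restrict_cong\<close>)
qed

text \<open>A larger ideal contains some \<open>a\<close> with nonzero value \<open>c\<close>. Since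
  \<open>a - c\<close> lies in the kernel, the ideal contains the constant \<open>c\<close> and
  hence 1.\<close>

lemma maximalideal_kernel:
  assumes A: "fun_subalgebra Y A" and const: "\<And>c. \<chi> (\<lambda>y\<in>Y. c) = (c :: complex)"
    and add: "\<And>f g. f \<in> A \<Longrightarrow> g \<in> A \<Longrightarrow> \<chi> (\<lambda>y\<in>Y. f y + g y) = \<chi> f + \<chi> g"
    and mult: "\<And>f g. f \<in> A \<Longrightarrow> g \<in> A \<Longrightarrow> \<chi> (\<lambda>y\<in>Y. f y * g y) = \<chi> f * \<chi> g"
  shows "maximalideal {f \<in> A. \<chi> f = 0} (function_ring Y\<lparr>carrier := A\<rparr>)"
proof -
  let ?R = "function_ring Y\<lparr>carrier := A\<rparr>" and ?K = "{f \<in> A. \<chi> f = 0}"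
  interpret R: cring ?R by (rule fun_subalgebra_cring[OF A])
  have scale: "\<chi> (\<lambda>y\<in>Y. c * f y) = c * \<chi> f" if "f \<in> A" for c f
    using mult[OF fun_subalgebraD(2)[OF A, of c] that] by (simp add: const cong: restrict_cong)
  have diff: "\<chi> (\<lambda>y\<in>Y. f y - c) = \<chi> f - c" if "f \<in> A" for c f
    using add[OF that fun_subalgebraD(2)[OF A, of "-c"]] by (simp add: const cong: restrict_cong)
  have neg: "(\<lambda>y\<in>Y. - f y) \<in> A" "\<chi> (\<lambda>y\<in>Y. - f y) = - \<chi> f" if "f \<in> A" for f
    using scale[OF that, of "-1"] fun_subalgebra_scale[OF A that, of "-1"] by simp_all
  have sub: "subgroup ?K (add_monoid ?R)"
  proof
    fix x assume "x \<in> ?K"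
    then show "inv\<^bsub>add_monoid ?R\<^esub> x \<in> ?K"
      using fun_subalgebra_uminus[OF A, of x] neg[of x] by (simp add: a_inv_def)
  qed (use const[of 0] fun_subalgebraD(2)[OF A, of 0] fun_subalgebraD(3)[OF A] add in \<open>auto simp: function_ring_def\<close>)
  have id: "ideal ?K ?R"
    by (rule idealI[OF R.ring_axioms sub])
      (use fun_subalgebraD(4)[OF A] mult in \<open>auto simp: function_ring_def\<close>)
  show ?thesis
  proof (rule maximalidealI[OF id])
    have "(\<lambda>y\<in>Y. 1) \<in> carrier ?R" "(\<lambda>y\<in>Y. 1) \<notin> ?K"
      using const[of 1] fun_subalgebraD(2)[OF A, of 1] by simp_all
    then show "carrier ?R \<noteq> ?K" by blast
    fix J assume J: "ideal J ?R" and KJ: "?K \<subseteq> J" and JA: "J \<subseteq> carrier ?R"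
    interpret J: ideal J ?R by (rule J)
    show "J = ?K \<or> J = carrier ?R"
    proof (rule disjCI)
      assume "J \<noteq> carrier ?R"
      show "J = ?K"
      proof (rule ccontr)
        assume "J \<noteq> ?K"
        then obtain a where a: "a \<in> J" "a \<in> A" "\<chi> a \<noteq> 0" using KJ JA by auto
        define c where "c = \<chi> a"
        have d: "(\<lambda>y\<in>Y. a y - c) \<in> J"
          using KJ diff[OF a(2), of c] fun_subalgebra_diff[OF A a(2), of c] by (auto simp: c_def)
        have inv_c: "(\<lambda>y\<in>Y. 1/c) \<in> A" "(\<lambda>y\<in>Y. - 1/c) \<in> A" by (rule fun_subalgebraD(2)[OF A])+
        have "(\<lambda>y\<in>Y. 1/c) \<otimes>\<^bsub>?R\<^esub> a \<oplus>\<^bsub>?R\<^esub> (\<lambda>y\<in>Y. - 1/c) \<otimes>\<^bsub>?R\<^esub> (\<lambda>y\<in>Y. a y - c) \<in> J"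
          using J.I_l_closed[OF a(1)] J.I_l_closed[OF d] inv_c
          by (intro additive_subgroup.a_closed[OF J.is_additive_subgroup]) auto
        moreover have "(\<lambda>y\<in>Y. 1/c) \<otimes>\<^bsub>?R\<^esub> a \<oplus>\<^bsub>?R\<^esub> (\<lambda>y\<in>Y. - 1/c) \<otimes>\<^bsub>?R\<^esub> (\<lambda>y\<in>Y. a y - c) = \<one>\<^bsub>?R\<^esub>"
        proof -
          have "c \<noteq> 0" using a(3) by (simp add: c_def)
          then have "1/c * t + - 1/c * (t - c) = 1" for t by (simp add: field_simps)
          then show ?thesis by (simp add: function_ring_def del: mult_minus_left cong: restrict_cong)
        qed
        ultimately show False using J.one_imp_carrier \<open>J \<noteq> carrier ?R\<close> by simp
      qed
    qed
  qed
qed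

lemma maximalideal_point:
  assumes "fun_subalgebra Y A" "y \<in> Y"
  shows "maximalideal {f \<in> A. f y = 0} (function_ring Y\<lparr>carrier := A\<rparr>)"
  by (rule maximalideal_kernel[OF assms(1)]) (use assms(2) in auto)

lemma maximalidealD:
  assumes A: "fun_subalgebra Y A" and M: "maximalideal M (function_ring Y\<lparr>carrier := A\<rparr>)"
  shows "M \<subseteq> A" "(\<lambda>y\<in>Y. 0) \<in> M" "(\<lambda>y\<in>Y. 1) \<notin> M"
    "f \<in> M \<Longrightarrow> g \<in> M \<Longrightarrow> (\<lambda>y\<in>Y. f y + g y) \<in> M"
    "f \<in> A \<Longrightarrow> g \<in> M \<Longrightarrow> (\<lambda>y\<in>Y. f y * g y) \<in> M"
    "f \<in> M \<Longrightarrow> (\<lambda>y\<in>Y. - f y) \<in> M"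
proof -
  interpret maximalideal M "function_ring Y\<lparr>carrier := A\<rparr>" by (rule M)
  show MA: "M \<subseteq> A" using a_subset by simp
  show "(\<lambda>y\<in>Y. 0) \<in> M" using additive_subgroup.zero_closed[OF is_additive_subgroup]
    by (simp add: function_ring_def)
  show "(\<lambda>y\<in>Y. 1) \<notin> M" using one_imp_carrier I_notcarr by (auto simp: function_ring_def)
  show "f \<in> M \<Longrightarrow> g \<in> M \<Longrightarrow> (\<lambda>y\<in>Y. f y + g y) \<in> M"
    using additive_subgroup.a_closed[OF is_additive_subgroup, of f g] by (simp add: function_ring_def)
  show mult: "(\<lambda>y\<in>Y. f y * g y) \<in> M" if "f \<in> A" "g \<in> M" for f g
    using I_l_closed[of g f] that by (simp add: function_ring_def)
  show "f \<in> M \<Longrightarrow> (\<lambda>y\<in>Y. - f y) \<in> M"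
    using mult[OF fun_subalgebraD(2)[OF A, of "-1"], of f] by (simp cong: restrict_cong)
qed

lemma maximalideal_eq:
  assumes A: "fun_subalgebra Y A"
    and M: "maximalideal M (function_ring Y\<lparr>carrier := A\<rparr>)" and N: "maximalideal N (function_ring Y\<lparr>carrier := A\<rparr>)"
    and MN: "M \<subseteq> N"
  shows "M = N"
proof -
  interpret M: maximalideal M "function_ring Y\<lparr>carrier := A\<rparr>" by (rule M)
  interpret N: maximalideal N "function_ring Y\<lparr>carrier := A\<rparr>" by (rule N)
  show ?thesis using M.I_maximal[OF N.is_ideal MN] N.I_notcarr N.a_subset by auto
qed

lemma residue_at_point:
  assumes A: "fun_subalgebra Y A" and y: "y \<in> Y" and a: "a \<in> A"
  shows "residue_at Y {f \<in> A. f y = 0} a = a y"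
  unfolding residue_at_def
  by (rule the_equality) (use y fun_subalgebra_diff[OF A a] in auto)

lemma subspace_iff_vsub:
  "VectorSpace.subspace class_ring W (module_vec TYPE(complex) n) \<longleftrightarrow> vsub n W"
proof -
  interpret vec_space "TYPE(complex)" n .
  have "VectorSpace.subspace class_ring W V \<longleftrightarrow> submodule class_ring W V"
    using vectorspace_axioms by (auto simp: subspace_def)
  also have "\<dots> \<longleftrightarrow> vsub n W"
  proof
    assume "submodule class_ring W V"
    then interpret submodule class_ring W V .
    show "vsub n W" unfolding vsub_def
      using subset module submodule_axioms m_closed zero_closed smult_closed by (auto simp: module_vec_simps class_ring_simps)
  next
    assume "vsub n W"
    then show "submodule class_ring W V"
      unfolding vsub_def submodule_def submodule_axioms_def using module_axioms by (auto simp: module_vec_simps class_ring_simps)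
  qed
  finally show ?thesis .
qed

lemma GL_simps [simp]: "\<one>\<^bsub>GL n\<^esub> = 1\<^sub>m n" "A \<otimes>\<^bsub>GL n\<^esub> B = A * B"
  by (simp_all add: GL_def units_of_def ring_mat_simps)

lemma carrier_GL: "g \<in> carrier (GL n) \<longleftrightarrow> (\<exists>h. inv_pair n g h)"
  by (auto simp: GL_def units_of_carrier Units_def ring_mat_simps inv_pair_def)

lemma group_GL: "group (GL n)"
proof -
  interpret ring "ring_mat TYPE(complex) n ()" by (rule ring_mat)
  show ?thesis unfolding GL_def by (rule units_group)
qed

lemma inv_GL: "inv_pair n g h \<Longrightarrow> inv\<^bsub>GL n\<^esub> g = h"
proof -
  assume gh: "inv_pair n g h"
  interpret group "GL n" by (rule group_GL)
  have "g \<in> carrier (GL n)" "h \<in> carrier (GL n)"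
    unfolding carrier_GL using gh inv_pair_sym by blast+
  then show ?thesis using gh by (intro inv_equality) (auto simp: inv_pair_def)
qed

lemma bact_bact:
  assumes g: "g \<in> bdpairs ds" and g': "g' \<in> bdpairs ds"
  shows "bact ds g' (bact ds g X) = bact ds (bmul g' g) X"
proof
  fix l
  let ?n = "sum_list ds"
  have c: "fst g \<in> carrier_mat ?n ?n" "snd g \<in> carrier_mat ?n ?n" "fst g' \<in> carrier_mat ?n ?n"
    "snd g' \<in> carrier_mat ?n ?n" "prbd ds X l \<in> carrier_mat ?n ?n"
    using g g' prbd_bd[of ds X l] by (auto simp: bdpairs_def inv_pair_def intro: bd_carrier)
  have "bact ds g' (bact ds g X) l = fst g' * (fst g * prbd ds X l * snd g) * snd g'"
    using prbd_bact[OF g, of X] by (simp add: bact_def)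
  also have "\<dots> = (fst g' * fst g) * prbd ds X l * (snd g * snd g')"
    using c by (simp add: assoc_mult_mat[of _ ?n ?n _ ?n _ ?n])
  finally show "bact ds g' (bact ds g X) l = bact ds (bmul g' g) X l" by (simp add: bact_def bmul_def)
qed

lemma bd_singleton: "bd [n] = carrier_mat n n"
  by (auto simp: bd_def)

lemma bdpairs_singleton: "(g, h) \<in> bdpairs [n] \<longleftrightarrow> inv_pair n g h"
  by (auto simp: bdpairs_def bd_singleton inv_pair_def)

lemma prbd_singleton: "X l \<in> carrier_mat n n \<Longrightarrow> prbd [n] X l = X l"
  by (rule prbd_id) (simp add: bd_singleton)

section \<open>Functions on the representations of a generated group\<close>

locale generated_group = group \<Gamma> for \<Gamma> :: "('a, 'b) monoid_scheme" +
  fixes n :: nat and S :: "'a set"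
  assumes finite_S: "finite S" and S_subset: "S \<subseteq> carrier \<Gamma>"
    and words: "\<gamma> \<in> carrier \<Gamma> \<Longrightarrow> \<exists>w\<in>lists S. \<gamma> = evalw \<Gamma> w"
begin

text \<open>A single block of size \<open>n\<close>: the block group is all of
  \<open>GL n\<close>.\<close>

sublocale N: tuples S "[n]" by unfold_locales (rule finite_S)

text \<open>The whole multiplication table serves as the set of relations, so that
  \<open>rels\<close> expresses that a family is multiplicative.\<close>

abbreviation "mtab \<equiv> {(\<gamma>, \<delta>, \<gamma> \<otimes>\<^bsub>\<Gamma>\<^esub> \<delta>) | \<gamma> \<delta>. \<gamma> \<in> carrier \<Gamma> \<and> \<delta> \<in> carrier \<Gamma>}"
abbreviation "Y \<equiv> Reps \<Gamma> n"
abbreviation "A \<equiv> invariant_ring \<Gamma> n"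

lemma evalw_carrier: "w \<in> lists S \<Longrightarrow> evalw \<Gamma> w \<in> carrier \<Gamma>"
  by (induction w) (use S_subset in auto)

lemma evalw_append: "u \<in> lists S \<Longrightarrow> w \<in> lists S \<Longrightarrow> evalw \<Gamma> (u @ w) = evalw \<Gamma> u \<otimes>\<^bsub>\<Gamma>\<^esub> evalw \<Gamma> w"
  by (induction u) (use S_subset evalw_carrier in \<open>auto simp: m_assoc subset_iff\<close>)

lemma Reps_iff:
  "\<rho> \<in> Reps \<Gamma> m \<longleftrightarrow> \<rho> \<in> extensional (carrier \<Gamma>) \<and> fam m (carrier \<Gamma>) \<rho> \<and> rels mtab {\<one>\<^bsub>\<Gamma>\<^esub>} m \<rho>"
proof
  assume r: "\<rho> \<in> Reps \<Gamma> m"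
  then have h: "\<rho> \<in> hom \<Gamma> (GL m)" by (simp add: Reps_def)
  have "\<rho> \<gamma> \<in> carrier_mat m m" if "\<gamma> \<in> carrier \<Gamma>" for \<gamma>
    using hom_in_carrier[OF h that] by (auto simp: carrier_GL inv_pair_def)
  moreover have "\<rho> \<one>\<^bsub>\<Gamma>\<^esub> = 1\<^sub>m m" using hom_one[OF h is_group group_GL] by simp
  ultimately show "\<rho> \<in> extensional (carrier \<Gamma>) \<and> fam m (carrier \<Gamma>) \<rho> \<and> rels mtab {\<one>\<^bsub>\<Gamma>\<^esub>} m \<rho>"
    using r hom_mult[OF h] by (auto simp: Reps_def fam_def rels_def)
next
  assume r: "\<rho> \<in> extensional (carrier \<Gamma>) \<and> fam m (carrier \<Gamma>) \<rho> \<and> rels mtab {\<one>\<^bsub>\<Gamma>\<^esub>} m \<rho>"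
  then have m: "\<rho> \<gamma> * \<rho> \<delta> = \<rho> (\<gamma> \<otimes>\<^bsub>\<Gamma>\<^esub> \<delta>)" if "\<gamma> \<in> carrier \<Gamma>" "\<delta> \<in> carrier \<Gamma>" for \<gamma> \<delta>
    using that by (force simp: rels_def)
  have "inv_pair m (\<rho> \<gamma>) (\<rho> (inv\<^bsub>\<Gamma>\<^esub> \<gamma>))" if "\<gamma> \<in> carrier \<Gamma>" for \<gamma>
    using r that by (simp add: inv_pair_def fam_def m rels_def)
  then have "\<rho> \<gamma> \<in> carrier (GL m)" if "\<gamma> \<in> carrier \<Gamma>" for \<gamma>
    using that by (auto simp only: carrier_GL)
  then show "\<rho> \<in> Reps \<Gamma> m" using r m by (auto simp: Reps_def hom_def)
qed

lemma Reps_carrier: "\<rho> \<in> Reps \<Gamma> m \<Longrightarrow> \<gamma> \<in> carrier \<Gamma> \<Longrightarrow> \<rho> \<gamma> \<in> carrier_mat m m"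
  by (simp add: Reps_iff fam_def)

lemma Reps_mult: "\<rho> \<in> Reps \<Gamma> m \<Longrightarrow> \<gamma> \<in> carrier \<Gamma> \<Longrightarrow> \<delta> \<in> carrier \<Gamma> \<Longrightarrow> \<rho> (\<gamma> \<otimes>\<^bsub>\<Gamma>\<^esub> \<delta>) = \<rho> \<gamma> * \<rho> \<delta>"
  by (force simp: Reps_iff rels_def)

lemma Reps_one: "\<rho> \<in> Reps \<Gamma> m \<Longrightarrow> \<rho> \<one>\<^bsub>\<Gamma>\<^esub> = 1\<^sub>m m"
  by (simp add: Reps_iff rels_def)

lemma restrict_Reps:
  assumes "fam m (carrier \<Gamma>) X" "rels mtab {\<one>\<^bsub>\<Gamma>\<^esub>} m X"
  shows "restrict X (carrier \<Gamma>) \<in> Reps \<Gamma> m"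
  using assms by (force simp: Reps_iff fam_def rels_def)

lemma Reps_word:
  assumes "\<rho> \<in> Reps \<Gamma> m"
  shows "w \<in> lists S \<Longrightarrow> wd m \<rho> w = \<rho> (evalw \<Gamma> w)"
  by (induction w) (use S_subset assms evalw_carrier in \<open>auto simp: Reps_one Reps_mult subset_iff\<close>)

lemma irreducible_rep_iff: "irreducible_rep \<Gamma> j \<sigma> \<longleftrightarrow> \<sigma> \<in> Reps \<Gamma> j \<and> irred (carrier \<Gamma>) j \<sigma>"
  unfolding irreducible_rep_def irred_def subspace_iff_vsub by (auto simp: Reps_iff)

lemma conj_action_eq:
  "inv_pair m g h \<Longrightarrow> conj_action \<Gamma> m g \<rho> = (\<lambda>\<gamma>\<in>carrier \<Gamma>. g * \<rho> \<gamma> * h)"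
  by (simp add: conj_action_def inv_GL)

lemma conj_action_Reps:
  assumes "inv_pair m g h" "\<rho> \<in> Reps \<Gamma> m"
  shows "conj_action \<Gamma> m g \<rho> \<in> Reps \<Gamma> m"
  unfolding conj_action_eq[OF assms(1)]
proof (rule restrict_Reps)
  show "fam m (carrier \<Gamma>) (\<lambda>\<gamma>. g * \<rho> \<gamma> * h)"
    using assms by (auto simp: fam_def inv_pair_def Reps_iff)
  show "rels mtab {\<one>\<^bsub>\<Gamma>\<^esub>} m (\<lambda>\<gamma>. g * \<rho> \<gamma> * h)"
    using assms by (intro rels_conj[where I = "carrier \<Gamma>"]) (auto simp: Reps_iff)
qed

lemma Y_prbd: "\<rho> \<in> Y \<Longrightarrow> l \<in> S \<Longrightarrow> prbd [n] \<rho> l = \<rho> l"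
  using S_subset by (intro prbd_singleton Reps_carrier) auto

lemma Y_prbd_word: "\<rho> \<in> Y \<Longrightarrow> w \<in> lists S \<Longrightarrow> wd n (prbd [n] \<rho>) w = \<rho> (evalw \<Gamma> w)"
  using Reps_word[of \<rho> n w] wd_cong[of w "prbd [n] \<rho>" \<rho> n] Y_prbd by auto

lemma entry_polynomial:
  assumes g: "\<gamma> \<in> carrier \<Gamma>" and ij: "i < n" "j < n"
  shows "\<exists>p\<in>N.P. \<forall>\<rho>\<in>Y. p \<rho> = \<rho> \<gamma> $$ (i, j)"
proof -
  obtain w where w: "w \<in> lists S" "\<gamma> = evalw \<Gamma> w" using words[OF g] by blast
  have "(\<lambda>X. wd n (prbd [n] X) w $$ (i, j)) \<in> N.P"
    using N.hpol_P[OF N.wd_entry_hpol[OF w(1), of i j]] ij by simp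
  then show ?thesis using Y_prbd_word[OF _ w(1)] w(2) by (intro bexI) auto
qed

text \<open>The generators of the coordinate ring involve every element of the group, but each
  element is a word in \<open>S\<close>, and the inverse of the determinant at
  \<open>\<gamma>\<close> is the determinant at the inverse of \<open>\<gamma>\<close>. So
  polynomials in the entries over \<open>S\<close> suffice.\<close>

lemma coordinate_ring_eq: "coordinate_ring \<Gamma> n = (\<lambda>p. restrict p Y) ` N.P"
proof
  note P = unital_subringD[OF N.P_subring]
  have full: "fun_subalgebra Y (Y \<rightarrow>\<^sub>E UNIV)" by (auto simp: fun_subalgebra_def PiE_def)
  have fr: "function_ring Y = function_ring Y\<lparr>carrier := Y \<rightarrow>\<^sub>E UNIV\<rparr>" by (simp add: function_ring_def)
  show "coordinate_ring \<Gamma> n \<subseteq> (\<lambda>p. restrict p Y) ` N.P"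
  proof
    fix f assume "f \<in> coordinate_ring \<Gamma> n"
    then show "f \<in> (\<lambda>p. restrict p Y) ` N.P" unfolding coordinate_ring_def
    proof (induction f rule: generate_ring.induct)
      case one
      show ?case by (rule image_eqI[OF _ P(1)]) (auto simp: function_ring_def)
    next
      case (incl f)
      then consider c where "f = (\<lambda>\<rho>\<in>Y. c)"
        | \<gamma> i j where "f = (\<lambda>\<rho>\<in>Y. \<rho> \<gamma> $$ (i, j))" "\<gamma> \<in> carrier \<Gamma>" "i < n" "j < n"
        | \<gamma> where "f = (\<lambda>\<rho>\<in>Y. 1 / det (\<rho> \<gamma>))" "\<gamma> \<in> carrier \<Gamma>" by auto
      then show ?case
      proof cases
        case 1
        then show ?thesis by (intro image_eqI[OF _ N.P_const[of c]]) auto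
      next
        case 2
        then obtain p where "p \<in> N.P" "\<forall>\<rho>\<in>Y. p \<rho> = \<rho> \<gamma> $$ (i, j)" using entry_polynomial by blast
        then show ?thesis using 2(1) by (intro image_eqI[of _ _ p]) (auto cong: restrict_cong)
      next
        case 3
        let ?g = "inv\<^bsub>\<Gamma>\<^esub> \<gamma>"
        have "\<forall>i\<in>{..<n}. \<forall>j\<in>{..<n}. \<exists>p. p \<in> N.P \<and> (\<forall>\<rho>\<in>Y. p \<rho> = \<rho> ?g $$ (i, j))"
          using entry_polynomial[of ?g] 3(2) by blast
        then obtain e where e: "\<And>i j. i < n \<Longrightarrow> j < n \<Longrightarrow> e i j \<in> N.P"
          "\<And>i j \<rho>. i < n \<Longrightarrow> j < n \<Longrightarrow> \<rho> \<in> Y \<Longrightarrow> e i j \<rho> = \<rho> ?g $$ (i, j)"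
          by (metis lessThan_iff)
        \<comment> \<open>The Leibniz formula for the determinant at the inverse element, with the
          polynomials \<open>e i j\<close> in place of entries.\<close>
        define p where "p = (\<lambda>X. \<Sum>\<pi>\<in>{\<pi>. \<pi> permutes {0..<n}}. signof \<pi> * (\<Prod>i\<in>{0..<n}. e i (\<pi> i) X))"
        have "p \<in> N.P" unfolding p_def N.P_def
        proof (intro falg_sum falg_cmult falg_prod)
          fix \<pi> i assume "\<pi> \<in> {\<pi>. \<pi> permutes {0..<n}}" "i \<in> {0..<n}"
          then have "\<pi> i < n" "i < n" using permutes_in_image by fastforce+
          then show "e i (\<pi> i) \<in> falg (co ` N.coords)" using e(1) by (simp add: N.P_def)
        qed
        moreover have "f \<rho> = p \<rho>" if r: "\<rho> \<in> Y" for \<rho>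
        proof -
          have c: "\<rho> \<gamma> \<in> carrier_mat n n" "\<rho> ?g \<in> carrier_mat n n" using r 3(2) Reps_carrier by auto
          have "\<rho> \<gamma> * \<rho> ?g = 1\<^sub>m n" using Reps_mult[OF r 3(2), of ?g] 3(2) Reps_one[OF r] by simp
          then have "det (\<rho> \<gamma>) * det (\<rho> ?g) = 1" using det_mult[OF c] by simp
          then have "1 / det (\<rho> \<gamma>) = det (\<rho> ?g)" by (metis nonzero_eq_divide_eq mult.commute mult_zero_left zero_neq_one)
          also have "\<dots> = p \<rho>" unfolding det_def'[OF c(2)] p_def
          proof (intro sum.cong arg_cong2[of _ _ _ _ times] prod.cong HOL.refl)
            fix \<pi> i assume "\<pi> \<in> {\<pi>. \<pi> permutes {0..<n}}" "i \<in> {0..<n}"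
            then have "\<pi> i < n" "i < n" using permutes_in_image by fastforce+
            then show "\<rho> ?g $$ (i, \<pi> i) = e i (\<pi> i) \<rho>" using e(2) r by simp
          qed
          finally show ?thesis using 3(1) r by simp
        qed
        ultimately show ?thesis using 3(1) by (intro image_eqI[of _ _ p]) (auto simp: fun_eq_iff)
      qed
    next
      case (a_inv f)
      then obtain p where p: "p \<in> N.P" "f = restrict p Y" by blast
      have "\<ominus>\<^bsub>function_ring Y\<^esub> f = (\<lambda>\<rho>\<in>Y. - f \<rho>)"
        by (subst fr, rule fun_subalgebra_uminus[OF full]) (simp add: p(2))
      also have "\<dots> = restrict (- p) Y" by (simp add: p(2) cong: restrict_cong)
      finally show ?case using P(5)[OF p(1)] by blast
    next
      case (eng_add f g)
      then obtain p q where p: "p \<in> N.P" "f = restrict p Y" "q \<in> N.P" "g = restrict q Y" by blast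
      have "f \<oplus>\<^bsub>function_ring Y\<^esub> g = restrict (p + q) Y"
        by (simp add: p function_ring_def cong: restrict_cong)
      then show ?case using P(3)[OF p(1,3)] by blast
    next
      case (eng_mult f g)
      then obtain p q where p: "p \<in> N.P" "f = restrict p Y" "q \<in> N.P" "g = restrict q Y" by blast
      have "f \<otimes>\<^bsub>function_ring Y\<^esub> g = restrict (p * q) Y"
        by (simp add: p function_ring_def cong: restrict_cong)
      then show ?case using P(4)[OF p(1,3)] by blast
    qed
  qed
  have "restrict p Y \<in> coordinate_ring \<Gamma> n" if "p \<in> N.P" for p
    using that unfolding N.P_def
  proof (induction p rule: falg.induct)
    case (const c)
    show ?case unfolding coordinate_ring_def
      by (intro generate_ring.incl UnI1 CollectI exI[of _ c] conjI HOL.refl TrueI)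
  next
    case (gen f)
    then obtain l i j where "f = co (l, i, j)" "l \<in> S" "i < n" "j < n" by (auto simp: N.coords_def)
    then have "restrict f Y = (\<lambda>\<rho>\<in>Y. \<rho> l $$ (i, j))" "l \<in> carrier \<Gamma>" "i < n" "j < n"
      using S_subset by (auto simp: co_def)
    then show ?case unfolding coordinate_ring_def by (intro generate_ring.incl) blast
  next
    case (add f g)
    have "restrict (f + g) Y = restrict f Y \<oplus>\<^bsub>function_ring Y\<^esub> restrict g Y"
      by (simp add: function_ring_def cong: restrict_cong)
    then show ?case using add.IH unfolding coordinate_ring_def by (simp only: generate_ring.eng_add)
  next
    case (mult f g)
    have "restrict (f * g) Y = restrict f Y \<otimes>\<^bsub>function_ring Y\<^esub> restrict g Y"
      by (simp add: function_ring_def cong: restrict_cong)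
    then show ?case using mult.IH unfolding coordinate_ring_def by (simp only: generate_ring.eng_mult)
  qed
  then show "(\<lambda>p. restrict p Y) ` N.P \<subseteq> coordinate_ring \<Gamma> n" by blast
qed

lemma conj_action_bact:
  assumes "inv_pair n g h" "\<rho> \<in> Y" "p \<in> N.P"
  shows "p (conj_action \<Gamma> n g \<rho>) = p (bact [n] (g, h) \<rho>)"
  by (rule N.P_cong[OF assms(3)])
    (use S_subset Y_prbd[OF assms(2)] in \<open>auto simp: conj_action_eq[OF assms(1)] bact_def subset_iff\<close>)

text \<open>An invariant function on representations is the restriction of an invariant polynomial:
  a polynomial that represents it is constant on the orbit of each representation, so averaging does
  not change its values there.\<close>

lemma invariant_ring_eq: "A = (\<lambda>p. restrict p Y) ` {p \<in> N.P. N.invar p}"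
proof
  have "restrict p Y \<in> A" if p: "p \<in> N.P" "N.invar p" for p
  proof -
    have "restrict p Y (conj_action \<Gamma> n g \<rho>) = restrict p Y \<rho>" if g: "g \<in> carrier (GL n)" and r: "\<rho> \<in> Y" for g \<rho>
    proof -
      obtain h where gh: "inv_pair n g h" using g by (auto simp: carrier_GL)
      then show ?thesis using r p(2) conj_action_Reps[OF gh r]
        by (simp add: conj_action_bact[OF gh r p(1)] N.invar_def bdpairs_singleton)
    qed
    then show ?thesis using p(1) by (simp add: invariant_ring_def coordinate_ring_eq)
  qed
  then show "(\<lambda>p. restrict p Y) ` {p \<in> N.P. N.invar p} \<subseteq> A" by blast
  show "A \<subseteq> (\<lambda>p. restrict p Y) ` {p \<in> N.P. N.invar p}"
  proof
    fix f assume f: "f \<in> A"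
    then obtain p where p: "p \<in> N.P" "f = restrict p Y"
      by (auto simp: invariant_ring_def coordinate_ring_eq)
    obtain E where E: "N.averaging E" "N.invar (E p)" using N.exists_averaging[OF p(1)] by blast
    have EP: "E p \<in> N.P" by (rule N.averaging_P[OF E(1) p(1)])
    have "E p \<rho> = p \<rho>" if r: "\<rho> \<in> Y" for \<rho>
    proof -
      define c where "c = p \<rho>"
      \<comment> \<open>The orbit is stable and \<open>p - c\<close> vanishes on it, so the average
        of \<open>p - c\<close> vanishes on it too.\<close>
      let ?Z = "{bact [n] g \<rho> | g. g \<in> bdpairs [n]}"
      have one: "(1\<^sub>m n, 1\<^sub>m n) \<in> bdpairs [n]" using one_bdpairs[of "[n]"] by simp
      have orb: "p (bact [n] g \<rho>) = c" if g: "g \<in> bdpairs [n]" for g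
      proof -
        have gh: "inv_pair n (fst g) (snd g)" using g bdpairs_singleton[of "fst g" "snd g" n] by simp
        then have "f (conj_action \<Gamma> n (fst g) \<rho>) = f \<rho>"
          using f r by (auto simp: invariant_ring_def carrier_GL)
        then show ?thesis using conj_action_bact[OF gh r p(1)] conj_action_Reps[OF gh r] r by (simp add: p(2) c_def)
      qed
      have "E (p + (\<lambda>_. -c)) (bact [n] (1\<^sub>m n, 1\<^sub>m n) \<rho>) = 0"
      proof (rule N.averagingD(5)[OF E(1), of ?Z])
        fix g X assume "g \<in> bdpairs [n]" "X \<in> ?Z"
        then obtain g' where g': "g' \<in> bdpairs [n]" "X = bact [n] g' \<rho>" by blast
        show "bact [n] g X \<in> ?Z"
          using bmul_bdpairs[OF \<open>g \<in> bdpairs [n]\<close> g'(1)] bact_bact[OF g'(1) \<open>g \<in> bdpairs [n]\<close>] g'(2) by blast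
      qed (use orb one in auto)
      then have "E p (bact [n] (1\<^sub>m n, 1\<^sub>m n) \<rho>) = c"
        by (simp add: N.averagingD(1)[OF E(1)] N.averagingD(3)[OF E(1) N.invar_const])
      then show ?thesis using E(2) one by (simp add: N.invar_def c_def)
    qed
    then have "f = restrict (E p) Y" by (auto simp: p(2))
    then show "f \<in> (\<lambda>p. restrict p Y) ` {p \<in> N.P. N.invar p}" using EP E(2) by blast
  qed
qed

lemma A_I: "p \<in> N.P \<Longrightarrow> N.invar p \<Longrightarrow> restrict p Y \<in> A"
  by (simp add: invariant_ring_eq)

lemma A_E: "f \<in> A \<Longrightarrow> \<exists>p. p \<in> N.P \<and> N.invar p \<and> f = restrict p Y"
  by (auto simp: invariant_ring_eq)

lemma A_subalgebra: "fun_subalgebra Y A"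
proof -
  note P = unital_subringD[OF N.P_subring]
  have "(\<lambda>y\<in>Y. f y + g y) \<in> A \<and> (\<lambda>y\<in>Y. f y * g y) \<in> A" if fg: "f \<in> A" "g \<in> A" for f g
  proof -
    obtain p q where p: "p \<in> N.P" "N.invar p" "f = restrict p Y" "q \<in> N.P" "N.invar q" "g = restrict q Y"
      using A_E fg by metis
    have "(\<lambda>y\<in>Y. f y + g y) = restrict (p + q) Y" "(\<lambda>y\<in>Y. f y * g y) = restrict (p * q) Y"
      by (simp_all add: p cong: restrict_cong)
    then show ?thesis using A_I[OF P(3)[OF p(1,4)] N.invar_add[OF p(2,5)]] A_I[OF P(4)[OF p(1,4)] N.invar_mult[OF p(2,5)]]
      by simp
  qed
  then show ?thesis using A_I[OF N.P_const N.invar_const]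
    by (auto simp: fun_subalgebra_def invariant_ring_eq)
qed

end

section \<open>Points of the character variety\<close>

lemma prbd_singleton_prbd: "sum_list ds = n \<Longrightarrow> prbd [n] (prbd ds X) = prbd ds X"
  using prbd_singleton[of "prbd ds X" _ n] bd_carrier[OF prbd_bd[of ds X]] by (intro ext) auto

context generated_group
begin

definition block_reps :: "nat list \<Rightarrow> ('a \<Rightarrow> complex mat) set" where
  "block_reps ds = {\<rho> \<in> Y. \<forall>\<gamma>\<in>carrier \<Gamma>. \<rho> \<gamma> \<in> bd ds}"

text \<open>
  Pulling invariants back along the projection to block diagonal tuples keeps the traces, over which
  the blockwise invariants are finite; so a zero of \<open>M\<close> can be found among the block diagonal tuples.
\<close>

theorem block_lying_over:
  assumes ds: "sum_list ds = n" and M: "maximalideal M (function_ring Y\<lparr>carrier := A\<rparr>)"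
    and van: "\<And>f. f \<in> A \<Longrightarrow> (\<And>\<rho>. \<rho> \<in> block_reps ds \<Longrightarrow> f \<rho> = 0) \<Longrightarrow> f \<in> M"
  shows "\<exists>\<rho>\<in>block_reps ds. M = git_point \<Gamma> n \<rho>"
proof -
  interpret D: tuples S ds by unfold_locales (rule finite_S)
  note P = unital_subringD[OF N.P_subring]
  note MD = maximalidealD[OF A_subalgebra M]
  define pb :: "(('a \<Rightarrow> complex mat) \<Rightarrow> complex) \<Rightarrow> ('a \<Rightarrow> complex mat) \<Rightarrow> complex"
    where "pb p = (\<lambda>X. p (prbd ds X))" for p
  have pb: "pb p X = p (prbd ds X)" for p X by (simp add: pb_def)
  have pb_add: "pb (p + q) = pb p + pb q" and pb_mult: "pb (p * q) = pb p * pb q" for p q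
    by (simp_all add: pb_def plus_fun_def times_fun_def)
  have pb_const: "pb (\<lambda>_. c) = (\<lambda>_. c)" for c by (simp add: pb_def)
  \<comment> \<open>This is an ideal over the pulled back invariants only. That suffices for
    \<open>lying_over\<close>, because the traces of words are among them.\<close>
  define M' where "M' = {pb p | p. p \<in> N.P \<and> N.invar p \<and> restrict p Y \<in> M}"
  \<comment> \<open>The tuples whose projection is the restriction to \<open>S\<close> of a block
    diagonal representation; the block group preserves this set.\<close>
  define H where "H = {X. \<exists>\<rho>\<in>block_reps ds. \<forall>l\<in>S. prbd ds X l = \<rho> l}"
  have pull: "pb p \<in> D.P" if "p \<in> N.P" for p
    using that unfolding N.P_def
  proof (induction p rule: falg.induct)
    case (const c) show ?case unfolding pb_const by (rule D.P_const)
  next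
    case (gen f)
    then obtain l i j where f: "f = co (l, i, j)" "l \<in> S" "i < n" "j < n" by (auto simp: N.coords_def)
    show ?case
    proof (cases "blkidx ds i = blkidx ds j")
      case True
      then have "(l, i, j) \<in> D.coords" using f ds by (simp add: D.coords_def)
      then have "co (l, i, j) \<in> D.P" by (simp add: D.P_def falg.gen)
      moreover have "pb f = co (l, i, j)" using f ds True by (auto simp: pb_def co_def prbd_def fun_eq_iff)
      ultimately show ?thesis by simp
    next
      case False
      then have "pb f = (\<lambda>_. 0)" using f ds by (auto simp: pb_def co_def prbd_def fun_eq_iff)
      then show ?thesis using D.P_const[of 0] by simp
    qed
  next
    case (add f g)
    show ?case unfolding pb_add by (rule unital_subringD(3)[OF D.P_subring add.IH])
  next
    case (mult f g)
    show ?case unfolding pb_mult by (rule unital_subringD(4)[OF D.P_subring mult.IH])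
  qed
  have bdp: "(fst g, snd g) \<in> bdpairs [n]" if "g \<in> bdpairs ds" for g
    using that ds unfolding bdpairs_singleton by (auto simp: bdpairs_def)
  have pull_inv: "D.invar (pb p)" if "N.invar p" for p
    unfolding D.invar_def
  proof (intro ballI allI)
    fix g and X :: "'a \<Rightarrow> complex mat" assume g: "g \<in> bdpairs ds"
    have "bact [n] (fst g, snd g) (prbd ds X) = bact ds g X" by (simp add: bact_def prbd_singleton_prbd[OF ds])
    moreover have "p (bact [n] (fst g, snd g) (prbd ds X)) = p (prbd ds X)"
      using that bdp[OF g] by (simp add: N.invar_def)
    ultimately have "p (bact ds g X) = p (prbd ds X)" by simp
    then show "pb p (bact ds g X) = pb p X" by (simp add: pb prbd_bact[OF g])
  qed
  have M'I: "pb p \<in> M'" if "p \<in> N.P" "N.invar p" "restrict p Y \<in> M" for p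
    using that unfolding M'_def by blast
  have mulM': "pb q * f \<in> M'" if q: "q \<in> N.P" "N.invar q" and f: "f \<in> M'" for q f
  proof -
    obtain p where p: "p \<in> N.P" "N.invar p" "restrict p Y \<in> M" "f = pb p"
      using f unfolding M'_def by blast
    have "(\<lambda>y\<in>Y. restrict q Y y * restrict p Y y) = restrict (q * p) Y" by (simp cong: restrict_cong)
    then have "restrict (q * p) Y \<in> M" using MD(5)[OF A_I[OF q] p(3)] by simp
    from M'I[OF P(4)[OF q(1) p(1)] N.invar_mult[OF q(2) p(2)] this]
    show ?thesis unfolding p(4) pb_mult .
  qed
  have "(\<exists>m\<in>M'. \<forall>X\<in>H. m X = 1) \<or>
    (\<exists>X. (\<forall>l. X l \<in> bd ds) \<and> (\<forall>p\<in>M'. p X = 0) \<and> (\<forall>p\<in>D.P. (\<forall>Y\<in>H. p Y = 0) \<longrightarrow> p X = 0))"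
  proof (rule D.lying_over)
    show "M' \<subseteq> {p \<in> D.P. D.invar p}" using pull pull_inv by (auto simp: M'_def)
    have "restrict 0 Y \<in> M" using MD(2) by (simp cong: restrict_cong)
    from M'I[OF P(2) N.invar_zero this] show "0 \<in> M'" using pb_const[of 0] by (simp add: zero_fun_def)
    show "f + g \<in> M'" if "f \<in> M'" "g \<in> M'" for f g
    proof -
      obtain p q where p: "p \<in> N.P" "N.invar p" "restrict p Y \<in> M" "f = pb p"
        and q: "q \<in> N.P" "N.invar q" "restrict q Y \<in> M" "g = pb q"
        using \<open>f \<in> M'\<close> \<open>g \<in> M'\<close> unfolding M'_def by blast
      have "(\<lambda>y\<in>Y. restrict p Y y + restrict q Y y) = restrict (p + q) Y" by (simp cong: restrict_cong)
      then have "restrict (p + q) Y \<in> M" using MD(4)[OF p(3) q(3)] by simp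
      from M'I[OF P(3)[OF p(1) q(1)] N.invar_add[OF p(2) q(2)] this]
      show ?thesis unfolding p(4) q(4) pb_add .
    qed
    show "f * g \<in> M'" if f: "f \<in> M'" and g: "g \<in> M'" for f g
    proof -
      obtain p where "p \<in> N.P" "N.invar p" "f = pb p"
        using f unfolding M'_def by blast
      then show ?thesis using mulM' g by simp
    qed
    show "- f \<in> M'" if "f \<in> M'" for f
      using mulM'[OF N.P_const N.invar_const that, of "-1"] by (simp add: pb_const fun_Compl_def times_fun_def)
    show "t * f \<in> M'" if t: "t \<in> D.TR (lists S)" and f: "f \<in> M'" for t f
    proof -
      have "\<exists>q. q \<in> N.P \<and> N.invar q \<and> t = pb q"
        using t unfolding D.TR_def
      proof (induction t rule: falg.induct)
        case (const c)
        show ?case using N.P_const N.invar_const by (intro exI[of _ "\<lambda>_. c"]) (auto simp: pb_const)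
      next
        case (gen g)
        then obtain w where w: "w \<in> lists S" "g = D.tw w" by blast
        \<comment> \<open>The trace of a word is the same whether the tuple is regarded as one block
          or as several.\<close>
        have "D.tw w = pb (N.tw w)"
          using ds by (simp add: fun_eq_iff pb D.tw_def N.tw_def prbd_singleton_prbd)
        then show ?case using w N.hpol_P[OF N.tw_hpol[OF w(1)]] N.tw_invar[OF w(1)] by blast
      next
        case (add f g)
        then obtain p q where "p \<in> N.P" "N.invar p" "f = pb p"
          "q \<in> N.P" "N.invar q" "g = pb q" by blast
        then show ?case using P(3) N.invar_add by (intro exI[of _ "p + q"]) (simp only: pb_add simp_thms)
      next
        case (mult f g)
        then obtain p q where "p \<in> N.P" "N.invar p" "f = pb p"
          "q \<in> N.P" "N.invar q" "g = pb q" by blast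
        then show ?case using P(4) N.invar_mult by (intro exI[of _ "p * q"]) (simp only: pb_mult simp_thms)
      qed
      then show ?thesis using mulM' f by blast
    qed
    show "bact ds g X \<in> H" if g: "g \<in> bdpairs ds" and X: "X \<in> H" for g X
    proof -
      obtain \<rho> where r: "\<rho> \<in> block_reps ds" "\<forall>l\<in>S. prbd ds X l = \<rho> l" using X by (auto simp: H_def)
      have gh: "inv_pair n (fst g) (snd g)" by (rule bdpairs_singleton[THEN iffD1, OF bdp[OF g]])
      have "conj_action \<Gamma> n (fst g) \<rho> \<in> block_reps ds"
        using r(1) conj_action_Reps[OF gh] g
        by (auto simp: block_reps_def conj_action_eq[OF gh] bdpairs_def intro!: bd_mult)
      moreover have "\<forall>l\<in>S. prbd ds (bact ds g X) l = conj_action \<Gamma> n (fst g) \<rho> l"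
        unfolding prbd_bact[OF g] using r(2) S_subset by (auto simp: conj_action_eq[OF gh] bact_def)
      ultimately show ?thesis unfolding H_def by blast
    qed
  qed
  then show ?thesis
  proof
    \<comment> \<open>Here the restriction of \<open>p\<close> lies in \<open>M\<close> and is 1 on
      all block representations. By hypothesis \<open>p - 1\<close> then lies in \<open>M\<close> as
      well, so \<open>M\<close> would contain 1.\<close>
    assume "\<exists>m\<in>M'. \<forall>X\<in>H. m X = 1"
    then obtain p where p: "p \<in> N.P" "N.invar p" "restrict p Y \<in> M" "\<forall>X\<in>H. pb p X = 1"
      unfolding M'_def by blast
    have 1: "p \<rho> = 1" if r: "\<rho> \<in> block_reps ds" for \<rho>
    proof -
      have pr: "prbd ds \<rho> l = \<rho> l" if "l \<in> S" for l
        using r that S_subset by (intro prbd_id) (auto simp: block_reps_def)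
      then have "\<rho> \<in> H" using r by (auto simp: H_def)
      then show ?thesis using p(4) N.P_cong[OF p(1), of "prbd ds \<rho>" \<rho>] pr by (simp add: pb)
    qed
    have pA: "restrict p Y \<in> A" using MD(1) p(3) by blast
    have "(\<lambda>y\<in>Y. restrict p Y y - 1) \<in> M"
      by (rule van[OF fun_subalgebra_diff[OF A_subalgebra pA]]) (auto simp: 1 block_reps_def)
    from MD(4)[OF p(3) MD(6)[OF this]] have "(\<lambda>y\<in>Y. 1) \<in> M" by (simp cong: restrict_cong)
    then show ?thesis using MD(3) by simp
  next
    assume "\<exists>X. (\<forall>l. X l \<in> bd ds) \<and> (\<forall>p\<in>M'. p X = 0) \<and> (\<forall>p\<in>D.P. (\<forall>Y\<in>H. p Y = 0) \<longrightarrow> p X = 0)"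
    then obtain X where X: "\<And>l. X l \<in> bd ds" and X0: "\<And>p. p \<in> M' \<Longrightarrow> p X = 0"
      and XH: "\<And>p. p \<in> D.P \<Longrightarrow> (\<And>Y. Y \<in> H \<Longrightarrow> p Y = 0) \<Longrightarrow> p X = 0" by blast
    have prX: "prbd ds X = X" using prbd_id[of X] X by auto
    have wbd: "wd n X w \<in> bd ds" for w
      by (induction w) (use bd_one[of ds] bd_mult X ds in auto)
    \<comment> \<open>Words with equal value in the group have equal entries on all of
      \<open>H\<close>. Polynomials that vanish on \<open>H\<close> vanish at \<open>X\<close>, so
      \<open>X\<close> inherits all relations of the group.\<close>
    have rel: "wd n X u = wd n X v" if uv: "u \<in> lists S" "v \<in> lists S" "evalw \<Gamma> u = evalw \<Gamma> v" for u v
    proof (rule eq_matI)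
      fix i j assume "i < dim_row (wd n X v)" "j < dim_col (wd n X v)"
      then have ij: "i < n" "j < n" using bd_carrier[OF wbd[of v]] ds by auto
      let ?e = "\<lambda>w Y. wd n (prbd ds Y) w $$ (i, j)"
      have "?e u \<in> D.P" "?e v \<in> D.P"
        using D.hpol_P[OF D.wd_entry_hpol[OF uv(1), of i j]] D.hpol_P[OF D.wd_entry_hpol[OF uv(2), of i j]] ij ds by simp_all
      then have "(?e u - ?e v) \<in> D.P" by (rule unital_subringD(6)[OF D.P_subring])
      moreover have "(?e u - ?e v) Y' = 0" if Y': "Y' \<in> H" for Y'
      proof -
        obtain \<rho> where r: "\<rho> \<in> Y" "\<forall>l\<in>S. prbd ds Y' l = \<rho> l" using Y' by (auto simp: H_def block_reps_def)
        have "wd n (prbd ds Y') w = \<rho> (evalw \<Gamma> w)" if "w \<in> lists S" for w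
          using Reps_word[OF r(1) that] wd_cong[of w "prbd ds Y'" \<rho> n] r(2) that by auto
        then show ?thesis using uv by simp
      qed
      ultimately have "(?e u - ?e v) X = 0" by (rule XH)
      then show "wd n X u $$ (i, j) = wd n X v $$ (i, j)" by (simp add: prX)
    qed (use bd_carrier[OF wbd[of u]] bd_carrier[OF wbd[of v]] in auto)
    \<comment> \<open>A chosen word for each element; by \<open>rel\<close> another choice gives the
      same matrix.\<close>
    obtain wo where wo: "\<And>\<gamma>. \<gamma> \<in> carrier \<Gamma> \<Longrightarrow> wo \<gamma> \<in> lists S \<and> evalw \<Gamma> (wo \<gamma>) = \<gamma>"
      using words by metis
    define \<rho> where "\<rho> = (\<lambda>\<gamma>\<in>carrier \<Gamma>. wd n X (wo \<gamma>))"
    have fX: "fam n S X" using bd_carrier[OF X] ds by (simp add: fam_def)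
    have val: "\<rho> \<gamma> = wd n X u" if "u \<in> lists S" "\<gamma> = evalw \<Gamma> u" for \<gamma> u
    proof -
      have g: "\<gamma> \<in> carrier \<Gamma>" unfolding that(2) by (rule evalw_carrier[OF that(1)])
      have "wd n X u = wd n X (wo \<gamma>)"
        using wo[OF g] by (intro rel[OF that(1)]) (simp_all only: that(2)[symmetric])
      then show ?thesis unfolding \<rho>_def restrict_apply'[OF g] by (rule HOL.sym)
    qed
    have "\<rho> \<in> Y" unfolding Reps_iff
    proof (intro conjI)
      show "\<rho> \<in> extensional (carrier \<Gamma>)" by (simp add: \<rho>_def)
      show "fam n (carrier \<Gamma>) \<rho>" using bd_carrier[OF wbd] ds by (simp add: fam_def \<rho>_def)
      have "\<rho> \<gamma> * \<rho> \<delta> = \<rho> (\<gamma> \<otimes>\<^bsub>\<Gamma>\<^esub> \<delta>)" if g: "\<gamma> \<in> carrier \<Gamma>" and d: "\<delta> \<in> carrier \<Gamma>" for \<gamma> \<delta>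
      proof -
        have w: "wo \<gamma> \<in> lists S" "evalw \<Gamma> (wo \<gamma>) = \<gamma>" "wo \<delta> \<in> lists S" "evalw \<Gamma> (wo \<delta>) = \<delta>"
          using wo[OF g] wo[OF d] by simp_all
        then have "\<rho> (\<gamma> \<otimes>\<^bsub>\<Gamma>\<^esub> \<delta>) = wd n X (wo \<gamma> @ wo \<delta>)"
          by (intro val) (simp_all only: evalw_append append_in_lists_conv simp_thms)
        then show ?thesis using val[OF w(1)] val[OF w(3)] w by (simp add: wd_append[OF fX w(3) w(1)])
      qed
      moreover have "\<rho> \<one>\<^bsub>\<Gamma>\<^esub> = 1\<^sub>m n" using val[of "[]" "\<one>\<^bsub>\<Gamma>\<^esub>"] by simp
      ultimately show "rels mtab {\<one>\<^bsub>\<Gamma>\<^esub>} n \<rho>" by (auto simp: rels_def)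
    qed
    then have rb: "\<rho> \<in> block_reps ds" using wbd by (simp add: block_reps_def \<rho>_def)
    have rX: "\<rho> l = X l" if "l \<in> S" for l
    proof -
      have "l = evalw \<Gamma> [l]" using that S_subset by auto
      then have "\<rho> l = wd n X [l]" using that by (intro val) auto
      then show ?thesis using fX that by (auto simp: fam_def)
    qed
    \<comment> \<open>Both ideals are maximal, so an inclusion is enough.\<close>
    have "M \<subseteq> git_point \<Gamma> n \<rho>"
    proof
      fix f assume f: "f \<in> M"
      then obtain p where p: "p \<in> N.P" "N.invar p" "f = restrict p Y" using MD(1) A_E by blast
      have "p X = 0" using X0[OF M'I[OF p(1,2)]] f p(3) prX by (simp add: pb)
      then have "f \<rho> = 0" using N.P_cong[OF p(1), of \<rho> X] rX p(3) \<open>\<rho> \<in> Y\<close> by simp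
      then show "f \<in> git_point \<Gamma> n \<rho>" using f MD(1) by (auto simp: git_point_def)
    qed
    moreover have "maximalideal (git_point \<Gamma> n \<rho>) (function_ring Y\<lparr>carrier := A\<rparr>)"
      unfolding git_point_def by (rule maximalideal_point[OF A_subalgebra \<open>\<rho> \<in> Y\<close>])
    ultimately have "M = git_point \<Gamma> n \<rho>" by (intro maximalideal_eq[OF A_subalgebra M])
    then show ?thesis using rb by blast
  qed
qed

end

section \<open>Polystable types\<close>

lemma blk_fbd: "blk X Y l = fbd (X l) (Y l)"
  by (simp add: blk_def)

lemma fams_dsum:
  assumes "\<forall>(m, \<sigma>)\<in>set L. fam m I \<sigma>" "l \<in> I"
  shows "dsum L l \<in> carrier_mat (dims L) (dims L)"
  using fam_dsum[OF assms(1)] assms(2) by (simp add: fam_def)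

lemma rels_dsum:
  assumes TE: "T \<subseteq> I \<times> I \<times> I" "E \<subseteq> I"
  shows "\<forall>(m, \<sigma>)\<in>set L. fam m I \<sigma> \<and> rels T E m \<sigma> \<Longrightarrow> rels T E (dims L) (dsum L)"
proof (induction L)
  case Nil
  show ?case by (auto simp: rels_def dsum_Nil)
next
  case (Cons p L)
  obtain m X where p: "p = (m, X)" by (cases p)
  have IH: "rels T E (dims L) (dsum L)" and X: "fam m I X" "rels T E m X" using Cons by (auto simp: p)
  have "\<forall>(m, \<sigma>)\<in>set L. fam m I \<sigma>" using Cons.prems by auto
  then have c: "X l \<in> carrier_mat m m" "dsum L l \<in> carrier_mat (dims L) (dims L)" if "l \<in> I" for l
    using X(1) that fams_dsum[of L I l] by (simp_all add: fam_def)
  have "blk X (dsum L) l * blk X (dsum L) q = blk X (dsum L) r" if t: "(l, q, r) \<in> T" for l q r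
  proof -
    have I: "l \<in> I" "q \<in> I" "r \<in> I" using t TE by auto
    have "X l * X q = X r" "dsum L l * dsum L q = dsum L r" using X(2) IH t by (auto simp: rels_def)
    then show ?thesis unfolding blk_fbd by (simp add: fbd_mult[OF c[OF I(1)] c[OF I(2)]])
  qed
  moreover have "blk X (dsum L) e = 1\<^sub>m (m + dims L)" if "e \<in> E" for e
    using X(2) IH that fbd_one[of m "dims L"] by (simp add: rels_def blk_fbd)
  ultimately show ?case by (auto simp: p dsum_Cons rels_def)
qed

lemma rels_dsumD:
  assumes TE: "T \<subseteq> I \<times> I \<times> I" "E \<subseteq> I"
  shows "\<forall>(m, \<sigma>)\<in>set L. fam m I \<sigma> \<Longrightarrow> rels T E (dims L) (dsum L) \<Longrightarrow> \<forall>(m, \<sigma>)\<in>set L. rels T E m \<sigma>"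
proof (induction L)
  case (Cons p L)
  obtain m X where p: "p = (m, X)" by (cases p)
  have X: "fam m I X" "fam (dims L) I (dsum L)" using Cons.prems(1) by (auto simp: p intro!: fam_dsum)
  have r: "rels T E (m + dims L) (blk X (dsum L))" using Cons.prems(2) by (simp add: p dsum_Cons)
  have Xl: "blk X (dsum L) l = four_block_mat (X l) (0\<^sub>m m (dims L)) (0\<^sub>m (dims L) m) (dsum L l)" if "l \<in> I" for l
  proof -
    have "X l \<in> carrier_mat m m" "dsum L l \<in> carrier_mat (dims L) (dims L)" using X that by (auto simp: fam_def)
    then show ?thesis by (simp add: blk_def)
  qed
  note rt = rels_triangular[OF r TE Xl X]
  have "rels T E m X" by (rule rt(1)) auto
  moreover have "rels T E (dims L) (dsum L)" by (rule rt(2)) auto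
  ultimately show ?case using Cons by (auto simp: p)
qed simp

section \<open>Simultaneous similarity and the order of summands\<close>

definition fam_sim :: "'i set \<Rightarrow> nat \<Rightarrow> ('i \<Rightarrow> complex mat) \<Rightarrow> ('i \<Rightarrow> complex mat) \<Rightarrow> bool" where
  "fam_sim I d X Z \<longleftrightarrow> (\<exists>g h. inv_pair d g h \<and> (\<forall>l\<in>I. Z l = g * X l * h))"

lemma fam_sim_refl: "fam d I X \<Longrightarrow> fam_sim I d X X"
  unfolding fam_sim_def using inv_pair_one[of d] by (intro exI[of _ "1\<^sub>m d"]) (auto simp: fam_def)

lemma fam_sim_trans:
  assumes "fam d I X" "fam_sim I d X Z" "fam_sim I d Z V"
  shows "fam_sim I d X V"
proof -
  obtain g h g' h' where gh: "inv_pair d g h" "\<forall>l\<in>I. Z l = g * X l * h"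
    and gh': "inv_pair d g' h'" "\<forall>l\<in>I. V l = g' * Z l * h'"
    using assms(2,3) by (auto simp: fam_sim_def)
  have c: "g \<in> carrier_mat d d" "h \<in> carrier_mat d d" "g' \<in> carrier_mat d d" "h' \<in> carrier_mat d d"
    using gh gh' by (auto simp: inv_pair_def)
  have "V l = (g' * g) * X l * (h * h')" if "l \<in> I" for l
  proof -
    have "X l \<in> carrier_mat d d" using assms(1) that by (simp add: fam_def)
    then show ?thesis using gh(2) gh'(2) that c by (simp add: assoc_mult_mat[of _ d d _ d _ d])
  qed
  then show ?thesis unfolding fam_sim_def using inv_pair_mult[OF gh'(1) gh(1)] by blast
qed

lemma fam_sim_blk:
  assumes "fam d I X" "fam e I V" "fam_sim I d X X'" "fam_sim I e V V'"
  shows "fam_sim I (d + e) (blk X V) (blk X' V')"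
proof -
  obtain g h g' h' where gh: "inv_pair d g h" "\<forall>l\<in>I. X' l = g * X l * h"
    and gh': "inv_pair e g' h'" "\<forall>l\<in>I. V' l = g' * V l * h'"
    using assms(3,4) by (auto simp: fam_sim_def)
  have "blk X' V' l = fbd g g' * blk X V l * fbd h h'" if "l \<in> I" for l
  proof -
    have "X l \<in> carrier_mat d d" "V l \<in> carrier_mat e e" using assms(1,2) that by (auto simp: fam_def)
    from blk_conj[of d g h e g' h' X l V, OF gh(1) gh'(1) this] show ?thesis using gh(2) gh'(2) that by (simp add: blk_fbd)
  qed
  then show ?thesis unfolding fam_sim_def using inv_pair_fbd[OF gh(1) gh'(1)] by blast
qed

text \<open>Conjugation by the block permutation matrix that exchanges the two groups of
  coordinates.\<close>

lemma fam_sim_swap: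
  assumes X: "fam d I X" and V: "fam e I V"
  shows "fam_sim I (d + e) (blk X V) (blk V X)"
proof -
  let ?g = "four_block_mat (0\<^sub>m e d) (1\<^sub>m e) (1\<^sub>m d) (0\<^sub>m d e) :: complex mat"
  let ?h = "four_block_mat (0\<^sub>m d e) (1\<^sub>m d) (1\<^sub>m e) (0\<^sub>m e d) :: complex mat"
  have "?g * ?h = 1\<^sub>m (e + d)"
    by (subst mult_four_block_mat[of _ e d _ e _ d _ _ e _ d]) auto
  moreover have "?h * ?g = 1\<^sub>m (d + e)"
    by (subst mult_four_block_mat[of _ d e _ d _ e _ _ d _ e]) auto
  moreover have "?g \<in> carrier_mat (e + d) (d + e)" "?h \<in> carrier_mat (d + e) (e + d)"
    by (rule four_block_carrier_mat; simp)+
  ultimately have ip: "inv_pair (d + e) ?g ?h" by (simp add: inv_pair_def add.commute)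
  have "blk V X l = ?g * blk X V l * ?h" if "l \<in> I" for l
  proof -
    have c: "X l \<in> carrier_mat d d" "V l \<in> carrier_mat e e" using X V that by (auto simp: fam_def)
    have "?g * blk X V l = four_block_mat (0\<^sub>m e d) (V l) (X l) (0\<^sub>m d e)"
      unfolding blk_def using c by (subst mult_four_block_mat[of _ e d _ e _ d _ _ d _ e]) auto
    also have "\<dots> * ?h = four_block_mat (V l) (0\<^sub>m e d) (0\<^sub>m d e) (X l)"
      using c by (subst mult_four_block_mat[of _ e d _ e _ d _ _ e _ d]) auto
    finally show ?thesis using c by (simp add: blk_def)
  qed
  then show ?thesis unfolding fam_sim_def using ip by blast
qed

text \<open>The first summand of \<open>L\<close> is moved past the summands that precede it in
  \<open>M\<close>; the rest is left to the induction.\<close>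

lemma fam_sim_dsum:
  assumes "mset L = mset M" "\<forall>(m, \<sigma>)\<in>set L. fam m I \<sigma>"
  shows "fam_sim I (dims L) (dsum L) (dsum M)"
  using assms
proof (induction L arbitrary: M)
  case Nil
  then show ?case using fam_sim_refl[OF fam_dsum[of "[]" I]] by simp
next
  case (Cons p L)
  obtain M1 M2 where M: "M = M1 @ p # M2" using Cons.prems(1) by (metis list.set_intros(1) set_mset_mset split_list)
  obtain m X where p: "p = (m, X)" by (cases p)
  have mL: "mset L = mset (M1 @ M2)" using Cons.prems(1) by (simp add: M)
  then have set: "set L = set M1 \<union> set M2" using mset_eq_setD[OF mL] by simp
  have fs: "\<forall>(m, \<sigma>)\<in>set L. fam m I \<sigma>" "\<forall>(m, \<sigma>)\<in>set M1. fam m I \<sigma>" "\<forall>(m, \<sigma>)\<in>set M2. fam m I \<sigma>"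
    "\<forall>(m, \<sigma>)\<in>set [p]. fam m I \<sigma>" "fam m I X"
    using Cons.prems(2) by (auto simp: p set)
  note f = fs(5) fs(1-4)[THEN fam_dsum]
  have d: "dims L = dims M1 + dims M2"
  proof -
    have "sum_mset (mset (map fst L)) = sum_mset (mset (map fst (M1 @ M2)))" using mL by (simp only: mset_map)
    then show ?thesis unfolding sum_mset_sum_list by (simp add: dims_def)
  qed
  have 1: "fam_sim I (m + dims L) (dsum (p # L)) (dsum (p # (M1 @ M2)))"
    unfolding p dsum_Cons by (intro fam_sim_blk f fam_sim_refl Cons.IH[OF mL] fs(1))
  have "fam_sim I (dims [p] + dims M1 + dims M2) (blk (blk (dsum [p]) (dsum M1)) (dsum M2))
     (blk (blk (dsum M1) (dsum [p])) (dsum M2))"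
    by (intro fam_sim_blk fam_blk f fam_sim_refl fam_sim_swap)
  then have 2: "fam_sim I (m + dims L) (dsum (p # (M1 @ M2))) (dsum M)"
    by (simp add: M dsum_append[symmetric] p d add.assoc)
  have "fam (m + dims L) I (dsum (p # L))" unfolding p dsum_Cons by (intro fam_blk f)
  from fam_sim_trans[OF this 1 2] show ?case by (simp add: p)
qed

lemma mset_map_arrange:
  "mset (map f L) = mset ds \<Longrightarrow> \<exists>L'. mset L' = mset L \<and> map f L' = ds"
proof (induction ds arbitrary: L)
  case (Cons d ds)
  have "d \<in> set (map f L)" using Cons.prems by (metis list.set_intros(1) set_mset_mset)
  then obtain x where x: "x \<in> set L" "f x = d" by auto
  have "mset L = add_mset x (mset (remove1 x L))" using x(1) by simp
  then have "mset (map f L) = add_mset d (mset (map f (remove1 x L)))"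
    unfolding mset_map x(2)[symmetric] by (metis image_mset_add_mset)
  then have "mset (map f (remove1 x L)) = mset ds" using Cons.prems by simp
  then obtain L' where "mset L' = mset (remove1 x L)" "map f L' = ds" using Cons.IH by blast
  then show ?case using x by (intro exI[of _ "x # L'"]) simp
qed simp

text \<open>Summands sorted by dimension are cut into one list per dimension, the form that
  \<open>type_polystable\<close> asks for.\<close>

lemma split_by_concat_replicate:
  "distinct js \<Longrightarrow> map fst L = concat (map (\<lambda>j. replicate (k j) j) js) \<Longrightarrow>
   \<exists>\<sigma>. L = concat (map (\<lambda>j. map (Pair j) (\<sigma> j)) js) \<and> (\<forall>j\<in>set js. length (\<sigma> j) = k j)"
proof (induction js arbitrary: L)
  case (Cons j js)
  define L1 L2 where "L1 = take (k j) L" and "L2 = drop (k j) L"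
  have m: "map fst L1 = replicate (k j) j" "map fst L2 = concat (map (\<lambda>j. replicate (k j) j) js)"
    using Cons.prems(2) by (simp_all add: L1_def L2_def take_map[symmetric] drop_map[symmetric])
  obtain \<sigma> where s: "L2 = concat (map (\<lambda>j. map (Pair j) (\<sigma> j)) js)" "\<forall>j\<in>set js. length (\<sigma> j) = k j"
    using Cons.IH[OF _ m(2)] Cons.prems(1) by auto
  have "fst q = j" if "q \<in> set L1" for q
    using arg_cong[OF m(1), of set] that by (force simp: set_replicate_conv_if split: if_splits)
  then have e1: "map (Pair j) (map snd L1) = L1" by (simp add: map_idI prod_eq_iff)
  have "length L1 = k j" using arg_cong[OF m(1), of length] by simp
  moreover have e2: "map (\<lambda>i. map (Pair i) ((\<sigma>(j := map snd L1)) i)) js = map (\<lambda>j. map (Pair j) (\<sigma> j)) js"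
    using Cons.prems(1) by auto
  moreover have "L = concat (map (\<lambda>i. map (Pair i) ((\<sigma>(j := map snd L1)) i)) (j # js))"
    unfolding list.map(2) concat.simps(2) e2 fun_upd_same e1 s(1)[symmetric] by (simp add: L1_def L2_def)
  ultimately show ?case using s(2) Cons.prems(1) by (intro exI[of _ "\<sigma>(j := map snd L1)"] conjI) auto
qed simp

lemma length_concat_ge: "\<forall>L\<in>set Ls. L \<noteq> [] \<Longrightarrow> length Ls \<le> length (concat Ls)"
proof (induction Ls)
  case (Cons L Ls)
  then have "L \<noteq> []" "length Ls \<le> length (concat Ls)" by auto
  then show ?case by (cases L) auto
qed simp

text \<open>Without empty lists, equality of lengths leaves one entry per list. This is the case in
  which a refinement of a type is the type itself.\<close>

lemma concat_of_singletons:
  "\<forall>L\<in>set Ls. L \<noteq> [] \<Longrightarrow> length (concat Ls) = length Ls \<Longrightarrow> map fst (concat Ls) = map dims Ls"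
proof (induction Ls)
  case (Cons L Ls)
  have "L \<noteq> []" "length Ls \<le> length (concat Ls)" using Cons.prems(1) length_concat_ge[of Ls] by auto
  then obtain q where "L = [q]" "length (concat Ls) = length Ls"
    using Cons.prems(2) by (cases L; cases "tl L") auto
  then show ?case using Cons by auto
qed simp

text \<open>A partition as a sorted list of its parts, so that it can serve as a list of block
  sizes; types are compared through the multisets of such lists.\<close>

definition part_list :: "nat \<Rightarrow> (nat \<Rightarrow> nat) \<Rightarrow> nat list" where
  "part_list n k = concat (map (\<lambda>j. replicate (k j) j) [1..<Suc n])"

lemma count_concat_replicate:
  "distinct js \<Longrightarrow> count (mset (concat (map (\<lambda>j. replicate (k j) j) js))) i = (if i \<in> set js then k i else 0)"
  by (induction js) (auto simp: mset_replicate)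

lemma count_part_list: "count (mset (part_list n k)) i = (if i \<in> {1..n} then k i else 0)"
  unfolding part_list_def by (subst count_concat_replicate) auto

lemma set_part_list: "set (part_list n k) \<subseteq> {1..n}"
  by (auto simp: part_list_def set_replicate_conv_if split: if_splits)

lemma sum_part_list: "sum_list (part_list n k) = (\<Sum>j=1..n. j * k j)"
proof -
  have "sum_list (concat (map (\<lambda>j. replicate (k j) j) js)) = (\<Sum>j\<leftarrow>js. j * k j)" for js
    by (induction js) (auto simp: sum_list_replicate mult.commute)
  then have "sum_list (part_list n k) = (\<Sum>j\<leftarrow>[1..<Suc n]. j * k j)" unfolding part_list_def .
  also have "\<dots> = (\<Sum>j=1..n. j * k j)"
    by (simp add: sum_list_distinct_conv_sum_set atLeastLessThanSuc_atLeastAtMost del: upt_Suc)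
  finally show ?thesis .
qed

lemma part_list_inj:
  assumes "k \<in> partitions_of n" "k' \<in> partitions_of n" "mset (part_list n k) = mset (part_list n k')"
  shows "k = k'"
proof
  fix j
  show "k j = k' j"
  proof (cases "j \<in> {1..n}")
    case True
    then show ?thesis using arg_cong[OF assms(3), of "\<lambda>M. count M j"] by (simp add: count_part_list)
  next
    case False
    then show ?thesis using assms(1,2) by (simp add: partitions_of_def)
  qed
qed

lemma part_list_exists:
  assumes "set ds \<subseteq> {1..n}" "sum_list ds = n"
  shows "\<exists>k\<in>partitions_of n. mset (part_list n k) = mset ds"
proof -
  define k where "k = count (mset ds)"
  have eq: "mset (part_list n k) = mset ds"
  proof (rule multiset_eqI)
    fix i show "count (mset (part_list n k)) i = count (mset ds) i"
      using assms(1) count_inI[of "mset ds" i] by (auto simp: count_part_list k_def)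
  qed
  have "(\<Sum>j=1..n. j * k j) = n"
    using arg_cong[OF eq, of sum_mset] assms(2) by (simp add: sum_mset_sum_list sum_part_list)
  moreover have "k j = 0" if "j \<notin> {1..n}" for j
    using that assms(1) count_inI[of "mset ds" j] by (auto simp: k_def)
  ultimately show ?thesis using eq by (auto simp: partitions_of_def)
qed

section \<open>Semisimple points and their types\<close>

context generated_group
begin

definition "irred_sum L \<longleftrightarrow>
  (\<forall>(m, \<sigma>)\<in>set L. irred (carrier \<Gamma>) m \<sigma> \<and> rels mtab {\<one>\<^bsub>\<Gamma>\<^esub>} m \<sigma>) \<and> dims L = n"

definition "pt L = git_point \<Gamma> n (restrict (dsum L) (carrier \<Gamma>))"

lemma mtab_sub: "mtab \<subseteq> carrier \<Gamma> \<times> carrier \<Gamma> \<times> carrier \<Gamma>" "{\<one>\<^bsub>\<Gamma>\<^esub>} \<subseteq> carrier \<Gamma>"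
  by auto

lemma irred_sum_fams: "irred_sum L \<Longrightarrow> \<forall>(m, \<sigma>)\<in>set L. fam m (carrier \<Gamma>) \<sigma>"
  by (auto simp: irred_sum_def irred_def)

lemma irred_sum_fam: "irred_sum L \<Longrightarrow> fam n (carrier \<Gamma>) (dsum L)"
  using fam_dsum[OF irred_sum_fams[of L]] by (simp add: irred_sum_def)

lemma irred_sum_Reps: "irred_sum L \<Longrightarrow> restrict (dsum L) (carrier \<Gamma>) \<in> Y"
  using rels_dsum[OF mtab_sub, of L] irred_sum_fams[of L] irred_sum_fam[of L]
  by (intro restrict_Reps) (auto simp: irred_sum_def split_beta)

lemma irred_sum_dims: "irred_sum L \<Longrightarrow> set (map fst L) \<subseteq> {1..n} \<and> sum_list (map fst L) = n"
proof -
  assume L: "irred_sum L"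
  have "1 \<le> m \<and> m \<le> n" if "m \<in> set (map fst L)" for m
    using that L member_le_sum_list[OF that] by (auto simp: irred_sum_def irred_def dims_def Suc_le_eq)
  then have "set (map fst L) \<subseteq> {1..n}" unfolding subset_iff atLeastAtMost_iff by blast
  then show ?thesis using L by (simp add: irred_sum_def dims_def)
qed

lemma irred_sum_mset: "irred_sum L \<Longrightarrow> mset L = mset M \<Longrightarrow> irred_sum M"
proof -
  assume L: "irred_sum L" and M: "mset L = mset M"
  have "sum_mset (mset (map fst L)) = sum_mset (mset (map fst M))" using M by (simp only: mset_map)
  then have "dims L = dims M" unfolding sum_mset_sum_list by (simp add: dims_def)
  then show "irred_sum M" using L mset_eq_setD[OF M] by (simp add: irred_sum_def)
qed

lemma git_point_eq:
  assumes "\<rho> \<in> Y" "\<rho>' \<in> Y" "\<And>p. p \<in> N.P \<Longrightarrow> N.invar p \<Longrightarrow> p \<rho> = p \<rho>'"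
  shows "git_point \<Gamma> n \<rho> = git_point \<Gamma> n \<rho>'"
proof -
  have "f \<rho> = f \<rho>'" if "f \<in> A" for f using A_E[OF that] assms by auto
  then show ?thesis unfolding git_point_def by metis
qed

text \<open>An invariant minus its value at \<open>\<rho>\<close> lies in the ideal of
  \<open>\<rho>\<close>, hence also in that of \<open>\<rho>'\<close>.\<close>

lemma git_point_inj:
  assumes r: "\<rho> \<in> Y" "\<rho>' \<in> Y" and eq: "git_point \<Gamma> n \<rho> = git_point \<Gamma> n \<rho>'"
    and p: "p \<in> N.P" "N.invar p"
  shows "p \<rho> = p \<rho>'"
proof -
  have "(\<lambda>y\<in>Y. restrict p Y y - p \<rho>) \<in> git_point \<Gamma> n \<rho>"
    using fun_subalgebra_diff[OF A_subalgebra A_I[OF p], of "p \<rho>"] r by (simp add: git_point_def)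
  then have "(\<lambda>y\<in>Y. restrict p Y y - p \<rho>) \<in> git_point \<Gamma> n \<rho>'" by (simp add: eq)
  then show ?thesis using r by (simp add: git_point_def)
qed

lemma P_restrict: "p \<in> N.P \<Longrightarrow> p (restrict X (carrier \<Gamma>)) = p X"
  by (rule N.P_cong) (use S_subset in auto)

lemma P_conj:
  assumes p: "p \<in> N.P" "N.invar p" and X: "fam n (carrier \<Gamma>) X" and gh: "inv_pair n g h"
  shows "p (\<lambda>l. g * X l * h) = p X"
proof -
  have "p (\<lambda>l. g * X l * h) = p (bact [n] (g, h) X)"
    by (rule N.P_cong[OF p(1)]) (use X S_subset in \<open>auto simp: bact_def fam_def prbd_singleton\<close>)
  also have "\<dots> = p X" using p(2) gh by (simp add: N.invar_def bdpairs_singleton)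
  finally show ?thesis .
qed

lemma P_cont_conj:
  assumes p: "p \<in> N.P" "N.invar p"
  shows "cont_on_fams (carrier \<Gamma>) n p" "conj_inv (carrier \<Gamma>) n p"
  using N.P_cont[OF S_subset p(1)] P_conj[OF p] by (auto simp: conj_inv_def)

lemma P_block_conj_inv:
  assumes p: "p \<in> N.P" "N.invar p" and ds: "sum_list ds = n"
  shows "block_conj_inv (carrier \<Gamma>) ds p"
  unfolding block_conj_inv_def
proof (intro allI impI)
  fix X gs hs
  assume *: "fam (sum_list ds) (carrier \<Gamma>) X \<and> length gs = length ds \<and> length hs = length ds \<and>
        (\<forall>i<length ds. inv_pair (ds ! i) (gs ! i) (hs ! i))"
  then have "inv_pair n (diag_block_mat gs) (diag_block_mat hs)"
    using inv_pair_diag_block[of gs ds hs] ds by simp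
  then show "p (\<lambda>l. diag_block_mat gs * X l * diag_block_mat hs) = p X"
    using * ds by (intro P_conj[OF p]) auto
qed

lemma pt_mset:
  assumes L: "irred_sum L" and M: "mset L = mset M"
  shows "pt L = pt M"
  unfolding pt_def
proof (rule git_point_eq)
  show "restrict (dsum L) (carrier \<Gamma>) \<in> Y" "restrict (dsum M) (carrier \<Gamma>) \<in> Y"
    using irred_sum_Reps[OF L] irred_sum_Reps[OF irred_sum_mset[OF L M]] .
  fix p assume p: "p \<in> N.P" "N.invar p"
  obtain g h where gh: "inv_pair n g h" "\<forall>l\<in>carrier \<Gamma>. dsum M l = g * dsum L l * h"
    using fam_sim_dsum[OF M irred_sum_fams[OF L]] L by (auto simp: fam_sim_def irred_sum_def)
  have "p (dsum M) = p (\<lambda>l. g * dsum L l * h)"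
    by (rule N.P_cong[OF p(1)]) (use gh(2) S_subset in auto)
  also have "\<dots> = p (dsum L)" by (rule P_conj[OF p irred_sum_fam[OF L] gh(1)])
  finally show "p (restrict (dsum L) (carrier \<Gamma>)) = p (restrict (dsum M) (carrier \<Gamma>))"
    by (simp add: P_restrict[OF p(1)])
qed

lemma wd_Reps:
  assumes "\<rho> \<in> Reps \<Gamma> m"
  shows "w \<in> lists (carrier \<Gamma>) \<Longrightarrow> evalw \<Gamma> w \<in> carrier \<Gamma> \<and> wd m \<rho> w = \<rho> (evalw \<Gamma> w)"
  by (induction w) (use assms in \<open>auto simp: Reps_one Reps_mult\<close>)

text \<open>Equal points have equal invariants, in particular equal traces of words in
  \<open>S\<close>. As every element of the group is such a word, the characters on the whole group
  agree.\<close>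

lemma pt_dims:
  assumes L: "irred_sum L" and M: "irred_sum M" and eq: "pt L = pt M"
  shows "mset (map fst L) = mset (map fst M)"
proof (rule character_determines_dims)
  show "\<forall>(m, \<sigma>)\<in>set L. irred (carrier \<Gamma>) m \<sigma>" "\<forall>(m, \<sigma>)\<in>set M. irred (carrier \<Gamma>) m \<sigma>"
    using L M by (auto simp: irred_sum_def)
  fix w assume w: "w \<in> lists (carrier \<Gamma>)"
  have "evalw \<Gamma> w \<in> carrier \<Gamma>" using wd_Reps[OF irred_sum_Reps[OF L] w] by simp
  then obtain u where u: "u \<in> lists S" "evalw \<Gamma> w = evalw \<Gamma> u" using words by metis
  have *: "(\<Sum>(m, \<sigma>)\<leftarrow>L. tr (wd m \<sigma> w)) = N.tw u (restrict (dsum L) (carrier \<Gamma>))" if L: "irred_sum L" for L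
  proof -
    let ?r = "restrict (dsum L) (carrier \<Gamma>)"
    have r: "?r \<in> Y" by (rule irred_sum_Reps[OF L])
    have "(\<Sum>(m, \<sigma>)\<leftarrow>L. tr (wd m \<sigma> w)) = tr (wd n (dsum L) w)"
      using tr_wd_dsum[OF w irred_sum_fams[OF L]] L by (simp add: irred_sum_def)
    also have "wd n (dsum L) w = wd n ?r w" by (rule wd_cong) (use w in auto)
    also have "\<dots> = wd n (prbd [n] ?r) u" using wd_Reps[OF r w] Y_prbd_word[OF r u(1)] u(2) by simp
    finally show ?thesis by (simp add: N.tw_def)
  qed
  have "N.tw u (restrict (dsum L) (carrier \<Gamma>)) = N.tw u (restrict (dsum M) (carrier \<Gamma>))"
    by (rule git_point_inj[OF irred_sum_Reps[OF L] irred_sum_Reps[OF M] eq[unfolded pt_def]])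
      (rule N.hpol_P[OF N.tw_hpol[OF u(1)]] N.tw_invar[OF u(1)])+
  then show "(\<Sum>(m, \<sigma>)\<leftarrow>L. tr (wd m \<sigma> w)) = (\<Sum>(m, \<sigma>)\<leftarrow>M. tr (wd m \<sigma> w))"
    by (simp only: *[OF L] *[OF M])
qed

definition "type_set ds = {pt L | L. irred_sum L \<and> mset (map fst L) = mset ds}"

text \<open>The closure of the image of the block representations, written as a common zero set.
  \<open>block_lying_over\<close> shows that it is the image itself.\<close>

definition "closed_type ds =
  {M. maximalideal M (function_ring Y\<lparr>carrier := A\<rparr>) \<and> (\<forall>f\<in>A. (\<forall>\<rho>\<in>block_reps ds. f \<rho> = 0) \<longrightarrow> f \<in> M)}"

lemma pt_maximal: "irred_sum L \<Longrightarrow> maximalideal (pt L) (function_ring Y\<lparr>carrier := A\<rparr>)"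
  unfolding pt_def git_point_def by (rule maximalideal_point[OF A_subalgebra irred_sum_Reps])

text \<open>Lying over provides a block diagonal representation above the point. Degenerating each
  block does not move the point, and the irreducible summands stay grouped into blocks of the sizes
  \<open>ds\<close>.\<close>

lemma closed_type_pt:
  assumes ds: "sum_list ds = n" and M: "M \<in> closed_type ds"
  shows "\<exists>Ls. irred_sum (concat Ls) \<and> map dims Ls = ds \<and> M = pt (concat Ls)"
proof -
  obtain \<rho> where r: "\<rho> \<in> block_reps ds" "M = git_point \<Gamma> n \<rho>"
    using block_lying_over[OF ds, of M] M by (auto simp: closed_type_def)
  have rY: "\<rho> \<in> Y" using r(1) by (simp add: block_reps_def)
  obtain \<Xi> where X: "map fst \<Xi> = ds" "\<forall>(m, X)\<in>set \<Xi>. fam m (carrier \<Gamma>) X" "\<forall>l\<in>carrier \<Gamma>. \<rho> l = dsum \<Xi> l"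
    using bd_family_decomp[of "carrier \<Gamma>" \<rho> ds] r(1) by (auto simp: block_reps_def)
  have dX: "dims \<Xi> = n" using ds X(1) by (simp add: dims_def)
  have "rels mtab {\<one>\<^bsub>\<Gamma>\<^esub>} n (dsum \<Xi>)"
    using rY X(3) unfolding Reps_iff rels_def by auto
  then have "\<forall>(m, X)\<in>set \<Xi>. rels mtab {\<one>\<^bsub>\<Gamma>\<^esub>} m X"
    using rels_dsumD[OF mtab_sub X(2)] dX by simp
  then have "\<forall>(m, X)\<in>set \<Xi>. fam m (carrier \<Gamma>) X \<and> rels mtab {\<one>\<^bsub>\<Gamma>\<^esub>} m X" using X(2) by auto
  from block_degeneration[OF this mtab_sub] obtain Ls where
    Ls: "list_all2 (\<lambda>p L. dims L = fst p) \<Xi> Ls"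
      "\<forall>(m, \<sigma>)\<in>set (concat Ls). irred (carrier \<Gamma>) m \<sigma> \<and> rels mtab {\<one>\<^bsub>\<Gamma>\<^esub>} m \<sigma>"
      "\<forall>f. cont_on_fams (carrier \<Gamma>) (dims \<Xi>) f \<and> block_conj_inv (carrier \<Gamma>) (map fst \<Xi>) f \<longrightarrow>
         f (dsum \<Xi>) = f (dsum (concat Ls))" by blast
  have dl: "map dims Ls = ds" using Ls(1) unfolding X(1)[symmetric]
    by (induction rule: list_all2_induct) auto
  have "dims (concat Ls) = sum_list (map dims Ls)" by (induction Ls) auto
  then have L: "irred_sum (concat Ls)" using Ls(2) ds dl by (simp add: irred_sum_def)
  have "M = pt (concat Ls)" unfolding r(2) pt_def
  proof (rule git_point_eq[OF rY irred_sum_Reps[OF L]])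
    fix p assume p: "p \<in> N.P" "N.invar p"
    have "p \<rho> = p (dsum \<Xi>)" by (rule N.P_cong[OF p(1)]) (use X(3) S_subset in auto)
    also have "\<dots> = p (dsum (concat Ls))"
      using Ls(3) P_cont_conj(1)[OF p] P_block_conj_inv[OF p ds] dX X(1) by auto
    finally show "p \<rho> = p (restrict (dsum (concat Ls)) (carrier \<Gamma>))" by (simp add: P_restrict[OF p(1)])
  qed
  then show ?thesis using L dl by blast
qed

lemma pt_closed_type:
  assumes L: "irred_sum L"
  shows "pt L \<in> closed_type (map fst L)"
proof -
  have "dsum L l \<in> bd (map fst L)" if "l \<in> carrier \<Gamma>" for l
    unfolding dsum_def
  proof (rule diag_block_bd)
    fix i assume "i < length (map fst L)"
    moreover obtain m \<sigma> where "L ! i = (m, \<sigma>)" by (cases "L ! i")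
    ultimately show "map (\<lambda>(m, \<sigma>). \<sigma> l) L ! i \<in> carrier_mat (map fst L ! i) (map fst L ! i)"
      using irred_sum_fams[OF L] that nth_mem[of i L] by (auto simp: fam_def)
  qed simp
  then have "restrict (dsum L) (carrier \<Gamma>) \<in> block_reps (map fst L)"
    using irred_sum_Reps[OF L] by (simp add: block_reps_def)
  then show ?thesis using pt_maximal[OF L] by (auto simp: closed_type_def pt_def git_point_def)
qed

lemma type_set_closed_type: "type_set ds \<subseteq> closed_type ds"
proof
  fix M assume "M \<in> type_set ds"
  then obtain L where L: "M = pt L" "irred_sum L" "mset (map fst L) = mset ds" by (auto simp: type_set_def)
  obtain L' where L': "mset L' = mset L" "map fst L' = ds" using mset_map_arrange[OF L(3)] by blast
  show "M \<in> closed_type ds"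
    using pt_closed_type[OF irred_sum_mset[OF L(2) L'(1)[symmetric]]] pt_mset[OF L(2) L'(1)[symmetric]] L(1) L'(2) by simp
qed

text \<open>A proper refinement has more parts. Removing all types with more parts therefore removes
  all proper refinements, without any mention of the refinement order.\<close>

definition "longer ds = {ds'. set ds' \<subseteq> {1..n} \<and> sum_list ds' = n \<and> length ds < length ds'}"

lemma finite_longer: "finite (longer ds)"
proof (rule finite_subset)
  show "longer ds \<subseteq> {ds'. set ds' \<subseteq> {1..n} \<and> length ds' \<le> n}"
  proof -
    have "length ds' \<le> sum_list ds'" if "set ds' \<subseteq> {1..n}" for ds' :: "nat list"
      using that by (induction ds') auto
    then show ?thesis by (auto simp: longer_def)
  qed
  show "finite {ds'. set ds' \<subseteq> {1..n} \<and> length ds' \<le> n}" by (rule finite_lists_length_le) simp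
qed

text \<open>
  A semisimple representation degenerating from a block diagonal one of type \<open>ds\<close> has a type that
  refines \<open>ds\<close>, so it has either the type \<open>ds\<close> itself or strictly more summands.
\<close>

theorem type_set_eq:
  assumes ds: "set ds \<subseteq> {1..n}" "sum_list ds = n"
  shows "type_set ds = closed_type ds - (\<Union>ds'\<in>longer ds. closed_type ds')"
proof
  have nonempty: "\<forall>L\<in>set Ls. L \<noteq> []" if "map dims Ls = ds'" "set ds' \<subseteq> {1..n}"
    for Ls :: "(nat \<times> ('a \<Rightarrow> complex mat)) list list" and ds'
  proof
    fix L assume "L \<in> set Ls"
    then have "dims L \<in> set ds'" using that(1) by auto
    then have "dims L \<in> {1..n}" using that(2) by blast
    then show "L \<noteq> []" by auto
  qed
  have "M \<notin> closed_type ds'" if "M \<in> type_set ds" and d: "ds' \<in> longer ds" for M ds'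
  proof
    assume M: "M \<in> closed_type ds'"
    have d: "set ds' \<subseteq> {1..n}" "sum_list ds' = n" "length ds < length ds'" using d by (auto simp: longer_def)
    obtain L where L: "M = pt L" "irred_sum L" "mset (map fst L) = mset ds"
      using \<open>M \<in> type_set ds\<close> by (auto simp: type_set_def)
    obtain Ls where Ls: "irred_sum (concat Ls)" "map dims Ls = ds'" "M = pt (concat Ls)"
      using closed_type_pt[OF d(2) M] by blast
    have "mset (map fst (concat Ls)) = mset ds"
      using pt_dims[OF Ls(1) L(2)] L(1,3) Ls(3) by simp
    then have "length (concat Ls) = length ds" by (metis length_map mset_eq_length)
    moreover have "length ds' \<le> length (concat Ls)"
      using length_concat_ge[OF nonempty[OF Ls(2) d(1)]] Ls(2) by auto
    ultimately show False using d(3) by simp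
  qed
  then show "type_set ds \<subseteq> closed_type ds - (\<Union>ds'\<in>longer ds. closed_type ds')"
    using type_set_closed_type by auto
  show "closed_type ds - (\<Union>ds'\<in>longer ds. closed_type ds') \<subseteq> type_set ds"
  proof
    fix M assume M: "M \<in> closed_type ds - (\<Union>ds'\<in>longer ds. closed_type ds')"
    obtain Ls where Ls: "irred_sum (concat Ls)" "map dims Ls = ds" "M = pt (concat Ls)"
      using closed_type_pt[OF ds(2)] M by blast
    note ne = nonempty[OF Ls(2) ds(1)]
    have "map fst (concat Ls) \<notin> longer ds" using pt_closed_type[OF Ls(1)] M Ls(3) by auto
    then have "length (concat Ls) \<le> length ds"
      using irred_sum_dims[OF Ls(1)] unfolding longer_def mem_Collect_eq length_map not_less[symmetric] by blast
    then have "length (concat Ls) = length Ls" using length_concat_ge[OF ne] Ls(2) by auto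
    from concat_of_singletons[OF ne this] have "map fst (concat Ls) = ds" using Ls(2) by simp
    then show "M \<in> type_set ds" unfolding type_set_def using Ls(1,3) by blast
  qed
qed

text \<open>Every representation is block diagonal for the single block \<open>n\<close>, and an
  invariant function that vanishes on all representations is zero, so the hypothesis of lying over
  holds trivially.\<close>

lemma maximalideal_pt:
  assumes M: "maximalideal M (function_ring Y\<lparr>carrier := A\<rparr>)"
  shows "\<exists>L. irred_sum L \<and> M = pt L"
proof -
  have "f \<in> M" if "f \<in> A" "\<And>\<rho>. \<rho> \<in> Y \<Longrightarrow> f \<rho> = 0" for f
  proof -
    have "f = (\<lambda>y\<in>Y. 0)" using that fun_subalgebraD(1)[OF A_subalgebra] by (intro ext) (auto simp: extensional_def)
    then show ?thesis using maximalidealD(2)[OF A_subalgebra M] by simp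
  qed
  moreover have "block_reps [n] = Y" by (auto simp: block_reps_def bd_singleton Reps_carrier)
  ultimately have "M \<in> closed_type [n]" using M by (simp add: closed_type_def)
  then show ?thesis using closed_type_pt[of "[n]" M] by auto
qed

text \<open>The same direct sums are described once by lists sorted by dimension and once by lists
  in any order; reordering and conjugation do not change the point.\<close>

lemma stratum_eq:
  assumes k: "k \<in> partitions_of n"
  shows "stratum \<Gamma> n k = type_set (part_list n k)"
proof
  have sum: "sum_list (part_list n k) = n" using k by (simp add: sum_part_list partitions_of_def)
  show "stratum \<Gamma> n k \<subseteq> type_set (part_list n k)"
  proof
    fix M assume "M \<in> stratum \<Gamma> n k"
    then obtain \<rho> \<sigma> g where r: "M = git_point \<Gamma> n \<rho>" "\<rho> \<in> Y" "g \<in> carrier (GL n)"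
        "\<rho> = conj_action \<Gamma> n g (direct_sum_rep \<Gamma> (concat (map \<sigma> [1..<Suc n])))"
      and s: "\<And>j. j \<in> {1..n} \<Longrightarrow> length (\<sigma> j) = k j"
        "\<And>j \<tau>. j \<in> {1..n} \<Longrightarrow> \<tau> \<in> set (\<sigma> j) \<Longrightarrow> irreducible_rep \<Gamma> j \<tau>"
      by (auto simp: stratum_def type_polystable_def)
    define L where "L = concat (map (\<lambda>j. map (Pair j) (\<sigma> j)) [1..<Suc n])"
    have fstL: "map fst L = part_list n k"
      unfolding L_def part_list_def map_concat map_map comp_def
      by (intro arg_cong[of _ _ concat] map_cong HOL.refl) (auto simp: s(1) map_replicate_const)
    have sndL: "map snd L = concat (map \<sigma> [1..<Suc n])"
      unfolding L_def map_concat map_map comp_def by simp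
    have L: "irred_sum L"
      using s(2) sum unfolding irred_sum_def dims_def fstL
      by (auto simp: L_def irreducible_rep_iff Reps_iff)
    have ds: "direct_sum_rep \<Gamma> (concat (map \<sigma> [1..<Suc n])) = restrict (dsum L) (carrier \<Gamma>)"
      unfolding sndL[symmetric] direct_sum_rep_def dsum_def map_map comp_def by (simp only: case_prod_beta')
    obtain h where gh: "inv_pair n g h" using r(3) by (auto simp: carrier_GL)
    have "M = pt L" unfolding r(1) pt_def
    proof (rule git_point_eq[OF r(2) irred_sum_Reps[OF L]])
      fix p assume p: "p \<in> N.P" "N.invar p"
      have "p \<rho> = p (\<lambda>l. g * dsum L l * h)"
        by (rule N.P_cong[OF p(1)]) (use S_subset in \<open>auto simp: r(4)[unfolded ds] conj_action_eq[OF gh]\<close>)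
      also have "\<dots> = p (dsum L)" by (rule P_conj[OF p irred_sum_fam[OF L] gh])
      finally show "p \<rho> = p (restrict (dsum L) (carrier \<Gamma>))" by (simp add: P_restrict[OF p(1)])
    qed
    then show "M \<in> type_set (part_list n k)" unfolding type_set_def mem_Collect_eq using L fstL by (intro exI[of _ L] conjI) simp_all
  qed
  show "type_set (part_list n k) \<subseteq> stratum \<Gamma> n k"
  proof
    fix M assume "M \<in> type_set (part_list n k)"
    then obtain L0 where L0: "M = pt L0" "irred_sum L0" "mset (map fst L0) = mset (part_list n k)"
      by (auto simp: type_set_def)
    obtain L where L: "mset L = mset L0" "map fst L = part_list n k" using mset_map_arrange[OF L0(3)] by blast
    have iL: "irred_sum L" "M = pt L"
      using irred_sum_mset[OF L0(2) L(1)[symmetric]] pt_mset[OF L0(2) L(1)[symmetric]] L0(1) by simp_all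
    have "distinct [1..<Suc n]" by simp
    from split_by_concat_replicate[OF this L(2)[unfolded part_list_def]] obtain \<sigma> where
      s: "L = concat (map (\<lambda>j. map (Pair j) (\<sigma> j)) [1..<Suc n])" "\<forall>j\<in>set [1..<Suc n]. length (\<sigma> j) = k j" by blast
    \<comment> \<open>Representations are \<open>undefined\<close> outside the group, while summands
      of an \<open>irred_sum\<close> are arbitrary there; hence the restriction.\<close>
    define \<sigma>' where "\<sigma>' j = map (\<lambda>\<tau>. restrict \<tau> (carrier \<Gamma>)) (\<sigma> j)" for j
    have sndL: "map (\<lambda>\<tau>. restrict \<tau> (carrier \<Gamma>)) (map snd L) = concat (map \<sigma>' [1..<Suc n])"
      unfolding s(1) \<sigma>'_def map_concat map_map comp_def by simp
    have ds: "direct_sum_rep \<Gamma> (concat (map \<sigma>' [1..<Suc n])) = restrict (dsum L) (carrier \<Gamma>)"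
      unfolding sndL[symmetric] direct_sum_rep_def dsum_def map_map comp_def
      by (intro restrict_ext) (simp add: case_prod_beta')
    have irr: "irreducible_rep \<Gamma> j \<tau>" if j: "j \<in> {1..n}" and t: "\<tau> \<in> set (\<sigma>' j)" for j \<tau>
    proof -
      obtain \<tau>0 where t0: "\<tau>0 \<in> set (\<sigma> j)" "\<tau> = restrict \<tau>0 (carrier \<Gamma>)" using t by (auto simp: \<sigma>'_def)
      have "(j, \<tau>0) \<in> set L" using t0(1) j unfolding s(1) by (auto simp del: upt_Suc)
      then have "irred (carrier \<Gamma>) j \<tau>0" "rels mtab {\<one>\<^bsub>\<Gamma>\<^esub>} j \<tau>0" using iL(1) by (auto simp: irred_sum_def)
      then show ?thesis unfolding irreducible_rep_iff t0(2) using restrict_Reps[of j \<tau>0]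
        by (simp add: irred_def fam_def)
    qed
    let ?r = "restrict (dsum L) (carrier \<Gamma>)"
    have rY: "?r \<in> Y" by (rule irred_sum_Reps[OF iL(1)])
    have one: "1\<^sub>m n \<in> carrier (GL n)" using inv_pair_one[of n] by (auto simp: carrier_GL)
    have conj: "?r = conj_action \<Gamma> n (1\<^sub>m n) (direct_sum_rep \<Gamma> (concat (map \<sigma>' [1..<Suc n])))"
      unfolding ds conj_action_eq[OF inv_pair_one]
      by (rule restrict_ext) (use irred_sum_fam[OF iL(1)] in \<open>simp add: fam_def left_mult_one_mat[of _ n n] right_mult_one_mat[of _ n n]\<close>)
    have len: "length (\<sigma>' j) = k j" if "j \<in> {1..n}" for j using s(2) that by (simp add: \<sigma>'_def del: upt_Suc)
    have "type_polystable \<Gamma> n k ?r" unfolding type_polystable_def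
      by (intro conjI exI[of _ \<sigma>'] ballI bexI[of _ "1\<^sub>m n"] rY irr one conj len)
    then show "M \<in> stratum \<Gamma> n k" unfolding stratum_def iL(2) pt_def by (intro imageI CollectI)
  qed
qed

lemma union_strata:
  "(\<Union>k\<in>partitions_of n. stratum \<Gamma> n k) = {M. maximalideal M (function_ring Y\<lparr>carrier := A\<rparr>)}"
proof
  have "maximalideal M (function_ring Y\<lparr>carrier := A\<rparr>)" if "M \<in> stratum \<Gamma> n k" "k \<in> partitions_of n" for M k
    using that pt_maximal by (auto simp: stratum_eq type_set_def)
  then show "(\<Union>k\<in>partitions_of n. stratum \<Gamma> n k) \<subseteq> {M. maximalideal M (function_ring Y\<lparr>carrier := A\<rparr>)}"
    by blast
  have "\<exists>k\<in>partitions_of n. M \<in> stratum \<Gamma> n k" if M: "maximalideal M (function_ring Y\<lparr>carrier := A\<rparr>)" for M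
  proof -
    obtain L where L: "irred_sum L" "M = pt L" using maximalideal_pt[OF M] by blast
    obtain k where "k \<in> partitions_of n" "mset (part_list n k) = mset (map fst L)"
      using part_list_exists[of "map fst L" n] irred_sum_dims[OF L(1)] by auto
    then show ?thesis using L by (intro bexI[of _ k]) (auto simp: stratum_eq type_set_def)
  qed
  then show "{M. maximalideal M (function_ring Y\<lparr>carrier := A\<rparr>)} \<subseteq> (\<Union>k\<in>partitions_of n. stratum \<Gamma> n k)"
    by blast
qed

lemma disjoint_strata: "disjoint_family_on (stratum \<Gamma> n) (partitions_of n)"
  unfolding disjoint_family_on_def
proof (intro ballI impI)
  fix k k' assume k: "k \<in> partitions_of n" "k' \<in> partitions_of n" "k \<noteq> k'"
  have False if M: "M \<in> type_set (part_list n k)" "M \<in> type_set (part_list n k')" for M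
  proof -
    obtain L where L: "M = pt L" "irred_sum L" "mset (map fst L) = mset (part_list n k)"
      using M(1) by (auto simp: type_set_def)
    obtain L' where L': "M = pt L'" "irred_sum L'" "mset (map fst L') = mset (part_list n k')"
      using M(2) by (auto simp: type_set_def)
    have "mset (part_list n k) = mset (part_list n k')"
      using pt_dims[OF L(2) L'(2)] L(1,3) L'(1,3) by simp
    then show False using part_list_inj[OF k(1,2)] k(3) by simp
  qed
  then show "stratum \<Gamma> n k \<inter> stratum \<Gamma> n k' = {}" using k by (auto simp: stratum_eq)
qed

end

section \<open>Homogeneous polynomials and Zariski topologies\<close>

definition exps :: "nat \<Rightarrow> nat \<Rightarrow> (nat \<Rightarrow> nat) set" where
  "exps N d = {\<alpha> \<in> {..N} \<rightarrow>\<^sub>E UNIV. sum \<alpha> {..N} = d}"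

definition vmonom :: "nat \<Rightarrow> (nat \<Rightarrow> nat) \<Rightarrow> complex vec \<Rightarrow> complex" where
  "vmonom N \<alpha> = (\<lambda>v. \<Prod>i\<le>N. (v $ i) ^ \<alpha> i)"

lemma finite_exps: "finite (exps N d)"
proof (rule finite_subset)
  show "exps N d \<subseteq> {..N} \<rightarrow>\<^sub>E {..d}"
  proof
    fix \<alpha> assume a: "\<alpha> \<in> exps N d"
    have "\<alpha> i \<le> d" if "i \<le> N" for i
      using a member_le_sum[of i "{..N}" \<alpha>] that by (auto simp: exps_def)
    then show "\<alpha> \<in> {..N} \<rightarrow>\<^sub>E {..d}" using a by (auto simp: exps_def PiE_def)
  qed
qed (auto intro: finite_PiE)

lemma homogeneous_polys_eq:
  "homogeneous_polys N d = {F. \<exists>c. F = (\<lambda>v. \<Sum>\<alpha>\<in>exps N d. c \<alpha> * vmonom N \<alpha> v)}"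
  by (simp add: homogeneous_polys_def exps_def vmonom_def)

lemma homogeneous_monom: "\<alpha> \<in> exps N d \<Longrightarrow> vmonom N \<alpha> \<in> homogeneous_polys N d"
  unfolding homogeneous_polys_eq
  by (intro CollectI exI[of _ "\<lambda>\<beta>. if \<beta> = \<alpha> then 1 else 0"] ext)
    (simp add: finite_exps if_distrib[of "\<lambda>c. c * _"] cong: if_cong)

lemma homogeneous_add:
  assumes "F \<in> homogeneous_polys N d" "G \<in> homogeneous_polys N d"
  shows "(\<lambda>v. F v + G v) \<in> homogeneous_polys N d"
proof -
  obtain c c' where "F = (\<lambda>v. \<Sum>\<alpha>\<in>exps N d. c \<alpha> * vmonom N \<alpha> v)" "G = (\<lambda>v. \<Sum>\<alpha>\<in>exps N d. c' \<alpha> * vmonom N \<alpha> v)"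
    using assms by (auto simp: homogeneous_polys_eq)
  then show ?thesis unfolding homogeneous_polys_eq
    by (intro CollectI exI[of _ "\<lambda>\<alpha>. c \<alpha> + c' \<alpha>"]) (simp add: distrib_right sum.distrib)
qed

lemma homogeneous_scale:
  assumes "F \<in> homogeneous_polys N d"
  shows "(\<lambda>v. b * F v) \<in> homogeneous_polys N d"
proof -
  obtain c where "F = (\<lambda>v. \<Sum>\<alpha>\<in>exps N d. c \<alpha> * vmonom N \<alpha> v)"
    using assms by (auto simp: homogeneous_polys_eq)
  then show ?thesis unfolding homogeneous_polys_eq
    by (intro CollectI exI[of _ "\<lambda>\<alpha>. b * c \<alpha>"]) (simp add: sum_distrib_left mult.assoc)
qed

lemma homogeneous_sum:
  assumes "\<And>i. i \<in> I \<Longrightarrow> F i \<in> homogeneous_polys N d"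
  shows "(\<lambda>v. \<Sum>i\<in>I. F i v) \<in> homogeneous_polys N d"
proof -
  have "\<forall>i\<in>I. \<exists>c. F i = (\<lambda>v. \<Sum>\<alpha>\<in>exps N d. c \<alpha> * vmonom N \<alpha> v)"
    using assms by (auto simp: homogeneous_polys_eq)
  then obtain c where "\<forall>i\<in>I. F i = (\<lambda>v. \<Sum>\<alpha>\<in>exps N d. c i \<alpha> * vmonom N \<alpha> v)" by metis
  then show ?thesis unfolding homogeneous_polys_eq
    by (intro CollectI exI[of _ "\<lambda>\<alpha>. \<Sum>i\<in>I. c i \<alpha>"])
      (simp add: sum_distrib_right sum.swap[of _ I])
qed

lemma homogeneous_mult:
  assumes F: "F \<in> homogeneous_polys N d" and G: "G \<in> homogeneous_polys N e"
  shows "(\<lambda>v. F v * G v) \<in> homogeneous_polys N (d + e)"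
proof -
  obtain c c' where c: "F = (\<lambda>v. \<Sum>\<alpha>\<in>exps N d. c \<alpha> * vmonom N \<alpha> v)" "G = (\<lambda>v. \<Sum>\<beta>\<in>exps N e. c' \<beta> * vmonom N \<beta> v)"
    using assms by (auto simp: homogeneous_polys_eq)
  have "(\<lambda>v. vmonom N \<alpha> v * vmonom N \<beta> v) \<in> homogeneous_polys N (d + e)"
    if "\<alpha> \<in> exps N d" "\<beta> \<in> exps N e" for \<alpha> \<beta>
  proof -
    have "(\<lambda>i\<in>{..N}. \<alpha> i + \<beta> i) \<in> exps N (d + e)" using that by (auto simp: exps_def sum.distrib)
    moreover have "vmonom N (\<lambda>i\<in>{..N}. \<alpha> i + \<beta> i) = (\<lambda>v. vmonom N \<alpha> v * vmonom N \<beta> v)"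
      by (simp add: vmonom_def power_add prod.distrib)
    ultimately show ?thesis using homogeneous_monom by metis
  qed
  then have "(\<lambda>v. \<Sum>\<alpha>\<in>exps N d. \<Sum>\<beta>\<in>exps N e. (c \<alpha> * c' \<beta>) * (vmonom N \<alpha> v * vmonom N \<beta> v)) \<in> homogeneous_polys N (d + e)"
    by (intro homogeneous_sum homogeneous_scale)
  moreover have "(\<lambda>v. F v * G v) =
      (\<lambda>v. \<Sum>\<alpha>\<in>exps N d. \<Sum>\<beta>\<in>exps N e. (c \<alpha> * c' \<beta>) * (vmonom N \<alpha> v * vmonom N \<beta> v))"
    unfolding c sum_product by (intro ext sum.cong HOL.refl) (simp add: mult_ac)
  ultimately show ?thesis by simp
qed

lemma homogeneous_const: "(\<lambda>_. c) \<in> homogeneous_polys N 0"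
proof -
  have "(\<lambda>i\<in>{..N}. 0) \<in> exps N 0" by (simp add: exps_def)
  from homogeneous_scale[OF homogeneous_monom[OF this], of c] show ?thesis by (simp add: vmonom_def)
qed

lemma homogeneous_coord:
  assumes "i \<le> N"
  shows "(\<lambda>v. v $ i) \<in> homogeneous_polys N 1"
proof -
  have "(\<lambda>j\<in>{..N}. if j = i then 1 else 0) \<in> exps N 1" using assms by (simp add: exps_def)
  moreover have "vmonom N (\<lambda>j\<in>{..N}. if j = i then 1 else 0) = (\<lambda>v. v $ i)"
    using assms by (simp add: vmonom_def fun_eq_iff power_0 if_distrib[of "\<lambda>e. _ ^ e"] prod.delta cong: if_cong)
  ultimately show ?thesis using homogeneous_monom by metis
qed

text \<open>The factor is 1 on the chart where coordinate 0 equals 1; it serves to equalize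
  degrees.\<close>

lemma homogeneous_raise:
  "F \<in> homogeneous_polys N d \<Longrightarrow> (\<lambda>v. (v $ 0) ^ e * F v) \<in> homogeneous_polys N (e + d)"
proof (induction e)
  case (Suc e)
  from homogeneous_mult[OF homogeneous_coord[of 0 N] Suc.IH[OF Suc.prems]] show ?case by (simp add: mult.assoc)
qed simp

lemma homogeneous_eval:
  assumes F: "F \<in> homogeneous_polys N d" and v: "v \<in> carrier_vec (Suc N)"
  shows "F (c \<cdot>\<^sub>v v) = c ^ d * F v"
proof -
  obtain b where b: "F = (\<lambda>v. \<Sum>\<alpha>\<in>exps N d. b \<alpha> * vmonom N \<alpha> v)"
    using assms by (auto simp: homogeneous_polys_eq)
  have "vmonom N \<alpha> (c \<cdot>\<^sub>v v) = c ^ d * vmonom N \<alpha> v" if "\<alpha> \<in> exps N d" for \<alpha>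
  proof -
    have "vmonom N \<alpha> (c \<cdot>\<^sub>v v) = (\<Prod>i\<le>N. c ^ \<alpha> i * (v $ i) ^ \<alpha> i)"
      unfolding vmonom_def by (rule prod.cong) (use v in \<open>auto simp: power_mult_distrib\<close>)
    also have "\<dots> = c ^ d * vmonom N \<alpha> v"
      using that by (simp add: vmonom_def prod.distrib exps_def flip: power_sum)
    finally show ?thesis .
  qed
  then show ?thesis by (simp add: b sum_distrib_left mult_ac)
qed

abbreviation coord_funs :: "nat \<Rightarrow> (complex vec \<Rightarrow> complex) set" where
  "coord_funs N \<equiv> (\<lambda>i v. v $ i) ` {..N}"

lemma homogeneous_falg:
  assumes F: "F \<in> homogeneous_polys N d"
  shows "F \<in> falg (coord_funs N)"
proof -
  obtain b where b: "F = (\<lambda>v. \<Sum>\<alpha>\<in>exps N d. b \<alpha> * vmonom N \<alpha> v)"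
    using assms by (auto simp: homogeneous_polys_eq)
  have "(\<lambda>v. (v $ i) ^ k) \<in> falg (coord_funs N)" if "i \<le> N" for i k
  proof -
    have "(\<lambda>v. v $ i) ^ k \<in> falg (coord_funs N)"
      using that by (intro unital_subring_power unital_subring_falg falg.gen) auto
    moreover have "(\<lambda>v :: complex vec. v $ i) ^ k = (\<lambda>v. (v $ i) ^ k)" by (simp add: fun_eq_iff power_fun_apply)
    ultimately show ?thesis by simp
  qed
  then show ?thesis unfolding b vmonom_def by (intro falg_sum falg_cmult falg_prod) auto
qed

text \<open>Summands of different degrees are brought to a common degree by powers of coordinate
  0.\<close>

lemma homogenization:
  "p \<in> falg (coord_funs N) \<Longrightarrow> \<exists>d. \<exists>F\<in>homogeneous_polys N d. \<forall>v. v $ 0 = 1 \<longrightarrow> F v = p v"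
proof (induction p rule: falg.induct)
  case (const c)
  show ?case by (intro exI[of _ 0] bexI[OF _ homogeneous_const[of c N]]) simp
next
  case (gen g)
  then obtain i where "i \<le> N" "g = (\<lambda>v. v $ i)" by auto
  then show ?case by (intro exI[of _ 1] bexI[OF _ homogeneous_coord[of i]]) simp_all
next
  case (add f g)
  then obtain d F e G where F: "F \<in> homogeneous_polys N d" "\<forall>v. v $ 0 = 1 \<longrightarrow> F v = f v"
    and G: "G \<in> homogeneous_polys N e" "\<forall>v. v $ 0 = 1 \<longrightarrow> G v = g v" by (elim exE bexE)
  have "(\<lambda>v. (v $ 0) ^ e * F v + (v $ 0) ^ d * G v) \<in> homogeneous_polys N (d + e)"
    using homogeneous_raise[OF F(1), of e] homogeneous_raise[OF G(1), of d]
    by (intro homogeneous_add) (simp_all add: add.commute)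
  then show ?case using F(2) G(2)
    by (intro exI[of _ "d + e"] bexI[of _ "\<lambda>v. (v $ 0) ^ e * F v + (v $ 0) ^ d * G v"]) simp_all
next
  case (mult f g)
  then obtain d F e G where F: "F \<in> homogeneous_polys N d" "\<forall>v. v $ 0 = 1 \<longrightarrow> F v = f v"
    and G: "G \<in> homogeneous_polys N e" "\<forall>v. v $ 0 = 1 \<longrightarrow> G v = g v" by (elim exE bexE)
  have "(\<lambda>v. F v * G v) \<in> homogeneous_polys N (d + e)" by (rule homogeneous_mult[OF F(1) G(1)])
  then show ?case using F(2) G(2)
    by (intro exI[of _ "d + e"] bexI[of _ "\<lambda>v. F v * G v"]) simp_all
qed

lemma line_through_eq:
  assumes v: "v \<in> nonzero_vecs N" "w \<in> nonzero_vecs N" and eq: "line_through v = line_through w"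
  shows "\<exists>c. c \<noteq> 0 \<and> w = c \<cdot>\<^sub>v v"
proof -
  have "w \<in> line_through w" using one_smult_vec[of w] by (metis (mono_tags, lifting) line_through_def mem_Collect_eq)
  then obtain c where c: "w = c \<cdot>\<^sub>v v" unfolding eq[symmetric] by (auto simp: line_through_def)
  have "c \<noteq> 0"
  proof
    assume "c = 0"
    then have "w = 0\<^sub>v (Suc N)" using c v(1) by (auto simp: nonzero_vecs_def)
    then show False using v(2) by (simp add: nonzero_vecs_def)
  qed
  then show ?thesis using c by blast
qed

lemma line_through_smult:
  assumes "c \<noteq> 0"
  shows "line_through (c \<cdot>\<^sub>v v) = line_through (v :: complex vec)"
proof -
  have "b \<cdot>\<^sub>v v = (b / c) \<cdot>\<^sub>v (c \<cdot>\<^sub>v v)" for b using assms by (simp add: smult_smult_assoc)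
  then show ?thesis unfolding line_through_def using smult_smult_assoc by blast
qed

section \<open>Basic open sets of projective space and of spectra\<close>

definition proj_basic :: "nat \<Rightarrow> (complex vec \<Rightarrow> complex) \<Rightarrow> complex vec set set" where
  "proj_basic N F = {line_through v | v. v \<in> nonzero_vecs N \<and> F v \<noteq> 0}"

text \<open>Homogeneity makes nonvanishing independent of the vector chosen on the line.\<close>

lemma proj_basic_iff:
  assumes F: "F \<in> homogeneous_polys N d" and v: "v \<in> nonzero_vecs N"
  shows "line_through v \<in> proj_basic N F \<longleftrightarrow> F v \<noteq> 0"
proof
  assume "line_through v \<in> proj_basic N F"
  then obtain w where w: "w \<in> nonzero_vecs N" "F w \<noteq> 0" "line_through w = line_through v"
    by (auto simp: proj_basic_def)
  obtain c where "c \<noteq> 0" "v = c \<cdot>\<^sub>v w" using line_through_eq[OF w(1) v w(3)] by blast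
  then show "F v \<noteq> 0" using homogeneous_eval[OF F, of w c] w by (simp add: nonzero_vecs_def)
qed (use v in \<open>auto simp: proj_basic_def\<close>)

lemma zariski_projective_space:
  "zariski (projective_space N) = topology_generated_by {proj_basic N F | F d. F \<in> homogeneous_polys N d}"
  by (simp add: projective_space_def proj_basic_def Let_def)

lemma open_proj_basic: "F \<in> homogeneous_polys N d \<Longrightarrow> openin (zariski (projective_space N)) (proj_basic N F)"
  unfolding zariski_projective_space by (rule topology_generated_by_Basis) blast

lemma topspace_projective_space:
  "topspace (zariski (projective_space N)) = line_through ` nonzero_vecs N"
proof
  show "topspace (zariski (projective_space N)) \<subseteq> line_through ` nonzero_vecs N"
    unfolding zariski_projective_space topology_generated_by_topspace by (auto simp: proj_basic_def)
  have "line_through ` nonzero_vecs N = proj_basic N (\<lambda>_. 1)" by (auto simp: proj_basic_def)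
  then show "line_through ` nonzero_vecs N \<subseteq> topspace (zariski (projective_space N))"
    using openin_subset[OF open_proj_basic[OF homogeneous_const[of 1 N]]] by simp
qed

definition spec_basic :: "'y set \<Rightarrow> ('y \<Rightarrow> complex) set \<Rightarrow> ('y \<Rightarrow> complex) \<Rightarrow> ('y \<Rightarrow> complex) set set" where
  "spec_basic Y A a = {M. maximalideal M (function_ring Y\<lparr>carrier := A\<rparr>) \<and> a \<notin> M}"

lemma zariski_max_spec:
  "zariski (max_spec Y A) = topology_generated_by {spec_basic Y A a | a. a \<in> A}"
  by (simp add: max_spec_def spec_basic_def Let_def)

lemma open_spec_basic: "a \<in> A \<Longrightarrow> openin (zariski (max_spec Y A)) (spec_basic Y A a)"
  unfolding zariski_max_spec by (rule topology_generated_by_Basis) blast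

lemma topspace_max_spec:
  assumes A: "fun_subalgebra Y A"
  shows "topspace (zariski (max_spec Y A)) = {M. maximalideal M (function_ring Y\<lparr>carrier := A\<rparr>)}"
proof
  show "topspace (zariski (max_spec Y A)) \<subseteq> {M. maximalideal M (function_ring Y\<lparr>carrier := A\<rparr>)}"
    unfolding zariski_max_spec topology_generated_by_topspace by (auto simp: spec_basic_def)
  have "{M. maximalideal M (function_ring Y\<lparr>carrier := A\<rparr>)} = spec_basic Y A (\<lambda>y\<in>Y. 1)"
    using maximalidealD(3)[OF A] by (auto simp: spec_basic_def)
  then show "{M. maximalideal M (function_ring Y\<lparr>carrier := A\<rparr>)} \<subseteq> topspace (zariski (max_spec Y A))"
    using openin_subset[OF open_spec_basic[OF fun_subalgebraD(2)[OF A, of 1]]] by simp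
qed

lemma closed_vanishing:
  assumes A: "fun_subalgebra Y A" and B: "B \<subseteq> A"
  shows "closedin (zariski (max_spec Y A)) {M. maximalideal M (function_ring Y\<lparr>carrier := A\<rparr>) \<and> B \<subseteq> M}"
proof -
  have "openin (zariski (max_spec Y A)) (\<Union>b\<in>B. spec_basic Y A b)"
    using B by (intro openin_Union) (auto intro: open_spec_basic)
  moreover have "topspace (zariski (max_spec Y A)) - {M. maximalideal M (function_ring Y\<lparr>carrier := A\<rparr>) \<and> B \<subseteq> M}
      = (\<Union>b\<in>B. spec_basic Y A b)"
    unfolding topspace_max_spec[OF A] by (auto simp: spec_basic_def)
  ultimately show ?thesis by (auto simp: closedin_def topspace_max_spec[OF A])
qed

section \<open>Embedding affine spectra into projective space\<close>

text \<open>\<open>v y\<close> consists of generators of \<open>A\<close> evaluated at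
  \<open>y\<close>, behind a leading 1 that selects an affine chart. Maximal ideals are assumed to
  come from points of \<open>Y\<close>, so that everything can be tested on
  \<open>Y\<close>.\<close>

locale affine_embedding =
  fixes Y :: "'y set" and A :: "('y \<Rightarrow> complex) set" and N :: nat and v :: "'y \<Rightarrow> complex vec"
  assumes A: "fun_subalgebra Y A"
    and v_carrier: "v y \<in> carrier_vec (Suc N)" and v_0: "v y $ 0 = 1"
    and coords_A: "i \<le> N \<Longrightarrow> (\<lambda>y\<in>Y. v y $ i) \<in> A"
    and gen: "f \<in> A \<Longrightarrow> \<exists>p\<in>falg (coord_funs N). f = (\<lambda>y\<in>Y. p (v y))"
    and points: "maximalideal M (function_ring Y\<lparr>carrier := A\<rparr>) \<Longrightarrow> \<exists>y\<in>Y. M = {f \<in> A. f y = 0}"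
begin

abbreviation "TA \<equiv> zariski (max_spec Y A)"
abbreviation "TP \<equiv> zariski (projective_space N)"

definition "pnt y = {f \<in> A. f y = 0}"
definition "lin y = line_through (v y)"
text \<open>The point \<open>y\<close> over a maximal ideal need not be unique, but
  \<open>lin y\<close> does not depend on its choice.\<close>

definition "emb M = lin (SOME y. y \<in> Y \<and> M = pnt y)"

lemma falg_A: "p \<in> falg (coord_funs N) \<Longrightarrow> (\<lambda>y\<in>Y. p (v y)) \<in> A"
proof (induction p rule: falg.induct)
  case (const c)
  show ?case by (rule fun_subalgebraD(2)[OF A])
next
  case (gen g)
  then obtain i where i: "i \<le> N" "g = (\<lambda>v. v $ i)" by auto
  show ?case unfolding i(2) by (rule coords_A[OF i(1)])
next
  case (add f g)
  have eq: "(\<lambda>y\<in>Y. (\<lambda>y\<in>Y. f (v y)) y + (\<lambda>y\<in>Y. g (v y)) y) = (\<lambda>y\<in>Y. (f + g) (v y))"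
    by (simp cong: restrict_cong)
  from fun_subalgebraD(3)[OF A add.IH] show ?case unfolding eq .
next
  case (mult f g)
  have eq: "(\<lambda>y\<in>Y. (\<lambda>y\<in>Y. f (v y)) y * (\<lambda>y\<in>Y. g (v y)) y) = (\<lambda>y\<in>Y. (f * g) (v y))"
    by (simp cong: restrict_cong)
  from fun_subalgebraD(4)[OF A mult.IH] show ?case unfolding eq .
qed

lemma homogeneous_A: "F \<in> homogeneous_polys N d \<Longrightarrow> (\<lambda>y\<in>Y. F (v y)) \<in> A"
  by (rule falg_A[OF homogeneous_falg])

lemma gen_homogeneous: "f \<in> A \<Longrightarrow> \<exists>d. \<exists>F\<in>homogeneous_polys N d. \<forall>y\<in>Y. f y = F (v y)"
proof -
  assume "f \<in> A"
  then obtain p where p: "p \<in> falg (coord_funs N)" "f = (\<lambda>y\<in>Y. p (v y))" using gen by blast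
  obtain d F where "F \<in> homogeneous_polys N d" "\<forall>w. w $ 0 = 1 \<longrightarrow> F w = p w"
    using homogenization[OF p(1)] by (elim exE bexE)
  then show ?thesis using v_0 by (intro exI[of _ d] bexI[of _ F]) (simp_all add: p(2))
qed

lemma v_nonzero: "v y \<in> nonzero_vecs N"
  using v_carrier[of y] v_0[of y] by (auto simp: nonzero_vecs_def)

lemma pnt_eq_iff:
  assumes "y \<in> Y" "z \<in> Y"
  shows "pnt y = pnt z \<longleftrightarrow> v y = v z"
proof
  assume eq: "pnt y = pnt z"
  have "v y $ i = v z $ i" if i: "i \<le> N" for i
  proof -
    let ?f = "\<lambda>x\<in>Y. (\<lambda>y\<in>Y. v y $ i) x - v y $ i"
    have "?f \<in> pnt y" using fun_subalgebra_diff[OF A coords_A[OF i]] assms by (simp add: pnt_def)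
    then have "?f \<in> pnt z" by (simp only: eq)
    then show ?thesis using assms by (simp add: pnt_def)
  qed
  then show "v y = v z" using v_carrier[of y] v_carrier[of z] by (intro eq_vecI) auto
next
  assume eq: "v y = v z"
  have "f y = f z" if "f \<in> A" for f using gen[OF that] eq assms by auto
  then show "pnt y = pnt z" unfolding pnt_def by metis
qed

lemma lin_eq_iff: "lin y = lin z \<longleftrightarrow> v y = v z"
proof
  assume "lin y = lin z"
  then obtain c where c: "v z = c \<cdot>\<^sub>v v y"
    using line_through_eq[OF v_nonzero[of y] v_nonzero[of z]] by (auto simp: lin_def)
  then have "c = 1" using v_0[of z] v_0[of y] v_carrier[of y] by simp
  then show "v y = v z" using c by simp
qed (simp add: lin_def)

lemma emb_pnt: "y \<in> Y \<Longrightarrow> emb (pnt y) = lin y"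
proof -
  assume y: "y \<in> Y"
  let ?z = "SOME z. z \<in> Y \<and> pnt y = pnt z"
  have "?z \<in> Y \<and> pnt y = pnt ?z" by (rule someI[of _ y]) (simp add: y)
  then have "v y = v ?z" using pnt_eq_iff[OF y] by blast
  then show ?thesis unfolding emb_def using lin_eq_iff by metis
qed

lemma maximal_iff: "maximalideal M (function_ring Y\<lparr>carrier := A\<rparr>) \<longleftrightarrow> M \<in> pnt ` Y"
  using points maximalideal_point[OF A] by (auto simp: pnt_def)

lemma topspace_TA: "topspace TA = pnt ` Y"
  unfolding topspace_max_spec[OF A] maximal_iff by simp

lemma inj_emb: "inj_on emb (pnt ` Y)"
proof (rule inj_onI)
  fix M M' assume "M \<in> pnt ` Y" "M' \<in> pnt ` Y" and eq: "emb M = emb M'"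
  then obtain y z where y: "y \<in> Y" "z \<in> Y" "M = pnt y" "M' = pnt z" by blast
  then have "v y = v z" using eq by (simp add: emb_pnt lin_eq_iff)
  then show "M = M'" using pnt_eq_iff[OF y(1,2)] y(3,4) by simp
qed

lemma pnt_spec_basic: "y \<in> Y \<Longrightarrow> a \<in> A \<Longrightarrow> pnt y \<in> spec_basic Y A a \<longleftrightarrow> a y \<noteq> 0"
  unfolding spec_basic_def maximal_iff by (auto simp: pnt_def)

lemma lin_proj_basic: "F \<in> homogeneous_polys N d \<Longrightarrow> lin y \<in> proj_basic N F \<longleftrightarrow> F (v y) \<noteq> 0"
  unfolding lin_def by (rule proj_basic_iff[OF _ v_nonzero])

lemma lin_topspace: "lin y \<in> topspace TP"
  unfolding topspace_projective_space lin_def using v_nonzero by blast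

text \<open>It suffices to treat basic sets: a homogeneous \<open>F\<close> and the element
  \<open>y \<mapsto> F (v y)\<close> of \<open>A\<close> are nonzero at the same points of
  \<open>Y\<close>.\<close>

lemma pull_open:
  assumes "openin TP V"
  shows "\<exists>U. openin TA U \<and> (\<forall>y\<in>Y. pnt y \<in> U \<longleftrightarrow> lin y \<in> V)"
proof -
  have "generate_topology_on {proj_basic N F | F d. F \<in> homogeneous_polys N d} V"
    using assms unfolding zariski_projective_space openin_topology_generated_by_iff .
  then show ?thesis
  proof (induction V rule: generate_topology_on.induct)
    case Empty
    show ?case by (intro exI[of _ "{}"]) simp
  next
    case (Int V W)
    then obtain U U' where "openin TA U" "openin TA U'" "\<forall>y\<in>Y. pnt y \<in> U \<longleftrightarrow> lin y \<in> V"
      "\<forall>y\<in>Y. pnt y \<in> U' \<longleftrightarrow> lin y \<in> W" by blast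
    then show ?case by (intro exI[of _ "U \<inter> U'"]) auto
  next
    case (UN K)
    then obtain U where "\<And>V. V \<in> K \<Longrightarrow> openin TA (U V) \<and> (\<forall>y\<in>Y. pnt y \<in> U V \<longleftrightarrow> lin y \<in> V)" by metis
    then show ?case by (intro exI[of _ "\<Union>(U ` K)"]) (auto intro: openin_Union)
  next
    case (Basis V)
    then obtain F d where F: "F \<in> homogeneous_polys N d" "V = proj_basic N F" by blast
    show ?case using open_spec_basic[OF homogeneous_A[OF F(1)]] F
      by (intro exI[of _ "spec_basic Y A (\<lambda>y\<in>Y. F (v y))"])
        (simp add: pnt_spec_basic homogeneous_A[OF F(1)] lin_proj_basic)
  qed
qed

text \<open>On basic sets this uses that every element of \<open>A\<close> arises from a homogeneous
  polynomial.\<close>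

lemma push_open:
  assumes "openin TA U"
  shows "\<exists>V. openin TP V \<and> (\<forall>y\<in>Y. pnt y \<in> U \<longleftrightarrow> lin y \<in> V)"
proof -
  have "generate_topology_on {spec_basic Y A a | a. a \<in> A} U"
    using assms unfolding zariski_max_spec openin_topology_generated_by_iff .
  then show ?thesis
  proof (induction U rule: generate_topology_on.induct)
    case Empty
    show ?case by (intro exI[of _ "{}"]) simp
  next
    case (Int U U')
    then obtain V V' where "openin TP V" "openin TP V'" "\<forall>y\<in>Y. pnt y \<in> U \<longleftrightarrow> lin y \<in> V"
      "\<forall>y\<in>Y. pnt y \<in> U' \<longleftrightarrow> lin y \<in> V'" by blast
    then show ?case by (intro exI[of _ "V \<inter> V'"]) auto
  next
    case (UN K)
    then obtain V where "\<And>U. U \<in> K \<Longrightarrow> openin TP (V U) \<and> (\<forall>y\<in>Y. pnt y \<in> U \<longleftrightarrow> lin y \<in> V U)" by metis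
    then show ?case by (intro exI[of _ "\<Union>(V ` K)"]) (auto intro: openin_Union)
  next
    case (Basis U)
    then obtain a where a: "a \<in> A" "U = spec_basic Y A a" by blast
    obtain d F where F: "F \<in> homogeneous_polys N d" "\<forall>y\<in>Y. a y = F (v y)"
      using gen_homogeneous[OF a(1)] by (elim exE bexE)
    show ?case using open_proj_basic[OF F(1)] F(2) a
      by (intro exI[of _ "proj_basic N F"]) (simp add: pnt_spec_basic lin_proj_basic[OF F(1)])
  qed
qed

text \<open>The image is cut out in the chart by the homogeneous polynomials that vanish at all
  \<open>v y\<close>. A vector \<open>w\<close> of this zero set satisfies all relations between the
  generators, so evaluation at \<open>w\<close> is a character of \<open>A\<close>; its kernel is
  maximal and hence belongs to some \<open>y\<close>.\<close>

lemma locally_closed_image: "locally_closed_in TP (lin ` Y)"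
proof -
  define H where "H = {F. (\<exists>d. F \<in> homogeneous_polys N d) \<and> (\<forall>y\<in>Y. F (v y) = 0)}"
  let ?U = "proj_basic N (\<lambda>v. v $ 0)" and ?C = "topspace TP - (\<Union>F\<in>H. proj_basic N F)"
  have U: "openin TP ?U" by (rule open_proj_basic[OF homogeneous_coord]) simp
  have "openin TP (\<Union>F\<in>H. proj_basic N F)"
    by (intro openin_Union) (auto simp: H_def intro: open_proj_basic)
  then have C: "closedin TP ?C" by (intro closedin_diff closedin_topspace)
  have "lin ` Y = ?U \<inter> ?C"
  proof
    have "lin y \<in> ?U" for y using lin_proj_basic[OF homogeneous_coord[of 0 N]] v_0 by simp
    moreover have "lin y \<notin> proj_basic N F" if "y \<in> Y" "F \<in> H" for y F
      using that lin_proj_basic by (auto simp: H_def)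
    ultimately show "lin ` Y \<subseteq> ?U \<inter> ?C" using lin_topspace by auto
    show "?U \<inter> ?C \<subseteq> lin ` Y"
    proof
      fix L assume L: "L \<in> ?U \<inter> ?C"
      then obtain u where u: "u \<in> nonzero_vecs N" "u $ 0 \<noteq> 0" "L = line_through u"
        by (auto simp: proj_basic_def)
      define w where "w = (1 / u $ 0) \<cdot>\<^sub>v u"
      have uc: "u \<in> carrier_vec (Suc N)" using u(1) by (simp add: nonzero_vecs_def)
      have w: "w \<in> carrier_vec (Suc N)" "w $ 0 = 1" "L = line_through w"
        using uc u(2,3) line_through_smult[of "1 / u $ 0" u] by (simp_all add: w_def)
      then have wn: "w \<in> nonzero_vecs N" by (auto simp: nonzero_vecs_def)
      have van: "F w = 0" if F: "F \<in> homogeneous_polys N d" "\<forall>y\<in>Y. F (v y) = 0" for F d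
      proof -
        have "F \<in> H" using F by (auto simp: H_def)
        then have "L \<notin> proj_basic N F" using L by blast
        then show ?thesis using proj_basic_iff[OF F(1) wn] w(3) by simp
      qed
      \<comment> \<open>Polynomials that agree at all \<open>v y\<close> agree at \<open>w\<close>,
        so an element of \<open>A\<close> has a well defined value at \<open>w\<close>.\<close>
      have wd: "p w = q w" if p: "p \<in> falg (coord_funs N)" "q \<in> falg (coord_funs N)" "\<forall>y\<in>Y. p (v y) = q (v y)" for p q
      proof -
        have "p - q \<in> falg (coord_funs N)" by (rule unital_subringD(6)[OF unital_subring_falg p(1,2)])
        from homogenization[OF this] obtain d F where F: "F \<in> homogeneous_polys N d" "\<forall>v. v $ 0 = 1 \<longrightarrow> F v = (p - q) v"
          by (elim exE bexE)
        have "F w = 0" by (rule van[OF F(1)]) (use F(2) v_0 p(3) in simp)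
        then show ?thesis using F(2) w(2) by simp
      qed
      have "\<forall>f\<in>A. \<exists>p. p \<in> falg (coord_funs N) \<and> f = (\<lambda>y\<in>Y. p (v y))" using gen by blast
      then obtain rep where rep: "\<And>f. f \<in> A \<Longrightarrow> rep f \<in> falg (coord_funs N)"
        "\<And>f. f \<in> A \<Longrightarrow> f = (\<lambda>y\<in>Y. rep f (v y))" by metis
      have val: "rep f w = p w" if "f \<in> A" "p \<in> falg (coord_funs N)" "\<And>y. y \<in> Y \<Longrightarrow> f y = p (v y)" for f p
      proof (rule wd[OF rep(1)[OF that(1)] that(2)], rule ballI)
        fix y assume y: "y \<in> Y"
        show "rep f (v y) = p (v y)" using fun_cong[OF rep(2)[OF that(1)], of y] that(3)[OF y] y by simp
      qed
      have repv: "f y = rep f (v y)" if "f \<in> A" "y \<in> Y" for f y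
        using fun_cong[OF rep(2)[OF that(1)], of y] that(2) by simp
      have "maximalideal {f \<in> A. rep f w = 0} (function_ring Y\<lparr>carrier := A\<rparr>)"
      proof (rule maximalideal_kernel[OF A])
        show "rep (\<lambda>y\<in>Y. c) w = c" for c
          by (rule val[OF fun_subalgebraD(2)[OF A] falg.const]) simp
        fix f g assume fg: "f \<in> A" "g \<in> A"
        have "rep (\<lambda>y\<in>Y. f y + g y) w = (rep f + rep g) w"
          by (rule val[OF fun_subalgebraD(3)[OF A fg] falg.add[OF rep(1) rep(1)]]) (simp_all add: fg repv[symmetric])
        then show "rep (\<lambda>y\<in>Y. f y + g y) w = rep f w + rep g w" by simp
        have "rep (\<lambda>y\<in>Y. f y * g y) w = (rep f * rep g) w"
          by (rule val[OF fun_subalgebraD(4)[OF A fg] falg.mult[OF rep(1) rep(1)]]) (simp_all add: fg repv[symmetric])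
        then show "rep (\<lambda>y\<in>Y. f y * g y) w = rep f w * rep g w" by simp
      qed
      then obtain y where y: "y \<in> Y" "{f \<in> A. rep f w = 0} = {f \<in> A. f y = 0}" using points by blast
      \<comment> \<open>A coordinate function minus its value at \<open>w\<close> lies in the
        kernel, hence vanishes at \<open>y\<close>.\<close>
      have "v y $ i = w $ i" if i: "i \<le> N" for i
      proof -
        let ?f = "\<lambda>x\<in>Y. (\<lambda>y\<in>Y. v y $ i) x - w $ i"
        have fA: "?f \<in> A" by (rule fun_subalgebra_diff[OF A coords_A[OF i]])
        have c: "(\<lambda>v. v $ i) \<in> falg (coord_funs N)" using i by (intro falg.gen) auto
        have "rep ?f w = ((\<lambda>v. v $ i) + (\<lambda>_. - w $ i)) w"
          by (rule val[OF fA falg.add[OF c falg.const]]) simp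
        then have "?f \<in> {f \<in> A. rep f w = 0}" using fA by simp
        then show ?thesis unfolding y(2) using y(1) by simp
      qed
      then have "v y = w" using v_carrier[of y] w(1) by (intro eq_vecI) auto
      then show "L \<in> lin ` Y" using y(1) w(3) by (auto simp: lin_def)
    qed
  qed
  then show ?thesis unfolding locally_closed_in_def using U C by blast
qed

lemma locally_closed_emb:
  assumes Z: "locally_closed_in TA Z"
  shows "locally_closed_in TP (emb ` Z)"
proof -
  obtain U C where UC: "openin TA U" "closedin TA C" "Z = U \<inter> C" using Z by (auto simp: locally_closed_in_def)
  obtain U0 C0 where UC0: "openin TP U0" "closedin TP C0" "lin ` Y = U0 \<inter> C0"
    using locally_closed_image by (auto simp: locally_closed_in_def)
  obtain V where V: "openin TP V" "\<forall>y\<in>Y. pnt y \<in> U \<longleftrightarrow> lin y \<in> V" using push_open[OF UC(1)] by blast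
  have "openin TA (topspace TA - C)" using UC(2) by (simp add: closedin_def)
  then obtain V' where V': "openin TP V'" "\<forall>y\<in>Y. pnt y \<in> topspace TA - C \<longleftrightarrow> lin y \<in> V'"
    using push_open by blast
  have CV: "pnt y \<in> C \<longleftrightarrow> lin y \<notin> V'" if "y \<in> Y" for y
    using V'(2) that topspace_TA by auto
  have "Z \<subseteq> pnt ` Y" using openin_subset[OF UC(1)] UC(3) topspace_TA by auto
  then have "emb ` Z = {lin y | y. y \<in> Y \<and> pnt y \<in> Z}" by (force simp: emb_pnt image_iff)
  also have "\<dots> = {lin y | y. y \<in> Y \<and> lin y \<in> V \<and> lin y \<notin> V'}"
    using V(2) CV UC(3) by auto
  also have "\<dots> = (lin ` Y) \<inter> (V - V')" by auto
  also have "\<dots> = (U0 \<inter> V) \<inter> (C0 - V')" using UC0(3) by auto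
  finally show ?thesis unfolding locally_closed_in_def
    using openin_Int[OF UC0(1) V(1)] closedin_diff[OF UC0(2) V'(1)] by blast
qed

lemma residue_pnt: "y \<in> Y \<Longrightarrow> a \<in> A \<Longrightarrow> residue_at Y (pnt y) a = a y"
  unfolding pnt_def by (rule residue_at_point[OF A])

lemma regular_max_spec_iff:
  "f \<in> regular (max_spec Y A) U \<longleftrightarrow> (\<forall>M\<in>U. \<exists>V. \<exists>a\<in>A. \<exists>b\<in>A. openin TA V \<and> M \<in> V \<and>
     (\<forall>M'\<in>U \<inter> V. residue_at Y M' b \<noteq> 0 \<and> f M' = residue_at Y M' a / residue_at Y M' b))"
  by (simp add: max_spec_def Let_def)

lemma regular_projective_iff:
  "f \<in> regular (projective_space N) U \<longleftrightarrow> (\<forall>L\<in>U. \<exists>V d. \<exists>F\<in>homogeneous_polys N d. \<exists>G\<in>homogeneous_polys N d.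
     openin TP V \<and> L \<in> V \<and> (\<forall>v\<in>nonzero_vecs N. line_through v \<in> U \<inter> V \<longrightarrow>
        G v \<noteq> 0 \<and> f (line_through v) = F v / G v))"
  by (simp add: projective_space_def Let_def)

text \<open>Regular functions of the induced structure are locally fractions of functions on
  \<open>Y\<close>. The projective side is brought to the same form next, so that both can be
  compared at the points of \<open>Y\<close>.\<close>

lemma regular_induced_max_spec:
  assumes U: "U \<subseteq> pnt ` Y"
  shows "f \<in> regular (induced (max_spec Y A) Z) U \<longleftrightarrow>
    (\<forall>x\<in>Y. pnt x \<in> U \<longrightarrow> (\<exists>V a b. openin TA V \<and> pnt x \<in> V \<and> a \<in> A \<and> b \<in> A \<and>
       (\<forall>y\<in>Y. pnt y \<in> U \<inter> V \<longrightarrow> b y \<noteq> 0 \<and> f (pnt y) = a y / b y)))"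
    (is "_ \<longleftrightarrow> ?R")
proof
  assume f: "f \<in> regular (induced (max_spec Y A) Z) U"
  show ?R
  proof (intro ballI impI)
    fix x assume x: "x \<in> Y" "pnt x \<in> U"
    obtain V h where V: "openin TA V" "pnt x \<in> V" "h \<in> regular (max_spec Y A) V" "\<forall>q\<in>U \<inter> V. f q = h q"
      using f x(2) unfolding induced_def by auto
    obtain V' a b where V': "a \<in> A" "b \<in> A" "openin TA V'" "pnt x \<in> V'"
        "\<forall>M'\<in>V \<inter> V'. residue_at Y M' b \<noteq> 0 \<and> h M' = residue_at Y M' a / residue_at Y M' b"
      using V(3)[unfolded regular_max_spec_iff] V(2) by blast
    have "b y \<noteq> 0 \<and> f (pnt y) = a y / b y" if "y \<in> Y" "pnt y \<in> U \<inter> (V \<inter> V')" for y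
      using bspec[OF V(4), of "pnt y"] bspec[OF V'(5), of "pnt y"] that by (simp add: residue_pnt V'(1,2))
    then show "\<exists>V a b. openin TA V \<and> pnt x \<in> V \<and> a \<in> A \<and> b \<in> A \<and>
       (\<forall>y\<in>Y. pnt y \<in> U \<inter> V \<longrightarrow> b y \<noteq> 0 \<and> f (pnt y) = a y / b y)"
      using openin_Int[OF V(1) V'(3)] V(2) V'(1,2,4) by (intro exI[of _ "V \<inter> V'"] exI[of _ a] exI[of _ b]) auto
  qed
next
  assume R: ?R
  show "f \<in> regular (induced (max_spec Y A) Z) U"
    unfolding induced_def space_with_functions.simps mem_Collect_eq
  proof
    fix M assume M: "M \<in> U"
    then obtain x where x: "x \<in> Y" "M = pnt x" using U by blast
    obtain V a b where V: "openin TA V" "pnt x \<in> V" "a \<in> A" "b \<in> A"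
      "\<forall>y\<in>Y. pnt y \<in> U \<inter> V \<longrightarrow> b y \<noteq> 0 \<and> f (pnt y) = a y / b y"
      using R x M by blast
    \<comment> \<open>Outside \<open>U\<close> the denominator may vanish on \<open>V\<close>; the
      neighbourhood is cut down so that the fraction is regular on all of it.\<close>
    let ?V = "V \<inter> spec_basic Y A b" and ?h = "\<lambda>M. residue_at Y M a / residue_at Y M b"
    have oV: "openin TA ?V" by (rule openin_Int[OF V(1) open_spec_basic[OF V(4)]])
    have mem: "\<exists>y\<in>Y. M' = pnt y \<and> b y \<noteq> 0" if "M' \<in> ?V" for M'
    proof -
      have "M' \<in> pnt ` Y" using that openin_subset[OF V(1)] topspace_TA by auto
      then show ?thesis using that pnt_spec_basic V(4) by blast
    qed
    have "M \<in> ?V" using x M V(2,5) by (simp add: pnt_spec_basic[OF x(1) V(4)])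
    moreover have "?h \<in> regular (max_spec Y A) ?V" unfolding regular_max_spec_iff
    proof
      fix M' assume "M' \<in> ?V"
      moreover have "residue_at Y M'' b \<noteq> 0" if "M'' \<in> ?V" for M''
        using mem[OF that] residue_pnt V(4) by auto
      ultimately show "\<exists>W. \<exists>a'\<in>A. \<exists>b'\<in>A. openin TA W \<and> M' \<in> W \<and> (\<forall>M''\<in>?V \<inter> W.
          residue_at Y M'' b' \<noteq> 0 \<and> ?h M'' = residue_at Y M'' a' / residue_at Y M'' b')"
        using oV V(3,4) by (intro exI[of _ ?V] bexI[of _ a] bexI[of _ b]) auto
    qed
    moreover have "f q = ?h q" if q: "q \<in> U \<inter> ?V" for q
    proof -
      obtain y where y: "y \<in> Y" "q = pnt y" using q U by blast
      then show ?thesis using V(5) q by (simp add: residue_pnt V(3,4))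
    qed
    ultimately show "\<exists>V h. openin TA V \<and> M \<in> V \<and> h \<in> regular (max_spec Y A) V \<and> (\<forall>q\<in>U \<inter> V. f q = h q)"
      using oV by (intro exI[of _ ?V] exI[of _ ?h]) simp
  qed
qed

lemma regular_induced_projective:
  assumes U: "U \<subseteq> lin ` Y"
  shows "f \<in> regular (induced (projective_space N) Z) U \<longleftrightarrow>
    (\<forall>x\<in>Y. lin x \<in> U \<longrightarrow> (\<exists>V d F G. openin TP V \<and> lin x \<in> V \<and> F \<in> homogeneous_polys N d \<and> G \<in> homogeneous_polys N d \<and>
       (\<forall>y\<in>Y. lin y \<in> U \<inter> V \<longrightarrow> G (v y) \<noteq> 0 \<and> f (lin y) = F (v y) / G (v y))))"
    (is "_ \<longleftrightarrow> ?R")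
proof
  assume f: "f \<in> regular (induced (projective_space N) Z) U"
  show ?R
  proof (intro ballI impI)
    fix x assume x: "x \<in> Y" "lin x \<in> U"
    obtain V h where V: "openin TP V" "lin x \<in> V" "h \<in> regular (projective_space N) V" "\<forall>q\<in>U \<inter> V. f q = h q"
      using f x(2) unfolding induced_def by auto
    obtain V' d F G where V': "F \<in> homogeneous_polys N d" "G \<in> homogeneous_polys N d" "openin TP V'" "lin x \<in> V'"
        "\<forall>w\<in>nonzero_vecs N. line_through w \<in> V \<inter> V' \<longrightarrow> G w \<noteq> 0 \<and> h (line_through w) = F w / G w"
      using V(3)[unfolded regular_projective_iff] V(2) by blast
    have "G (v y) \<noteq> 0 \<and> f (lin y) = F (v y) / G (v y)" if "y \<in> Y" "lin y \<in> U \<inter> (V \<inter> V')" for y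
      using bspec[OF V(4), of "lin y"] bspec[OF V'(5) v_nonzero, of y] that by (simp add: lin_def)
    then show "\<exists>V d F G. openin TP V \<and> lin x \<in> V \<and> F \<in> homogeneous_polys N d \<and> G \<in> homogeneous_polys N d \<and>
       (\<forall>y\<in>Y. lin y \<in> U \<inter> V \<longrightarrow> G (v y) \<noteq> 0 \<and> f (lin y) = F (v y) / G (v y))"
      using openin_Int[OF V(1) V'(3)] V(2) V'(1,2,4)
      by (intro exI[of _ "V \<inter> V'"] exI[of _ d] exI[of _ F] exI[of _ G]) auto
  qed
next
  assume R: ?R
  show "f \<in> regular (induced (projective_space N) Z) U"
    unfolding induced_def space_with_functions.simps mem_Collect_eq
  proof
    fix L assume L: "L \<in> U"
    then obtain x where x: "x \<in> Y" "L = lin x" using U by blast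
    obtain V d F G where V: "openin TP V" "lin x \<in> V" "F \<in> homogeneous_polys N d" "G \<in> homogeneous_polys N d"
      "\<forall>y\<in>Y. lin y \<in> U \<inter> V \<longrightarrow> G (v y) \<noteq> 0 \<and> f (lin y) = F (v y) / G (v y)"
      using mp[OF bspec[OF R x(1)] L[unfolded x(2)]] by (elim exE conjE) blast
    \<comment> \<open>The fraction as a function of lines, through a chosen vector; as
      \<open>F\<close> and \<open>G\<close> have the same degree, any other vector on the line gives
      the same value.\<close>
    define h where "h M = (let w = SOME w. w \<in> nonzero_vecs N \<and> line_through w = M in F w / G w)" for M
    have h: "h (line_through w) = F w / G w" if w: "w \<in> nonzero_vecs N" for w
    proof -
      let ?u = "SOME u. u \<in> nonzero_vecs N \<and> line_through u = line_through w"
      have u: "?u \<in> nonzero_vecs N \<and> line_through ?u = line_through w" by (rule someI[of _ w]) (simp add: w)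
      then obtain c where c: "c \<noteq> 0" "w = c \<cdot>\<^sub>v ?u" using line_through_eq[OF _ w] by blast
      have uc: "?u \<in> carrier_vec (Suc N)" using u by (simp add: nonzero_vecs_def)
      have "F w = c ^ d * F ?u" "G w = c ^ d * G ?u"
        using homogeneous_eval[OF V(3) uc, of c] homogeneous_eval[OF V(4) uc, of c] unfolding c(2)[symmetric] .
      then show ?thesis using c(1) by (simp add: h_def Let_def)
    qed
    let ?V = "V \<inter> proj_basic N G"
    have oV: "openin TP ?V" by (rule openin_Int[OF V(1) open_proj_basic[OF V(4)]])
    have "L \<in> ?V" using x L V(2,5) lin_proj_basic[OF V(4)] by simp
    moreover have "h \<in> regular (projective_space N) ?V" unfolding regular_projective_iff
    proof
      fix L' assume "L' \<in> ?V"
      moreover have "G w \<noteq> 0 \<and> h (line_through w) = F w / G w"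
        if "w \<in> nonzero_vecs N" "line_through w \<in> ?V" for w
        using that h proj_basic_iff[OF V(4)] by blast
      ultimately show "\<exists>W e. \<exists>F'\<in>homogeneous_polys N e. \<exists>G'\<in>homogeneous_polys N e. openin TP W \<and> L' \<in> W \<and>
          (\<forall>w\<in>nonzero_vecs N. line_through w \<in> ?V \<inter> W \<longrightarrow> G' w \<noteq> 0 \<and> h (line_through w) = F' w / G' w)"
        using oV V(3,4) by (intro exI[of _ ?V] exI[of _ d] bexI[of _ F] bexI[of _ G]) auto
    qed
    moreover have "f q = h q" if q: "q \<in> U \<inter> ?V" for q
    proof -
      obtain y where y: "y \<in> Y" "q = lin y" using q U by blast
      then show ?thesis using V(5) q h[OF v_nonzero[of y]] by (simp add: lin_def)
    qed
    ultimately show "\<exists>V h. openin TP V \<and> L \<in> V \<and> h \<in> regular (projective_space N) V \<and> (\<forall>q\<in>U \<inter> V. f q = h q)"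
      using oV by (intro exI[of _ ?V] exI[of _ h]) simp
  qed
qed

text \<open>Open sets correspond by \<open>pull_open\<close> and \<open>push_open\<close>; local
  fractions correspond by exchanging elements of \<open>A\<close> with homogeneous
  polynomials.\<close>

theorem locally_closed_quasi_projective:
  assumes Z: "locally_closed_in TA Z"
  shows "quasi_projective_variety (induced (max_spec Y A) Z)"
proof -
  have ZY: "Z \<subseteq> pnt ` Y" using Z openin_subset topspace_TA by (fastforce simp: locally_closed_in_def)
  have WY: "emb ` Z \<subseteq> lin ` Y" using ZY emb_pnt by fastforce
  have WT: "emb ` Z \<subseteq> topspace TP" using WY lin_topspace by auto
  have in_Z: "lin y \<in> emb ` Z \<longleftrightarrow> pnt y \<in> Z" if y: "y \<in> Y" for y
  proof -
    have "emb (pnt y) \<in> emb ` Z \<longleftrightarrow> pnt y \<in> Z"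
      using y ZY by (intro inj_on_image_mem_iff[OF inj_emb]) auto
    then show ?thesis by (simp add: emb_pnt y)
  qed
  have homeo: "homeomorphic_map (subtopology TA Z) (subtopology TP (emb ` Z)) emb"
  proof (rule bijective_open_imp_homeomorphic_map)
    have tZ: "topspace (subtopology TA Z) = Z" using ZY by (auto simp: topspace_TA)
    show "emb ` topspace (subtopology TA Z) = topspace (subtopology TP (emb ` Z))"
      using WT unfolding tZ by auto
    show "inj_on emb (topspace (subtopology TA Z))" unfolding tZ by (rule inj_on_subset[OF inj_emb ZY])
    show "continuous_map (subtopology TA Z) (subtopology TP (emb ` Z)) emb"
      unfolding continuous_map_in_subtopology
    proof
      show "emb \<in> topspace (subtopology TA Z) \<rightarrow> emb ` Z" unfolding tZ by auto
      show "continuous_map (subtopology TA Z) TP emb" unfolding continuous_map_def tZ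
      proof (intro conjI allI impI)
        show "emb \<in> Z \<rightarrow> topspace TP" using WT by auto
        fix V assume "openin TP V"
        then obtain U where U: "openin TA U" "\<forall>y\<in>Y. pnt y \<in> U \<longleftrightarrow> lin y \<in> V" using pull_open by blast
        have "{M \<in> Z. emb M \<in> V} = U \<inter> Z" using U(2) ZY emb_pnt by fastforce
        then show "openin (subtopology TA Z) {M \<in> Z. emb M \<in> V}" using U(1) by (auto simp: openin_subtopology)
      qed
    qed
    show "open_map (subtopology TA Z) (subtopology TP (emb ` Z)) emb" unfolding open_map_def
    proof (intro allI impI)
      fix U assume "openin (subtopology TA Z) U"
      then obtain U' where U': "openin TA U'" "U = U' \<inter> Z" by (auto simp: openin_subtopology)
      obtain V where V: "openin TP V" "\<forall>y\<in>Y. pnt y \<in> U' \<longleftrightarrow> lin y \<in> V" using push_open[OF U'(1)] by blast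
      have "emb ` U = V \<inter> emb ` Z"
      proof -
        have "M \<in> U' \<longleftrightarrow> emb M \<in> V" if "M \<in> Z" for M using V(2) that ZY emb_pnt by fastforce
        then show ?thesis unfolding U'(2) by auto
      qed
      then show "openin (subtopology TP (emb ` Z)) (emb ` U)" using V(1) by (auto simp: openin_subtopology)
    qed
  qed
  have reg: "f \<in> regular (induced (projective_space N) (emb ` Z)) V \<longleftrightarrow>
      f \<circ> emb \<in> regular (induced (max_spec Y A) Z) {M \<in> Z. emb M \<in> V}"
    if V: "openin (subtopology TP (emb ` Z)) V" for V f
  proof -
    let ?U = "{M \<in> Z. emb M \<in> V}"
    have VW: "V \<subseteq> emb ` Z" using openin_subset[OF V] by simp
    have UV: "pnt y \<in> ?U \<longleftrightarrow> lin y \<in> V" if "y \<in> Y" for y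
      using in_Z[OF that] VW emb_pnt[OF that] by auto
    have "V \<subseteq> lin ` Y" "?U \<subseteq> pnt ` Y" using VW WY ZY by auto
    note iff = regular_induced_projective[OF this(1), of f "emb ` Z"] regular_induced_max_spec[OF this(2), of "f \<circ> emb" Z]
    show ?thesis unfolding iff
    proof (intro ball_cong HOL.refl imp_cong)
      fix x assume x: "x \<in> Y"
      show "lin x \<in> V \<longleftrightarrow> pnt x \<in> ?U" using UV[OF x] by simp
      show "(\<exists>V' d F G. openin TP V' \<and> lin x \<in> V' \<and> F \<in> homogeneous_polys N d \<and> G \<in> homogeneous_polys N d \<and>
          (\<forall>y\<in>Y. lin y \<in> V \<inter> V' \<longrightarrow> G (v y) \<noteq> 0 \<and> f (lin y) = F (v y) / G (v y))) \<longleftrightarrow>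
        (\<exists>W a b. openin TA W \<and> pnt x \<in> W \<and> a \<in> A \<and> b \<in> A \<and>
          (\<forall>y\<in>Y. pnt y \<in> ?U \<inter> W \<longrightarrow> b y \<noteq> 0 \<and> (f \<circ> emb) (pnt y) = a y / b y))"
      proof
        assume "\<exists>V' d F G. openin TP V' \<and> lin x \<in> V' \<and> F \<in> homogeneous_polys N d \<and> G \<in> homogeneous_polys N d \<and>
          (\<forall>y\<in>Y. lin y \<in> V \<inter> V' \<longrightarrow> G (v y) \<noteq> 0 \<and> f (lin y) = F (v y) / G (v y))"
        then obtain V' d F G where V': "openin TP V'" "lin x \<in> V'" "F \<in> homogeneous_polys N d" "G \<in> homogeneous_polys N d"
          "\<And>y. y \<in> Y \<Longrightarrow> lin y \<in> V \<inter> V' \<Longrightarrow> G (v y) \<noteq> 0 \<and> f (lin y) = F (v y) / G (v y)" by (elim exE conjE) blast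
        obtain W where W: "openin TA W" "\<forall>y\<in>Y. pnt y \<in> W \<longleftrightarrow> lin y \<in> V'" using pull_open[OF V'(1)] by blast
        show "\<exists>W a b. openin TA W \<and> pnt x \<in> W \<and> a \<in> A \<and> b \<in> A \<and>
          (\<forall>y\<in>Y. pnt y \<in> ?U \<inter> W \<longrightarrow> b y \<noteq> 0 \<and> (f \<circ> emb) (pnt y) = a y / b y)"
        proof (intro exI conjI ballI impI)
          show "openin TA W" "pnt x \<in> W" using W V'(2) x by auto
          show "(\<lambda>y\<in>Y. F (v y)) \<in> A" "(\<lambda>y\<in>Y. G (v y)) \<in> A" by (rule homogeneous_A[OF V'(3)] homogeneous_A[OF V'(4)])+
          fix y assume y: "y \<in> Y" "pnt y \<in> ?U \<inter> W"
          then have "lin y \<in> V \<inter> V'" using W(2) UV[OF y(1)] by auto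
          from V'(5)[OF y(1) this]
          show "(\<lambda>y\<in>Y. G (v y)) y \<noteq> 0" "(f \<circ> emb) (pnt y) = (\<lambda>y\<in>Y. F (v y)) y / (\<lambda>y\<in>Y. G (v y)) y"
            using y(1) by (simp_all add: emb_pnt)
        qed
      next
        assume "\<exists>W a b. openin TA W \<and> pnt x \<in> W \<and> a \<in> A \<and> b \<in> A \<and>
          (\<forall>y\<in>Y. pnt y \<in> ?U \<inter> W \<longrightarrow> b y \<noteq> 0 \<and> (f \<circ> emb) (pnt y) = a y / b y)"
        then obtain W a b where W: "openin TA W" "pnt x \<in> W" "a \<in> A" "b \<in> A"
          "\<And>y. y \<in> Y \<Longrightarrow> pnt y \<in> ?U \<inter> W \<Longrightarrow> b y \<noteq> 0 \<and> (f \<circ> emb) (pnt y) = a y / b y" by (elim exE conjE) blast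
        obtain V' where V': "openin TP V'" "\<forall>y\<in>Y. pnt y \<in> W \<longleftrightarrow> lin y \<in> V'" using push_open[OF W(1)] by blast
        obtain d F where F: "F \<in> homogeneous_polys N d" "\<forall>y\<in>Y. a y = F (v y)"
          using gen_homogeneous[OF W(3)] by (elim exE bexE)
        obtain e G where G: "G \<in> homogeneous_polys N e" "\<forall>y\<in>Y. b y = G (v y)"
          using gen_homogeneous[OF W(4)] by (elim exE bexE)
        show "\<exists>V' d F G. openin TP V' \<and> lin x \<in> V' \<and> F \<in> homogeneous_polys N d \<and> G \<in> homogeneous_polys N d \<and>
          (\<forall>y\<in>Y. lin y \<in> V \<inter> V' \<longrightarrow> G (v y) \<noteq> 0 \<and> f (lin y) = F (v y) / G (v y))"
        proof (intro exI conjI ballI impI)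
          show "openin TP V'" "lin x \<in> V'" using V' W(2) x by auto
          \<comment> \<open>Powers of coordinate 0, which is 1 at every \<open>v y\<close>, give
            numerator and denominator the same degree.\<close>
          show "(\<lambda>w. (w $ 0) ^ e * F w) \<in> homogeneous_polys N (e + d)" by (rule homogeneous_raise[OF F(1)])
          show "(\<lambda>w. (w $ 0) ^ d * G w) \<in> homogeneous_polys N (e + d)"
            using homogeneous_raise[OF G(1), of d] by (simp add: add.commute)
          fix y assume y: "y \<in> Y" "lin y \<in> V \<inter> V'"
          then have "pnt y \<in> ?U \<inter> W" using V'(2) UV[OF y(1)] by auto
          from W(5)[OF y(1) this]
          show "(v y $ 0) ^ d * G (v y) \<noteq> 0" "f (lin y) = ((v y $ 0) ^ e * F (v y)) / ((v y $ 0) ^ d * G (v y))"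
            using y(1) F(2) G(2) v_0 by (simp_all add: emb_pnt)
        qed
      qed
    qed
  qed
  have "isomorphic_spaces (induced (max_spec Y A) Z) (induced (projective_space N) (emb ` Z))"
    unfolding isomorphic_spaces_def
  proof (intro exI[of _ emb] conjI allI impI)
    show "homeomorphic_map (zariski (induced (max_spec Y A) Z)) (zariski (induced (projective_space N) (emb ` Z))) emb"
      using homeo by (simp add: induced_def)
    fix V and f assume "openin (zariski (induced (projective_space N) (emb ` Z))) V"
    then have V: "openin (subtopology TP (emb ` Z)) V" by (simp add: induced_def)
    have "topspace (zariski (induced (max_spec Y A) Z)) = Z"
      using ZY by (auto simp: induced_def topspace_TA)
    then show "f \<in> regular (induced (projective_space N) (emb ` Z)) V \<longleftrightarrow>
        f \<circ> emb \<in> regular (induced (max_spec Y A) Z) {p \<in> topspace (zariski (induced (max_spec Y A) Z)). emb p \<in> V}"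
      using reg[OF V] by simp
  qed
  then show ?thesis unfolding quasi_projective_variety_def using locally_closed_emb[OF Z] by blast
qed

end

section \<open>The stratification\<close>

context generated_group
begin

abbreviation "X \<equiv> zariski (max_spec Y A)"

lemma topspace_X: "topspace X = {M. maximalideal M (function_ring Y\<lparr>carrier := A\<rparr>)}"
  by (rule topspace_max_spec[OF A_subalgebra])

lemma closed_closed_type: "closedin X (closed_type ds)"
proof -
  let ?B = "{f \<in> A. \<forall>\<rho>\<in>block_reps ds. f \<rho> = 0}"
  have "closed_type ds = {M. maximalideal M (function_ring Y\<lparr>carrier := A\<rparr>) \<and> ?B \<subseteq> M}"
    by (auto simp: closed_type_def)
  then show ?thesis using closed_vanishing[OF A_subalgebra, of ?B] by simp
qed

lemma stratum_locally_closed: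
  assumes k: "k \<in> partitions_of n"
  shows "locally_closed_in X (stratum \<Gamma> n k)"
proof -
  let ?ds = "part_list n k"
  have ds: "set ?ds \<subseteq> {1..n}" "sum_list ?ds = n"
    using set_part_list k by (simp_all add: sum_part_list partitions_of_def)
  have "closedin X (\<Union>ds'\<in>longer ?ds. closed_type ds')"
    by (intro closedin_Union) (auto simp: finite_longer closed_closed_type)
  then have "openin X (topspace X - (\<Union>ds'\<in>longer ?ds. closed_type ds'))" by (simp add: closedin_def)
  moreover have "stratum \<Gamma> n k = (topspace X - (\<Union>ds'\<in>longer ?ds. closed_type ds')) \<inter> closed_type ?ds"
    unfolding stratum_eq[OF k] type_set_eq[OF ds] using closedin_subset[OF closed_closed_type[of ?ds]] by auto
  ultimately show ?thesis unfolding locally_closed_in_def using closed_closed_type by blast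
qed

text \<open>Module generators over an algebra of finitely many traces, together with these traces,
  generate the invariants as an algebra.\<close>

lemma invariant_ring_generators:
  "\<exists>gs. set gs \<subseteq> {p \<in> N.P. N.invar p} \<and> (\<forall>p\<in>N.P. N.invar p \<longrightarrow> p \<in> falg (set gs))"
proof -
  obtain W B where W: "finite W" "W \<subseteq> lists S" and B: "finite B" "B \<subseteq> {p \<in> N.P. N.invar p}"
    and gen: "\<forall>p\<in>N.P. N.invar p \<longrightarrow> p \<in> ideal_span (N.TR W) B"
    using N.invariants_finite_over_traces by blast
  obtain gs where gs: "set gs = N.tw ` W \<union> B" using finite_list[of "N.tw ` W \<union> B"] W(1) B(1) by blast
  have "N.tw w \<in> N.P" "N.invar (N.tw w)" if "w \<in> W" for w
    using that W(2) N.hpol_P[OF N.tw_hpol[of w]] N.tw_invar[of w] by auto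
  then have "set gs \<subseteq> {p \<in> N.P. N.invar p}" using gs B(2) by auto
  moreover have "p \<in> falg (set gs)" if "p \<in> ideal_span (N.TR W) B" for p
    using that
  proof (induction p rule: ideal_span.induct)
    case zero
    show ?case using falg.const[of 0] by (simp add: zero_fun_def)
  next
    case (step b u x)
    have "b \<in> falg (set gs)" using step(1) unfolding N.TR_def
      by (rule falg_mono) (auto simp: gs intro: falg.gen)
    moreover have "u \<in> falg (set gs)" using step(2) gs by (intro falg.gen) simp
    ultimately show ?case using step(4) by (intro falg.add falg.mult)
  qed
  ultimately show ?thesis using gen by (intro exI[of _ gs]) simp
qed

lemma quasi_projective:
  assumes "locally_closed_in X Z"
  shows "quasi_projective_variety (induced (max_spec Y A) Z)"
proof -
  obtain gs where gs: "set gs \<subseteq> {p \<in> N.P. N.invar p}" "\<And>p. p \<in> N.P \<Longrightarrow> N.invar p \<Longrightarrow> p \<in> falg (set gs)"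
    using invariant_ring_generators by (elim exE conjE) blast
  define m where "m = length gs"
  \<comment> \<open>Coordinate 0 is the constant 1 of the chart, so the generators are shifted by
    one place.\<close>
  define v where "v \<rho> = vec (Suc m) (\<lambda>i. if i = 0 then 1 else (gs ! (i - 1)) \<rho>)" for \<rho>
  have gs_coord: "\<exists>p\<in>falg (coord_funs m). \<forall>\<rho>. f \<rho> = p (v \<rho>)" if "f \<in> falg (set gs)" for f
    using that
  proof (induction f rule: falg.induct)
    case (const c)
    show ?case by (intro bexI[OF _ falg.const[of c]]) simp
  next
    case (gen g)
    then obtain i where i: "i < m" "g = gs ! i" by (auto simp: in_set_conv_nth m_def)
    have "(\<lambda>v. v $ Suc i) \<in> falg (coord_funs m)" using i(1) by (intro falg.gen) auto
    then show ?case by (rule bexI[rotated]) (use i in \<open>simp add: v_def\<close>)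
  next
    case (add f g)
    then obtain p q where "p \<in> falg (coord_funs m)" "\<forall>\<rho>. f \<rho> = p (v \<rho>)" "q \<in> falg (coord_funs m)" "\<forall>\<rho>. g \<rho> = q (v \<rho>)"
      by (elim bexE) blast
    then show ?case by (intro bexI[of _ "p + q"] falg.add) simp_all
  next
    case (mult f g)
    then obtain p q where "p \<in> falg (coord_funs m)" "\<forall>\<rho>. f \<rho> = p (v \<rho>)" "q \<in> falg (coord_funs m)" "\<forall>\<rho>. g \<rho> = q (v \<rho>)"
      by (elim bexE) blast
    then show ?case by (intro bexI[of _ "p * q"] falg.mult) simp_all
  qed
  interpret E: affine_embedding Y A m v
  proof
    show "fun_subalgebra Y A" by (rule A_subalgebra)
    show "v \<rho> \<in> carrier_vec (Suc m)" "v \<rho> $ 0 = 1" for \<rho> by (simp_all add: v_def)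
    show "(\<lambda>\<rho>\<in>Y. v \<rho> $ i) \<in> A" if i: "i \<le> m" for i
    proof (cases i)
      case 0
      then show ?thesis using fun_subalgebraD(2)[OF A_subalgebra, of 1] by (simp add: v_def)
    next
      case (Suc j)
      then have "gs ! j \<in> set gs" using i by (simp add: m_def)
      then have "restrict (gs ! j) Y \<in> A" using gs(1) by (intro A_I) auto
      moreover have "(\<lambda>\<rho>\<in>Y. v \<rho> $ i) = restrict (gs ! j) Y" using Suc i by (intro restrict_ext) (simp add: v_def)
      ultimately show ?thesis by simp
    qed
    show "\<exists>p\<in>falg (coord_funs m). f = (\<lambda>\<rho>\<in>Y. p (v \<rho>))" if f: "f \<in> A" for f
    proof -
      obtain q where q: "q \<in> N.P" "N.invar q" "f = restrict q Y" using A_E[OF f] by blast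
      obtain p where p: "p \<in> falg (coord_funs m)" "\<forall>\<rho>. q \<rho> = p (v \<rho>)" using gs_coord[OF gs(2)[OF q(1,2)]] by (elim bexE) blast
      then show ?thesis unfolding q(3) by (intro bexI[OF _ p(1)] restrict_ext) simp
    qed
    show "\<exists>\<rho>\<in>Y. M = {f \<in> A. f \<rho> = 0}" if "maximalideal M (function_ring Y\<lparr>carrier := A\<rparr>)" for M
      using maximalideal_pt[OF that] irred_sum_Reps by (auto simp: pt_def git_point_def)
  qed
  show ?thesis by (rule E.locally_closed_quasi_projective[OF assms])
qed

end

theorem proposition2:
  fixes \<Gamma> :: "('a, 'b) monoid_scheme" and n :: nat
  assumes "finitely_presented \<Gamma>"
  shows "topspace (zariski (character_variety \<Gamma> n)) = (\<Union>k\<in>partitions_of n. stratum \<Gamma> n k) \<and>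
         disjoint_family_on (stratum \<Gamma> n) (partitions_of n) \<and>
         (\<forall>k\<in>partitions_of n.
            locally_closed_in (zariski (character_variety \<Gamma> n)) (stratum \<Gamma> n k) \<and>
            quasi_projective_variety (induced (character_variety \<Gamma> n) (stratum \<Gamma> n k)))"
proof -
  obtain S where S: "finite S" "S \<subseteq> carrier \<Gamma>" "\<forall>\<gamma>\<in>carrier \<Gamma>. \<exists>w\<in>lists S. \<gamma> = evalw \<Gamma> w"
    using finitely_presented_generators[OF assms] by blast
  interpret group \<Gamma> using assms by (simp add: finitely_presented_def)
  interpret generated_group \<Gamma> n S by unfold_locales (use S in auto)
  show ?thesis unfolding character_variety_def
    using topspace_X union_strata disjoint_strata stratum_locally_closed quasi_projective by simp
qed

end
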